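(* Let $b,\iota>0$, let $k\ge0$ be an integer, and suppose $\sigma>2(\iota+b)$. For every integer $n\ge 0$ and $\lambda\in i\mathbb R$, the Cherednik-Opdam transforms of the Jacobi type functions $Q^{(k)}_{n,1}$ and $Q^{(k)}_{n,-1}$ are given by $$\mathcal F_{\pm1}(Q^{(k)}_{n,1})(\lambda)=\frac{(\sigma_0+1)_n}{n!}\,\widetilde{w_\sigma}(\lambda)\sum_{m=0}^n\frac{(-n)_m(n+\sigma_0+\delta_0+2k+1)_m}{(\sigma_0+1)_m\,m!}\;\frac{\left(\frac{\sigma-\rho+\lambda}{2}\right)_m\left(\frac{\sigma-\rho-\lambda}{2}\right)_m}{\left(\frac{\sigma}{2}\right)_m\left(\frac{\sigma+1-\iota}{2}\right)_m}\,L_{k,m}(\lambda)$$ and $$\mathcal F_{\pm1}(Q^{(k)}_{n,-1})(\lambda)=-\frac{(\sigma_0+1)_n}{n!\,\sigma}\,(\pm\lambda+\rho)\,\widetilde{w_\sigma}(\lambda)\sum_{m=0}^n\frac{(-n)_m(n+\sigma_0+\delta_0+2k+1)_m}{(\sigma_0+1)_m\,m!}\;\frac{\left(\frac{\sigma-\rho+\lambda}{2}\right)_m\left(\frac{\sigma-\rho-\lambda}{2}\right)_m}{\left(\frac{\sigma}{2}\right)_m\left(\frac{\sigma+1-\iota}{2}\right)_m}\,M_{k,m}(\lambda).$$ Moreover, for each fixed $k\ge0$ the $\mathbb C^2$-valued polynomials (up to the common factor $\widetilde{w_\sigma}(\lambda)$) $\mathcal F(Q^{(k)}_{n,\pm1})(\lambda)=\big(\mathcal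 F_1(Q^{(k)}_{n,\pm1})(\lambda),\mathcal F_{-1}(Q^{(k)}_{n,\pm1})(\lambda)\big)$, $n=0,1,2,\dots$, form an orthogonal basis for the space $L^2(i\mathbb R^+,d\hat\mu)\otimes\mathbb C^2$, and $$\|\mathcal F(Q^{(k)}_{n,\pm1})\|=\|Q^{(k)}_{n,\pm1}\| ,$$ where the norm on the right is that of $L^2(\mathbb R,d\mu)$.
   Context: Put $\rho=b+\iota$ and $d\mu(t)=2^{2b+\iota}|\sinh t|^{2b}|\sinh(2t)|^{\iota}dt$ on $\mathbb R$. The hypergeometric series is ${}_pF_q(a_1,\dots,a_p;b_1,\dots,b_q;x)=\sum_{m\ge0}\frac{(a_1)_m\cdots(a_p)_m}{(b_1)_m\cdots(b_q)_m}\frac{x^m}{m!}$ with $(a)_m=a(a+1)\cdots(a+m-1)$; ${}_2F_1(\cdot,\cdot;\cdot;x)$ for $x\le0$ is understood as the analytic continuation. For $\lambda\in i\mathbb R$ let $$G(\lambda,t)={}_2F_1\!\left(\tfrac{\lambda+\rho}{2},\tfrac{-\lambda+\rho}{2};\tfrac{1+\iota}{2}+b;-\sinh^2t\right)+\frac{1}{\lambda+\rho}\sinh(2t)\;{}_2F_1'\!\left(\tfrac{\lambda+\rho}{2},\tfrac{-\lambda+\rho}{2};\tfrac{1+\iota}{2}+b;-\sinh^2t\right),$$ where ${}_2F_1'$ is the derivative of ${}_2F_1$ with respect to its last argument. The Cherednik-Opdam transform of $f$ is $\mathcal Ff=(\mathcal F_1f,\mathcal F_{-1}f)$ with $$\mathcal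 F_{\pm1}f(\lambda)=\int_{\mathbb R}f(t)\,G(\lambda,\pm t)\,d\mu(t).$$ For even $f$ one has $\mathcal F_1f=\mathcal F_{-1}f=:\widetilde f$. On the imaginary half axis $i\mathbb R^+$ let $$d\hat\mu(\lambda)=(2\pi)^{-1}\frac{c_{-1}(\rho)^2}{c(\lambda)c(-\lambda)}d\lambda,\quad c(\lambda)=\frac{\Gamma(\lambda)\,\Gamma(\frac{\lambda}{2}+b)}{\Gamma(\lambda+b)\,\Gamma(\frac{\lambda}{2}+b+\frac{\iota}{2})},\quad c_{-1}(\lambda)=\frac{\Gamma(\lambda+1)\,\Gamma(\frac{\lambda}{2}+b+1)}{\Gamma(\lambda+b+1)\,\Gamma(\frac{\lambda}{2}+b+\frac{\iota}{2}+1)} .$$ The transform $\mathcal F$ extends (Opdam) to a unitary operator from $L^2(\mathbb R,d\mu)$ onto $L^2(i\mathbb R^+,d\hat\mu)\otimes\mathbb C^2$. Put $w_{\sigma,k}(t)=(\cosh t)^{-\sigma}(\tanh t)^{2k}$, $w_\sigma=w_{\sigma,0}$, so $\widetilde{w_\sigma}(\lambda)=\mathcal F_{\pm1}w_\sigma(\lambda)$, and $$\sigma_0=\sigma-(\iota+b+1),\qquad \delta_0=\frac{\iota-1}{2}+b,\qquad \delta_1=\delta_0+1 .$$ $P_n^{\alpha,\beta}$ denotes the Jacobi polynomial in the standard normalization $P_n^{\alpha,\beta}(1)=\frac{(\alpha+1)_n}{n!}$, orthogonal on $(-1,1)$ with respect to $(1-x)^\alpha(1+x)^\beta dx$. The Jacobi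 type functions are $$Q^{(k)}_{n,1}(t)=w_{\sigma,k}(t)\,P_n^{\sigma_0,\,\delta_0+2k}(2\tanh^2t-1),\qquad Q^{(k)}_{n,-1}(t)=w_{\sigma,k}(t)\,P_n^{\sigma_0,\,\delta_1+2k}(2\tanh^2t-1)\,\tanh t .$$ The polynomials $L_{k,m}$ and $M_{k,m}$ are $$L_{k,m}(x)={}_3F_2\!\left(-k,\;\tfrac{\sigma-\rho+x}{2},\;\tfrac{\sigma-\rho-x}{2};\;\tfrac{\sigma}{2}+m,\;\tfrac{\sigma+1-\iota}{2};\;1\right),$$ $$M_{k,m}(x)={}_3F_2\!\left(-k,\;\tfrac{\sigma-\rho+x}{2},\;\tfrac{\sigma-\rho-x}{2};\;\tfrac{\sigma}{2}+1+m,\;\tfrac{\sigma+1-\iota}{2};\;1\right).$$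
   Formalization: Misprints corrected: in c and c_{-1}, λ/2+b becomes λ/2+b/2; for Q_{n,-1}, (±λ+ρ) becomes ±(λ−ρ), δ_0 becomes δ_1 and (σ/2)_m becomes (σ/2+1)_m; in L_{k,m} and M_{k,m} every parameter except −k is shifted by m. *)

theory Defs
  imports "HOL-Complex_Analysis.Complex_Analysis"
begin

definition hyp_pFq :: "complex list \<Rightarrow> complex list \<Rightarrow> complex \<Rightarrow> complex" where
  "hyp_pFq as bs x =
     (\<Sum>m. prod_list (map (\<lambda>a. pochhammer a m) as) / prod_list (map (\<lambda>b. pochhammer b m) bs)
           * x ^ m / fact m)"

text \<open>
  Analytic continuation of the Gauss series from the unit disc to the plane slit along
  \<open>[1,\<infinity>)\<close>. By the identity theorem the values on the slit plane do not depend on the choice;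
  the values on the slit are irrelevant and never used.
\<close>

definition hyp_2F1 :: "complex \<Rightarrow> complex \<Rightarrow> complex \<Rightarrow> complex \<Rightarrow> complex" where
  "hyp_2F1 a b c =
     (SOME f. f holomorphic_on - (complex_of_real ` {1..}) \<and>
              (\<forall>z\<in>ball 0 1. f z = hyp_pFq [a, b] [c] z))"

text \<open>
  For \<open>\<alpha>, \<beta> > -1\<close> the polynomial of degree \<open>n\<close> is determined by orthogonality to all polynomials of
  smaller degree together with its value at \<open>1\<close>.
\<close>

definition jacobi_poly :: "nat \<Rightarrow> real \<Rightarrow> real \<Rightarrow> real poly" where
  "jacobi_poly n \<alpha> \<beta> =
     (THE p. degree p = n \<and>
             poly p 1 = pochhammer (\<alpha> + 1) n / fact n \<and>
             (\<forall>q. degree q < n \<longrightarrow>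
                (LINT x:{-1<..<1}|lborel.
                   poly p x * poly q x * ((1 - x) powr \<alpha> * (1 + x) powr \<beta>)) = 0))"

text \<open>
  Elements of \<open>L\<^sup>2\<close> are represented by square integrable functions, without passing to classes
  modulo null sets. On \<^typ>\<open>complex \<times> complex\<close> the library norm is the Hermitian one,
  \<open>norm (u, v) = sqrt (\<bar>u\<bar>\<^sup>2 + \<bar>v\<bar>\<^sup>2)\<close>.
\<close>

definition L2_space ::
    "'a measure \<Rightarrow> ('a \<Rightarrow> 'b::{real_normed_vector, second_countable_topology}) set" where
  "L2_space M = {f \<in> borel_measurable M. integrable M (\<lambda>x. (norm (f x))\<^sup>2)}"

definition L2_nrm :: "'a measure \<Rightarrow> ('a \<Rightarrow> 'b::real_normed_vector) \<Rightarrow> real" where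
  "L2_nrm M f = sqrt (\<integral>x. (norm (f x))\<^sup>2 \<partial>M)"

definition L2_inner ::
    "'a measure \<Rightarrow> ('a \<Rightarrow> complex \<times> complex) \<Rightarrow> ('a \<Rightarrow> complex \<times> complex) \<Rightarrow> complex" where
  "L2_inner M f g = (\<integral>x. fst (f x) * cnj (fst (g x)) + snd (f x) * cnj (snd (g x)) \<partial>M)"

text \<open>
  Nonzero, pairwise orthogonal, with dense complex linear span (complex scalars act
  componentwise on \<^typ>\<open>complex \<times> complex\<close>).
\<close>

definition L2_orthogonal_basis ::
    "'a measure \<Rightarrow> 'i set \<Rightarrow> ('i \<Rightarrow> 'a \<Rightarrow> complex \<times> complex) \<Rightarrow> bool" where
  "L2_orthogonal_basis M I e \<longleftrightarrow>
     (\<forall>i\<in>I. e i \<in> L2_space M \<and> L2_nrm M (e i) \<noteq> 0) \<and>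
     (\<forall>i\<in>I. \<forall>j\<in>I. i \<noteq> j \<longrightarrow> L2_inner M (e i) (e j) = 0) \<and>
     (\<forall>f\<in>L2_space M. \<forall>\<epsilon>>0. \<exists>J c. finite J \<and> J \<subseteq> I \<and>
        L2_nrm M (\<lambda>x. f x - (\<Sum>i\<in>J. (c i * fst (e i x), c i * snd (e i x)))) < \<epsilon>)"

definition co_rho :: "real \<Rightarrow> real \<Rightarrow> real" where
  "co_rho b \<iota> = b + \<iota>"

definition co_mu :: "real \<Rightarrow> real \<Rightarrow> real measure" where
  "co_mu b \<iota> =
     density lborel
       (\<lambda>t. ennreal (2 powr (2 * b + \<iota>) * \<bar>sinh t\<bar> powr (2 * b) * \<bar>sinh (2 * t)\<bar> powr \<iota>))"

definition co_kernel :: "real \<Rightarrow> real \<Rightarrow> complex \<Rightarrow> real \<Rightarrow> complex" where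
  "co_kernel b \<iota> l t =
     (let \<rho> = complex_of_real (co_rho b \<iota>);
          F = hyp_2F1 ((l + \<rho>) / 2) ((- l + \<rho>) / 2) (complex_of_real ((1 + \<iota>) / 2 + b));
          z = complex_of_real (- (sinh t)\<^sup>2)
      in F z + 1 / (l + \<rho>) * complex_of_real (sinh (2 * t)) * deriv F z)"

text \<open>The sign \<open>s \<in> {1, -1}\<close> selects the component of the transform.\<close>

definition co_transform ::
    "real \<Rightarrow> real \<Rightarrow> int \<Rightarrow> (real \<Rightarrow> complex) \<Rightarrow> complex \<Rightarrow> complex" where
  "co_transform b \<iota> s f l = (\<integral>t. f t * co_kernel b \<iota> l (of_int s * t) \<partial>co_mu b \<iota>)"

definition co_transform_pair ::
    "real \<Rightarrow> real \<Rightarrow> (real \<Rightarrow> complex) \<Rightarrow> complex \<Rightarrow> complex \<times> complex" where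
  "co_transform_pair b \<iota> f l = (co_transform b \<iota> 1 f l, co_transform b \<iota> (-1) f l)"

text \<open>
  The \<open>c\<close>-functions are those of Opdam's rank one Plancherel formula, with \<open>b/2\<close> in the second
  pair of Gamma factors. The source prints \<open>b\<close> there, which is a misprint: for that density the
  transform is not isometric and the functions below are not orthogonal.
\<close>

definition c_fun :: "real \<Rightarrow> real \<Rightarrow> complex \<Rightarrow> complex" where
  "c_fun b \<iota> l =
     (Gamma l * Gamma (l / 2 + of_real (b / 2))) /
     (Gamma (l + of_real b) * Gamma (l / 2 + of_real (b / 2) + of_real (\<iota> / 2)))"

definition c_minus :: "real \<Rightarrow> real \<Rightarrow> complex \<Rightarrow> complex" where
  "c_minus b \<iota> l =
     (Gamma (l + 1) * Gamma (l / 2 + of_real (b / 2) + 1)) /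
     (Gamma (l + of_real b + 1) * Gamma (l / 2 + of_real (b / 2) + of_real (\<iota> / 2) + 1))"

definition im_axis :: "complex set" where
  "im_axis = {l. Re l = 0}"

definition im_half_axis :: "complex set" where
  "im_half_axis = {l. Re l = 0 \<and> Im l > 0}"

text \<open>
  \<open>d\<lambda>\<close> is arc length on the half axis, i.e. Lebesgue measure in \<open>y\<close> for \<open>\<lambda> = \<i> y\<close>. There
  \<open>c(\<lambda>) c(-\<lambda>) = \<bar>c(\<lambda>)\<bar>\<^sup>2\<close>, so the density is real and nonnegative and \<^const>\<open>Re\<close> only
  changes its type.
\<close>

definition co_mu_hat :: "real \<Rightarrow> real \<Rightarrow> complex measure" where
  "co_mu_hat b \<iota> =
     distr
       (density (restrict_space lborel {0<..})
          (\<lambda>y. let l = \<i> * complex_of_real y in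
             ennreal (Re (1 / (2 * of_real pi) *
               ((c_minus b \<iota> (of_real (co_rho b \<iota>)))\<^sup>2 / (c_fun b \<iota> l * c_fun b \<iota> (- l)))))))
       (restrict_space borel im_half_axis)
       (\<lambda>y. \<i> * complex_of_real y)"

definition w_fun :: "real \<Rightarrow> nat \<Rightarrow> real \<Rightarrow> real" where
  "w_fun \<sigma> k t = cosh t powr (- \<sigma>) * tanh t ^ (2 * k)"

definition w_tilde :: "real \<Rightarrow> real \<Rightarrow> real \<Rightarrow> complex \<Rightarrow> complex" where
  "w_tilde b \<iota> \<sigma> = co_transform b \<iota> 1 (\<lambda>t. of_real (w_fun \<sigma> 0 t))"

definition sigma0 :: "real \<Rightarrow> real \<Rightarrow> real \<Rightarrow> real" where
  "sigma0 b \<iota> \<sigma> = \<sigma> - (\<iota> + b + 1)"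

definition delta0 :: "real \<Rightarrow> real \<Rightarrow> real" where
  "delta0 b \<iota> = (\<iota> - 1) / 2 + b"

definition delta1 :: "real \<Rightarrow> real \<Rightarrow> real" where
  "delta1 b \<iota> = delta0 b \<iota> + 1"

text \<open>\<open>jacobi_fun b \<iota> \<sigma> k n s\<close> is \<open>Q\<^sup>(\<^sup>k\<^sup>)\<close> with indices \<open>n, s\<close>, where \<open>s \<in> {1, -1}\<close>.\<close>

definition jacobi_fun ::
    "real \<Rightarrow> real \<Rightarrow> real \<Rightarrow> nat \<Rightarrow> nat \<Rightarrow> int \<Rightarrow> real \<Rightarrow> complex" where
  "jacobi_fun b \<iota> \<sigma> k n s t = complex_of_real
     (if s = 1
      then w_fun \<sigma> k t *
           poly (jacobi_poly n (sigma0 b \<iota> \<sigma>) (delta0 b \<iota> + 2 * real k)) (2 * (tanh t)\<^sup>2 - 1)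
      else w_fun \<sigma> k t *
           poly (jacobi_poly n (sigma0 b \<iota> \<sigma>) (delta1 b \<iota> + 2 * real k)) (2 * (tanh t)\<^sup>2 - 1) *
           tanh t)"

text \<open>
  With \<open>tanh\<^sup>2 = 1 - cosh\<^sup>-\<^sup>2\<close> the transform of \<open>w_fun (\<sigma> + 2m) k\<close> is the alternating binomial
  sum of the transforms of \<open>w_fun (\<sigma> + 2m + 2j) 0\<close>, and
  \<open>w_tilde (\<sigma> + 2m) = ((\<sigma>-\<rho>+\<lambda>)/2)\<^sub>m ((\<sigma>-\<rho>-\<lambda>)/2)\<^sub>m / ((\<sigma>/2)\<^sub>m ((\<sigma>+1-\<iota>)/2)\<^sub>m) w_tilde \<sigma>\<close>;
  hence all four parameters other than \<open>-k\<close> are shifted by \<open>m\<close>. The source shows the shift only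
  in the first denominator parameter, which is a misprint. For the odd functions
  \<open>1/(\<sigma> + 2m) = (1/\<sigma>) (\<sigma>/2)\<^sub>m / (\<sigma>/2 + 1)\<^sub>m\<close> replaces \<open>\<sigma>/2\<close> by \<open>\<sigma>/2 + 1\<close>.
\<close>

definition L_fun :: "real \<Rightarrow> real \<Rightarrow> real \<Rightarrow> nat \<Rightarrow> nat \<Rightarrow> complex \<Rightarrow> complex" where
  "L_fun b \<iota> \<sigma> k m x =
     hyp_pFq
       [- of_nat k,
        (of_real (\<sigma> - co_rho b \<iota>) + x) / 2 + of_nat m,
        (of_real (\<sigma> - co_rho b \<iota>) - x) / 2 + of_nat m]
       [of_real (\<sigma> / 2) + of_nat m,
        of_real ((\<sigma> + 1 - \<iota>) / 2) + of_nat m]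
       1"

definition M_fun :: "real \<Rightarrow> real \<Rightarrow> real \<Rightarrow> nat \<Rightarrow> nat \<Rightarrow> complex \<Rightarrow> complex" where
  "M_fun b \<iota> \<sigma> k m x =
     hyp_pFq
       [- of_nat k,
        (of_real (\<sigma> - co_rho b \<iota>) + x) / 2 + of_nat m,
        (of_real (\<sigma> - co_rho b \<iota>) - x) / 2 + of_nat m]
       [of_real (\<sigma> / 2) + 1 + of_nat m,
        of_real ((\<sigma> + 1 - \<iota>) / 2) + of_nat m]
       1"

text \<open>
  Two further misprints of the source concern the transform of the odd functions (\<open>s = -1\<close>). As their
  Jacobi polynomial has second parameter \<open>\<delta>\<^sub>1 + 2k\<close>, the formula has to contain \<open>\<delta>\<^sub>1\<close>, not \<open>\<delta>\<^sub>0\<close>. And as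
  the two components of the transform of an odd function are negatives of each other, the linear
  factor is \<open>\<plusminus>(\<lambda> - \<rho>)\<close>, not \<open>\<plusminus>\<lambda> + \<rho>\<close> (the lower sign agrees, the upper one does not).
\<close>

end

theory Submission
  imports Defs
begin

text \<open>
  With \<open>u = cosh\<^sup>-\<^sup>2 t\<close> the functions \<open>Q\<close> are \<open>(cosh t)\<^sup>-\<^sup>\<sigma> p(u) (tanh t)\<^sup>\<epsilon>\<close>, \<open>\<epsilon> \<in> {0, 1}\<close>, with \<open>p\<close> a polynomial, so
  everything is determined by the transforms of the powers of \<open>cosh\<close>. In the variable
  \<open>\<xi> = ln (sinh\<^sup>2 t)\<close> these are Mellin transforms of the Gauss function, and Euler's integral
  evaluates them as quotients of Gamma functions. This gives the two sums.

  Plancherel's theorem for the transform is not used. On the spectral side the square of the Gamma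
  factor turns the Plancherel density into the weight of Wilson's integral of
  \<open>\<bar>\<Gamma>(a + i y) \<Gamma>(b + i y) \<Gamma>(c + i y) \<Gamma>(d + i y) / \<Gamma>(2 i y)\<bar>\<^sup>2\<close>, whose value agrees with the beta
  integral of \<open>u\<^sup>i\<^sup>+\<^sup>j\<close>: the transform is isometric on the functions above, and orthogonality is that
  of the Jacobi polynomials. Wilson's integral follows from a contour shift, which gives the
  recurrence in each parameter, and from the limit in which a parameter tends to infinity, which
  shows that the recurrence has no other periodic factor.

  For completeness, the weight decays exponentially, so the even polynomials are dense in the
  even part of its \<open>L\<^sup>2\<close> space; they are the spectral images of the polynomials \<open>p\<close>, and each \<open>p\<close> is
  approximated by multiples of \<open>(1 - u)\<^sup>k\<close>, that is by combinations of the \<open>Q\<close>.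
\<close>

section \<open>The Gamma function on vertical lines\<close>

text \<open>Without Plancherel's theorem, isometry has to come from comparing two Gram matrices. On
  the space side the Gram matrix of the functions
  \<open>(cosh t)^(-\<sigma> - 2 i) (tanh t)^\<epsilon>\<close> is a Hankel matrix of beta values.
  On the spectral side Legendre's duplication formula turns \<open>1 / |c(i y)|^2\<close> into a
  multiple of \<open>|Gamma(\<rho>/2 + i y/2) Gamma((b+1)/2 + i y/2)|^2 y sinh(pi y)\<close>, and
  the square of the transform of \<open>(cosh t)^(-\<sigma>)\<close> contributes the parameter
  \<open>(\<sigma> - \<rho>)/2\<close> twice. The powers \<open>u^i\<close> and \<open>u^j\<close>
  raise these two equal parameters by \<open>i\<close> and \<open>j\<close>, so one four-parameter
  integral contains all inner products; the odd functions merely replace \<open>\<rho>/2\<close> by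
  \<open>\<rho>/2 + 1\<close>. This is why Wilson's integral is needed with general parameters.
  Integrals over the half axis are doubled to even integrals over the line, where polynomials,
  exponentials and the reflection \<open>y \<mapsto> - y\<close> are available.\<close>

lemma exp_abs_integrable:
  fixes e :: real assumes "e > 0"
  shows "integrable lborel (\<lambda>y::real. exp (- e * \<bar>y\<bar>))"
proof -
  have A: "set_integrable lborel {0..} (\<lambda>y::real. exp (- e * y))"
  proof -
    have "(\<lambda>y::real. exp (- e * y)) integrable_on {0..}"
      using integrable_on_exp_minus_to_infinity[OF assms] by simp
    then have "set_integrable lebesgue {0..} (\<lambda>y::real. exp (- e * y))"
      by (intro nonnegative_absolutely_integrable_1) auto
    then show ?thesis by (simp add: set_integrable_def integrable_completion)
  qed
  have 1: "integrable lborel (\<lambda>y::real. indicator {0..} y *\<^sub>R exp (- e * y))"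
    using A by (simp add: set_integrable_def)
  have 2: "integrable lborel (\<lambda>y::real. indicator {0..} (-y) *\<^sub>R exp (- e * (-y)))"
    using lborel_integrable_real_affine[OF 1, of "-1" 0] by simp
  show ?thesis
    by (rule Bochner_Integration.integrable_bound[OF Bochner_Integration.integrable_add[OF 1 2]])
       (auto simp: indicator_def)
qed

lemma integrable_exp_bound:
  fixes f :: "real \<Rightarrow> 'a::euclidean_space"
  assumes "e > 0" "f \<in> borel_measurable borel" "\<And>y. norm (f y) \<le> C * exp (- e * \<bar>y\<bar>)"
  shows "integrable lborel f"
proof (rule Bochner_Integration.integrable_bound)
  show "integrable lborel (\<lambda>y::real. C * exp (- e * \<bar>y\<bar>))"
    using exp_abs_integrable[OF assms(1)] by simp
  have "norm (f y) \<le> norm (C * exp (- e * \<bar>y\<bar>))" for y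
    using assms(3)[of y] by (smt (verit) real_norm_def)
  then show "AE y in lborel. norm (f y) \<le> norm (C * exp (- e * \<bar>y\<bar>))" by simp
qed (use assms in auto)

lemma Complex_pos_not_nonpos_Ints [simp]: "x > 0 \<Longrightarrow> Complex x y \<notin> \<int>\<^sub>\<le>\<^sub>0"
  by (auto elim!: nonpos_Ints_cases simp: complex_eq_iff)

lemma cnj_Complex: "cnj (Complex x y) = Complex x (- y)"
  by (simp add: complex_eq_iff)

lemma norm_Gamma_cnj: "norm (Gamma (Complex x (- y))) = norm (Gamma (Complex x y))"
  by (metis cnj_Complex cnj_Gamma complex_mod_cnj)

text \<open>In the quotient of Gauss's products for \<open>x + i y\<close> and \<open>x\<close> the
  factors \<open>n!\<close> and \<open>n^x\<close> cancel, because
  \<open>|n^(x + i y)| = n^x\<close>. What remains is a product of factors that are at most 1 and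
  increase with \<open>x\<close>, so the bounds below follow factor by factor.\<close>

lemma norm_Gamma_ratio_LIMSEQ:
  assumes "x > 0"
  shows "(\<lambda>n. \<Prod>k\<le>n. (x + real k) / norm (Complex (x + real k) y))
           \<longlonglongrightarrow> norm (Gamma (Complex x y)) / Gamma x"
proof -
  have "(\<lambda>n. norm (Gamma_series (Complex x y) n) / Gamma_series x n)
          \<longlonglongrightarrow> norm (Gamma (Complex x y)) / Gamma x"
  proof (intro tendsto_divide tendsto_norm Gamma_series_LIMSEQ)
    show "Gamma x \<noteq> 0" using Gamma_real_pos[OF assms] by linarith
  qed
  moreover have "norm (Gamma_series (Complex x y) n) / Gamma_series x n =
        (\<Prod>k\<le>n. (x + real k) / norm (Complex (x + real k) y))" for n
  proof -
    have 1: "norm (pochhammer (Complex x y) (n + 1)) = (\<Prod>k\<le>n. norm (Complex (x + real k) y))"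
    proof -
      have "Complex x y + of_nat k = Complex (x + real k) y" for k
        by (simp add: complex_eq_iff)
      then show ?thesis
        by (simp add: pochhammer_prod prod_norm lessThan_Suc_atMost atLeast0LessThan flip: prod_norm)
    qed
    have 2: "pochhammer x (n + 1) = (\<Prod>k\<le>n. x + real k)"
      by (simp add: pochhammer_prod lessThan_Suc_atMost atLeast0LessThan)
    have 3: "norm (exp (Complex x y * of_real (ln (of_nat n)))) = exp (x * ln (of_nat n))"
      by simp
    show ?thesis
      unfolding Gamma_series_def 2 norm_divide norm_mult 1
      using 3 by (simp add: prod_dividef)
  qed
  ultimately show ?thesis by simp
qed

lemma ratio_norm_mono:
  assumes "0 < x" "x \<le> x'"
  shows "x / norm (Complex x y) \<le> x' / norm (Complex x' y)"
proof -
  have "x * sqrt (x'\<^sup>2 + y\<^sup>2) \<le> x' * sqrt (x\<^sup>2 + y\<^sup>2)"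
  proof (rule power2_le_imp_le)
    have "x\<^sup>2 * y\<^sup>2 \<le> x'\<^sup>2 * y\<^sup>2"
      using assms by (intro mult_right_mono power_mono) auto
    then show "(x * sqrt (x'\<^sup>2 + y\<^sup>2))\<^sup>2 \<le> (x' * sqrt (x\<^sup>2 + y\<^sup>2))\<^sup>2"
      by (simp add: power_mult_distrib algebra_simps)
  qed (use assms in auto)
  moreover have "sqrt (x'\<^sup>2 + y\<^sup>2) > 0" "sqrt (x\<^sup>2 + y\<^sup>2) > 0"
    using assms by (auto simp: sum_power2_gt_zero_iff)
  ultimately show ?thesis
    using assms by (simp add: complex_norm field_simps)
qed

text \<open>This comparison carries bounds to the left: at integer abscissas the reflection formula
  and the functional equation give \<open>|Gamma|\<close> explicitly, and every smaller abscissa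
  inherits the decay.\<close>

lemma norm_Gamma_ratio_mono:
  assumes "0 < x" "x \<le> x'"
  shows "norm (Gamma (Complex x y)) / Gamma x \<le> norm (Gamma (Complex x' y)) / Gamma x'"
proof (rule LIMSEQ_le[OF norm_Gamma_ratio_LIMSEQ norm_Gamma_ratio_LIMSEQ])
  show "\<exists>N. \<forall>n\<ge>N. (\<Prod>k\<le>n. (x + real k) / norm (Complex (x + real k) y))
      \<le> (\<Prod>k\<le>n. (x' + real k) / norm (Complex (x' + real k) y))"
    using assms by (auto intro!: prod_mono ratio_norm_mono)
qed (use assms in auto)

lemma norm_Gamma_le:
  assumes "0 < x"
  shows "norm (Gamma (Complex x y)) \<le> Gamma x"
proof -
  have "norm (Gamma (Complex x y)) / Gamma x \<le> 1"
  proof (rule LIMSEQ_le[OF norm_Gamma_ratio_LIMSEQ[OF assms] tendsto_const], intro exI allI impI)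
    fix n :: nat
    have "(x + real k) / norm (Complex (x + real k) y) \<le> 1" for k
      using assms complex_Re_le_cmod[of "Complex (x + real k) y"]
      by (simp add: divide_le_eq)
    then show "(\<Prod>k\<le>n. (x + real k) / norm (Complex (x + real k) y)) \<le> 1"
      using assms by (intro prod_le_1) auto
  qed
  then show ?thesis using Gamma_real_pos[OF assms] by (simp add: field_simps)
qed

lemma Gamma_Complex_plus1:
  assumes "x > 0"
  shows "Gamma (Complex (x + 1) y) = Complex x y * Gamma (Complex x y)"
proof -
  have "Complex (x + 1) y = Complex x y + 1" by (simp add: complex_eq_iff)
  then show ?thesis using Gamma_plus1[of "Complex x y"] assms by simp
qed

lemma norm_Gamma_plus1_sq:
  assumes "x > 0"
  shows "(norm (Gamma (Complex (x + 1) y)))\<^sup>2 = (x\<^sup>2 + y\<^sup>2) * (norm (Gamma (Complex x y)))\<^sup>2"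
  by (simp add: Gamma_Complex_plus1[OF assms] norm_mult power_mult_distrib complex_norm)

text \<open>\<open>Gamma(1 - i y)\<close> is the conjugate of
  \<open>Gamma(1 + i y) = i y Gamma(i y)\<close>, so the reflection formula at \<open>i y\<close>
  yields the modulus.\<close>

lemma norm_Gamma_1_sq:
  assumes "y \<noteq> 0"
  shows "(norm (Gamma (Complex 1 y)))\<^sup>2 = pi * y / sinh (pi * y)"
proof -
  have "of_real ((norm (Gamma (Complex 1 y)))\<^sup>2) = Gamma (Complex 1 y) * cnj (Gamma (Complex 1 y))"
    by (rule complex_norm_square)
  also have "\<dots> = Gamma (Complex 1 y) * Gamma (Complex 1 (- y))"
    by (simp add: cnj_Gamma cnj_Complex)
  also have "\<dots> = \<i> * y * Gamma (\<i> * y) * Gamma (1 - \<i> * y)"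
  proof -
    have "Complex 1 y = \<i> * y + 1" "Complex 1 (- y) = 1 - \<i> * y" by (simp_all add: complex_eq_iff)
    moreover have "Gamma (\<i> * y + 1) = \<i> * y * Gamma (\<i> * y)"
      by (rule Gamma_plus1) (use assms in \<open>auto elim!: nonpos_Ints_cases simp: complex_eq_iff\<close>)
    ultimately show ?thesis by simp
  qed
  also have "\<dots> = \<i> * y * (of_real pi / sin (of_real pi * (\<i> * y)))"
    using Gamma_reflection_complex[of "\<i> * y"] by (simp add: mult.assoc)
  also have "sin (of_real pi * (\<i> * y)) = \<i> * of_real (sinh (pi * y))"
  proof -
    have "of_real pi * (\<i> * of_real y) = \<i> * complex_of_real (pi * y)" by simp
    then show ?thesis
      by (simp only: sin_i_times) (simp add: sinh_field_def exp_of_real[symmetric] exp_minus)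
  qed
  also have "\<i> * y * (of_real pi / (\<i> * of_real (sinh (pi * y)))) = of_real (pi * y / sinh (pi * y))"
    by simp
  finally show ?thesis by (simp only: of_real_eq_iff)
qed

text \<open>On this line \<open>1 - z\<close> is the conjugate of \<open>z\<close>, so the
  reflection formula is a formula for the modulus.\<close>

lemma norm_Gamma_half_sq: "(norm (Gamma (Complex (1/2) y)))\<^sup>2 = pi / cosh (pi * y)"
proof -
  have "of_real ((norm (Gamma (Complex (1/2) y)))\<^sup>2) = Gamma (Complex (1/2) y) * cnj (Gamma (Complex (1/2) y))"
    by (rule complex_norm_square)
  also have "\<dots> = Gamma (Complex (1/2) y) * Gamma (Complex (1/2) (- y))"
    by (simp add: cnj_Gamma cnj_Complex)
  also have "Complex (1/2) (- y) = 1 - Complex (1/2) y" by (simp add: complex_eq_iff)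
  also have "Gamma (Complex (1/2) y) * Gamma (1 - Complex (1/2) y) = of_real pi / sin (of_real pi * Complex (1/2) y)"
    by (rule Gamma_reflection_complex)
  also have "of_real pi * Complex (1/2) y = of_real (pi/2) + \<i> * of_real (pi * y)"
    by (simp add: complex_eq_iff)
  also have "sin (of_real (pi/2) + \<i> * of_real (pi * y)) = of_real (cosh (pi * y))"
  proof -
    have 1: "sin (complex_of_real (pi / 2)) = 1" "cos (complex_of_real (pi / 2)) = 0"
      by (metis of_real_1 sin_of_real sin_pi_half, metis of_real_0 cos_of_real cos_pi_half)
    show ?thesis
      unfolding sin_add 1 cos_i_times
      by (simp add: cosh_field_def exp_of_real[symmetric] exp_minus)
  qed
  finally show ?thesis by (simp only: of_real_eq_iff flip: of_real_divide)
qed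

text \<open>Polynomial factors are absorbed by an arbitrarily small loss in the exponential rate,
  which is why the decay rates below stay short of the true ones.\<close>

lemma square_le_exp:
  fixes e :: real
  assumes "e > 0"
  shows "\<exists>C>0. \<forall>y. 1 + y\<^sup>2 \<le> C * exp (e * \<bar>y\<bar>)"
proof (intro exI conjI allI)
  show "1 + 2 / e\<^sup>2 > 0" using assms by (simp add: add_pos_pos)
  fix y :: real
  have "(e * \<bar>y\<bar>)\<^sup>2 / 2 \<le> exp (e * \<bar>y\<bar>)"
    using exp_lower_Taylor_quadratic[of "e * \<bar>y\<bar>"] assms by (smt (verit) abs_ge_zero mult_nonneg_nonneg)
  then have "y\<^sup>2 \<le> 2 / e\<^sup>2 * exp (e * \<bar>y\<bar>)"
    using assms by (simp add: field_simps power_mult_distrib)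
  moreover have "1 \<le> exp (e * \<bar>y\<bar>)" using assms by simp
  ultimately have "1 + y\<^sup>2 \<le> exp (e * \<bar>y\<bar>) + 2 / e\<^sup>2 * exp (e * \<bar>y\<bar>)" by (rule add_mono[rotated])
  then show "1 + y\<^sup>2 \<le> (1 + 2 / e\<^sup>2) * exp (e * \<bar>y\<bar>)" by (simp only: ring_distribs mult_1)
qed

text \<open>Multiplied out, this is \<open>1 + 2 t \<le> exp (2 t)\<close>.\<close>

lemma div_sinh_le:
  fixes t :: real assumes "t > 0"
  shows "t / sinh t \<le> (1 + 2 * t) * exp (- t)"
proof -
  have "1 + 2 * t \<le> exp (2 * t)" by (rule exp_ge_add_one_self)
  then have *: "exp (2 * t) * (1 + 2 * t) - (1 + 2 * t) \<ge> 2 * t * exp (2 * t)"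
    by (simp add: algebra_simps)
  have s: "sinh t > 0" using assms by simp
  have "t * exp t * 2 \<le> (1 + 2 * t) * (exp t - exp (- t))"
  proof -
    have "t * exp t * 2 * exp t \<le> (1 + 2 * t) * (exp t - exp (- t)) * exp t"
    proof -
      have "exp t * exp t = exp (2 * t)" "exp t * exp (- t) = 1" by (simp_all flip: exp_add)
      moreover have "t * exp t * 2 * exp t = 2 * t * (exp t * exp t)"
        "(1 + 2 * t) * (exp t - exp (- t)) * exp t = (1 + 2 * t) * (exp t * exp t - exp t * exp (- t))"
        by (simp_all only: algebra_simps)
      ultimately have "t * exp t * 2 * exp t = 2 * t * exp (2 * t)"
        "(1 + 2 * t) * (exp t - exp (- t)) * exp t = exp (2 * t) * (1 + 2 * t) - (1 + 2 * t)"
        by (simp_all only: algebra_simps mult_1_right)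
      then show ?thesis using * by linarith
    qed
    then show ?thesis by (simp only: mult_le_cancel_right_pos[OF exp_gt_zero])
  qed
  then have "t * exp t \<le> (1 + 2 * t) * sinh t" by (simp add: sinh_def)
  then have "t \<le> (1 + 2 * t) * sinh t * exp (- t)"
    by (simp add: exp_minus field_simps)
  then show ?thesis using s by (simp add: field_simps)
qed

text \<open>The true size is \<open>pi y / sinh (pi y)\<close> times a polynomial of degree
  \<open>2 n\<close> in \<open>y\<close>. The rate is generalized in the induction because every
  step spends half of the remaining gap to \<open>pi\<close> on the factor
  \<open>(n + 1)^2 + y^2\<close>.\<close>

lemma norm_Gamma_nat_decay:
  assumes "\<theta> < pi"
  shows "\<exists>C>0. \<forall>y. (norm (Gamma (Complex (real (Suc n)) y)))\<^sup>2 \<le> C * exp (- \<theta> * \<bar>y\<bar>)"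
  using assms
proof (induction n arbitrary: \<theta>)
  case 0
  define e where "e = pi - \<theta>"
  have e: "e > 0" using 0 by (simp add: e_def)
  obtain C where C: "C > 0" "\<And>y. 1 + y\<^sup>2 \<le> C * exp (e * \<bar>y\<bar>)" using square_le_exp[OF e] by auto
  show ?case
  proof (intro exI[of _ "(1 + pi\<^sup>2) * C"] conjI allI)
    show "(1 + pi\<^sup>2) * C > 0" using C by (simp add: add_pos_nonneg)
    fix y :: real
    have b: "(norm (Gamma (Complex 1 y)))\<^sup>2 \<le> (1 + 2 * (pi * \<bar>y\<bar>)) * exp (- pi * \<bar>y\<bar>)"
    proof (cases "y = 0")
      case True
      have "Complex 1 0 = 1" by (simp add: complex_eq_iff)
      then show ?thesis using True by simp
    next
      case False
      have "pi * y / sinh (pi * y) = (pi * \<bar>y\<bar>) / sinh (pi * \<bar>y\<bar>)"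
        by (cases "y > 0") auto
      then show ?thesis using norm_Gamma_1_sq[OF False] div_sinh_le[of "pi * \<bar>y\<bar>"] False by simp
    qed
    have "2 * (pi * \<bar>y\<bar>) \<le> pi\<^sup>2 + y\<^sup>2"
      using zero_le_power2[of "pi - \<bar>y\<bar>"] by (simp add: power2_diff)
    then have "1 + 2 * (pi * \<bar>y\<bar>) \<le> (1 + pi\<^sup>2) * (1 + y\<^sup>2)"
      by (simp add: algebra_simps) (smt (verit) mult_nonneg_nonneg zero_le_power2)
    also have "\<dots> \<le> (1 + pi\<^sup>2) * (C * exp (e * \<bar>y\<bar>))"
      by (intro mult_left_mono C) auto
    finally have "(1 + 2 * (pi * \<bar>y\<bar>)) * exp (- pi * \<bar>y\<bar>) \<le> (1 + pi\<^sup>2) * (C * exp (e * \<bar>y\<bar>)) * exp (- pi * \<bar>y\<bar>)"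
      by (rule mult_right_mono) simp
    also have "\<dots> = (1 + pi\<^sup>2) * C * exp (- \<theta> * \<bar>y\<bar>)"
      by (simp add: e_def algebra_simps flip: exp_add)
    finally show "(norm (Gamma (Complex (real (Suc 0)) y)))\<^sup>2 \<le> (1 + pi\<^sup>2) * C * exp (- \<theta> * \<bar>y\<bar>)"
      using b by simp
  qed
next
  case (Suc n)
  define e where "e = (pi - \<theta>) / 2"
  have e: "e > 0" using Suc by (simp add: e_def)
  obtain C where C: "C > 0" "\<And>y. 1 + y\<^sup>2 \<le> C * exp (e * \<bar>y\<bar>)" using square_le_exp[OF e] by auto
  have "\<theta> + e < pi" using Suc.prems by (simp add: e_def field_simps)
  from Suc.IH[OF this] obtain D where D: "D > 0"
    "\<And>y. (norm (Gamma (Complex (real (Suc n)) y)))\<^sup>2 \<le> D * exp (- (\<theta> + e) * \<bar>y\<bar>)" by auto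
  define N where "N = (real (Suc n))\<^sup>2"
  have N: "N \<ge> 1" by (simp add: N_def)
  show ?case
  proof (intro exI[of _ "N * C * D"] conjI allI)
    show "N * C * D > 0" using C D N by simp
    fix y :: real
    have "(norm (Gamma (Complex (real (Suc (Suc n))) y)))\<^sup>2 = (N + y\<^sup>2) * (norm (Gamma (Complex (real (Suc n)) y)))\<^sup>2"
      using norm_Gamma_plus1_sq[of "real (Suc n)" y] by (simp add: N_def add.commute)
    also have "\<dots> \<le> (N * (C * exp (e * \<bar>y\<bar>))) * (D * exp (- (\<theta> + e) * \<bar>y\<bar>))"
    proof (intro mult_mono D)
      have "N + y\<^sup>2 \<le> N * (1 + y\<^sup>2)"
        using mult_right_mono[OF N, of "y\<^sup>2"] by (simp add: algebra_simps)
      also have "\<dots> \<le> N * (C * exp (e * \<bar>y\<bar>))"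
        using N by (intro mult_left_mono C) auto
      finally show "N + y\<^sup>2 \<le> N * (C * exp (e * \<bar>y\<bar>))" .
    qed (use N C in auto)
    also have "\<dots> = N * C * D * exp (- \<theta> * \<bar>y\<bar>)"
      by (simp add: algebra_simps flip: exp_add)
    finally show "(norm (Gamma (Complex (real (Suc (Suc n))) y)))\<^sup>2 \<le> N * C * D * exp (- \<theta> * \<bar>y\<bar>)" .
  qed
qed

text \<open>Uniformity in \<open>x\<close> is what the contour shift needs, where a whole strip has
  to be controlled. One integer to the right of \<open>a1\<close> serves all \<open>x\<close> by
  monotonicity, at the price of a bound for the real Gamma function on
  \<open>{a0..a1}\<close>.\<close>

lemma norm_Gamma_decay:
  assumes "0 < a0" "\<theta> < pi"
  shows "\<exists>C>0. \<forall>x\<in>{a0..a1}. \<forall>y. (norm (Gamma (Complex x y)))\<^sup>2 \<le> C * exp (- \<theta> * \<bar>y\<bar>)"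
proof -
  obtain n where n: "a1 \<le> real (Suc n)"
    by (metis real_arch_simple le_trans of_nat_le_iff le_SucI order.refl order_trans)
  obtain D where D: "D > 0" "\<And>y. (norm (Gamma (Complex (real (Suc n)) y)))\<^sup>2 \<le> D * exp (- \<theta> * \<bar>y\<bar>)"
    using norm_Gamma_nat_decay[OF assms(2)] by blast
  have "continuous_on {a0..a1} (Gamma :: real \<Rightarrow> real)"
    using assms by (intro continuous_on_Gamma) (auto elim!: nonpos_Ints_cases)
  then have "bounded (Gamma ` {a0..a1})"
    by (intro compact_imp_bounded compact_continuous_image) auto
  then obtain B where B: "B > 0" "\<And>x. x \<in> {a0..a1} \<Longrightarrow> \<bar>Gamma x\<bar> \<le> B"
    by (auto simp: bounded_pos)
  define G where "G = Gamma (real (Suc n))"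
  have G: "G > 0" unfolding G_def by (rule Gamma_real_pos) simp
  show ?thesis
  proof (intro exI[of _ "(B / G)\<^sup>2 * D"] conjI ballI allI)
    show "(B / G)\<^sup>2 * D > 0" using B G D by simp
    fix x y assume x: "x \<in> {a0..a1}"
    then have x0: "x > 0" using assms by auto
    have "norm (Gamma (Complex x y)) / Gamma x \<le> norm (Gamma (Complex (real (Suc n)) y)) / G"
      unfolding G_def using x x0 n by (intro norm_Gamma_ratio_mono) auto
    then have "norm (Gamma (Complex x y)) \<le> Gamma x / G * norm (Gamma (Complex (real (Suc n)) y))"
      using Gamma_real_pos[OF x0] G by (simp add: field_simps)
    also have "\<dots> \<le> B / G * norm (Gamma (Complex (real (Suc n)) y))"
      using B(2)[OF x] G by (intro mult_right_mono divide_right_mono) auto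
    finally have "(norm (Gamma (Complex x y)))\<^sup>2 \<le> (B / G * norm (Gamma (Complex (real (Suc n)) y)))\<^sup>2"
      by (rule power_mono) simp
    also have "\<dots> \<le> (B / G)\<^sup>2 * (D * exp (- \<theta> * \<bar>y\<bar>))"
      unfolding power_mult_distrib by (intro mult_left_mono D) auto
    finally show "(norm (Gamma (Complex x y)))\<^sup>2 \<le> (B / G)\<^sup>2 * D * exp (- \<theta> * \<bar>y\<bar>)" by simp
  qed
qed

section \<open>The Wilson integral\<close>

text \<open>The factor \<open>y sinh (2 pi y)\<close> is \<open>pi / 2\<close> times
  \<open>1 / |Gamma(2 i y)|^2\<close>, written so that nothing is singular at
  \<open>y = 0\<close>.\<close>

definition wilson_kernel :: "real \<Rightarrow> real \<Rightarrow> real \<Rightarrow> real \<Rightarrow> real \<Rightarrow> real" where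
  "wilson_kernel a b c d y =
     (norm (Gamma (Complex a y)))\<^sup>2 * (norm (Gamma (Complex b y)))\<^sup>2 *
     (norm (Gamma (Complex c y)))\<^sup>2 * (norm (Gamma (Complex d y)))\<^sup>2 * (y * sinh (2 * pi * y))"

text \<open>The weight of the continuous dual Hahn polynomials, to which Wilson's weight divided by
  \<open>Gamma(d)^2\<close> tends for large \<open>d\<close>.\<close>

definition hahn_kernel :: "real \<Rightarrow> real \<Rightarrow> real \<Rightarrow> real \<Rightarrow> real" where
  "hahn_kernel a b c y =
     (norm (Gamma (Complex a y)))\<^sup>2 * (norm (Gamma (Complex b y)))\<^sup>2 *
     (norm (Gamma (Complex c y)))\<^sup>2 * (y * sinh (2 * pi * y))"

definition wilson_value :: "real \<Rightarrow> real \<Rightarrow> real \<Rightarrow> real \<Rightarrow> real" where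
  "wilson_value a b c d =
     Gamma (a + b) * Gamma (a + c) * Gamma (a + d) * Gamma (b + c) * Gamma (b + d) * Gamma (c + d) /
     Gamma (a + b + c + d)"

lemma y_sinh_nonneg: "0 \<le> y * sinh (2 * pi * y)" for y :: real
  by (cases "y \<ge> 0") (auto simp: zero_le_mult_iff mult_le_0_iff)

lemma y_sinh_le:
  assumes "e > 0"
  shows "\<exists>C>0. \<forall>y. y * sinh (2 * pi * y) \<le> C * exp ((2 * pi + e) * \<bar>y\<bar>)"
proof -
  obtain C where C: "C > 0" "\<And>y. 1 + y\<^sup>2 \<le> C * exp (e * \<bar>y\<bar>)" using square_le_exp[OF assms] by auto
  have "y * sinh (2 * pi * y) \<le> C * exp ((2 * pi + e) * \<bar>y\<bar>)" for y
  proof -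
    have "sinh t \<le> exp t" if "t \<ge> 0" for t :: real
      using that by (simp add: sinh_def) (smt (verit) exp_gt_zero)
    then have s: "sinh (2 * pi * \<bar>y\<bar>) \<le> exp (2 * pi * \<bar>y\<bar>)" by simp
    have "\<bar>y\<bar> \<le> 1 + y\<^sup>2"
      using zero_le_power2[of "\<bar>y\<bar> - 1"] by (simp add: power2_diff)
    then have "\<bar>y\<bar> \<le> C * exp (e * \<bar>y\<bar>)" using C(2)[of y] by linarith
    then have "\<bar>y\<bar> * sinh (2 * pi * \<bar>y\<bar>) \<le> C * exp (e * \<bar>y\<bar>) * exp (2 * pi * \<bar>y\<bar>)"
      using s by (intro mult_mono) auto
    moreover have "y * sinh (2 * pi * y) = \<bar>y\<bar> * sinh (2 * pi * \<bar>y\<bar>)" by (cases "y \<ge> 0") auto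
    ultimately show ?thesis by (simp add: algebra_simps flip: exp_add)
  qed
  then show ?thesis using C(1) by blast
qed

lemma continuous_on_Gamma_line [continuous_intros]:
  assumes "a > 0"
  shows "continuous_on A (\<lambda>y. Gamma (Complex a y))"
proof -
  have "isCont (\<lambda>y. Gamma (of_real a + \<i> * of_real y)) y" for y
    using Complex_pos_not_nonpos_Ints[OF assms, of y]
    by (intro isCont_Gamma continuous_intros) (simp add: Complex_eq)
  then show ?thesis by (simp add: Complex_eq continuous_at_imp_continuous_on)
qed

lemma wilson_kernel_nonneg: "0 \<le> wilson_kernel a b c d y"
  using y_sinh_nonneg by (auto simp: wilson_kernel_def)

lemma hahn_kernel_nonneg: "0 \<le> hahn_kernel a b c y"
  using y_sinh_nonneg by (auto simp: hahn_kernel_def)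

lemma continuous_on_wilson_kernel:
  assumes "a > 0" "b > 0" "c > 0" "d > 0"
  shows "continuous_on A (wilson_kernel a b c d)"
  using assms unfolding wilson_kernel_def by (intro continuous_intros) auto

lemma wilson_kernel_decay:
  assumes "a > 0" "b > 0" "c > 0" "d > 0"
  shows "\<exists>C>0. \<forall>y. wilson_kernel a b c d y \<le> C * exp (- (pi / 2) * \<bar>y\<bar>)"
proof -
  have *: "\<exists>C>0. \<forall>y. (norm (Gamma (Complex x y)))\<^sup>2 \<le> C * exp (- (3 * pi / 4) * \<bar>y\<bar>)"
    if "x > 0" for x
    using norm_Gamma_decay[OF that, of "3 * pi / 4" x] by simp
  obtain A B C D where A: "A > 0" "\<And>y. (norm (Gamma (Complex a y)))\<^sup>2 \<le> A * exp (- (3 * pi / 4) * \<bar>y\<bar>)"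
    and B: "B > 0" "\<And>y. (norm (Gamma (Complex b y)))\<^sup>2 \<le> B * exp (- (3 * pi / 4) * \<bar>y\<bar>)"
    and C: "C > 0" "\<And>y. (norm (Gamma (Complex c y)))\<^sup>2 \<le> C * exp (- (3 * pi / 4) * \<bar>y\<bar>)"
    and D: "D > 0" "\<And>y. (norm (Gamma (Complex d y)))\<^sup>2 \<le> D * exp (- (3 * pi / 4) * \<bar>y\<bar>)"
    using *[OF assms(1)] *[OF assms(2)] *[OF assms(3)] *[OF assms(4)] by blast
  \<comment> \<open>Four factors of rate \<open>3 pi / 4\<close> against the growth
    \<open>2 pi + pi / 2\<close> leave the rate \<open>pi / 2\<close>.\<close>
  obtain S where S: "S > 0" "\<And>y. y * sinh (2 * pi * y) \<le> S * exp ((2 * pi + pi / 2) * \<bar>y\<bar>)"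
    using y_sinh_le[of "pi / 2"] by auto
  show ?thesis
  proof (intro exI[of _ "A * B * C * D * S"] conjI allI)
    show "A * B * C * D * S > 0" using A B C D S by simp
    fix y
    have "wilson_kernel a b c d y \<le> A * exp (- (3 * pi / 4) * \<bar>y\<bar>) * (B * exp (- (3 * pi / 4) * \<bar>y\<bar>)) *
       (C * exp (- (3 * pi / 4) * \<bar>y\<bar>)) * (D * exp (- (3 * pi / 4) * \<bar>y\<bar>)) *
       (S * exp ((2 * pi + pi / 2) * \<bar>y\<bar>))"
      unfolding wilson_kernel_def
      using A(1) B(1) C(1) D(1) S(1) y_sinh_nonneg[of y]
      by (intro mult_mono A(2) B(2) C(2) D(2) S(2)) auto
    also have "\<dots> = A * B * C * D * S * (exp (- (3 * pi / 4) * \<bar>y\<bar>) * exp (- (3 * pi / 4) * \<bar>y\<bar>) *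
       exp (- (3 * pi / 4) * \<bar>y\<bar>) * exp (- (3 * pi / 4) * \<bar>y\<bar>) * exp ((2 * pi + pi / 2) * \<bar>y\<bar>))"
      by (simp only: mult_ac)
    also have "\<dots> = A * B * C * D * S * exp (- (pi / 2) * \<bar>y\<bar>)"
      unfolding exp_add[symmetric] by (simp add: algebra_simps)
    finally show "wilson_kernel a b c d y \<le> A * B * C * D * S * exp (- (pi / 2) * \<bar>y\<bar>)" .
  qed
qed

lemma hahn_kernel_integrable:
  assumes "a > 0" "b > 0" "c > 0"
  shows "integrable lborel (hahn_kernel a b c)"
proof -
  have *: "\<exists>C>0. \<forall>y. (norm (Gamma (Complex x y)))\<^sup>2 \<le> C * exp (- (3 * pi / 4) * \<bar>y\<bar>)"
    if "x > 0" for x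
    using norm_Gamma_decay[OF that, of "3 * pi / 4" x] by simp
  obtain A B C where A: "A > 0" "\<And>y. (norm (Gamma (Complex a y)))\<^sup>2 \<le> A * exp (- (3 * pi / 4) * \<bar>y\<bar>)"
    and B: "B > 0" "\<And>y. (norm (Gamma (Complex b y)))\<^sup>2 \<le> B * exp (- (3 * pi / 4) * \<bar>y\<bar>)"
    and C: "C > 0" "\<And>y. (norm (Gamma (Complex c y)))\<^sup>2 \<le> C * exp (- (3 * pi / 4) * \<bar>y\<bar>)"
    using *[OF assms(1)] *[OF assms(2)] *[OF assms(3)] by blast
  \<comment> \<open>Three factors supply only \<open>9 pi / 4\<close>, so the loss allowed in the
    growth of \<open>sinh\<close> has to be less than \<open>pi / 4\<close>; with
    \<open>pi / 8\<close> the rate left is \<open>pi / 8\<close>.\<close>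
  obtain S where S: "S > 0" "\<And>y. y * sinh (2 * pi * y) \<le> S * exp ((2 * pi + pi / 8) * \<bar>y\<bar>)"
    using y_sinh_le[of "pi / 8"] by auto
  show ?thesis
  proof (rule integrable_exp_bound)
    show "hahn_kernel a b c \<in> borel_measurable borel"
      unfolding hahn_kernel_def using assms
      by (intro borel_measurable_continuous_onI continuous_intros) auto
    fix y
    have "hahn_kernel a b c y \<le> A * exp (- (3 * pi / 4) * \<bar>y\<bar>) * (B * exp (- (3 * pi / 4) * \<bar>y\<bar>)) *
       (C * exp (- (3 * pi / 4) * \<bar>y\<bar>)) * (S * exp ((2 * pi + pi / 8) * \<bar>y\<bar>))"
      unfolding hahn_kernel_def
      using A(1) B(1) C(1) S(1) y_sinh_nonneg[of y]
      by (intro mult_mono A(2) B(2) C(2) S(2)) auto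
    also have "\<dots> = A * B * C * S * (exp (- (3 * pi / 4) * \<bar>y\<bar>) * exp (- (3 * pi / 4) * \<bar>y\<bar>) *
       exp (- (3 * pi / 4) * \<bar>y\<bar>) * exp ((2 * pi + pi / 8) * \<bar>y\<bar>))"
      by (simp only: mult_ac)
    also have "\<dots> = A * B * C * S * exp (- (pi / 8) * \<bar>y\<bar>)"
      unfolding exp_add[symmetric] by (simp add: algebra_simps)
    finally show "norm (hahn_kernel a b c y) \<le> A * B * C * S * exp (- (pi / 8) * \<bar>y\<bar>)"
      using hahn_kernel_nonneg[of a b c y] by simp
  qed simp
qed

lemma wilson_kernel_integrable:
  assumes "a > 0" "b > 0" "c > 0" "d > 0"
  shows "integrable lborel (wilson_kernel a b c d)"
proof -
  obtain C where C: "\<And>y. wilson_kernel a b c d y \<le> C * exp (- (pi / 2) * \<bar>y\<bar>)"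
    using wilson_kernel_decay[OF assms] by blast
  show ?thesis
    by (rule integrable_exp_bound[of "pi / 2" _ C])
      (use C wilson_kernel_nonneg continuous_on_wilson_kernel[OF assms] in
        \<open>auto intro: borel_measurable_continuous_onI\<close>)
qed

lemma wilson_kernel_plus1:
  assumes "d > 0"
  shows "wilson_kernel a b c (d + 1) y = (d\<^sup>2 + y\<^sup>2) * wilson_kernel a b c d y"
  unfolding wilson_kernel_def norm_Gamma_plus1_sq[OF assms] by (simp add: mult_ac)

section \<open>Contour shift and recurrence\<close>

lemma norm_sin_le: "norm (sin z) \<le> exp \<bar>Im z\<bar>" for z :: complex
proof -
  have "norm (sin z) = norm (exp (\<i> * z) - exp (- \<i> * z)) / 2"
    by (simp add: sin_exp_eq norm_divide norm_mult)
  also have "\<dots> \<le> (norm (exp (\<i> * z)) + norm (exp (- \<i> * z))) / 2"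
    by (intro divide_right_mono norm_triangle_ineq4) auto
  also have "\<dots> = (exp (- Im z) + exp (Im z)) / 2" by simp
  also have "\<dots> \<le> exp \<bar>Im z\<bar>"
  proof -
    have mean_le: "(u + v) / 2 \<le> e" if "u \<le> e" "v \<le> e" for u v e :: real using that by simp
    show ?thesis by (rule mean_le) simp_all
  qed
  finally show ?thesis .
qed

text \<open>On the closed strip both arguments have real part in \<open>{a..a + 1}\<close>, so one
  constant from \<open>norm_Gamma_decay\<close> bounds both factors; the product of the norms is at
  most the mean of the squares.\<close>

lemma norm_Gamma_pair_decay:
  assumes "a > 0"
  shows "\<exists>C>0. \<forall>s. 0 \<le> Re s \<and> Re s \<le> 1 \<longrightarrow>
    norm (Gamma (of_real a + s) * Gamma (of_real a + 1 - s)) \<le> C * exp (- (3 * pi / 4) * \<bar>Im s\<bar>)"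
proof -
  obtain C where C: "C > 0"
    "\<And>x y. x \<in> {a..a+1} \<Longrightarrow> (norm (Gamma (Complex x y)))\<^sup>2 \<le> C * exp (- (3 * pi / 4) * \<bar>y\<bar>)"
    using norm_Gamma_decay[OF assms, of "3 * pi / 4" "a + 1"] by auto
  have "norm (Gamma (of_real a + s) * Gamma (of_real a + 1 - s)) \<le> C * exp (- (3 * pi / 4) * \<bar>Im s\<bar>)"
    if "0 \<le> Re s" "Re s \<le> 1" for s
  proof -
    have e: "of_real a + s = Complex (a + Re s) (Im s)" "of_real a + 1 - s = Complex (a + 1 - Re s) (- Im s)"
      by (simp_all add: complex_eq_iff)
    define u v where "u = norm (Gamma (of_real a + s))" and "v = norm (Gamma (of_real a + 1 - s))"
    have "u\<^sup>2 \<le> C * exp (- (3 * pi / 4) * \<bar>Im s\<bar>)" "v\<^sup>2 \<le> C * exp (- (3 * pi / 4) * \<bar>Im s\<bar>)"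
      unfolding u_def v_def e using C(2)[of "a + Re s" "Im s"] C(2)[of "a + 1 - Re s" "- Im s"] that by auto
    moreover have "2 * (u * v) \<le> u\<^sup>2 + v\<^sup>2"
      using zero_le_power2[of "u - v"] by (simp add: power2_diff)
    ultimately have "u * v \<le> C * exp (- (3 * pi / 4) * \<bar>Im s\<bar>)" by linarith
    then show ?thesis by (simp add: u_def v_def norm_mult)
  qed
  then show ?thesis using C(1) by blast
qed

text \<open>This links the Lebesgue integral over the line to integrals over \<open>[-n, n]\<close>,
  where primitives and differentiation under the integral are available.\<close>

lemma tendsto_integral_symmetric:
  fixes f :: "real \<Rightarrow> 'a::euclidean_space"
  assumes "integrable lborel f" "continuous_on UNIV f"
  shows "(\<lambda>n. integral {- real n..real n} f) \<longlonglongrightarrow> (LINT y|lborel. f y)"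
proof -
  have "(\<lambda>n. LINT y|lborel. indicator {- real n..real n} y *\<^sub>R f y) \<longlonglongrightarrow> (LINT y|lborel. f y)"
  proof (rule integral_dominated_convergence[where w = "\<lambda>y. norm (f y)"])
    show "AE y in lborel. (\<lambda>n. indicator {- real n..real n} y *\<^sub>R f y) \<longlonglongrightarrow> f y"
    proof (rule AE_I2)
      fix y :: real
      obtain N where N: "\<bar>y\<bar> \<le> real N" using real_arch_simple by blast
      have "\<forall>\<^sub>F n in sequentially. indicator {- real n..real n} y *\<^sub>R f y = f y"
        by (rule eventually_sequentiallyI[of N]) (use N in \<open>auto simp: indicator_def\<close>)
      then show "(\<lambda>n. indicator {- real n..real n} y *\<^sub>R f y) \<longlonglongrightarrow> f y"
        by (rule tendsto_eventually)
    qed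
  qed (use assms in \<open>auto simp: indicator_def\<close>)
  moreover have "(LINT y|lborel. indicator {- real n..real n} y *\<^sub>R f y) = integral {- real n..real n} f" for n
  proof -
    have "set_integrable lborel {- real n..real n} f"
      using assms(2) by (intro borel_integrable_atLeastAtMost') (auto intro: continuous_on_subset)
    from set_borel_integral_eq_integral(2)[OF this] show ?thesis
      by (simp add: set_lebesgue_integral_def)
  qed
  ultimately show ?thesis by simp
qed

text \<open>
  The integrand below is the boundary value of a function that is odd under \<open>s \<mapsto> 1 - s\<close>; shifting the
  contour from \<open>Re s = 0\<close> to \<open>Re s = 1\<close> shows that its integral vanishes.
\<close>

lemma wilson_contour_shift:
  assumes pos: "a > 0" "b > 0" "c > 0" "d > 0"
  shows "(LINT y|lborel. wilson_kernel a b c d y *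
            ((a + b + c + d) * y\<^sup>2 - (a*b*c + a*b*d + a*c*d + b*c*d))) = 0"
proof -
  \<comment> \<open>At \<open>s = i y\<close> the product \<open>g x s\<close> equals
    \<open>|Gamma(x + i y)|^2 (x - i y)\<close>, the contribution of \<open>x\<close> to Wilson's
    weight up to a linear factor. It is invariant under \<open>s \<mapsto> 1 - s\<close>, while the
    sine changes sign.\<close>
  define g where "g = (\<lambda>(a::real) (s::complex). Gamma (of_real a + s) * Gamma (of_real a + 1 - s))"
  define h where "h = (\<lambda>s. g a s * g b s * g c s * g d s * sin (2 * of_real pi * s))"
  \<comment> \<open>The poles of \<open>h\<close> have real part at most \<open>- m\<close> or at
    least \<open>1 + m\<close>, so the open strip \<open>S\<close> contains the closed strip between
    the two contours.\<close>
  define m where "m = min (min a b) (min c d)"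
  have m: "m > 0" "m \<le> a" "m \<le> b" "m \<le> c" "m \<le> d" using pos by (auto simp: m_def)
  define S where "S = {s. - m < Re s} \<inter> {s. Re s < 1 + m}"
  have S: "open S" "convex S"
    unfolding S_def by (auto intro!: open_Int convex_Int open_halfspace_Re_gt open_halfspace_Re_lt
        convex_halfspace_Re_gt convex_halfspace_Re_lt)
  have nz: "of_real x + s \<notin> \<int>\<^sub>\<le>\<^sub>0" "of_real x + 1 - s \<notin> \<int>\<^sub>\<le>\<^sub>0" if "s \<in> S" "m \<le> x" for x s
    using that by (auto simp: S_def elim!: nonpos_Ints_cases simp: complex_eq_iff)
  have hol: "h holomorphic_on S"
    unfolding h_def g_def using m nz by (intro holomorphic_intros) auto
  \<comment> \<open>On a convex domain \<open>h\<close> has a primitive. Each side of the rectangle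
    then contributes a difference of values of \<open>H\<close>, and Cauchy's theorem for the
    rectangle is a telescoping sum.\<close>
  obtain H where H: "\<And>s. s \<in> S \<Longrightarrow> (H has_field_derivative h s) (at s)"
    using holomorphic_convex_primitive'[OF S(2,1) hol] at_within_open[OF _ S(1)] by metis
  obtain K where K: "K > 0" "\<And>s. 0 \<le> Re s \<Longrightarrow> Re s \<le> 1 \<Longrightarrow> norm (h s) \<le> K * exp (- pi * \<bar>Im s\<bar>)"
  proof -
    have gb: "\<exists>C>0. \<forall>s. 0 \<le> Re s \<longrightarrow> Re s \<le> 1 \<longrightarrow> norm (g x s) \<le> C * exp (- (3 * pi / 4) * \<bar>Im s\<bar>)"
      if "x > 0" for x
      using norm_Gamma_pair_decay[OF that] unfolding g_def by blast
    obtain A where A: "A > 0" "\<And>s. 0 \<le> Re s \<Longrightarrow> Re s \<le> 1 \<Longrightarrow> norm (g a s) \<le> A * exp (- (3 * pi / 4) * \<bar>Im s\<bar>)"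
      using gb[OF pos(1)] by blast
    obtain B where B: "B > 0" "\<And>s. 0 \<le> Re s \<Longrightarrow> Re s \<le> 1 \<Longrightarrow> norm (g b s) \<le> B * exp (- (3 * pi / 4) * \<bar>Im s\<bar>)"
      using gb[OF pos(2)] by blast
    obtain C where C: "C > 0" "\<And>s. 0 \<le> Re s \<Longrightarrow> Re s \<le> 1 \<Longrightarrow> norm (g c s) \<le> C * exp (- (3 * pi / 4) * \<bar>Im s\<bar>)"
      using gb[OF pos(3)] by blast
    obtain D where D: "D > 0" "\<And>s. 0 \<le> Re s \<Longrightarrow> Re s \<le> 1 \<Longrightarrow> norm (g d s) \<le> D * exp (- (3 * pi / 4) * \<bar>Im s\<bar>)"
      using gb[OF pos(4)] by blast
    show ?thesis
    proof (rule that[of "A * B * C * D"])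
      show "A * B * C * D > 0" using A B C D by simp
      fix s assume s: "0 \<le> Re s" "Re s \<le> 1"
      have "norm (sin (2 * of_real pi * s)) \<le> exp (2 * pi * \<bar>Im s\<bar>)"
        using norm_sin_le[of "2 * of_real pi * s"] by (simp add: abs_mult)
      then have "norm (h s) \<le> A * exp (- (3 * pi / 4) * \<bar>Im s\<bar>) * (B * exp (- (3 * pi / 4) * \<bar>Im s\<bar>)) *
         (C * exp (- (3 * pi / 4) * \<bar>Im s\<bar>)) * (D * exp (- (3 * pi / 4) * \<bar>Im s\<bar>)) * exp (2 * pi * \<bar>Im s\<bar>)"
        unfolding h_def norm_mult using A(1) B(1) C(1) D(1)
        by (intro mult_mono A(2)[OF s] B(2)[OF s] C(2)[OF s] D(2)[OF s]) auto
      also have "\<dots> = A * B * C * D * (exp (- (3 * pi / 4) * \<bar>Im s\<bar>) * exp (- (3 * pi / 4) * \<bar>Im s\<bar>) *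
         exp (- (3 * pi / 4) * \<bar>Im s\<bar>) * exp (- (3 * pi / 4) * \<bar>Im s\<bar>) * exp (2 * pi * \<bar>Im s\<bar>))"
        by (simp only: mult_ac)
      also have "\<dots> = A * B * C * D * exp (- pi * \<bar>Im s\<bar>)"
        unfolding exp_add[symmetric] by (simp add: algebra_simps)
      finally show "norm (h s) \<le> A * B * C * D * exp (- pi * \<bar>Im s\<bar>)" .
    qed
  qed
  have inS: "Complex x y \<in> S" if "0 \<le> x" "x \<le> 1" for x y using that m by (auto simp: S_def)
  have cont: "continuous_on UNIV (\<lambda>y. h (Complex 0 y))"
  proof -
    have "continuous_on UNIV (\<lambda>y. Complex 0 y)"
      by (simp add: Complex_eq) (intro continuous_intros)
    then show ?thesis
      by (rule continuous_on_compose2[OF holomorphic_on_imp_continuous_on[OF hol]]) (use inS in auto)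
  qed
  have int: "integrable lborel (\<lambda>y. h (Complex 0 y))"
    by (rule integrable_exp_bound[of pi _ K]) (use K(2)[of "Complex 0 _"] cont in
        \<open>auto intro: borel_measurable_continuous_onI\<close>)
  define J where "J = (\<lambda>R::real. integral {-R..R} (\<lambda>y. h (Complex 0 y)))"
  have hI: "h (Complex 1 y) = - h (Complex 0 (- y))" for y
  proof -
    have s: "Complex 1 y = 1 - Complex 0 (- y)" by (simp add: complex_eq_iff)
    have "g x (1 - z) = g x z" for x z by (simp add: g_def mult.commute add_diff_eq)
    moreover have "sin (2 * of_real pi * (1 - z)) = - sin (2 * of_real pi * z)" for z :: complex
      by (simp add: right_diff_distrib sin_diff)
    ultimately show ?thesis unfolding s h_def by simp
  qed
  have hint: "((\<lambda>y. \<i> * h (Complex x y)) has_integral (H (Complex x R) - H (Complex x (- R)))) {-R..R}"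
    if "x \<in> {0..1}" "R \<ge> 0" for x R
  proof (rule fundamental_theorem_of_calculus)
    fix y
    have "((\<lambda>y. H (Complex x y)) has_vector_derivative (\<i> * h (Complex x y))) (at y)"
    proof -
      have "((\<lambda>y. Complex x y) has_vector_derivative \<i>) (at y)"
        unfolding Complex_eq by (auto intro!: derivative_eq_intros)
      moreover have "(H has_field_derivative h (Complex x y)) (at (Complex x y))"
        using that inS H by auto
      ultimately show ?thesis using field_vector_diff_chain_at by (fastforce simp: o_def)
    qed
    then show "((\<lambda>y. H (Complex x y)) has_vector_derivative (\<i> * h (Complex x y))) (at y within {-R..R})"
      by (rule has_vector_derivative_at_within)
  qed (use that in auto)
  have side: "norm (H (Complex 0 y) - H (Complex 1 y)) \<le> K * exp (- pi * \<bar>y\<bar>)" for y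
  proof -
    define T where "T = closed_segment (Complex 0 y) (Complex 1 y)"
    have T: "s \<in> T \<Longrightarrow> 0 \<le> Re s \<and> Re s \<le> 1 \<and> Im s = y" for s
      by (auto simp: T_def closed_segment_def complex_eq_iff algebra_simps)
    have "norm (H (Complex 0 y) - H (Complex 1 y)) \<le> K * exp (- pi * \<bar>y\<bar>) * norm (Complex 0 y - Complex 1 y)"
    proof (rule field_differentiable_bound[of T])
      fix s assume s: "s \<in> T"
      then show "norm (h s) \<le> K * exp (- pi * \<bar>y\<bar>)" using T[OF s] K(2)[of s] by simp
      have "s \<in> S" using inS[of "Re s" y] T[OF s] by (metis complex_surj)
      then show "(H has_field_derivative h s) (at s within T)"
        using H has_field_derivative_at_within by blast
    qed (auto simp: T_def)
    moreover have "norm (Complex 0 y - Complex 1 y) = 1" by (simp add: cmod_def)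
    ultimately show ?thesis by simp
  qed
  have J_bound: "norm (J R) \<le> K * exp (- pi * R)" if "R \<ge> 0" for R
  proof -
    have "\<i> * J R = H (Complex 0 R) - H (Complex 0 (- R))"
      using integral_unique[OF hint[of 0 R]] that by (simp add: J_def)
    moreover have "\<i> * (- J R) = H (Complex 1 R) - H (Complex 1 (- R))"
    proof -
      have "integral {-R..R} (\<lambda>y. \<i> * h (Complex 1 y)) = \<i> * (- J R)"
        unfolding J_def hI using Henstock_Kurzweil_Integration.integral_reflect_real[of R "-R" "\<lambda>y. h (Complex 0 y)"] by simp
      then show ?thesis using integral_unique[OF hint[of 1 R]] that by simp
    qed
    \<comment> \<open>By the oddness of \<open>h\<close> the two vertical sides reinforce each other
      instead of cancelling; they equal the horizontal sides, which decay with
      \<open>R\<close>.\<close>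
    ultimately have "2 * \<i> * J R = (H (Complex 0 R) - H (Complex 1 R)) - (H (Complex 0 (- R)) - H (Complex 1 (- R)))"
      by (simp add: algebra_simps)
    then have "norm (2 * \<i> * J R) \<le> K * exp (- pi * \<bar>R\<bar>) + K * exp (- pi * \<bar>- R\<bar>)"
      using order_trans[OF norm_triangle_ineq4 add_mono[OF side[of R] side[of "- R"]]] by simp
    then show ?thesis using that by (simp add: norm_mult)
  qed
  have "(\<lambda>n. J (real n)) \<longlonglongrightarrow> 0"
  proof (rule Lim_null_comparison)
    show "\<forall>\<^sub>F n in sequentially. norm (J (real n)) \<le> K * exp (- pi * real n)"
      using J_bound by simp
    have "(\<lambda>n. K * exp (- pi) ^ n) \<longlonglongrightarrow> 0"
      by (intro tendsto_mult_right_zero LIMSEQ_realpow_zero) auto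
    then show "(\<lambda>n. K * exp (- pi * real n)) \<longlonglongrightarrow> 0"
      by (simp flip: exp_of_nat2_mult)
  qed
  then have zero: "(LINT y|lborel. h (Complex 0 y)) = 0"
    using tendsto_integral_symmetric[OF int cont] unfolding J_def by (rule LIMSEQ_unique[rotated])
  \<comment> \<open>In the product of the four factors \<open>x - i y\<close> the elementary
    symmetric functions of degree 1 and 3 come with odd powers of \<open>i\<close>; after
    multiplication by the \<open>i\<close> of the sine they alone are real.\<close>
  have hval: "Re (h (Complex 0 y)) = - (wilson_kernel a b c d y *
            ((a + b + c + d) * y\<^sup>2 - (a*b*c + a*b*d + a*c*d + b*c*d)))" for y
  proof -
    have gv: "g x (Complex 0 y) = of_real ((norm (Gamma (Complex x y)))\<^sup>2) * Complex x (- y)" if "x > 0" for x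
    proof -
      have "of_real x + Complex 0 y = Complex x y" "of_real x + 1 - Complex 0 y = Complex (x + 1) (- y)"
        by (simp_all add: complex_eq_iff)
      then have "g x (Complex 0 y) = Complex x (- y) * (Gamma (Complex x y) * cnj (Gamma (Complex x y)))"
        using that by (simp add: g_def Gamma_Complex_plus1 cnj_Gamma cnj_Complex)
      then show ?thesis by (simp only: complex_norm_square[symmetric] mult.commute)
    qed
    have sv: "sin (2 * of_real pi * Complex 0 y) = \<i> * of_real (sinh (2 * pi * y))"
    proof -
      have "2 * of_real pi * Complex 0 y = \<i> * of_real (2 * pi * y)" by (simp add: complex_eq_iff)
      then show ?thesis
        by (simp only: sin_i_times) (simp add: sinh_field_def exp_of_real[symmetric] exp_minus)
    qed
    have "h (Complex 0 y) = of_real ((norm (Gamma (Complex a y)))\<^sup>2 * (norm (Gamma (Complex b y)))\<^sup>2 *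
       (norm (Gamma (Complex c y)))\<^sup>2 * (norm (Gamma (Complex d y)))\<^sup>2 * sinh (2 * pi * y)) *
       (Complex a (- y) * Complex b (- y) * Complex c (- y) * Complex d (- y) * \<i>)"
      unfolding h_def gv[OF pos(1)] gv[OF pos(2)] gv[OF pos(3)] gv[OF pos(4)] sv by (simp add: mult_ac)
    moreover have "Re (Complex a (- y) * Complex b (- y) * Complex c (- y) * Complex d (- y) * \<i>) =
       - (y * ((a + b + c + d) * y\<^sup>2 - (a*b*c + a*b*d + a*c*d + b*c*d)))"
      by (simp add: algebra_simps power2_eq_square)
    moreover have "Re (of_real r * z) = r * Re z" for r z by simp
    ultimately show ?thesis
      unfolding wilson_kernel_def by (simp only:) (simp only: mult_ac mult_minus_right)
  qed
  have "0 = Re (LINT y|lborel. h (Complex 0 y))" using zero by simp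
  also have "\<dots> = (LINT y|lborel. Re (h (Complex 0 y)))" using int by simp
  finally show ?thesis unfolding hval by simp
qed

text \<open>The vanishing integral fixes the mean of \<open>y^2\<close> as \<open>q / p\<close>, the
  third elementary symmetric function of the parameters over the first. Raising \<open>d\<close>
  multiplies the weight by \<open>d^2 + y^2\<close>, and \<open>d^2 p + q\<close> factors as
  \<open>(a + d)(b + d)(c + d)\<close>.\<close>

lemma wilson_recurrence:
  assumes pos: "a > 0" "b > 0" "c > 0" "d > 0"
  shows "(LINT y|lborel. wilson_kernel a b c (d + 1) y) =
     (a + d) * (b + d) * (c + d) / (a + b + c + d) * (LINT y|lborel. wilson_kernel a b c d y)"
proof -
  let ?w = "wilson_kernel a b c d"
  have int: "integrable lborel ?w" by (rule wilson_kernel_integrable[OF pos])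
  \<comment> \<open>The second moment exists because \<open>y^2\<close> times the weight is the
    weight for \<open>d + 1\<close> minus \<open>d^2\<close> times the weight for
    \<open>d\<close>.\<close>
  have "integrable lborel (\<lambda>y. wilson_kernel a b c (d + 1) y - d\<^sup>2 * ?w y)"
    using wilson_kernel_integrable[of a b c "d + 1"] pos int by simp
  then have int2: "integrable lborel (\<lambda>y. y\<^sup>2 * ?w y)"
    by (simp add: wilson_kernel_plus1[OF pos(4)] ring_distribs)
  define T Y where "T = (LINT y|lborel. ?w y)" and "Y = (LINT y|lborel. y\<^sup>2 * ?w y)"
  define p q where "p = a + b + c + d" and "q = a*b*c + a*b*d + a*c*d + b*c*d"
  have p: "p > 0" using pos by (simp add: p_def)
  have "0 = (LINT y|lborel. ?w y * (p * y\<^sup>2 - q))"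
    using wilson_contour_shift[OF pos] by (simp add: p_def q_def)
  also have "\<dots> = (LINT y|lborel. p * (y\<^sup>2 * ?w y) - q * ?w y)"
    by (simp add: algebra_simps)
  also have "\<dots> = p * Y - q * T"
    using int int2 unfolding T_def Y_def by (subst Bochner_Integration.integral_diff) auto
  finally have Y: "Y = q / p * T" using p by (simp add: field_simps)
  have "(LINT y|lborel. wilson_kernel a b c (d + 1) y) = (LINT y|lborel. d\<^sup>2 * ?w y + y\<^sup>2 * ?w y)"
    by (simp add: wilson_kernel_plus1[OF pos(4)] ring_distribs)
  also have "\<dots> = d\<^sup>2 * T + Y"
    using int int2 unfolding T_def Y_def by (subst Bochner_Integration.integral_add) auto
  also have "\<dots> = (d\<^sup>2 * p + q) / p * T" unfolding Y using p by (simp add: field_simps)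
  also have "d\<^sup>2 * p + q = (a + d) * (b + d) * (c + d)"
    by (simp add: p_def q_def algebra_simps power2_eq_square)
  finally show ?thesis by (simp add: p_def T_def)
qed

section \<open>Independence of the ratio from the parameters\<close>

lemma Gamma_real_plus1: "x > 0 \<Longrightarrow> Gamma (x + 1) = x * Gamma (x :: real)"
  by (rule Gamma_plus1) (auto elim!: nonpos_Ints_cases)

lemma wilson_value_pos:
  assumes "a > 0" "b > 0" "c > 0" "d > 0"
  shows "wilson_value a b c d > 0"
  using assms unfolding wilson_value_def by (intro divide_pos_pos mult_pos_pos Gamma_real_pos) auto

lemma wilson_value_plus1:
  assumes pos: "a > 0" "b > 0" "c > 0" "d > 0"
  shows "wilson_value a b c (d + 1) = (a + d) * (b + d) * (c + d) / (a + b + c + d) * wilson_value a b c d"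
proof -
  have "Gamma (x + (d + 1)) = (x + d) * Gamma (x + d)" if "x > 0" for x
    using Gamma_real_plus1[of "x + d"] that pos by (simp add: add.assoc)
  from this[OF pos(1)] this[OF pos(2)] this[OF pos(3)] this[of "a + b + c"] show ?thesis
    using pos by (simp add: wilson_value_def)
qed

definition wilson_ratio :: "real \<Rightarrow> real \<Rightarrow> real \<Rightarrow> real \<Rightarrow> real" where
  "wilson_ratio a b c d = (LINT y|lborel. wilson_kernel a b c d y) / wilson_value a b c d"

lemma wilson_ratio_add_nat:
  assumes pos: "a > 0" "b > 0" "c > 0" "d > 0"
  shows "wilson_ratio a b c (d + real n) = wilson_ratio a b c d"
proof (induction n)
  case (Suc n)
  have d: "d + real n > 0" using pos by simp
  have "(a + (d + real n)) * (b + (d + real n)) * (c + (d + real n)) / (a + b + c + (d + real n)) \<noteq> 0"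
    using pos d by (simp add: add_pos_pos less_imp_neq[symmetric])
  then have "wilson_ratio a b c (d + real n + 1) = wilson_ratio a b c (d + real n)"
    unfolding wilson_ratio_def wilson_recurrence[OF pos(1-3) d] wilson_value_plus1[OF pos(1-3) d]
    by (rule mult_divide_mult_cancel_left)
  then show ?case using Suc by (simp add: ac_simps)
qed simp

lemma wilson_ratio_perm:
  "wilson_ratio a b c d = wilson_ratio a b d c" "wilson_ratio a b c d = wilson_ratio a d c b"
  "wilson_ratio a b c d = wilson_ratio d b c a"
  by (simp_all add: wilson_ratio_def wilson_kernel_def wilson_value_def ac_simps)

text \<open>Gauss's product read backwards: \<open>Gamma_series z n\<close> is \<open>n! n^z\<close>
  over a Pochhammer symbol that equals \<open>Gamma(z + n + 1) / Gamma(z)\<close>. The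
  normalizations \<open>n! n^z\<close> can then be cancelled between different
  \<open>z\<close>.\<close>

lemma Gamma_shift_LIMSEQ:
  assumes "z \<notin> \<int>\<^sub>\<le>\<^sub>0"
  shows "(\<lambda>n. Gamma (z + of_nat (Suc n)) / (fact n * exp (z * of_real (ln (real n))))) \<longlonglongrightarrow> (1 :: 'a :: Gamma)"
proof -
  have nz: "Gamma z \<noteq> 0" using assms by (simp add: Gamma_eq_zero_iff)
  have "(\<lambda>n. Gamma z / Gamma_series z n) \<longlonglongrightarrow> Gamma z / Gamma z"
    using nz by (intro tendsto_divide tendsto_const Gamma_series_LIMSEQ)
  moreover have "Gamma z / Gamma_series z n = Gamma (z + of_nat (Suc n)) / (fact n * exp (z * of_real (ln (real n))))" for n
    using pochhammer_Gamma[OF assms, of "Suc n"] nz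
    by (simp add: Gamma_series_def field_simps)
  ultimately show ?thesis using nz by simp
qed

lemma norm_Gamma_ratio_shift:
  assumes "d > 0"
  shows "(\<lambda>n. norm (Gamma (Complex (d + real n) y)) / Gamma (d + real n)) \<longlonglongrightarrow> 1"
proof (rule LIMSEQ_imp_Suc)
  have 1: "(\<lambda>n. norm (Gamma (Complex d y + of_nat (Suc n)) / (fact n * exp (Complex d y * of_real (ln (real n))))))
       \<longlonglongrightarrow> norm (1 :: complex)"
    using assms by (intro tendsto_norm Gamma_shift_LIMSEQ) auto
  have 2: "(\<lambda>n. Gamma (d + of_nat (Suc n)) / (fact n * exp (d * of_real (ln (real n))))) \<longlonglongrightarrow> 1"
    using assms by (intro Gamma_shift_LIMSEQ) (auto elim!: nonpos_Ints_cases)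
  have "(\<lambda>n. norm (Gamma (Complex d y + of_nat (Suc n)) / (fact n * exp (Complex d y * of_real (ln (real n))))) /
       (Gamma (d + of_nat (Suc n)) / (fact n * exp (d * of_real (ln (real n)))))) \<longlonglongrightarrow> 1"
    using tendsto_divide[OF 1 2] by simp
  moreover have "Complex d y + of_nat (Suc n) = Complex (d + real (Suc n)) y" for n
    by (simp add: complex_eq_iff)
  ultimately show "(\<lambda>n. norm (Gamma (Complex (d + real (Suc n)) y)) / Gamma (d + real (Suc n))) \<longlonglongrightarrow> 1"
    by (simp add: norm_divide norm_mult)
qed

lemma wilson_value_LIMSEQ:
  assumes pos: "a > 0" "b > 0" "c > 0" "d > 0"
  shows "(\<lambda>n. wilson_value a b c (d + real n) / (Gamma (d + real n))\<^sup>2)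
           \<longlonglongrightarrow> Gamma (a + b) * Gamma (a + c) * Gamma (b + c)"
proof (rule LIMSEQ_imp_Suc)
  define q where "q = (\<lambda>(z::real) n. Gamma (z + of_nat (Suc n)) / (fact n * exp (z * of_real (ln (real n)))))"
  have q: "q z \<longlonglongrightarrow> 1" if "z > 0" for z
    unfolding q_def using that by (intro Gamma_shift_LIMSEQ) (auto elim!: nonpos_Ints_cases)
  have "(\<lambda>n. Gamma (a + b) * Gamma (a + c) * Gamma (b + c) *
     (q (a + d) n * q (b + d) n * q (c + d) n / (q (a + b + c + d) n * (q d n)\<^sup>2)))
     \<longlonglongrightarrow> Gamma (a + b) * Gamma (a + c) * Gamma (b + c) * (1 * 1 * 1 / (1 * 1\<^sup>2))"
    using pos by (intro tendsto_intros q) auto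
  moreover have "Gamma (a + b) * Gamma (a + c) * Gamma (b + c) *
     (q (a + d) n * q (b + d) n * q (c + d) n / (q (a + b + c + d) n * (q d n)\<^sup>2)) =
     wilson_value a b c (d + real (Suc n)) / (Gamma (d + real (Suc n)))\<^sup>2" for n
  proof -
    define L where "L = ln (real n)"
    \<comment> \<open>The exponents of \<open>n\<close> balance:
      \<open>(a + d) + (b + d) + (c + d) = (a + b + c + d) + 2 d\<close>. This makes
      \<open>Gamma(d + n)^2\<close> the right divisor.\<close>
    have e: "exp ((a + d) * L) * exp ((b + d) * L) * exp ((c + d) * L) =
        exp ((a + b + c + d) * L) * (exp (d * L))\<^sup>2"
      by (simp add: power2_eq_square algebra_simps flip: exp_add)
    define u where "u = exp ((a + d) * L) * exp ((b + d) * L) * exp ((c + d) * L)"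
    have u: "u \<noteq> 0" by (simp add: u_def)
    have "q (a + d) n * q (b + d) n * q (c + d) n =
        Gamma (a + d + of_nat (Suc n)) * Gamma (b + d + of_nat (Suc n)) * Gamma (c + d + of_nat (Suc n)) / (fact n ^ 3 * u)"
      by (simp add: q_def u_def L_def power3_eq_cube)
    moreover have "q (a + b + c + d) n * (q d n)\<^sup>2 =
        Gamma (a + b + c + d + of_nat (Suc n)) * (Gamma (d + of_nat (Suc n)))\<^sup>2 / (fact n ^ 3 * u)"
      unfolding u_def e by (simp add: q_def L_def power3_eq_cube power2_eq_square)
    ultimately show ?thesis
      using u by (simp add: wilson_value_def ac_simps)
  qed
  ultimately show "(\<lambda>n. wilson_value a b c (d + real (Suc n)) / (Gamma (d + real (Suc n)))\<^sup>2)
           \<longlonglongrightarrow> Gamma (a + b) * Gamma (a + c) * Gamma (b + c)" by simp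
qed

text \<open>Because \<open>|Gamma(x + i y)| \<le> Gamma(x)\<close>, the limit function is itself the
  integrable majorant.\<close>

lemma wilson_kernel_LIMSEQ:
  assumes pos: "a > 0" "b > 0" "c > 0" "d > 0"
  shows "(\<lambda>n. (LINT y|lborel. wilson_kernel a b c (d + real n) y) / (Gamma (d + real n))\<^sup>2)
           \<longlonglongrightarrow> (LINT y|lborel. hahn_kernel a b c y)"
proof -
  have e: "wilson_kernel a b c (d + real n) y / (Gamma (d + real n))\<^sup>2 =
      hahn_kernel a b c y * (norm (Gamma (Complex (d + real n) y)) / Gamma (d + real n))\<^sup>2" for n y
    by (simp add: wilson_kernel_def hahn_kernel_def power_divide)
  have "(\<lambda>n. LINT y|lborel. wilson_kernel a b c (d + real n) y / (Gamma (d + real n))\<^sup>2)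
           \<longlonglongrightarrow> (LINT y|lborel. hahn_kernel a b c y)"
  proof (rule integral_dominated_convergence[where w = "hahn_kernel a b c"])
    show "integrable lborel (hahn_kernel a b c)" by (rule hahn_kernel_integrable[OF pos(1-3)])
    show "hahn_kernel a b c \<in> borel_measurable lborel"
      using borel_measurable_integrable[OF hahn_kernel_integrable[OF pos(1-3)]] .
    show "(\<lambda>y. wilson_kernel a b c (d + real n) y / (Gamma (d + real n))\<^sup>2) \<in> borel_measurable lborel" for n
      using borel_measurable_integrable[OF wilson_kernel_integrable[OF pos(1-3), of "d + real n"]] pos by simp
    show "AE y in lborel. (\<lambda>n. wilson_kernel a b c (d + real n) y / (Gamma (d + real n))\<^sup>2) \<longlonglongrightarrow> hahn_kernel a b c y"
    proof (rule AE_I2)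
      fix y
      have "(\<lambda>n. hahn_kernel a b c y * (norm (Gamma (Complex (d + real n) y)) / Gamma (d + real n))\<^sup>2)
          \<longlonglongrightarrow> hahn_kernel a b c y * 1\<^sup>2"
        by (intro tendsto_intros norm_Gamma_ratio_shift pos)
      then show "(\<lambda>n. wilson_kernel a b c (d + real n) y / (Gamma (d + real n))\<^sup>2) \<longlonglongrightarrow> hahn_kernel a b c y"
        by (simp add: e)
    qed
    show "AE y in lborel. norm (wilson_kernel a b c (d + real n) y / (Gamma (d + real n))\<^sup>2) \<le> hahn_kernel a b c y" for n
    proof (rule AE_I2)
      fix y
      have d: "d + real n > 0" using pos by simp
      have "norm (Gamma (Complex (d + real n) y)) / Gamma (d + real n) \<le> 1"
        using norm_Gamma_le[OF d] Gamma_real_pos[OF d] by (simp add: divide_le_eq)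
      then have "(norm (Gamma (Complex (d + real n) y)) / Gamma (d + real n))\<^sup>2 \<le> 1"
        using Gamma_real_pos[OF d] by (intro power_le_one) auto
      then show "norm (wilson_kernel a b c (d + real n) y / (Gamma (d + real n))\<^sup>2) \<le> hahn_kernel a b c y"
        unfolding e using hahn_kernel_nonneg[of a b c y] by (simp add: abs_mult mult_left_le)
    qed
  qed
  then show ?thesis by simp
qed

text \<open>By periodicity the ratio at \<open>d\<close> equals the ratio at every
  \<open>d + n\<close>, hence the limit of these, and the limit does not contain
  \<open>d\<close>.\<close>

lemma wilson_ratio_indep:
  assumes pos: "a > 0" "b > 0" "c > 0" "d > 0" "d' > 0"
  shows "wilson_ratio a b c d = wilson_ratio a b c d'"
proof -
  have *: "wilson_ratio a b c d =
      (LINT y|lborel. hahn_kernel a b c y) / (Gamma (a + b) * Gamma (a + c) * Gamma (b + c))" if "d > 0" for d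
  proof -
    have g: "Gamma (d + real n) \<noteq> 0" for n
      using Gamma_real_pos[of "d + real n"] that by (metis add_pos_nonneg less_irrefl of_nat_0_le_iff)
    have nz: "Gamma (a + b) * Gamma (a + c) * Gamma (b + c) \<noteq> 0"
      using pos by (intro mult_pos_pos Gamma_real_pos less_imp_neq[symmetric]) auto
    have "(\<lambda>n. (LINT y|lborel. wilson_kernel a b c (d + real n) y) / (Gamma (d + real n))\<^sup>2 /
        (wilson_value a b c (d + real n) / (Gamma (d + real n))\<^sup>2))
        \<longlonglongrightarrow> (LINT y|lborel. hahn_kernel a b c y) / (Gamma (a + b) * Gamma (a + c) * Gamma (b + c))"
      by (rule tendsto_divide[OF wilson_kernel_LIMSEQ[OF pos(1-3) that] wilson_value_LIMSEQ[OF pos(1-3) that] nz])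
    moreover have "(LINT y|lborel. wilson_kernel a b c (d + real n) y) / (Gamma (d + real n))\<^sup>2 /
        (wilson_value a b c (d + real n) / (Gamma (d + real n))\<^sup>2) = wilson_ratio a b c d" for n
      using wilson_ratio_add_nat[OF pos(1-3) that, of n] g[of n] by (simp add: wilson_ratio_def)
    ultimately have "(\<lambda>n::nat. wilson_ratio a b c d)
        \<longlonglongrightarrow> (LINT y|lborel. hahn_kernel a b c y) / (Gamma (a + b) * Gamma (a + c) * Gamma (b + c))" by simp
    then show ?thesis by (rule LIMSEQ_unique[OF tendsto_const])
  qed
  show ?thesis using *[OF pos(4)] *[OF pos(5)] by simp
qed

lemma wilson_ratio_const:
  assumes pos: "a > 0" "b > 0" "c > 0" "d > 0"
  shows "wilson_ratio a b c d = wilson_ratio (1/2) (1/2) (1/2) (1/2)"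
proof -
  have "wilson_ratio a b c d = wilson_ratio a b c (1/2)" by (intro wilson_ratio_indep pos) auto
  also have "\<dots> = wilson_ratio a b (1/2) c" by (rule wilson_ratio_perm)
  also have "\<dots> = wilson_ratio a b (1/2) (1/2)" by (intro wilson_ratio_indep pos) auto
  also have "\<dots> = wilson_ratio a (1/2) (1/2) b" by (rule wilson_ratio_perm)
  also have "\<dots> = wilson_ratio a (1/2) (1/2) (1/2)" by (intro wilson_ratio_indep pos) auto
  also have "\<dots> = wilson_ratio (1/2) (1/2) (1/2) a" by (rule wilson_ratio_perm)
  also have "\<dots> = wilson_ratio (1/2) (1/2) (1/2) (1/2)" by (intro wilson_ratio_indep pos) auto
  finally show ?thesis .
qed

section \<open>The constant in Wilson's formula\<close>

lemma integrable_inverse_cosh_sq: "integrable lborel (\<lambda>y::real. (1 + y\<^sup>2) / (cosh (pi * y))\<^sup>2)"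
proof -
  obtain C where C: "C > 0" "\<And>y. 1 + y\<^sup>2 \<le> C * exp (pi * \<bar>y\<bar>)" using square_le_exp[OF pi_gt_zero] by auto
  show ?thesis
  proof (rule integrable_exp_bound[of pi _ "4 * C"])
    fix y :: real
    have "exp (pi * \<bar>y\<bar>) \<le> 2 * cosh (pi * \<bar>y\<bar>)" by (simp add: cosh_def)
    then have "exp (pi * \<bar>y\<bar>) \<le> 2 * cosh (pi * y)" by (cases "y \<ge> 0") auto
    then have "(exp (pi * \<bar>y\<bar>))\<^sup>2 \<le> (2 * cosh (pi * y))\<^sup>2" by (intro power_mono) auto
    then have "(1 + y\<^sup>2) * (exp (pi * \<bar>y\<bar>))\<^sup>2 \<le> (C * exp (pi * \<bar>y\<bar>)) * (2 * cosh (pi * y))\<^sup>2"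
      using C by (intro mult_mono) auto
    then have "(1 + y\<^sup>2) * exp (pi * \<bar>y\<bar>) \<le> C * (4 * (cosh (pi * y))\<^sup>2)"
      by (simp add: power2_eq_square mult_ac)
    then show "norm ((1 + y\<^sup>2) / (cosh (pi * y))\<^sup>2) \<le> 4 * C * exp (- pi * \<bar>y\<bar>)"
      by (simp add: field_simps exp_minus)
  qed (auto intro!: borel_measurable_continuous_onI continuous_intros)
qed

lemma integral_inverse_cosh_sq: "(LINT y|lborel. 1 / (cosh (pi * y))\<^sup>2) = 2 / pi"
proof -
  have int: "integrable lborel (\<lambda>y::real. 1 / (cosh (pi * y))\<^sup>2)"
    by (rule Bochner_Integration.integrable_bound[OF integrable_inverse_cosh_sq])
       (auto intro!: divide_right_mono borel_measurable_continuous_onI continuous_intros)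
  have "(\<lambda>n. integral {- real n..real n} (\<lambda>y::real. 1 / (cosh (pi * y))\<^sup>2))
      \<longlonglongrightarrow> (LINT y|lborel. 1 / (cosh (pi * y))\<^sup>2)"
    by (rule tendsto_integral_symmetric[OF int]) (auto intro!: continuous_intros)
  moreover have "integral {- real n..real n} (\<lambda>y::real. 1 / (cosh (pi * y))\<^sup>2) = 2 / pi * tanh (pi * real n)" for n
  proof -
    have "((\<lambda>y. tanh (pi * y) / pi) has_real_derivative 1 / (cosh (pi * y))\<^sup>2) (at y within A)" for y A
    proof -
      have "1 - (tanh (pi * y))\<^sup>2 = 1 / (cosh (pi * y))\<^sup>2"
        using hyperbolic_pythagoras[of "pi * y"]
        by (simp add: tanh_def power_divide eq_divide_eq left_diff_distrib)
      then show ?thesis by (auto intro!: derivative_eq_intros)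
    qed
    then have "((\<lambda>y. 1 / (cosh (pi * y))\<^sup>2) has_integral
        (tanh (pi * real n) / pi - tanh (pi * (- real n)) / pi)) {- real n..real n}"
      by (intro fundamental_theorem_of_calculus) (auto simp flip: has_real_derivative_iff_has_vector_derivative)
    then show ?thesis by (simp add: integral_unique)
  qed
  moreover have "(\<lambda>n. 2 / pi * tanh (pi * real n)) \<longlonglongrightarrow> 2 / pi * 1"
    by (intro tendsto_intros filterlim_compose[OF tanh_real_at_top]
        filterlim_tendsto_pos_mult_at_top[OF tendsto_const] filterlim_real_sequentially) auto
  ultimately show ?thesis using LIMSEQ_unique by fastforce
qed

text \<open>
  As \<open>a \<rightarrow> 0\<close> with the other parameters \<open>1/2\<close>, the integrand tends to \<open>2 \<pi>\<^sup>4 / cosh\<^sup>2 (\<pi> y)\<close>.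
\<close>

lemma wilson_ratio_half: "wilson_ratio (1/2) (1/2) (1/2) (1/2) = 2 * pi\<^sup>2"
proof -
  \<comment> \<open>The parameter \<open>1/2\<close> makes \<open>|Gamma|^2\<close> elementary, and
    a vanishing fourth parameter does so in the limit, through \<open>|Gamma(\<alpha> + i y)|^2 =
    |Gamma(\<alpha> + 1 + i y)|^2 / (\<alpha>^2 + y^2)\<close>. Values up to 1 keep
    \<open>\<alpha> n + 1\<close> at most 2 for the comparison that gives the majorant.\<close>
  define \<alpha> where "\<alpha> = (\<lambda>n. inverse (real (Suc n)))"
  have \<alpha>: "\<alpha> n > 0" "\<alpha> n \<le> 1" for n by (auto simp: \<alpha>_def field_simps)
  have \<alpha>0: "\<alpha> \<longlonglongrightarrow> 0" unfolding \<alpha>_def by (rule LIMSEQ_inverse_real_of_nat)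
  have Gc: "(\<lambda>n. Gamma (\<alpha> n + x)) \<longlonglongrightarrow> Gamma x" if "x > 0" for x
  proof -
    have "x \<notin> \<int>\<^sub>\<le>\<^sub>0" using that by (auto elim!: nonpos_Ints_cases)
    then show ?thesis using tendsto_Gamma[OF tendsto_add[OF \<alpha>0 tendsto_const[of x]]] by simp
  qed
  define w where "w = (\<lambda>n y. wilson_kernel (1/2) (1/2) (1/2) (\<alpha> n) y / (Gamma (\<alpha> n + 1))\<^sup>2)"
  have Gp: "Gamma (\<alpha> n + 1) > 0" for n using \<alpha>(1)[of n] by (intro Gamma_real_pos) linarith
  have wv: "w n y = 2 * pi ^ 3 * (norm (Gamma (Complex (\<alpha> n + 1) y)) / Gamma (\<alpha> n + 1))\<^sup>2 *
      (y * sinh (pi * y) / (((\<alpha> n)\<^sup>2 + y\<^sup>2) * (cosh (pi * y))\<^sup>2))" for n y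
  proof -
    have "(\<alpha> n)\<^sup>2 + y\<^sup>2 > 0" using \<alpha>(1)[of n] by (simp add: add_pos_nonneg)
    then have "(norm (Gamma (Complex (\<alpha> n) y)))\<^sup>2 = (norm (Gamma (Complex (\<alpha> n + 1) y)))\<^sup>2 / ((\<alpha> n)\<^sup>2 + y\<^sup>2)"
      unfolding norm_Gamma_plus1_sq[OF \<alpha>(1)] by (intro nonzero_mult_div_cancel_left[symmetric]) linarith
    moreover have "sinh (2 * pi * y) = 2 * sinh (pi * y) * cosh (pi * y)"
      using sinh_double[of "pi * y"] by (simp add: mult.assoc)
    ultimately show ?thesis
      unfolding w_def wilson_kernel_def norm_Gamma_half_sq
      by (simp add: power2_eq_square power3_eq_cube) (simp add: mult_ac)
  qed
  define F where "F = (\<lambda>y. 2 * pi ^ 4 * (1 / (cosh (pi * y))\<^sup>2))"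
  have "(\<lambda>n. LINT y|lborel. w n y) \<longlonglongrightarrow> (LINT y|lborel. F y)"
  proof (rule integral_dominated_convergence[where w = "\<lambda>y. 2 * pi ^ 4 * ((1 + y\<^sup>2) / (cosh (pi * y))\<^sup>2)"])
    show "integrable lborel (\<lambda>y. 2 * pi ^ 4 * ((1 + y\<^sup>2) / (cosh (pi * y))\<^sup>2))"
      using integrable_inverse_cosh_sq by (intro integrable_mult_right) auto
    show "F \<in> borel_measurable lborel"
      unfolding F_def by (auto intro!: borel_measurable_continuous_onI continuous_intros)
    show "w n \<in> borel_measurable lborel" for n
      using borel_measurable_integrable[OF wilson_kernel_integrable[of "1/2" "1/2" "1/2" "\<alpha> n"]] \<alpha>(1)[of n]
      unfolding w_def by simp
    have Fy: "2 * pi ^ 3 * (norm (Gamma (Complex 1 y)) / Gamma 1)\<^sup>2 *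
        (y * sinh (pi * y) / ((0\<^sup>2 + y\<^sup>2) * (cosh (pi * y))\<^sup>2)) = F y" if "y \<noteq> 0" for y
    proof -
      have "(norm (Gamma (Complex 1 y)) / Gamma 1)\<^sup>2 = pi * y / sinh (pi * y)"
        using norm_Gamma_1_sq[OF that] by simp
      then show ?thesis using that by (simp only: F_def) (simp add: power2_eq_square eval_nat_numeral)
    qed
    show "AE y in lborel. (\<lambda>n. w n y) \<longlonglongrightarrow> F y"
    proof (rule AE_mp[OF AE_lborel_singleton[of 0]], rule AE_I2, rule impI)
      fix y :: real assume y: "y \<noteq> 0"
      have c: "(\<lambda>n. Gamma (Complex (\<alpha> n + 1) y)) \<longlonglongrightarrow> Gamma (Complex 1 y)"
      proof (rule tendsto_Gamma)
        show "(\<lambda>n. Complex (\<alpha> n + 1) y) \<longlonglongrightarrow> Complex 1 y"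
          using tendsto_Complex[OF tendsto_add[OF \<alpha>0 tendsto_const[of 1]] tendsto_const[of y]] by simp
      qed auto
      have "w \<equiv> (\<lambda>n y. 2 * pi ^ 3 * (norm (Gamma (Complex (\<alpha> n + 1) y)) / Gamma (\<alpha> n + 1))\<^sup>2 *
           (y * sinh (pi * y) / (((\<alpha> n)\<^sup>2 + y\<^sup>2) * (cosh (pi * y))\<^sup>2)))"
        by (rule eq_reflection) (intro ext wv)
      then have "(\<lambda>n. w n y) \<longlonglongrightarrow> 2 * pi ^ 3 * (norm (Gamma (Complex 1 y)) / Gamma 1)\<^sup>2 *
           (y * sinh (pi * y) / ((0\<^sup>2 + y\<^sup>2) * (cosh (pi * y))\<^sup>2))"
        using y by (simp only:) (intro tendsto_intros c Gc \<alpha>0, auto)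
      then show "(\<lambda>n. w n y) \<longlonglongrightarrow> F y" using Fy[OF y] by simp
    qed
    show "AE y in lborel. norm (w n y) \<le> 2 * pi ^ 4 * ((1 + y\<^sup>2) / (cosh (pi * y))\<^sup>2)" for n
    proof (rule AE_mp[OF AE_lborel_singleton[of 0]], rule AE_I2, rule impI)
      fix y :: real assume y: "y \<noteq> 0"
      \<comment> \<open>At the abscissa 2 one has
        \<open>|Gamma(2 + i y)|^2 = (1 + y^2) pi y / sinh (pi y)\<close>. This bound is uniform in
        \<open>n\<close>, and its extra factor \<open>1 + y^2\<close> is harmless against
        \<open>cosh^2\<close>.\<close>
      have "norm (Gamma (Complex (\<alpha> n + 1) y)) / Gamma (\<alpha> n + 1) \<le> norm (Gamma (Complex (1 + 1) y)) / Gamma (1 + 1)"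
        using \<alpha>[of n] by (intro norm_Gamma_ratio_mono) auto
      then have "(norm (Gamma (Complex (\<alpha> n + 1) y)) / Gamma (\<alpha> n + 1))\<^sup>2 \<le> (norm (Gamma (Complex (1 + 1) y)))\<^sup>2"
        using Gamma_real_plus1[of 1] Gp[of n] by (intro power_mono) auto
      also have "\<dots> = (1 + y\<^sup>2) * (pi * y / sinh (pi * y))"
        using norm_Gamma_plus1_sq[of 1 y] norm_Gamma_1_sq[OF y] by simp
      finally have 1: "(norm (Gamma (Complex (\<alpha> n + 1) y)) / Gamma (\<alpha> n + 1))\<^sup>2 \<le> (1 + y\<^sup>2) * (pi * y / sinh (pi * y))" .
      have 3: "0 \<le> pi * y / sinh (pi * y)" using norm_Gamma_1_sq[OF y] by (metis zero_le_power2)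
      have ys: "y * sinh (pi * y) > 0" using y by (cases "y > 0") (auto simp: zero_less_mult_iff mult_less_0_iff)
      have 2: "y * sinh (pi * y) / (((\<alpha> n)\<^sup>2 + y\<^sup>2) * (cosh (pi * y))\<^sup>2) \<le> y * sinh (pi * y) / (y\<^sup>2 * (cosh (pi * y))\<^sup>2)"
        using ys y by (intro divide_left_mono mult_right_mono mult_pos_pos) (auto simp: add_nonneg_pos)
      have "w n y \<le> 2 * pi ^ 3 * ((1 + y\<^sup>2) * (pi * y / sinh (pi * y))) * (y * sinh (pi * y) / (y\<^sup>2 * (cosh (pi * y))\<^sup>2))"
        unfolding wv using ys by (intro mult_mono mult_left_mono 1 2 mult_nonneg_nonneg 3) auto
      also have "\<dots> = 2 * pi ^ 4 * ((1 + y\<^sup>2) / (cosh (pi * y))\<^sup>2)"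
        using y by (simp add: power2_eq_square eval_nat_numeral)
      finally show "norm (w n y) \<le> 2 * pi ^ 4 * ((1 + y\<^sup>2) / (cosh (pi * y))\<^sup>2)"
        using wilson_kernel_nonneg by (simp add: w_def)
    qed
  qed
  moreover have "(LINT y|lborel. F y) = 4 * pi ^ 3"
  proof -
    have "(LINT y|lborel. F y) = 2 * pi ^ 4 * (2 / pi)"
      unfolding F_def integral_inverse_cosh_sq[symmetric] by (rule integral_mult_right_zero)
    then show ?thesis by (simp add: eval_nat_numeral)
  qed
  moreover have "(LINT y|lborel. w n y) = (LINT y|lborel. wilson_kernel (1/2) (1/2) (1/2) (\<alpha> n) y) / (Gamma (\<alpha> n + 1))\<^sup>2" for n
    by (simp add: w_def)
  ultimately have L: "(\<lambda>n. (LINT y|lborel. wilson_kernel (1/2) (1/2) (1/2) (\<alpha> n) y) / (Gamma (\<alpha> n + 1))\<^sup>2) \<longlonglongrightarrow> 4 * pi ^ 3"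
    by simp
  have V: "wilson_value (1/2) (1/2) (1/2) (\<alpha> n) = Gamma (\<alpha> n + 1/2) ^ 3 / Gamma (\<alpha> n + 3/2)" for n
    by (simp add: wilson_value_def add.commute power3_eq_cube)
  have "(\<lambda>n. wilson_value (1/2) (1/2) (1/2) (\<alpha> n)) \<longlonglongrightarrow> Gamma (1/2) ^ 3 / Gamma (3/2)"
  proof -
    have "Gamma (3/2 :: real) \<noteq> 0" using Gamma_real_pos[of "3/2"] by linarith
    then show ?thesis unfolding V by (intro tendsto_divide tendsto_power Gc) auto
  qed
  also have "Gamma (1/2 :: real) ^ 3 / Gamma (3/2) = 2 * pi"
  proof -
    have "Gamma (3/2 :: real) = sqrt pi / 2"
      using Gamma_real_plus1[of "1/2"] by (simp add: Gamma_one_half_real eq_divide_eq)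
    then show ?thesis by (simp only: Gamma_one_half_real) (simp add: power3_eq_cube)
  qed
  finally have V': "(\<lambda>n. wilson_value (1/2) (1/2) (1/2) (\<alpha> n)) \<longlonglongrightarrow> 2 * pi" .
  have "(\<lambda>n. (LINT y|lborel. wilson_kernel (1/2) (1/2) (1/2) (\<alpha> n) y) / (Gamma (\<alpha> n + 1))\<^sup>2 *
       (Gamma (\<alpha> n + 1))\<^sup>2 / wilson_value (1/2) (1/2) (1/2) (\<alpha> n)) \<longlonglongrightarrow> 4 * pi ^ 3 * (Gamma 1)\<^sup>2 / (2 * pi)"
    by (intro tendsto_divide tendsto_mult tendsto_power L V' Gc) auto
  moreover have "(LINT y|lborel. wilson_kernel (1/2) (1/2) (1/2) (\<alpha> n) y) / (Gamma (\<alpha> n + 1))\<^sup>2 *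
       (Gamma (\<alpha> n + 1))\<^sup>2 / wilson_value (1/2) (1/2) (1/2) (\<alpha> n) = wilson_ratio (1/2) (1/2) (1/2) (1/2)" for n
    using wilson_ratio_const[of "1/2" "1/2" "1/2" "\<alpha> n"] \<alpha>(1)[of n] less_imp_neq[OF Gp[of n]]
    by (simp add: wilson_ratio_def)
  ultimately have "(\<lambda>n::nat. wilson_ratio (1/2) (1/2) (1/2) (1/2)) \<longlonglongrightarrow> 4 * pi ^ 3 * (Gamma 1)\<^sup>2 / (2 * pi)"
    by simp
  then have "wilson_ratio (1/2) (1/2) (1/2) (1/2) = 4 * pi ^ 3 * (Gamma 1)\<^sup>2 / (2 * pi)"
    by (rule LIMSEQ_unique[OF tendsto_const])
  then show ?thesis by (simp add: eval_nat_numeral)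
qed

text \<open>The classical normalization is \<open>1 / (2 pi)\<close> times the integral over the
  half line with \<open>1 / |Gamma(2 i y)|^2\<close>. Doubling the half line and the factor
  \<open>pi / 2\<close> hidden in \<open>y sinh (2 pi y)\<close> turn \<open>2 pi\<close> into
  \<open>2 pi^2\<close>.\<close>

theorem wilson_integral:
  assumes "a > 0" "b > 0" "c > 0" "d > 0"
  shows "(LINT y|lborel. wilson_kernel a b c d y) = 2 * pi\<^sup>2 * wilson_value a b c d"
proof -
  have "(LINT y|lborel. wilson_kernel a b c d y) / wilson_value a b c d = 2 * pi\<^sup>2"
    using wilson_ratio_const[OF assms] wilson_ratio_half by (simp only: wilson_ratio_def)
  then show ?thesis using wilson_value_pos[OF assms] by (simp add: field_simps)
qed

section \<open>The Mellin transform of the Gauss function\<close>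

text \<open>As an identity of measures the substitution transfers integrability and the value of
  integrals together, for functions with values in any Banach space. The line is exhausted by the
  intervals \<open>[-n, n]\<close>, whose images exhaust \<open>range g\<close>.\<close>

lemma distr_density_diffeo:
  fixes g :: "real \<Rightarrow> real"
  assumes g: "\<And>x. (g has_real_derivative g' x) (at x)" and g'pos: "\<And>x. g' x > 0"
    and g'cont: "continuous_on UNIV g'"
  shows "distr (density lborel (\<lambda>x. ennreal (g' x))) borel g = density lborel (indicator (range g))"
proof (rule measure_eqI)
  have gcont: "continuous_on UNIV g"
    using g by (meson DERIV_isCont continuous_at_imp_continuous_on)
  have gm [measurable]: "g \<in> borel_measurable borel" by (intro borel_measurable_continuous_onI gcont)
  have g'm [measurable]: "g' \<in> borel_measurable borel" by (intro borel_measurable_continuous_onI g'cont)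
  have mono: "g x < g y" if "x < y" for x y
    using DERIV_pos_imp_increasing[OF that] g g'pos by blast
  have monole: "g x \<le> g y" if "x \<le> y" for x y
    using mono[of x y] that by (cases "x = y") auto
  have range: "x \<in> range g \<longleftrightarrow> (\<exists>n::nat. x \<in> {g (- real n)..g (real n)})" for x
  proof
    assume "x \<in> range g"
    then obtain z where z: "x = g z" by auto
    obtain n where "\<bar>z\<bar> \<le> real n" using real_arch_simple by blast
    then show "\<exists>n::nat. x \<in> {g (- real n)..g (real n)}"
      using monole[of "- real n" z] monole[of z "real n"] z by (intro exI[of _ n]) (auto simp: abs_le_iff)
  next
    assume "\<exists>n::nat. x \<in> {g (- real n)..g (real n)}"
    then obtain n :: nat where "g (- real n) \<le> x" "x \<le> g (real n)" by auto
    then show "x \<in> range g"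
      using IVT'[of g "- real n" x "real n"] gcont continuous_on_subset by fastforce
  qed
  have incI: "incseq (\<lambda>n. {g (- real n)..g (real n)})"
    by (auto simp: incseq_def intro: order_trans monole)
  have rangeU: "range g = (\<Union>n. {g (- real n)..g (real n)})" using range by blast
  have rs: "range g \<in> sets borel" unfolding rangeU by auto
  show "sets (distr (density lborel (\<lambda>x. ennreal (g' x))) borel g) = sets (density lborel (indicator (range g)))"
    by simp
  fix A assume "A \<in> sets (distr (density lborel (\<lambda>x. ennreal (g' x))) borel g)"
  then have A [measurable]: "A \<in> sets borel" by simp
  have "emeasure (distr (density lborel (\<lambda>x. ennreal (g' x))) borel g) A =
      (\<integral>\<^sup>+x. ennreal (g' x) * indicator A (g x) \<partial>lborel)"
    by (subst emeasure_distr) (auto simp: emeasure_density indicator_def vimage_def intro!: nn_integral_cong)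
  also have "\<dots> = (\<integral>\<^sup>+x. (SUP n::nat. ennreal (g' x) * indicator A (g x) * indicator {- real n..real n} x) \<partial>lborel)"
  proof (intro nn_integral_cong)
    fix x :: real
    obtain n where n: "\<bar>x\<bar> \<le> real n" using real_arch_simple by blast
    show "ennreal (g' x) * indicator A (g x) = (SUP n::nat. ennreal (g' x) * indicator A (g x) * indicator {- real n..real n} x)"
    proof (rule antisym)
      show "ennreal (g' x) * indicator A (g x) \<le> (SUP n::nat. ennreal (g' x) * indicator A (g x) * indicator {- real n..real n} x)"
        by (rule SUP_upper2[of n]) (use n in \<open>auto simp: indicator_def\<close>)
      show "(SUP n::nat. ennreal (g' x) * indicator A (g x) * indicator {- real n..real n} x) \<le> ennreal (g' x) * indicator A (g x)"
        by (rule SUP_least) (auto simp: indicator_def)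
    qed
  qed
  also have "\<dots> = (SUP n::nat. \<integral>\<^sup>+x. ennreal (g' x) * indicator A (g x) * indicator {- real n..real n} x \<partial>lborel)"
    by (rule nn_integral_monotone_convergence_SUP) (auto simp: incseq_def le_fun_def indicator_def)
  also have "\<dots> = (SUP n::nat. \<integral>\<^sup>+x. indicator A x * indicator {g (- real n)..g (real n)} x \<partial>lborel)"
  proof (intro SUP_cong refl)
    fix n :: nat
    have "(\<integral>\<^sup>+x. ennreal (g' x) * indicator A (g x) * indicator {- real n..real n} x \<partial>lborel) =
        (\<integral>\<^sup>+x. ennreal (indicator A (g x) * g' x * indicator {- real n..real n} x) \<partial>lborel)"
      by (intro nn_integral_cong) (auto simp: indicator_def)
    also have "\<dots> = (\<integral>\<^sup>+x. ennreal (indicator A x * indicator {g (- real n)..g (real n)} x) \<partial>lborel)"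
      by (rule nn_integral_substitution[symmetric])
        (auto simp: set_borel_measurable_def less_imp_le[OF g'pos] intro!: g continuous_on_subset[OF g'cont])
    also have "\<dots> = (\<integral>\<^sup>+x. indicator A x * indicator {g (- real n)..g (real n)} x \<partial>lborel)"
      by (intro nn_integral_cong) (auto simp: indicator_def)
    finally show "(\<integral>\<^sup>+x. ennreal (g' x) * indicator A (g x) * indicator {- real n..real n} x \<partial>lborel) =
        (\<integral>\<^sup>+x. indicator A x * indicator {g (- real n)..g (real n)} x \<partial>lborel)" .
  qed
  also have "\<dots> = (\<integral>\<^sup>+x. (SUP n::nat. indicator A x * indicator {g (- real n)..g (real n)} x) \<partial>lborel)"
  proof (rule nn_integral_monotone_convergence_SUP[symmetric])
    have "(indicator {g (- real m)..g (real m)} x :: ennreal) \<le> indicator {g (- real n)..g (real n)} x"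
      if "m \<le> n" for m n x
      using incseqD[OF incI that] by (intro indicator_leI) (rule subsetD)
    then show "incseq (\<lambda>n x. indicator A x * indicator {g (- real n)..g (real n)} x :: ennreal)"
      by (auto simp: incseq_def le_fun_def intro!: mult_left_mono)
  qed auto
  also have "\<dots> = (\<integral>\<^sup>+x. indicator (range g) x * indicator A x \<partial>lborel)"
  proof (intro nn_integral_cong antisym)
    fix x
    show "(SUP n::nat. indicator A x * indicator {g (- real n)..g (real n)} x) \<le> (indicator (range g) x * indicator A x :: ennreal)"
      using range[of x] by (intro SUP_least) (auto simp: indicator_def)
    show "(indicator (range g) x * indicator A x :: ennreal) \<le> (SUP n::nat. indicator A x * indicator {g (- real n)..g (real n)} x)"
    proof (cases "x \<in> range g")
      case True
      then obtain n :: nat where n: "x \<in> {g (- real n)..g (real n)}" using range by blast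
      show ?thesis by (rule SUP_upper2[of n]) (use n in \<open>auto simp: indicator_def\<close>)
    qed auto
  qed
  also have "\<dots> = emeasure (density lborel (indicator (range g))) A"
    using rs by (subst emeasure_density) auto
  finally show "emeasure (distr (density lborel (\<lambda>x. ennreal (g' x))) borel g) A =
      emeasure (density lborel (indicator (range g))) A" .
qed

lemma
  fixes g :: "real \<Rightarrow> real" and f :: "real \<Rightarrow> 'a::{banach, second_countable_topology}"
  assumes g: "\<And>x. (g has_real_derivative g' x) (at x)" and g'pos: "\<And>x. g' x > 0"
    and g'cont: "continuous_on UNIV g'" and r: "range g = R" and R: "R \<in> sets borel"
    and f [measurable]: "f \<in> borel_measurable borel"
  shows integrable_substitution_diffeo:
      "set_integrable lborel R f \<longleftrightarrow> integrable lborel (\<lambda>x. g' x *\<^sub>R f (g x))" (is ?A)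
    and integral_substitution_diffeo:
      "(LINT x:R|lborel. f x) = (LINT x|lborel. g' x *\<^sub>R f (g x))" (is ?B)
proof -
  have gcont: "continuous_on UNIV g"
    using g by (meson DERIV_isCont continuous_at_imp_continuous_on)
  have gm [measurable]: "g \<in> borel_measurable borel" by (intro borel_measurable_continuous_onI gcont)
  have g'm [measurable]: "g' \<in> borel_measurable borel" by (intro borel_measurable_continuous_onI g'cont)
  note D = distr_density_diffeo[OF g g'pos g'cont, unfolded r]
  have ind: "(indicator R :: real \<Rightarrow> ennreal) = (\<lambda>x. ennreal (indicator R x))"
    by (rule ext) (simp add: ennreal_indicator)
  have Rm [measurable]: "(indicator R :: real \<Rightarrow> real) \<in> borel_measurable borel" using R by simp
  have "set_integrable lborel R f \<longleftrightarrow> integrable (density lborel (indicator R)) f"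
    unfolding ind set_integrable_def by (subst integrable_density) (auto simp: R)
  also have "\<dots> \<longleftrightarrow> integrable (density lborel (\<lambda>x. ennreal (g' x))) (\<lambda>x. f (g x))"
    unfolding D[symmetric] by (subst integrable_distr_eq) auto
  also have "\<dots> \<longleftrightarrow> integrable lborel (\<lambda>x. g' x *\<^sub>R f (g x))"
    by (subst integrable_density) (auto intro!: AE_I2 less_imp_le[OF g'pos])
  finally show ?A .
  have "(LINT x:R|lborel. f x) = (LINT x|density lborel (indicator R). f x)"
    unfolding ind set_lebesgue_integral_def by (subst integral_density) (auto simp: R)
  also have "\<dots> = (LINT x|density lborel (\<lambda>x. ennreal (g' x)). f (g x))"
    unfolding D[symmetric] by (subst integral_distr) auto
  also have "\<dots> = (LINT x|lborel. g' x *\<^sub>R f (g x))"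
    by (subst integral_density) (auto intro!: AE_I2 less_imp_le[OF g'pos])
  finally show ?B .
qed

text \<open>A shear moves each horizontal line by a constant, so translation invariance and
  Tonelli's theorem replace a Jacobian determinant. In logarithmic coordinates the substitutions
  behind the beta and Mellin integrals are compositions of shears.\<close>

lemma distr_shear_fst:
  fixes \<tau> :: "real \<Rightarrow> real"
  assumes [measurable]: "\<tau> \<in> borel_measurable borel"
  shows "distr (lborel \<Otimes>\<^sub>M lborel) (lborel \<Otimes>\<^sub>M lborel) (\<lambda>(x, y). (x + \<tau> y, y)) = lborel \<Otimes>\<^sub>M lborel"
proof (rule measure_eqI)
  fix A assume "A \<in> sets (distr (lborel \<Otimes>\<^sub>M lborel) (lborel \<Otimes>\<^sub>M lborel) (\<lambda>(x::real, y::real). (x + \<tau> y, y)))"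
  then have A [measurable]: "A \<in> sets (lborel \<Otimes>\<^sub>M lborel :: (real \<times> real) measure)" by simp
  have "emeasure (distr (lborel \<Otimes>\<^sub>M lborel) (lborel \<Otimes>\<^sub>M lborel) (\<lambda>(x, y). (x + \<tau> y, y))) A =
     (\<integral>\<^sup>+p. indicator A p \<partial>distr (lborel \<Otimes>\<^sub>M lborel) (lborel \<Otimes>\<^sub>M lborel) (\<lambda>(x, y). (x + \<tau> y, y)))"
    using A by simp
  also have "\<dots> = (\<integral>\<^sup>+p. indicator A ((\<lambda>(x, y). (x + \<tau> y, y)) p) \<partial>(lborel \<Otimes>\<^sub>M lborel))"
    using A by (subst nn_integral_distr) auto
  also have "\<dots> = (\<integral>\<^sup>+y. (\<integral>\<^sup>+x. indicator A (x + \<tau> y, y) \<partial>lborel) \<partial>lborel)"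
    by (subst lborel_pair.nn_integral_snd[symmetric]) auto
  also have "\<dots> = (\<integral>\<^sup>+y. (\<integral>\<^sup>+x. indicator A (x, y) \<partial>lborel) \<partial>lborel)"
  proof (rule nn_integral_cong)
    fix y :: real
    show "(\<integral>\<^sup>+x. indicator A (x + \<tau> y, y) \<partial>lborel) = (\<integral>\<^sup>+x. indicator A (x, y) \<partial>lborel)"
      using nn_integral_real_affine[of "\<lambda>x. indicator A (x, y)" 1 "\<tau> y"] by (simp add: add.commute)
  qed
  also have "\<dots> = emeasure (lborel \<Otimes>\<^sub>M lborel) A"
    using A by (subst lborel_pair.nn_integral_snd) auto
  finally show "emeasure (distr (lborel \<Otimes>\<^sub>M lborel) (lborel \<Otimes>\<^sub>M lborel) (\<lambda>(x, y). (x + \<tau> y, y))) A =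
     emeasure (lborel \<Otimes>\<^sub>M lborel) A" .
qed simp

lemma distr_shear_snd:
  fixes \<tau> :: "real \<Rightarrow> real"
  assumes [measurable]: "\<tau> \<in> borel_measurable borel"
  shows "distr (lborel \<Otimes>\<^sub>M lborel) (lborel \<Otimes>\<^sub>M lborel) (\<lambda>(x, y). (x, y + \<tau> x)) = lborel \<Otimes>\<^sub>M lborel"
proof (rule measure_eqI)
  fix A assume "A \<in> sets (distr (lborel \<Otimes>\<^sub>M lborel) (lborel \<Otimes>\<^sub>M lborel) (\<lambda>(x::real, y::real). (x, y + \<tau> x)))"
  then have A [measurable]: "A \<in> sets (lborel \<Otimes>\<^sub>M lborel :: (real \<times> real) measure)" by simp
  have "emeasure (distr (lborel \<Otimes>\<^sub>M lborel) (lborel \<Otimes>\<^sub>M lborel) (\<lambda>(x, y). (x, y + \<tau> x))) A =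
     (\<integral>\<^sup>+p. indicator A p \<partial>distr (lborel \<Otimes>\<^sub>M lborel) (lborel \<Otimes>\<^sub>M lborel) (\<lambda>(x, y). (x, y + \<tau> x)))"
    using A by simp
  also have "\<dots> = (\<integral>\<^sup>+p. indicator A ((\<lambda>(x, y). (x, y + \<tau> x)) p) \<partial>(lborel \<Otimes>\<^sub>M lborel))"
    using A by (subst nn_integral_distr) auto
  also have "\<dots> = (\<integral>\<^sup>+x. (\<integral>\<^sup>+y. indicator A (x, y + \<tau> x) \<partial>lborel) \<partial>lborel)"
    by (subst lborel.nn_integral_fst[symmetric]) auto
  also have "\<dots> = (\<integral>\<^sup>+x. (\<integral>\<^sup>+y. indicator A (x, y) \<partial>lborel) \<partial>lborel)"
  proof (rule nn_integral_cong)
    fix x :: real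
    show "(\<integral>\<^sup>+y. indicator A (x, y + \<tau> x) \<partial>lborel) = (\<integral>\<^sup>+y. indicator A (x, y) \<partial>lborel)"
      using nn_integral_real_affine[of "\<lambda>y. indicator A (x, y)" 1 "\<tau> x"] by (simp add: add.commute)
  qed
  also have "\<dots> = emeasure (lborel \<Otimes>\<^sub>M lborel) A"
    using A by (subst lborel.nn_integral_fst) auto
  finally show "emeasure (distr (lborel \<Otimes>\<^sub>M lborel) (lborel \<Otimes>\<^sub>M lborel) (\<lambda>(x, y). (x, y + \<tau> x))) A =
     emeasure (lborel \<Otimes>\<^sub>M lborel) A" .
qed simp

lemma
  fixes f :: "real \<times> real \<Rightarrow> complex" and \<tau> :: "real \<Rightarrow> real"
  assumes \<tau> [measurable]: "\<tau> \<in> borel_measurable borel" and f [measurable]: "f \<in> borel_measurable borel"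
  shows integrable_shear_fst: "integrable (lborel \<Otimes>\<^sub>M lborel) (\<lambda>(x, y). f (x + \<tau> y, y)) \<longleftrightarrow>
      integrable (lborel \<Otimes>\<^sub>M lborel) f" (is ?A)
    and integral_shear_fst: "(LINT p|(lborel \<Otimes>\<^sub>M lborel). (\<lambda>(x, y). f (x + \<tau> y, y)) p) =
      (LINT p|(lborel \<Otimes>\<^sub>M lborel). f p)" (is ?B)
    and integrable_shear_snd: "integrable (lborel \<Otimes>\<^sub>M lborel) (\<lambda>(x, y). f (x, y + \<tau> x)) \<longleftrightarrow>
      integrable (lborel \<Otimes>\<^sub>M lborel) f" (is ?C)
    and integral_shear_snd: "(LINT p|(lborel \<Otimes>\<^sub>M lborel). (\<lambda>(x, y). f (x, y + \<tau> x)) p) =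
      (LINT p|(lborel \<Otimes>\<^sub>M lborel). f p)" (is ?D)
proof -
  have fm: "f \<in> borel_measurable (lborel \<Otimes>\<^sub>M lborel)"
    using f unfolding borel_prod[symmetric] by simp
  have T: "(\<lambda>(x, y). (x + \<tau> y, y)) \<in> measurable (lborel \<Otimes>\<^sub>M lborel) (lborel \<Otimes>\<^sub>M lborel)"
    "(\<lambda>(x, y). (x, y + \<tau> x)) \<in> measurable (lborel \<Otimes>\<^sub>M lborel) (lborel \<Otimes>\<^sub>M lborel)"
    by auto
  have e: "(\<lambda>(x, y). f (x + \<tau> y, y)) = (\<lambda>p. f ((\<lambda>(x, y). (x + \<tau> y, y)) p))"
    "(\<lambda>(x, y). f (x, y + \<tau> x)) = (\<lambda>p. f ((\<lambda>(x, y). (x, y + \<tau> x)) p))" by auto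
  have "integrable (lborel \<Otimes>\<^sub>M lborel) f \<longleftrightarrow> integrable (distr (lborel \<Otimes>\<^sub>M lborel) (lborel \<Otimes>\<^sub>M lborel) (\<lambda>(x, y). (x + \<tau> y, y))) f"
    by (simp only: distr_shear_fst[OF \<tau>])
  also have "\<dots> \<longleftrightarrow> integrable (lborel \<Otimes>\<^sub>M lborel) (\<lambda>p. f ((\<lambda>(x, y). (x + \<tau> y, y)) p))"
    by (rule integrable_distr_eq[OF T(1) fm])
  finally show ?A unfolding e by simp
  have "(LINT p|(lborel \<Otimes>\<^sub>M lborel). f p) = (LINT p|distr (lborel \<Otimes>\<^sub>M lborel) (lborel \<Otimes>\<^sub>M lborel) (\<lambda>(x, y). (x + \<tau> y, y)). f p)"
    by (simp only: distr_shear_fst[OF \<tau>])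
  also have "\<dots> = (LINT p|(lborel \<Otimes>\<^sub>M lborel). f ((\<lambda>(x, y). (x + \<tau> y, y)) p))"
    by (rule integral_distr[OF T(1) fm])
  finally show ?B unfolding e by simp
  have "integrable (lborel \<Otimes>\<^sub>M lborel) f \<longleftrightarrow> integrable (distr (lborel \<Otimes>\<^sub>M lborel) (lborel \<Otimes>\<^sub>M lborel) (\<lambda>(x, y). (x, y + \<tau> x))) f"
    by (simp only: distr_shear_snd[OF \<tau>])
  also have "\<dots> \<longleftrightarrow> integrable (lborel \<Otimes>\<^sub>M lborel) (\<lambda>p. f ((\<lambda>(x, y). (x, y + \<tau> x)) p))"
    by (rule integrable_distr_eq[OF T(2) fm])
  finally show ?C unfolding e by simp
  have "(LINT p|(lborel \<Otimes>\<^sub>M lborel). f p) = (LINT p|distr (lborel \<Otimes>\<^sub>M lborel) (lborel \<Otimes>\<^sub>M lborel) (\<lambda>(x, y). (x, y + \<tau> x)). f p)"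
    by (simp only: distr_shear_snd[OF \<tau>])
  also have "\<dots> = (LINT p|(lborel \<Otimes>\<^sub>M lborel). f ((\<lambda>(x, y). (x, y + \<tau> x)) p))"
    by (rule integral_distr[OF T(2) fm])
  finally show ?D unfolding e by simp
qed

lemma
  fixes p q :: "real \<Rightarrow> complex"
  assumes p: "integrable lborel p" and q: "integrable lborel q"
  shows integrable_tensor: "integrable (lborel \<Otimes>\<^sub>M lborel) (\<lambda>(x, y). p x * q y)" (is ?A)
    and integral_tensor: "(LINT z|(lborel \<Otimes>\<^sub>M lborel). (\<lambda>(x, y). p x * q y) z) =
      (LINT x|lborel. p x) * (LINT y|lborel. q y)" (is ?B)
proof -
  have [measurable]: "p \<in> borel_measurable lborel" "q \<in> borel_measurable lborel"
    using p q by auto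
  show ?A
  proof (rule lborel_pair.Fubini_integrable)
    show "integrable lborel (\<lambda>x. LINT y|lborel. norm (case (x, y) of (x, y) \<Rightarrow> p x * q y))"
      using p by (simp add: norm_mult)
  qed (use q in auto)
  have "(LINT z|(lborel \<Otimes>\<^sub>M lborel). (\<lambda>(x, y). p x * q y) z) = (LINT x|lborel. LINT y|lborel. p x * q y)"
    using lborel_pair.integral_fst'[OF \<open>?A\<close>] by simp
  then show ?B by simp
qed

section \<open>Gamma and beta integrals in logarithmic coordinates\<close>

definition softplus :: "real \<Rightarrow> real" where "softplus t = ln (1 + exp t)"

lemma exp_softplus [simp]: "exp (softplus t) = 1 + exp t"
  by (simp add: softplus_def add_pos_pos)

lemma softplus_bounds: "softplus t \<ge> 0" "softplus t \<ge> t"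
proof -
  show "softplus t \<ge> 0" by (simp add: softplus_def)
  have "exp t \<le> exp (softplus t)" by simp
  then show "softplus t \<ge> t" by (simp only: exp_le_cancel_iff)
qed

lemma continuous_on_softplus [continuous_intros]:
  "continuous_on A f \<Longrightarrow> continuous_on A (\<lambda>x. softplus (f x))"
  unfolding softplus_def by (intro continuous_intros) (auto simp: add_pos_pos less_imp_neq[symmetric])

lemma softplus_measurable [measurable]: "softplus \<in> borel_measurable borel"
  by (intro borel_measurable_continuous_onI continuous_intros)

lemma
  assumes "Re z > 0"
  shows integrable_Gamma_log: "integrable lborel (\<lambda>t. exp (z * of_real t - of_real (exp t)))" (is ?A)
    and integral_Gamma_log: "(LINT t|lborel. exp (z * of_real t - of_real (exp t))) = Gamma z" (is ?B)
proof -
  define f where "f = (\<lambda>t. complex_of_real t powr (z - 1) / of_real (exp t))"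
  have abs: "f absolutely_integrable_on {0<..}"
    unfolding f_def by (rule absolutely_integrable_Gamma_integral'[OF assms])
  have [measurable]: "f \<in> borel_measurable borel" unfolding f_def by measurable
  have r: "range exp = {0::real<..}" using exp_total by auto
  have e: "exp t *\<^sub>R f (exp t) = exp (z * of_real t - of_real (exp t))" for t
  proof -
    have "exp t *\<^sub>R f (exp t) = exp (of_real t) * (exp ((z - 1) * of_real t) / exp (of_real (exp t)))"
      by (simp add: f_def powr_def scaleR_conv_of_real Ln_of_real exp_of_real)
    also have "\<dots> = exp (z * of_real t - of_real (exp t))"
      by (simp add: algebra_simps flip: exp_add exp_diff)
    finally show ?thesis .
  qed
  have "set_integrable lborel {0<..} f"
    using abs unfolding set_integrable_def by (simp add: integrable_completion)
  then show ?A
    using integrable_substitution_diffeo[of exp exp "{0<..}" f] r by (simp add: e continuous_on_exp)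
  have "(LINT x:{0<..}|lborel. f x) = Gamma z"
    using set_borel_integral_eq_integral(2)[OF \<open>set_integrable lborel {0<..} f\<close>]
      integral_unique[OF Gamma_integral_complex'[OF assms]] by (simp add: f_def)
  then show ?B
    using integral_substitution_diffeo[of exp exp "{0<..}" f] r by (simp add: e continuous_on_exp)
qed

text \<open>The integrand \<open>x^A (1 + x)^(-d)\<close> of the beta integral of the second kind
  against \<open>dx / x\<close>, with \<open>x = e^t\<close>. Complex powers become exponentials
  without a choice of branch, and multiplicative substitutions become translations.\<close>

definition beta_density :: "complex \<Rightarrow> complex \<Rightarrow> real \<Rightarrow> complex" where
  "beta_density A d t = exp (A * of_real t - d * of_real (softplus t))"

lemma beta_density_measurable [measurable]: "beta_density A d \<in> borel_measurable borel"
  unfolding beta_density_def by measurable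

lemma continuous_on_beta_density: "continuous_on S (beta_density A d)"
  unfolding beta_density_def by (intro continuous_intros)

lemma integrable_beta_density:
  assumes "Re A > 0" "Re d > Re A"
  shows "integrable lborel (beta_density A d)"
proof (rule integrable_exp_bound)
  define e where "e = min (Re A) (Re d - Re A)"
  show e: "e > 0" using assms by (simp add: e_def)
  fix t :: real
  have "Re A * t - Re d * softplus t \<le> - e * \<bar>t\<bar>"
  proof (cases "t \<ge> 0")
    case True
    have "Re d * t \<le> Re d * softplus t" using assms softplus_bounds[of t] by (intro mult_left_mono) auto
    moreover have "e * t \<le> (Re d - Re A) * t" using True by (intro mult_right_mono) (auto simp: e_def)
    ultimately show ?thesis using True by (simp add: algebra_simps)
  next
    case False
    have "Re d * softplus t \<ge> 0" using assms softplus_bounds[of t] by (intro mult_nonneg_nonneg) auto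
    moreover have "Re A * t \<le> e * t" using False by (intro mult_right_mono_neg) (auto simp: e_def)
    ultimately have "Re A * t - Re d * softplus t \<le> e * t" by linarith
    then show ?thesis using False by simp
  qed
  then show "norm (beta_density A d t) \<le> 1 * exp (- e * \<bar>t\<bar>)" by (simp add: beta_density_def)
qed simp

text \<open>The product \<open>Gamma(A) Gamma(B)\<close> is a double integral in logarithmic
  variables. The first shear passes to the logarithm of the ratio of the two original variables, the
  second to the logarithm of their sum, and then the integrand separates.\<close>

lemma integral_beta_density:
  assumes "Re A > 0" "Re d > Re A"
  shows "(LINT t|lborel. beta_density A d t) = Gamma A * Gamma (d - A) / Gamma d"
proof -
  define B where "B = d - A"
  have B: "Re B > 0" "d = A + B" using assms by (auto simp: B_def)
  define F where "F = (\<lambda>p. exp (A * of_real (fst p) - of_real (exp (fst p))) * exp (B * of_real (snd p) - of_real (exp (snd p))))"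
  have Fm: "F \<in> borel_measurable borel" unfolding F_def
    by (intro borel_measurable_continuous_onI continuous_intros)
  have FI: "(LINT p|(lborel \<Otimes>\<^sub>M lborel). F p) = Gamma A * Gamma B"
    using integral_tensor[OF integrable_Gamma_log[OF assms(1)] integrable_Gamma_log[OF B(1)]]
    by (simp add: F_def case_prod_beta' integral_Gamma_log assms B)
  define G where "G = (\<lambda>(x, y). F (x + y, y))"
  have Gm: "G \<in> borel_measurable borel" unfolding G_def F_def case_prod_beta'
    by (intro borel_measurable_continuous_onI continuous_intros)
  have GI: "(LINT p|(lborel \<Otimes>\<^sub>M lborel). G p) = Gamma A * Gamma B"
    using integral_shear_fst[of "\<lambda>y. y" F] Fm FI by (simp add: G_def)
  define \<tau> where "\<tau> = (\<lambda>t. - softplus t)"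
  have \<tau>: "\<tau> \<in> borel_measurable borel" unfolding \<tau>_def by measurable
  have "(\<lambda>(x, y). G (x, y + \<tau> x)) = (\<lambda>(x, y). beta_density A d x * exp (d * of_real y - of_real (exp y)))"
  proof (intro ext, clarify)
    fix x y
    define L where "L = softplus x"
    have s: "exp (x + (y - L)) + exp (y - L) = exp y"
    proof -
      have "exp (x + (y - L)) + exp (y - L) = (exp x + 1) * (exp y / exp L)"
        by (simp add: exp_add exp_diff ring_distribs add_divide_distrib)
      also have "\<dots> = exp y" by (simp add: L_def add.commute add_pos_pos less_imp_neq[symmetric])
      finally show ?thesis .
    qed
    have "G (x, y + \<tau> x) = exp (A * of_real (x + (y - L)) - of_real (exp (x + (y - L))) + (B * of_real (y - L) - of_real (exp (y - L))))"
      by (simp add: G_def F_def \<tau>_def L_def exp_add)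
    also have "A * of_real (x + (y - L)) - of_real (exp (x + (y - L))) + (B * of_real (y - L) - of_real (exp (y - L))) =
        (A * of_real x - d * of_real L) + (d * of_real y - of_real (exp (x + (y - L)) + exp (y - L)))"
      by (simp add: B algebra_simps)
    also have "exp \<dots> = beta_density A d x * exp (d * of_real y - of_real (exp y))"
      unfolding s by (simp add: exp_add beta_density_def L_def)
    finally show "G (x, y + \<tau> x) = beta_density A d x * exp (d * of_real y - of_real (exp y))" .
  qed
  then have "Gamma A * Gamma B = (LINT p|(lborel \<Otimes>\<^sub>M lborel). (\<lambda>(x, y). beta_density A d x * exp (d * of_real y - of_real (exp y))) p)"
    using integral_shear_snd[OF \<tau> Gm] GI by simp
  also have "\<dots> = (LINT t|lborel. beta_density A d t) * Gamma d"
    using integral_tensor[OF integrable_beta_density[OF assms] integrable_Gamma_log[of d]] assms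
    by (simp add: integral_Gamma_log)
  finally have "(LINT t|lborel. beta_density A d t) * Gamma d = Gamma A * Gamma B" by simp
  moreover have "Gamma d \<noteq> 0"
    using assms by (auto simp: Gamma_eq_zero_iff elim!: nonpos_Ints_cases)
  ultimately show ?thesis by (simp add: B_def field_simps)
qed

text \<open>
  The two shears substitute \<open>e\<^sup>\<eta> = e\<^sup>\<xi> e\<^sup>v / (1 + e\<^sup>v)\<close> and \<open>e\<^sup>w = e\<^sup>v (1 + e\<^sup>\<eta>) / e\<^sup>\<eta>\<close>;
  afterwards the variables separate.
\<close>

definition euler_mellin :: "complex \<Rightarrow> complex \<Rightarrow> complex \<Rightarrow> complex \<Rightarrow> real \<times> real \<Rightarrow> complex" where
  "euler_mellin a b c d = (\<lambda>(\<xi>, v). beta_density c d \<xi> * (beta_density b c v *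
      exp (- a * of_real (ln (1 + exp \<xi> * exp (v - softplus v))))))"

lemma
  assumes "Re b > 0" "Re c > Re b" "Re (a - c + d) > 0" "Re (b - c + d) > 0"
  shows integrable_euler_mellin: "integrable (lborel \<Otimes>\<^sub>M lborel) (euler_mellin a b c d)" (is ?A)
    and integral_euler_mellin: "(LINT p|(lborel \<Otimes>\<^sub>M lborel). euler_mellin a b c d p) =
      Gamma b * Gamma (a - c + d) / Gamma (a + b - c + d) *
      (Gamma (b - c + d) * Gamma (c - b) / Gamma d)" (is ?B)
proof -
  let ?\<Phi> = "euler_mellin a b c d"
  have pos: "1 + exp x * exp y > 0" for x y :: real by (simp add: add_pos_pos)
  have \<Phi>m: "?\<Phi> \<in> borel_measurable borel"
    unfolding euler_mellin_def beta_density_def case_prod_beta'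
    by (intro borel_measurable_continuous_onI continuous_intros) (use pos in \<open>auto simp: less_imp_neq[symmetric]\<close>)
  define \<tau> where "\<tau> = (\<lambda>v. softplus v - v)"
  define \<Psi> where "\<Psi> = (\<lambda>(\<eta>, v). ?\<Phi> (\<eta> + \<tau> v, v))"
  have \<tau>: "\<tau> \<in> borel_measurable borel" unfolding \<tau>_def by measurable
  have \<Psi>v: "\<Psi> (\<eta>, v) = exp (c * of_real \<eta> - a * of_real (softplus \<eta>) + (b - c + d) * of_real v
       - d * of_real (ln (exp v * (1 + exp \<eta>) + exp \<eta>)))" for \<eta> v
  proof -
    have 1: "exp (\<eta> + \<tau> v) * exp (v - softplus v) = exp \<eta>" by (simp add: \<tau>_def flip: exp_add)
    have 2: "softplus (\<eta> + \<tau> v) = ln (exp v * (1 + exp \<eta>) + exp \<eta>) - v"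
    proof -
      have "1 + exp (\<eta> + \<tau> v) = (exp v * (1 + exp \<eta>) + exp \<eta>) / exp v"
        by (simp add: \<tau>_def exp_add exp_diff field_simps)
      moreover have "exp v * (1 + exp \<eta>) + exp \<eta> \<noteq> 0"
        by (intro less_imp_neq[symmetric] add_pos_pos mult_pos_pos) auto
      ultimately show ?thesis by (simp add: softplus_def ln_div)
    qed
    show ?thesis
      unfolding \<Psi>_def euler_mellin_def beta_density_def case_prod_conv 1 2
      by (simp add: \<tau>_def softplus_def[of \<eta>] algebra_simps flip: exp_add)
  qed
  have \<Psi>m: "\<Psi> \<in> borel_measurable borel"
  proof -
    have p2: "exp v * (1 + exp \<eta>) + exp \<eta> > 0" for v \<eta> :: real by (simp add: add_pos_pos)
    have "\<Psi> = (\<lambda>p. exp (c * of_real (fst p) - a * of_real (softplus (fst p)) + (b - c + d) * of_real (snd p)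
       - d * of_real (ln (exp (snd p) * (1 + exp (fst p)) + exp (fst p)))))"
      using \<Psi>v by (intro ext) auto
    then show ?thesis
      by (simp only:) (intro borel_measurable_continuous_onI continuous_intros, use p2 in \<open>auto simp: less_imp_neq[symmetric]\<close>)
  qed
  define \<kappa> where "\<kappa> = (\<lambda>\<eta>. \<eta> - softplus \<eta>)"
  have \<kappa>: "\<kappa> \<in> borel_measurable borel" unfolding \<kappa>_def by measurable
  have sep: "(\<lambda>(\<eta>, w). \<Psi> (\<eta>, w + \<kappa> \<eta>)) = (\<lambda>(\<eta>, w). beta_density b (a + b - c + d) \<eta> * beta_density (b - c + d) d w)"
  proof (intro ext, clarify)
    fix \<eta> w
    have "exp (w + \<kappa> \<eta>) * (1 + exp \<eta>) + exp \<eta> = exp \<eta> * (1 + exp w)"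
      by (simp add: \<kappa>_def exp_add exp_diff add_pos_pos less_imp_neq[symmetric] ring_distribs)
        (simp add: field_simps add_pos_pos less_imp_neq[symmetric])
    moreover have "1 + exp w \<noteq> 0" by (intro less_imp_neq[symmetric] add_pos_pos) auto
    ultimately have "ln (exp (w + \<kappa> \<eta>) * (1 + exp \<eta>) + exp \<eta>) = \<eta> + softplus w"
      by (simp add: ln_mult softplus_def)
    then show "\<Psi> (\<eta>, w + \<kappa> \<eta>) = beta_density b (a + b - c + d) \<eta> * beta_density (b - c + d) d w"
      unfolding \<Psi>v beta_density_def by (simp add: \<kappa>_def algebra_simps flip: exp_add)
  qed
  have p: "integrable lborel (beta_density b (a + b - c + d))"
    using assms by (intro integrable_beta_density) auto
  have q: "integrable lborel (beta_density (b - c + d) d)"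
    using assms by (intro integrable_beta_density) auto
  \<comment> \<open>Shears preserve integrability in both directions, so absolute convergence is
    inherited from the separated product; it is the hypothesis of Fubini's theorem in
    \<open>integral_hyp_2F1_mellin\<close>.\<close>
  show ?A
    using integrable_tensor[OF p q] integrable_shear_snd[OF \<kappa> \<Psi>m] integrable_shear_fst[OF \<tau> \<Phi>m]
    unfolding sep \<Psi>_def[symmetric] by simp
  have "(LINT p|(lborel \<Otimes>\<^sub>M lborel). ?\<Phi> p) = (LINT p|(lborel \<Otimes>\<^sub>M lborel). \<Psi> p)"
    using integral_shear_fst[OF \<tau> \<Phi>m] unfolding \<Psi>_def by simp
  also have "\<dots> = (LINT p|(lborel \<Otimes>\<^sub>M lborel). (\<lambda>(\<eta>, w). beta_density b (a + b - c + d) \<eta> * beta_density (b - c + d) d w) p)"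
    using integral_shear_snd[OF \<kappa> \<Psi>m] unfolding sep by simp
  also have "\<dots> = (LINT t|lborel. beta_density b (a + b - c + d) t) * (LINT t|lborel. beta_density (b - c + d) d t)"
    by (rule integral_tensor[OF p q])
  also have "(LINT t|lborel. beta_density b (a + b - c + d) t) = Gamma b * Gamma (a - c + d) / Gamma (a + b - c + d)"
    using assms by (subst integral_beta_density) (auto simp: algebra_simps)
  also have "(LINT t|lborel. beta_density (b - c + d) d t) = Gamma (b - c + d) * Gamma (c - b) / Gamma d"
    using assms by (subst integral_beta_density) (auto simp: algebra_simps)
  finally show ?B .
qed

section \<open>Euler's integral and the continuation of the Gauss series\<close>

definition logistic :: "real \<Rightarrow> real" where "logistic v = exp (v - softplus v)"

lemma logistic_eq: "logistic v = exp v / (1 + exp v)"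
  by (simp add: logistic_def exp_diff)

lemma logistic_bounds: "0 < logistic v" "logistic v < 1"
  by (auto simp: logistic_eq add_pos_pos)

lemma continuous_on_logistic [continuous_intros]:
  "continuous_on A f \<Longrightarrow> continuous_on A (\<lambda>x. logistic (f x))"
  unfolding logistic_def by (intro continuous_intros)

lemma logistic_measurable [measurable]: "logistic \<in> borel_measurable borel"
  by (intro borel_measurable_continuous_onI continuous_intros)

abbreviation slit_plane :: "complex set" where "slit_plane \<equiv> - (complex_of_real ` {1..})"

lemma open_slit_plane: "open slit_plane"
proof -
  have "closed (complex_of_real ` {1..})"
    by (intro closed_injective_linear_image) (auto intro: bounded_linear_of_real injI simp: bounded_linear.linear)
  then show ?thesis by (simp add: open_Compl)
qed

lemma connected_slit_plane: "connected slit_plane"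
proof -
  have "starlike slit_plane"
    unfolding starlike_def
  proof (intro bexI ballI subsetI)
    show "0 \<in> slit_plane" by auto
    fix z w assume z: "z \<in> slit_plane" and w: "w \<in> closed_segment 0 z"
    then obtain u where u: "0 \<le> u" "u \<le> 1" "w = of_real u * z"
      by (auto simp: closed_segment_def scaleR_conv_of_real)
    show "w \<in> slit_plane"
    proof (rule ComplI, elim imageE)
      fix r :: real assume r: "w = of_real r" "r \<in> {1..}"
      then have "u \<noteq> 0" using u by auto
      then have "z = of_real (r / u)" using u r by (simp add: field_simps)
      moreover have "r / u \<ge> 1" using u r \<open>u \<noteq> 0\<close> by (simp add: le_divide_eq)
      ultimately have "z \<in> complex_of_real ` {1..}" by (intro image_eqI[of _ _ "r / u"]) auto
      then show False using z by blast
    qed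
  qed
  then show ?thesis by (rule starlike_imp_connected)
qed

lemma ball_subset_slit_plane: "ball 0 1 \<subseteq> slit_plane"
  by auto

text \<open>For \<open>z\<close> off the slit the segment from 1 to \<open>1 - z\<close> avoids the
  cut of the logarithm, so the principal branch defines \<open>(1 - z s)^(-a)\<close> for all
  \<open>s\<close> in \<open>[0, 1]\<close>.\<close>

lemma slit_plane_one_minus:
  assumes "z \<in> slit_plane" "0 \<le> s" "s \<le> 1"
  shows "1 - z * of_real s \<notin> \<real>\<^sub>\<le>\<^sub>0"
proof
  assume "1 - z * of_real s \<in> \<real>\<^sub>\<le>\<^sub>0"
  then obtain r where r: "1 - z * of_real s = of_real r" "r \<le> 0" by (auto elim!: nonpos_Reals_cases)
  then have zs: "z * of_real s = of_real (1 - r)" by (simp add: algebra_simps)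
  have "s \<noteq> 0" using r by auto
  then have "z = of_real ((1 - r) / s)" using zs by (simp add: field_simps)
  moreover have "(1 - r) / s \<ge> 1" using assms r \<open>s \<noteq> 0\<close> by (simp add: le_divide_eq)
  ultimately have "z \<in> complex_of_real ` {1..}" by (intro image_eqI[of _ _ "(1 - r) / s"]) auto
  then show False using assms(1) by blast
qed

definition euler_kernel :: "complex \<Rightarrow> complex \<Rightarrow> real \<Rightarrow> complex" where
  "euler_kernel a z s = exp (- a * Ln (1 - z * of_real s))"

text \<open>In the variable \<open>s = logistic v\<close> the factor
  \<open>beta_density b c v\<close> is \<open>s^b (1 - s)^(c - b)\<close>, and
  \<open>dv = ds / (s (1 - s))\<close> restores the usual exponents \<open>b - 1\<close> and
  \<open>c - b - 1\<close>.\<close>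

definition euler_integral :: "complex \<Rightarrow> complex \<Rightarrow> complex \<Rightarrow> complex \<Rightarrow> complex" where
  "euler_integral a b c z = (LINT v|lborel. beta_density b c v * euler_kernel a z (logistic v))"

lemma euler_kernel_bounded:
  assumes "compact K" "K \<subseteq> slit_plane"
  shows "\<exists>M>0. \<forall>z\<in>K. \<forall>s\<in>{0..1}. norm (euler_kernel a z s) \<le> M"
proof -
  have "continuous_on (K \<times> {0..1}) (\<lambda>p. euler_kernel a (fst p) (snd p))"
    unfolding euler_kernel_def
    by (intro continuous_intros) (use assms(2) slit_plane_one_minus in \<open>auto simp: subset_eq\<close>)
  then have "bounded ((\<lambda>p. euler_kernel a (fst p) (snd p)) ` (K \<times> {0..1}))"
    using assms by (intro compact_imp_bounded compact_continuous_image compact_Times) auto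
  then show ?thesis by (auto simp: bounded_pos) 
qed

lemma continuous_on_euler_integrand:
  assumes "z \<in> slit_plane"
  shows "continuous_on A (\<lambda>v. beta_density b c v * euler_kernel a z (logistic v))"
  unfolding euler_kernel_def
  using slit_plane_one_minus[OF assms] logistic_bounds
  by (intro continuous_intros continuous_on_beta_density) (auto simp: less_imp_le)

lemma integrable_euler_integrand:
  assumes "Re b > 0" "Re c > Re b" "z \<in> slit_plane"
  shows "integrable lborel (\<lambda>v. beta_density b c v * euler_kernel a z (logistic v))"
proof -
  obtain M where M: "\<And>s. s \<in> {0..1} \<Longrightarrow> norm (euler_kernel a z s) \<le> M"
    using euler_kernel_bounded[of "{z}" a] assms(3) by (metis compact_sing empty_subsetI insert_subset insertI1)
  show ?thesis
  proof (rule Bochner_Integration.integrable_bound)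
    show "integrable lborel (\<lambda>v. M * norm (beta_density b c v))"
      using integrable_beta_density[OF assms(1,2)] by simp
    have "norm (beta_density b c v * euler_kernel a z (logistic v)) \<le> norm (M * norm (beta_density b c v))" for v
    proof -
      have "norm (euler_kernel a z (logistic v)) \<le> M" using logistic_bounds[of v] by (intro M) auto
      moreover from this have "M \<ge> 0" using norm_ge_zero order_trans by blast
      ultimately show ?thesis by (simp add: norm_mult abs_mult mult.commute[of M] mult_left_mono)
    qed
    then show "AE v in lborel. norm (beta_density b c v * euler_kernel a z (logistic v)) \<le> norm (M * norm (beta_density b c v))"
      by simp
  qed (use continuous_on_euler_integrand[OF assms(3), of UNIV] in \<open>auto intro: borel_measurable_continuous_onI\<close>)
qed

text \<open>Truncations to \<open>[-n, n]\<close> are holomorphic by differentiation under the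
  integral. The error is at most \<open>M\<close> times the tail of the integral of
  \<open>|beta_density|\<close>, which does not depend on \<open>z\<close>, so the convergence is
  locally uniform.\<close>

lemma holomorphic_euler_integral:
  assumes bc: "Re b > 0" "Re c > Re b"
  shows "euler_integral a b c holomorphic_on slit_plane"
proof -
  have "euler_integral a b c field_differentiable at z0" if z0: "z0 \<in> slit_plane" for z0
  proof -
    obtain r where r: "r > 0" "cball z0 r \<subseteq> slit_plane"
      using open_slit_plane z0 open_contains_cball by blast
    obtain M where M: "M > 0" "\<And>z s. z \<in> cball z0 r \<Longrightarrow> s \<in> {0..1} \<Longrightarrow> norm (euler_kernel a z s) \<le> M"
      using euler_kernel_bounded[OF compact_cball r(2), of a] by blast
    define U where "U = ball z0 r"
    have U: "z \<in> U \<Longrightarrow> z \<in> slit_plane" "z \<in> U \<Longrightarrow> z \<in> cball z0 r" for z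
      using subsetD[OF r(2), of z] by (simp_all add: U_def)
    define f where "f = (\<lambda>(n::nat) z. integral (cbox (- real n) (real n)) (\<lambda>v. beta_density b c v * euler_kernel a z (logistic v)))"
    have nz: "1 - z * of_real (logistic v) \<noteq> 0" "1 - z * of_real (logistic v) \<notin> \<real>\<^sub>\<le>\<^sub>0" if "z \<in> U" for z v
      using slit_plane_one_minus[OF U(1)[OF that], of "logistic v"] logistic_bounds[of v] by (auto simp: less_imp_le)
    have hol: "f n holomorphic_on U" for n
      unfolding f_def
    proof (rule leibniz_rule_holomorphic)
      fix z v assume z: "z \<in> U"
      show "((\<lambda>z. beta_density b c v * euler_kernel a z (logistic v)) has_field_derivative
          beta_density b c v * (euler_kernel a z (logistic v) * (a * of_real (logistic v) / (1 - z * of_real (logistic v))))) (at z within U)"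
        unfolding euler_kernel_def using nz[OF z, of v]
        by (auto intro!: derivative_eq_intros simp: field_simps)
    next
      fix z assume "z \<in> U"
      then show "(\<lambda>v. beta_density b c v * euler_kernel a z (logistic v)) integrable_on cbox (- real n) (real n)"
        by (intro integrable_continuous continuous_on_euler_integrand U)
    next
      show "continuous_on (U \<times> cbox (- real n) (real n)) (\<lambda>(z, v). beta_density b c v *
         (euler_kernel a z (logistic v) * (a * of_real (logistic v) / (1 - z * of_real (logistic v)))))"
        unfolding euler_kernel_def case_prod_beta' beta_density_def
        by (intro continuous_intros) (use nz in \<open>auto simp: less_imp_le\<close>)
    qed (simp add: U_def)
    define T where "T = (\<lambda>n::nat. (LINT v|lborel. norm (beta_density b c v)) -
        integral {- real n..real n} (\<lambda>v. norm (beta_density b c v)))"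
    have wi: "integrable lborel (\<lambda>v. norm (beta_density b c v))" using integrable_beta_density[OF bc] by simp
    have wc: "continuous_on A (\<lambda>v. norm (beta_density b c v))" for A
      by (intro continuous_intros continuous_on_beta_density)
    have "T \<longlonglongrightarrow> (LINT v|lborel. norm (beta_density b c v)) - (LINT v|lborel. norm (beta_density b c v))"
      unfolding T_def by (intro tendsto_intros tendsto_integral_symmetric wi wc)
    then have T0: "T \<longlonglongrightarrow> 0" by simp
    have diff: "norm (f n z - euler_integral a b c z) \<le> M * T n" if z: "z \<in> U" for n z
    proof -
      let ?h = "\<lambda>v. beta_density b c v * euler_kernel a z (logistic v)"
      let ?I = "{- real n..real n}"
      have hi: "integrable lborel ?h" by (rule integrable_euler_integrand[OF bc U(1)[OF z]])
      have set: "set_integrable lborel ?I ?h" "set_integrable lborel ?I (\<lambda>v. norm (beta_density b c v))"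
        by (intro borel_integrable_atLeastAtMost' continuous_on_euler_integrand U(1)[OF z] wc)+
      have fn: "f n z = (LINT v|lborel. indicator ?I v *\<^sub>R ?h v)"
        using set_borel_integral_eq_integral(2)[OF set(1)] by (simp add: f_def set_lebesgue_integral_def)
      have Tn: "T n = (LINT v|lborel. norm (beta_density b c v)) - (LINT v|lborel. indicator ?I v *\<^sub>R norm (beta_density b c v))"
        using set_borel_integral_eq_integral(2)[OF set(2)] by (simp add: T_def set_lebesgue_integral_def)
      have "f n z - euler_integral a b c z = (LINT v|lborel. indicator ?I v *\<^sub>R ?h v - ?h v)"
        unfolding fn euler_integral_def using set(1) hi
        by (subst Bochner_Integration.integral_diff) (auto simp: set_integrable_def)
      also have "norm \<dots> \<le> (LINT v|lborel. M * (norm (beta_density b c v) - indicator ?I v *\<^sub>R norm (beta_density b c v)))"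
      proof (rule order_trans[OF integral_norm_bound integral_mono])
        show "integrable lborel (\<lambda>v. norm (indicator ?I v *\<^sub>R ?h v - ?h v))"
          using set(1) hi by (intro integrable_norm Bochner_Integration.integrable_diff) (auto simp: set_integrable_def)
        show "integrable lborel (\<lambda>v. M * (norm (beta_density b c v) - indicator ?I v *\<^sub>R norm (beta_density b c v)))"
          using set(2) wi by (intro integrable_mult_right Bochner_Integration.integrable_diff) (auto simp: set_integrable_def)
        fix v
        have "norm (euler_kernel a z (logistic v)) \<le> M"
          using logistic_bounds[of v] by (intro M U(2)[OF z]) auto
        then show "norm (indicator ?I v *\<^sub>R ?h v - ?h v) \<le> M * (norm (beta_density b c v) - indicator ?I v *\<^sub>R norm (beta_density b c v))"
          by (auto simp: indicator_def norm_mult mult.commute[of M] mult_left_mono)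
      qed
      also have "\<dots> = M * T n"
        unfolding Tn using set(2) wi by (simp add: set_integrable_def)
      finally show ?thesis .
    qed
    have "euler_integral a b c holomorphic_on U"
    proof (rule holomorphic_uniform_sequence[of U f])
      show "open U" by (simp add: U_def)
      show "f n holomorphic_on U" for n by (rule hol)
      fix x assume "x \<in> U"
      then obtain d where d: "d > 0" "cball x d \<subseteq> U"
        using open_contains_cball[of U] open_ball unfolding U_def by metis
      have "uniform_limit (cball x d) f (euler_integral a b c) sequentially"
      proof (rule uniform_limitI)
        fix e :: real assume e: "e > 0"
        have "(\<lambda>n. M * T n) \<longlonglongrightarrow> 0" by (rule tendsto_mult_right_zero[OF T0])
        then have "\<forall>\<^sub>F n in sequentially. M * T n < e" using order_tendstoD(2) e by blast
        then show "\<forall>\<^sub>F n in sequentially. \<forall>z\<in>cball x d. dist (f n z) (euler_integral a b c z) < e"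
        proof eventually_elim
          case (elim n)
          then show ?case using diff d(2) by (auto simp: dist_norm intro: le_less_trans)
        qed
      qed
      then show "\<exists>d>0. cball x d \<subseteq> U \<and> uniform_limit (cball x d) f (euler_integral a b c) sequentially"
        using d by blast
    qed
    then show ?thesis
      using r by (auto intro: holomorphic_on_imp_differentiable_at simp: U_def)
  qed
  then show ?thesis
    by (meson field_differentiable_at_within holomorphic_onI)
qed

definition euler_const :: "complex \<Rightarrow> complex \<Rightarrow> complex" where
  "euler_const b c = Gamma b * Gamma (c - b) / Gamma c"

lemma Gamma_nonzero_pos: "Re z > 0 \<Longrightarrow> Gamma z \<noteq> 0"
  by (auto simp: Gamma_eq_zero_iff elim!: nonpos_Ints_cases)

lemma euler_const_nonzero: "Re b > 0 \<Longrightarrow> Re c > Re b \<Longrightarrow> euler_const b c \<noteq> 0"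
  unfolding euler_const_def by (simp add: Gamma_nonzero_pos)

text \<open>Binomial expansion of \<open>(1 - z s)^(-a)\<close> under Euler's integral: a power
  \<open>s^n\<close> raises both parameters of \<open>beta_density\<close> by \<open>n\<close>, and
  each term is again a beta integral.\<close>

lemma hyp_2F1_series_sums:
  assumes bc: "Re b > 0" "Re c > Re b" and z: "norm z < 1"
  shows "(\<lambda>n. pochhammer a n * pochhammer b n / pochhammer c n / fact n * z ^ n) sums
     (euler_integral a b c z / euler_const b c)"
proof -
  define k where "k = (\<lambda>n. pochhammer a n / fact n)"
  have binom: "(\<lambda>n. k n * x ^ n) sums ((1 - x) powr (- a))" if "norm x < 1" for x
  proof -
    have "(\<lambda>n. (- a gchoose n) * (- x) ^ n) sums (1 + - x) powr (- a)"
      using that by (intro gen_binomial_complex) simp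
    moreover have "(- a gchoose n) * (- x) ^ n = k n * x ^ n" for n
    proof -
      have "(- 1) ^ n * (- 1) ^ n = (1 :: complex)" by (simp flip: power_mult_distrib)
      moreover have "(- a gchoose n) * (- x) ^ n = ((- 1) ^ n * (- 1) ^ n) * (k n * x ^ n)"
        unfolding gbinomial_pochhammer k_def by (subst power_minus) simp
      ultimately show ?thesis by simp
    qed
    ultimately show ?thesis by simp
  qed
  \<comment> \<open>A radius between \<open>|z|\<close> and 1: convergence of the binomial series
    there gives the absolute convergence at \<open>z\<close> that justifies exchanging sum and
    integral.\<close>
  define r where "r = (1 + norm z) / 2"
  have r: "norm z < r" "r < 1" "r > 0" using z norm_ge_zero[of z] by (auto simp: r_def field_simps intro: add_pos_nonneg)
  have abs: "summable (\<lambda>n. norm (k n * z ^ n))"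
    using powser_insidea[OF sums_summable[OF binom[of "of_real r"]], of z] r by simp
  define F where "F = (\<lambda>n v. (k n * z ^ n) * beta_density (b + of_nat n) (c + of_nat n) v)"
  have shift: "beta_density (b + of_nat n) (c + of_nat n) v = beta_density b c v * of_real (logistic v) ^ n" for n v
    unfolding beta_density_def logistic_def exp_of_real[symmetric] exp_of_nat_mult[symmetric] exp_add[symmetric]
    by (simp add: algebra_simps)
  have Fi: "integrable lborel (F n)" for n
    unfolding F_def using bc by (intro integrable_mult_right integrable_beta_density) auto
  have Fn: "norm (F n v) \<le> norm (k n * z ^ n) * norm (beta_density b c v)" for n v
  proof -
    have "norm (of_real (logistic v) ^ n :: complex) \<le> 1"
      using logistic_bounds[of v] by (simp add: norm_power power_le_one)
    then show ?thesis
      unfolding F_def shift by (simp add: norm_mult mult_left_le mult.assoc mult_left_mono)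
  qed
  have zs: "z \<in> slit_plane" using z by auto
  have "(\<lambda>n. LINT v|lborel. F n v) sums (LINT v|lborel. (\<Sum>n. F n v))"
  proof (rule sums_integral[OF Fi])
    have "summable (\<lambda>n. norm (F n v))" for v
      by (rule summable_comparison_test'[OF summable_mult2[OF abs, of "norm (beta_density b c v)"], of 0])
        (simp add: Fn)
    then show "AE v in lborel. summable (\<lambda>n. norm (F n v))" by simp
    show "summable (\<lambda>n. LINT v|lborel. norm (F n v))"
    proof (rule summable_comparison_test'[OF summable_mult2[OF abs, of "LINT v|lborel. norm (beta_density b c v)"], of 0])
      fix n :: nat
      have "(LINT v|lborel. norm (F n v)) \<le> (LINT v|lborel. norm (k n * z ^ n) * norm (beta_density b c v))"
        using Fi[of n] integrable_beta_density[OF bc] Fn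
        by (intro integral_mono integrable_mult_right) auto
      then show "norm (LINT v|lborel. norm (F n v)) \<le> norm (k n * z ^ n) * (LINT v|lborel. norm (beta_density b c v))"
        by simp
    qed
  qed
  also have "(\<lambda>v. \<Sum>n. F n v) = (\<lambda>v. beta_density b c v * euler_kernel a z (logistic v))"
  proof
    fix v
    have n1: "norm (z * of_real (logistic v)) < 1"
    proof -
      have "norm z * logistic v \<le> norm z" using logistic_bounds[of v] by (intro mult_left_le) auto
      then show ?thesis using z logistic_bounds[of v] by (simp add: norm_mult)
    qed
    have "(\<lambda>n. beta_density b c v * (k n * (z * of_real (logistic v)) ^ n)) sums
        (beta_density b c v * ((1 - z * of_real (logistic v)) powr (- a)))"
      by (intro sums_mult binom n1)
    moreover have "beta_density b c v * (k n * (z * of_real (logistic v)) ^ n) = F n v" for n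
      by (simp add: F_def shift power_mult_distrib mult_ac)
    moreover have "(1 - z * of_real (logistic v)) powr (- a) = euler_kernel a z (logistic v)"
      using slit_plane_one_minus[OF zs, of "logistic v"] logistic_bounds[of v]
      by (auto simp: euler_kernel_def powr_def)
    ultimately show "(\<Sum>n. F n v) = beta_density b c v * euler_kernel a z (logistic v)"
      by (simp add: sums_iff)
  qed
  also have "(LINT v|lborel. beta_density b c v * euler_kernel a z (logistic v)) = euler_integral a b c z"
    by (simp add: euler_integral_def)
  also have "(\<lambda>n. LINT v|lborel. F n v) =
      (\<lambda>n. euler_const b c * (pochhammer a n * pochhammer b n / pochhammer c n / fact n * z ^ n))"
  proof
    fix n
    have nb: "b \<notin> \<int>\<^sub>\<le>\<^sub>0" "c \<notin> \<int>\<^sub>\<le>\<^sub>0" using bc by (auto elim!: nonpos_Ints_cases)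
    have "(LINT v|lborel. F n v) = k n * z ^ n * (Gamma (b + of_nat n) * Gamma (c - b) / Gamma (c + of_nat n))"
      unfolding F_def using bc by (subst integral_mult_right_zero, subst integral_beta_density) auto
    also have "\<dots> = euler_const b c * (pochhammer a n * pochhammer b n / pochhammer c n / fact n * z ^ n)"
      using bc by (simp add: pochhammer_Gamma[OF nb(1)] pochhammer_Gamma[OF nb(2)] euler_const_def k_def
          Gamma_nonzero_pos) (simp add: mult_ac)
    finally show "(LINT v|lborel. F n v) = euler_const b c * (pochhammer a n * pochhammer b n / pochhammer c n / fact n * z ^ n)" .
  qed
  finally have "(\<lambda>n. euler_const b c * (pochhammer a n * pochhammer b n / pochhammer c n / fact n * z ^ n) / euler_const b c)
      sums (euler_integral a b c z / euler_const b c)" by (rule sums_divide)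
  then show ?thesis using euler_const_nonzero[OF bc] by simp
qed

lemma hyp_pFq_2_1: "hyp_pFq [a, b] [c] z = (\<Sum>n. pochhammer a n * pochhammer b n / pochhammer c n / fact n * z ^ n)"
  by (simp add: hyp_pFq_def divide_inverse mult_ac)

text \<open>\<open>hyp_2F1\<close> is a choice, so a function with the required properties has to be
  exhibited; Euler's integral divided by its value at \<open>z = 0\<close> is one.\<close>

lemma hyp_2F1_spec:
  assumes bc: "Re b > 0" "Re c > Re b"
  shows "hyp_2F1 a b c holomorphic_on slit_plane"
    and "\<And>z. z \<in> ball 0 1 \<Longrightarrow> hyp_2F1 a b c z = hyp_pFq [a, b] [c] z"
proof -
  have "\<exists>f. f holomorphic_on slit_plane \<and> (\<forall>z\<in>ball 0 1. f z = hyp_pFq [a, b] [c] z)"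
  proof (intro exI conjI ballI)
    show "(\<lambda>z. euler_integral a b c z / euler_const b c) holomorphic_on slit_plane"
      using euler_const_nonzero[OF bc] by (intro holomorphic_intros holomorphic_euler_integral[OF bc])
    fix z :: complex assume "z \<in> ball 0 1"
    then show "euler_integral a b c z / euler_const b c = hyp_pFq [a, b] [c] z"
      using hyp_2F1_series_sums[OF bc, of z a] by (simp add: hyp_pFq_2_1 sums_iff)
  qed
  from someI_ex[OF this]
  show "hyp_2F1 a b c holomorphic_on slit_plane"
    and "\<And>z. z \<in> ball 0 1 \<Longrightarrow> hyp_2F1 a b c z = hyp_pFq [a, b] [c] z"
    unfolding hyp_2F1_def by auto
qed

lemma hyp_2F1_euler_integral:
  assumes bc: "Re b > 0" "Re c > Re b" and z: "z \<in> slit_plane"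
  shows "hyp_2F1 a b c z = euler_integral a b c z / euler_const b c"
proof (rule analytic_continuation_open[where f = "hyp_2F1 a b c" and
      g = "\<lambda>z. euler_integral a b c z / euler_const b c" and s = "ball 0 1" and s' = slit_plane and z = z])
  show "(\<lambda>z. euler_integral a b c z / euler_const b c) holomorphic_on slit_plane"
    using euler_const_nonzero[OF bc] by (intro holomorphic_intros holomorphic_euler_integral[OF bc])
  fix z :: complex assume "z \<in> ball 0 1"
  then show "hyp_2F1 a b c z = euler_integral a b c z / euler_const b c"
    using hyp_2F1_series_sums[OF bc, of z a] hyp_2F1_spec(2)[OF bc, of z a]
    by (simp add: hyp_pFq_2_1 sums_iff)
qed (use hyp_2F1_spec(1)[OF bc] open_slit_plane connected_slit_plane ball_subset_slit_plane z in auto)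

text \<open>Termwise differentiation proves it on the disc; both sides are holomorphic on the slit
  plane, so the identity continues to all of it.\<close>

lemma deriv_hyp_2F1:
  assumes bc: "Re b > 0" "Re c > Re b" and z: "z \<in> slit_plane"
  shows "deriv (hyp_2F1 a b c) z = a * b / c * hyp_2F1 (a + 1) (b + 1) (c + 1) z"
proof (rule analytic_continuation_open[where f = "deriv (hyp_2F1 a b c)" and
      g = "\<lambda>z. a * b / c * hyp_2F1 (a + 1) (b + 1) (c + 1) z" and s = "ball 0 1" and s' = slit_plane and z = z])
  have bc': "Re (b + 1) > 0" "Re (c + 1) > Re (b + 1)" using bc by auto
  show "deriv (hyp_2F1 a b c) holomorphic_on slit_plane"
    by (intro holomorphic_deriv hyp_2F1_spec(1) bc open_slit_plane)
  show "(\<lambda>z. a * b / c * hyp_2F1 (a + 1) (b + 1) (c + 1) z) holomorphic_on slit_plane"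
    by (intro holomorphic_intros hyp_2F1_spec(1) bc')
  fix z :: complex assume z: "z \<in> ball 0 1"
  define k where "k = (\<lambda>n. pochhammer a n * pochhammer b n / pochhammer c n / fact n)"
  have c0: "c \<noteq> 0" using bc by auto
  have pc: "pochhammer (c + 1) n \<noteq> 0" for n
  proof
    assume "pochhammer (c + 1) n = 0"
    then obtain k where "c + 1 = - of_nat k" by (auto simp: pochhammer_eq_0_iff)
    from arg_cong[OF this, of Re] show False using bc by simp
  qed
  have sm: "summable (\<lambda>n. k n * w ^ n)" if "norm w < 1" for w
    using sums_summable[OF hyp_2F1_series_sums[OF bc that, of a]] by (simp add: k_def)
  have "((\<lambda>z. \<Sum>n. k n * z ^ n) has_field_derivative (\<Sum>n. diffs k n * z ^ n)) (at z)"
    using z by (intro termdiffs_strong'[of 1] sm) auto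
  then have "(hyp_2F1 a b c has_field_derivative (\<Sum>n. diffs k n * z ^ n)) (at z)"
  proof (rule has_field_derivative_transform_within_open[of _ _ _ "ball 0 1"])
    fix w :: complex assume "w \<in> ball 0 1"
    then show "(\<Sum>n. k n * w ^ n) = hyp_2F1 a b c w"
      using hyp_2F1_spec(2)[OF bc, of w a] by (simp add: hyp_pFq_2_1 k_def)
  qed (use z in auto)
  then have "deriv (hyp_2F1 a b c) z = (\<Sum>n. diffs k n * z ^ n)" by (rule DERIV_imp_deriv)
  also have "(\<lambda>n. diffs k n * z ^ n) = (\<lambda>n. a * b / c *
      (pochhammer (a + 1) n * pochhammer (b + 1) n / pochhammer (c + 1) n / fact n * z ^ n))"
  proof
    fix n
    have "diffs k n = a * b / c * (pochhammer (a + 1) n * pochhammer (b + 1) n / pochhammer (c + 1) n / fact n)"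
      using c0 pc[of n] by (simp add: diffs_def k_def pochhammer_rec divide_simps del: of_nat_Suc)
    then show "diffs k n * z ^ n = a * b / c *
      (pochhammer (a + 1) n * pochhammer (b + 1) n / pochhammer (c + 1) n / fact n * z ^ n)" by simp
  qed
  also have "(\<Sum>n. \<dots> n) = a * b / c * hyp_pFq [a + 1, b + 1] [c + 1] z"
    using z hyp_2F1_series_sums[OF bc', of z "a + 1"]
    by (subst suminf_mult) (auto simp: hyp_pFq_2_1 sums_iff)
  also have "\<dots> = a * b / c * hyp_2F1 (a + 1) (b + 1) (c + 1) z"
    using hyp_2F1_spec(2)[OF bc' z] by simp
  finally show "deriv (hyp_2F1 a b c) z = a * b / c * hyp_2F1 (a + 1) (b + 1) (c + 1) z" .
qed (use open_slit_plane connected_slit_plane ball_subset_slit_plane z in auto)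

lemma neg_exp_in_slit_plane: "- complex_of_real (exp \<xi>) \<in> slit_plane"
proof -
  have "- exp \<xi> < 1" by (smt (verit) exp_gt_zero)
  then show ?thesis by (auto simp flip: of_real_minus)
qed

lemma euler_kernel_neg_exp:
  "euler_kernel a (- of_real (exp \<xi>)) s = exp (- a * of_real (ln (1 + exp \<xi> * s)))" if "s \<ge> 0"
proof -
  have "1 + exp \<xi> * s > 0" using that by (simp add: add_pos_nonneg)
  moreover have "1 - (- complex_of_real (exp \<xi>)) * of_real s = of_real (1 + exp \<xi> * s)" by simp
  ultimately show ?thesis unfolding euler_kernel_def by (simp only: Ln_of_real)
qed

text \<open>The exponent of \<open>e^\<xi>\<close> in the density is the lower parameter
  \<open>c\<close> of the Gauss function; this coincidence lets the double integral separate into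
  two beta integrals. It occurs below because \<open>log_weight\<close> contains
  \<open>e^(\<gamma> \<xi>)\<close> and the kernel has lower parameter
  \<open>\<gamma>\<close>.\<close>

lemma integral_hyp_2F1_mellin:
  assumes "Re b > 0" "Re c > Re b" "Re (a - c + d) > 0" "Re (b - c + d) > 0"
  shows "(LINT \<xi>|lborel. beta_density c d \<xi> * hyp_2F1 a b c (- of_real (exp \<xi>))) =
         Gamma c * Gamma (a - c + d) * Gamma (b - c + d) / (Gamma d * Gamma (a + b - c + d))"
proof -
  note int = integrable_euler_mellin[OF assms]
  have K: "euler_const b c \<noteq> 0" using assms by (intro euler_const_nonzero)
  have e: "beta_density c d \<xi> * hyp_2F1 a b c (- of_real (exp \<xi>)) =
      (LINT v|lborel. euler_mellin a b c d (\<xi>, v)) / euler_const b c" for \<xi>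
  proof -
    have "(LINT v|lborel. euler_mellin a b c d (\<xi>, v)) = beta_density c d \<xi> *
        (LINT v|lborel. beta_density b c v * exp (- a * of_real (ln (1 + exp \<xi> * exp (v - softplus v)))))"
      unfolding euler_mellin_def by simp
    also have "(\<lambda>v. beta_density b c v * exp (- a * of_real (ln (1 + exp \<xi> * exp (v - softplus v))))) =
        (\<lambda>v. beta_density b c v * euler_kernel a (- of_real (exp \<xi>)) (logistic v))"
      using logistic_bounds by (intro ext) (simp add: euler_kernel_neg_exp less_imp_le flip: logistic_def)
    finally show ?thesis
      using hyp_2F1_euler_integral[OF assms(1,2) neg_exp_in_slit_plane, of a \<xi>]
      by (simp add: euler_integral_def)
  qed
  have "(LINT \<xi>|lborel. beta_density c d \<xi> * hyp_2F1 a b c (- of_real (exp \<xi>))) =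
      (LINT p|(lborel \<Otimes>\<^sub>M lborel). euler_mellin a b c d p) / euler_const b c"
    unfolding e using lborel_pair.integral_fst'[OF int] by simp
  then show ?thesis
    using integral_euler_mellin[OF assms] assms
    by (simp add: euler_const_def Gamma_nonzero_pos) (simp add: mult_ac)
qed

text \<open>
  The bound for \<open>m = 1\<close> uses \<open>1 + x s \<ge> s (1 + x)\<close>: one power of \<open>s\<close> of the Euler integral is traded for
  decay in \<open>x\<close>.
\<close>

lemma hyp_2F1_neg_bound:
  assumes bc: "Re b > real m" "Re c > Re b" and a: "Re a \<ge> real m" and m: "m \<le> 1"
  shows "\<exists>C. \<forall>\<xi>. norm (hyp_2F1 a b c (- of_real (exp \<xi>))) \<le> C / (1 + exp \<xi>) ^ m"
proof -
  have b0: "Re b > 0" using bc m by linarith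
  define I where "I = (LINT v|lborel. norm (beta_density (b - of_nat m) (c - of_nat m) v))"
  have "norm (hyp_2F1 a b c (- of_real (exp \<xi>))) \<le> I / norm (euler_const b c) / (1 + exp \<xi>) ^ m" for \<xi>
  proof -
    let ?z = "- complex_of_real (exp \<xi>)"
    have bd: "norm (beta_density b c v * euler_kernel a ?z (logistic v)) \<le>
        norm (beta_density (b - of_nat m) (c - of_nat m) v) / (1 + exp \<xi>) ^ m" for v
    proof -
      let ?s = "logistic v"
      have s: "0 < ?s" "?s < 1" by (rule logistic_bounds)+
      have q: "1 + exp \<xi> * ?s \<ge> 1" using s by simp
      have "norm (euler_kernel a ?z ?s) = exp (- Re a * ln (1 + exp \<xi> * ?s))"
        using s by (simp add: euler_kernel_neg_exp)
      also have "\<dots> \<le> exp (- real m * ln (1 + exp \<xi> * ?s))"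
        using a q by (simp add: mult_right_mono)
      also have "\<dots> = 1 / (1 + exp \<xi> * ?s) ^ m"
        using q by (simp add: exp_minus exp_of_nat_mult inverse_eq_divide)
      also have "\<dots> \<le> 1 / (?s * (1 + exp \<xi>)) ^ m"
      proof (intro divide_left_mono power_mono mult_pos_pos zero_less_power)
        show "?s * (1 + exp \<xi>) \<le> 1 + exp \<xi> * ?s" using s by (simp add: algebra_simps)
      qed (use s q in \<open>auto simp: add_pos_pos\<close>)
      finally have k: "norm (euler_kernel a ?z ?s) \<le> 1 / (?s * (1 + exp \<xi>)) ^ m" .
      have w: "beta_density b c v = beta_density (b - of_nat m) (c - of_nat m) v * of_real (?s ^ m)"
        unfolding beta_density_def logistic_def of_real_power exp_of_real[symmetric] exp_of_nat_mult[symmetric] exp_add[symmetric]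
        by (simp add: algebra_simps)
      have "norm (beta_density b c v * euler_kernel a ?z ?s) \<le>
          norm (beta_density (b - of_nat m) (c - of_nat m) v) * ?s ^ m * (1 / (?s * (1 + exp \<xi>)) ^ m)"
        unfolding w norm_mult using s k by (intro mult_mono) (auto simp: norm_power)
      also have "\<dots> = norm (beta_density (b - of_nat m) (c - of_nat m) v) / (1 + exp \<xi>) ^ m"
        using s by (simp add: power_mult_distrib)
      finally show ?thesis .
    qed
    have "norm (euler_integral a b c ?z) \<le> (LINT v|lborel. norm (beta_density (b - of_nat m) (c - of_nat m) v) / (1 + exp \<xi>) ^ m)"
      unfolding euler_integral_def
    proof (rule order_trans[OF integral_norm_bound integral_mono])
      show "integrable lborel (\<lambda>v. norm (beta_density b c v * euler_kernel a ?z (logistic v)))"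
        using integrable_euler_integrand[OF b0 bc(2) neg_exp_in_slit_plane] by simp
      have "integrable lborel (beta_density (b - of_nat m) (c - of_nat m))"
        using bc by (intro integrable_beta_density) auto
      then show "integrable lborel (\<lambda>v. norm (beta_density (b - of_nat m) (c - of_nat m) v) / (1 + exp \<xi>) ^ m)"
        by simp
    qed (rule bd)
    also have "\<dots> = I / (1 + exp \<xi>) ^ m" by (simp add: I_def)
    finally show ?thesis
      unfolding hyp_2F1_euler_integral[OF b0 bc(2) neg_exp_in_slit_plane]
      using euler_const_nonzero[OF b0 bc(2)] by (simp add: norm_divide divide_right_mono field_simps)
  qed
  then show ?thesis by blast
qed

lemma of_real_pos_not_nonpos_Ints: "x > 0 \<Longrightarrow> complex_of_real x \<notin> \<int>\<^sub>\<le>\<^sub>0"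
  using Complex_pos_not_nonpos_Ints[of x 0] by (simp add: complex_of_real_def)

section \<open>The transform of powers of cosh\<close>

locale cherednik_opdam =
  fixes b \<iota> :: real
  assumes b_pos: "b > 0" and \<iota>_pos: "\<iota> > 0"
begin

definition \<rho> :: real where "\<rho> = b + \<iota>"
text \<open>The lower parameter of the Gauss function in the kernel;
  \<open>\<gamma> > \<rho> / 2\<close> is the condition under which Euler's integral represents it
  for imaginary spectral parameter.\<close>

definition \<gamma> :: real where "\<gamma> = b + (\<iota> + 1) / 2"

lemma \<rho>_pos: "\<rho> > 0" and \<gamma>_pos: "\<gamma> > 0" and \<gamma>_gt: "\<gamma> > \<rho> / 2"
  using b_pos \<iota>_pos by (auto simp: \<rho>_def \<gamma>_def field_simps)

section \<open>The measure in the variable \<open>\<xi> = ln (sinh^2 t)\<close>\<close>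

definition log_weight :: "real \<Rightarrow> real" where
  "log_weight \<xi> = 2 powr (2 * \<rho>) * exp (\<gamma> * \<xi> - (1 - \<iota>) / 2 * softplus \<xi>)"

lemma log_weight_pos: "log_weight \<xi> > 0"
  by (simp add: log_weight_def)

lemma continuous_on_log_weight: "continuous_on A log_weight"
  unfolding log_weight_def by (intro continuous_intros)

lemma log_weight_measurable [measurable]: "log_weight \<in> borel_measurable borel"
  by (intro borel_measurable_continuous_onI continuous_on_log_weight)

text \<open>At \<open>t = 0\<close> the value is the default \<open>ln 0\<close> and has no meaning;
  identities are stated for \<open>t \<noteq> 0\<close>, and the point is a null set.\<close>

definition log_sinh_sq :: "real \<Rightarrow> real" where "log_sinh_sq t = ln ((sinh t)\<^sup>2)"

lemma log_sinh_sq_measurable [measurable]: "log_sinh_sq \<in> borel_measurable borel"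
proof -
  have [measurable]: "(sinh :: real \<Rightarrow> real) \<in> borel_measurable borel"
    by (intro borel_measurable_continuous_onI continuous_intros)
  show ?thesis unfolding log_sinh_sq_def by measurable
qed

lemma log_sinh_sq_minus [simp]: "log_sinh_sq (- t) = log_sinh_sq t"
  by (simp add: log_sinh_sq_def)

lemma exp_log_sinh_sq: "t \<noteq> 0 \<Longrightarrow> exp (log_sinh_sq t) = (sinh t)\<^sup>2"
  by (simp add: log_sinh_sq_def)

lemma cosh_sq_log_sinh_sq: "t \<noteq> 0 \<Longrightarrow> (cosh t)\<^sup>2 = exp (softplus (log_sinh_sq t))"
  by (simp add: exp_log_sinh_sq cosh_square_eq)

lemma cosh_powr_log_sinh_sq: "t \<noteq> 0 \<Longrightarrow> cosh t powr p = exp (p / 2 * softplus (log_sinh_sq t))"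
proof -
  assume t: "t \<noteq> 0"
  have "2 * ln (cosh t) = ln ((cosh t)\<^sup>2)" by (simp add: ln_realpow)
  also have "\<dots> = softplus (log_sinh_sq t)" unfolding cosh_sq_log_sinh_sq[OF t] by (rule ln_exp)
  finally have "ln (cosh t) = softplus (log_sinh_sq t) / 2" by simp
  then show ?thesis by (simp add: powr_def)
qed

lemma tanh_sq_log_sinh_sq: "t \<noteq> 0 \<Longrightarrow> (tanh t)\<^sup>2 = logistic (log_sinh_sq t)"
  by (simp add: tanh_def power_divide exp_log_sinh_sq logistic_eq cosh_square_eq add.commute)

definition mu_density :: "real \<Rightarrow> real" where
  "mu_density t = 2 powr (2 * b + \<iota>) * \<bar>sinh t\<bar> powr (2 * b) * \<bar>sinh (2 * t)\<bar> powr \<iota>"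

lemma mu_density_measurable [measurable]: "mu_density \<in> borel_measurable borel"
proof -
  have [measurable]: "(sinh :: real \<Rightarrow> real) \<in> borel_measurable borel"
    by (intro borel_measurable_continuous_onI continuous_intros)
  show ?thesis unfolding mu_density_def by measurable
qed

lemma mu_density_nonneg: "mu_density t \<ge> 0"
  by (simp add: mu_density_def)

lemma mu_density_minus [simp]: "mu_density (- t) = mu_density t"
  by (simp add: mu_density_def)

lemma co_mu_eq: "co_mu b \<iota> = density lborel (\<lambda>t. ennreal (mu_density t))"
  by (simp add: co_mu_def mu_density_def)

lemma sets_co_mu [measurable_cong, simp]: "sets (co_mu b \<iota>) = sets borel"
  by (simp_all add: co_mu_eq)

text \<open>The inverse of \<open>log_sinh_sq\<close> on the positive half line, in the direction in
  which \<open>distr_density_diffeo\<close> applies: a map defined on the whole line.\<close>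

definition half_line_map :: "real \<Rightarrow> real" where "half_line_map \<xi> = arsinh (exp (\<xi> / 2))"

definition half_line_deriv :: "real \<Rightarrow> real" where
  "half_line_deriv \<xi> = exp (\<xi> / 2 - softplus \<xi> / 2) / 2"

lemma half_line_map:
  "(half_line_map has_real_derivative half_line_deriv \<xi>) (at \<xi>)"
  "half_line_deriv \<xi> > 0" "continuous_on UNIV half_line_deriv" "range half_line_map = {0<..}"
proof -
  have s: "sqrt (1 + exp \<xi>) = exp (softplus \<xi> / 2)"
  proof (rule real_sqrt_unique)
    show "(exp (softplus \<xi> / 2))\<^sup>2 = 1 + exp \<xi>"
      by (simp add: power2_eq_square flip: exp_add)
  qed simp
  have "(exp (\<xi> / 2))\<^sup>2 = exp \<xi>" by (simp add: power2_eq_square flip: exp_add)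
  then show deriv: "(half_line_map has_real_derivative half_line_deriv \<xi>) (at \<xi>)"
  proof -
    assume e: "(exp (\<xi> / 2))\<^sup>2 = exp \<xi>"
    have "((\<lambda>\<xi>. exp (\<xi> / 2)) has_real_derivative exp (\<xi> / 2) / 2) (at \<xi>)"
      by (auto intro!: derivative_eq_intros)
    from DERIV_chain2[OF arsinh_real_has_field_derivative this]
    show "(half_line_map has_real_derivative half_line_deriv \<xi>) (at \<xi>)"
      unfolding half_line_map_def half_line_deriv_def e add.commute[of _ 1] s
      by (simp add: exp_diff)
  qed
  show "half_line_deriv \<xi> > 0" by (simp add: half_line_deriv_def)
  show "continuous_on UNIV half_line_deriv" unfolding half_line_deriv_def by (intro continuous_intros) auto
  show "range half_line_map = {0<..}"
  proof (intro equalityI subsetI)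
    fix t :: real assume t: "t \<in> {0<..}"
    then have "half_line_map (2 * ln (sinh t)) = t"
      by (simp add: half_line_map_def arsinh_sinh_real)
    then show "t \<in> range half_line_map" by (metis rangeI)
  qed (auto simp: half_line_map_def)
qed

lemma log_sinh_sq_half_line_map: "log_sinh_sq (half_line_map \<xi>) = \<xi>"
  by (simp add: log_sinh_sq_def half_line_map_def ln_realpow)

lemma mu_density_half_line_map: "2 * mu_density (half_line_map \<xi>) * half_line_deriv \<xi> = log_weight \<xi>"
proof -
  define u s where "u = \<xi> / 2" and "s = softplus \<xi> / 2"
  have sh: "sinh (half_line_map \<xi>) = exp u" by (simp add: half_line_map_def u_def)
  have "cosh (half_line_map \<xi>) powr 1 = exp s"
    using cosh_powr_log_sinh_sq[of "half_line_map \<xi>" 1] half_line_map(4)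
    by (metis greaterThan_iff less_irrefl log_sinh_sq_half_line_map mult.commute mult_1 rangeI s_def times_divide_eq_right)
  then have ch: "cosh (half_line_map \<xi>) = exp s" by simp
  have "sinh (2 * half_line_map \<xi>) = 2 * exp (u + s)"
    by (simp add: sinh_double sh ch exp_add)
  then have "mu_density (half_line_map \<xi>) = 2 powr (2 * b + \<iota>) * exp u powr (2 * b) * (2 * exp (u + s)) powr \<iota>"
    by (simp add: mu_density_def sh)
  also have "\<dots> = 2 powr (2 * b + \<iota>) * 2 powr \<iota> * (exp (2 * b * u) * exp (\<iota> * (u + s)))"
    by (simp add: powr_mult exp_powr_real mult_ac)
  also have "\<dots> = 2 powr (2 * \<rho>) * exp (2 * b * u + \<iota> * (u + s))"
    by (simp add: \<rho>_def exp_add flip: powr_add) (simp add: ring_distribs add.commute)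
  finally have "2 * mu_density (half_line_map \<xi>) * half_line_deriv \<xi> =
      2 powr (2 * \<rho>) * (exp (2 * b * u + \<iota> * (u + s)) * exp (u - s))"
    by (simp add: half_line_deriv_def u_def s_def)
  also have "exp (2 * b * u + \<iota> * (u + s)) * exp (u - s) = exp (\<gamma> * \<xi> - (1 - \<iota>) / 2 * softplus \<xi>)"
    unfolding exp_add[symmetric] by (rule arg_cong[of _ _ exp]) (simp add: u_def s_def \<gamma>_def field_simps)
  finally show ?thesis by (simp add: log_weight_def)
qed

lemma distr_co_mu: "distr (co_mu b \<iota>) borel log_sinh_sq = density lborel (\<lambda>\<xi>. ennreal (log_weight \<xi>))"
proof (rule measure_eqI)
  fix A assume "A \<in> sets (distr (co_mu b \<iota>) borel log_sinh_sq)"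
  then have A [measurable]: "A \<in> sets borel" by simp
  define k where "k = (\<lambda>t. ennreal (mu_density t) * indicator A (log_sinh_sq t))"
  have [measurable]: "k \<in> borel_measurable borel" unfolding k_def by measurable
  have "emeasure (distr (co_mu b \<iota>) borel log_sinh_sq) A = (\<integral>\<^sup>+t. k t \<partial>lborel)"
    unfolding co_mu_eq
    by (subst emeasure_distr) (auto simp: emeasure_density k_def indicator_def vimage_def intro!: nn_integral_cong)
  also have "\<dots> = (\<integral>\<^sup>+t. k t * indicator {0<..} t + k t * indicator {..<0} t \<partial>lborel)"
    by (rule nn_integral_cong_AE, rule AE_mp[OF AE_lborel_singleton[of 0]]) (auto simp: indicator_def)
  also have "\<dots> = (\<integral>\<^sup>+t. k t * indicator {0<..} t \<partial>lborel) + (\<integral>\<^sup>+t. k t * indicator {..<0} t \<partial>lborel)"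
    by (rule nn_integral_add) auto
  \<comment> \<open>The reflection \<open>t \<mapsto> - t\<close> leaves \<open>k\<close> unchanged,
    so both half lines contribute equally; hence the factor 2 in
    \<open>mu_density_half_line_map\<close>.\<close>
  also have "(\<integral>\<^sup>+t. k t * indicator {..<0} t \<partial>lborel) = (\<integral>\<^sup>+t. k t * indicator {0<..} t \<partial>lborel)"
    using nn_integral_real_affine[of "\<lambda>t. k t * indicator {..<0} t" "-1" 0]
    by (simp add: k_def indicator_def)
  also have "(\<integral>\<^sup>+t. k t * indicator {0<..} t \<partial>lborel) = (\<integral>\<^sup>+t. k t \<partial>density lborel (indicator {0<..}))"
    by (subst nn_integral_density) (auto simp: mult.commute)
  also have "density lborel (indicator {0<..}) = distr (density lborel (\<lambda>x. ennreal (half_line_deriv x))) borel half_line_map"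
    using distr_density_diffeo[OF half_line_map(1-3)] half_line_map(4) by simp
  also have "(\<integral>\<^sup>+t. k t \<partial>\<dots>) = (\<integral>\<^sup>+\<xi>. ennreal (half_line_deriv \<xi>) * k (half_line_map \<xi>) \<partial>lborel)"
  proof -
    have "continuous_on UNIV half_line_map"
      using half_line_map(1) by (meson DERIV_isCont continuous_at_imp_continuous_on)
    then have [measurable]: "half_line_map \<in> borel_measurable borel" by (rule borel_measurable_continuous_onI)
    have [measurable]: "half_line_deriv \<in> borel_measurable borel"
      using half_line_map(3) by (rule borel_measurable_continuous_onI)
    show ?thesis by (subst nn_integral_distr, simp, simp, subst nn_integral_density) auto
  qed
  also have "\<dots> + \<dots> = (\<integral>\<^sup>+\<xi>. ennreal (log_weight \<xi>) * indicator A \<xi> \<partial>lborel)"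
  proof -
    have "continuous_on UNIV half_line_map"
      using half_line_map(1) by (meson DERIV_isCont continuous_at_imp_continuous_on)
    then have [measurable]: "half_line_map \<in> borel_measurable borel" by (rule borel_measurable_continuous_onI)
    have [measurable]: "half_line_deriv \<in> borel_measurable borel"
      using half_line_map(3) by (rule borel_measurable_continuous_onI)
    have "ennreal (half_line_deriv \<xi>) * k (half_line_map \<xi>) + ennreal (half_line_deriv \<xi>) * k (half_line_map \<xi>)
        = ennreal (log_weight \<xi>) * indicator A \<xi>" for \<xi>
    proof (cases "\<xi> \<in> A")
      case True
      have "ennreal (half_line_deriv \<xi>) * ennreal (mu_density (half_line_map \<xi>)) +
          ennreal (half_line_deriv \<xi>) * ennreal (mu_density (half_line_map \<xi>)) =
          ennreal (half_line_deriv \<xi> * mu_density (half_line_map \<xi>) + half_line_deriv \<xi> * mu_density (half_line_map \<xi>))"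
        using half_line_map(2)[of \<xi>] mu_density_nonneg
        by (subst ennreal_plus) (auto simp: ennreal_mult)
      also have "half_line_deriv \<xi> * mu_density (half_line_map \<xi>) + half_line_deriv \<xi> * mu_density (half_line_map \<xi>) = log_weight \<xi>"
        using mu_density_half_line_map[of \<xi>] by (simp add: mult_ac)
      finally show ?thesis using True by (simp add: k_def log_sinh_sq_half_line_map)
    qed (simp add: k_def log_sinh_sq_half_line_map)
    then show ?thesis
      by (subst nn_integral_add[symmetric]) auto
  qed
  also have "\<dots> = emeasure (density lborel (\<lambda>\<xi>. ennreal (log_weight \<xi>))) A"
    by (subst emeasure_density) auto
  finally show "emeasure (distr (co_mu b \<iota>) borel log_sinh_sq) A = emeasure (density lborel (\<lambda>\<xi>. ennreal (log_weight \<xi>))) A" .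
qed simp

lemma
  fixes h :: "real \<Rightarrow> 'a::{banach, second_countable_topology}"
  assumes h [measurable]: "h \<in> borel_measurable borel" and f [measurable]: "f \<in> borel_measurable borel"
    and fh: "\<And>t. t \<noteq> 0 \<Longrightarrow> f t = h (log_sinh_sq t)"
  shows integrable_co_mu_iff: "integrable (co_mu b \<iota>) f \<longleftrightarrow> integrable lborel (\<lambda>\<xi>. log_weight \<xi> *\<^sub>R h \<xi>)" (is ?A)
    and integral_co_mu_eq: "(\<integral>t. f t \<partial>co_mu b \<iota>) = (\<integral>\<xi>. log_weight \<xi> *\<^sub>R h \<xi> \<partial>lborel)" (is ?B)
proof -
  have ae: "AE t in co_mu b \<iota>. f t = h (log_sinh_sq t)"
    unfolding co_mu_eq using AE_lborel_singleton[of 0]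
    by (subst AE_density) (auto simp: fh elim!: eventually_mono)
  have "integrable (co_mu b \<iota>) f \<longleftrightarrow> integrable (co_mu b \<iota>) (\<lambda>t. h (log_sinh_sq t))"
    using ae by (intro integrable_cong_AE) auto
  also have "\<dots> \<longleftrightarrow> integrable (distr (co_mu b \<iota>) borel log_sinh_sq) h"
    by (subst integrable_distr_eq) auto
  also have "\<dots> \<longleftrightarrow> integrable lborel (\<lambda>\<xi>. log_weight \<xi> *\<^sub>R h \<xi>)"
    unfolding distr_co_mu by (subst integrable_density) (auto intro!: AE_I2 less_imp_le[OF log_weight_pos])
  finally show ?A .
  have "(\<integral>t. f t \<partial>co_mu b \<iota>) = (\<integral>t. h (log_sinh_sq t) \<partial>co_mu b \<iota>)"
    using ae by (intro integral_cong_AE) auto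
  also have "\<dots> = (\<integral>\<xi>. h \<xi> \<partial>distr (co_mu b \<iota>) borel log_sinh_sq)"
    by (subst integral_distr) auto
  also have "\<dots> = (\<integral>\<xi>. log_weight \<xi> *\<^sub>R h \<xi> \<partial>lborel)"
    unfolding distr_co_mu by (subst integral_density) (auto intro!: AE_I2 less_imp_le[OF log_weight_pos])
  finally show ?B .
qed

lemma integral_co_mu_odd:
  fixes f :: "real \<Rightarrow> complex"
  assumes "\<And>t. f (- t) = - f t"
  shows "(\<integral>t. f t \<partial>co_mu b \<iota>) = 0"
proof (cases "f \<in> borel_measurable borel")
  case True
  then have [measurable]: "f \<in> borel_measurable borel" .
  have "(\<integral>t. f t \<partial>co_mu b \<iota>) = (\<integral>t. mu_density t *\<^sub>R f t \<partial>lborel)"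
    unfolding co_mu_eq by (subst integral_density) (auto intro!: AE_I2 mu_density_nonneg)
  also have "\<dots> = (\<integral>t. mu_density (- t) *\<^sub>R f (- t) \<partial>lborel)"
    using lborel_integral_real_affine[of "-1" "\<lambda>t. mu_density t *\<^sub>R f t" 0] by simp
  also have "\<dots> = - (\<integral>t. mu_density t *\<^sub>R f t \<partial>lborel)" by (simp add: assms)
  also have "\<dots> = - (\<integral>t. f t \<partial>co_mu b \<iota>)"
    unfolding co_mu_eq by (subst integral_density) (auto intro!: AE_I2 mu_density_nonneg)
  finally show ?thesis by (simp add: complex_eq_iff)
next
  case False
  \<comment> \<open>A function that is not integrable has Bochner integral 0 by convention.\<close>
  then have "\<not> integrable (co_mu b \<iota>) f"
    using borel_measurable_integrable by (auto cong: measurable_cong_sets)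
  then show ?thesis by (rule not_integrable_integral_eq)
qed

section \<open>The kernel and its parity\<close>

definition kernel_even :: "complex \<Rightarrow> real \<Rightarrow> complex" where
  "kernel_even l t = hyp_2F1 ((l + of_real \<rho>) / 2) ((- l + of_real \<rho>) / 2) (of_real \<gamma>) (- of_real ((sinh t)\<^sup>2))"

text \<open>Differentiating the Gauss function raises its parameters by 1 and produces the factor
  \<open>(l + \<rho>)(\<rho> - l) / (4 \<gamma>)\<close>, whose first part cancels against the
  \<open>1 / (l + \<rho>)\<close> of the kernel.\<close>

definition kernel_odd :: "complex \<Rightarrow> real \<Rightarrow> complex" where
  "kernel_odd l t = (of_real \<rho> - l) / of_real (4 * \<gamma>) * of_real (sinh (2 * t)) *
     hyp_2F1 ((l + of_real \<rho>) / 2 + 1) ((- l + of_real \<rho>) / 2 + 1) (of_real \<gamma> + 1) (- of_real ((sinh t)\<^sup>2))"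

lemma kernel_even_minus [simp]: "kernel_even l (- t) = kernel_even l t"
  and kernel_odd_minus [simp]: "kernel_odd l (- t) = - kernel_odd l t"
  by (simp_all add: kernel_even_def kernel_odd_def)

lemma neg_sinh_sq_in_slit_plane: "- complex_of_real ((sinh t)\<^sup>2) \<in> slit_plane"
proof -
  have lt: "- (sinh t)\<^sup>2 < 1" by (smt (verit) zero_le_power2)
  show ?thesis
  proof (rule ComplI, elim imageE)
    fix x assume x: "- complex_of_real ((sinh t)\<^sup>2) = of_real x" "x \<in> {1..}"
    then have "complex_of_real (- (sinh t)\<^sup>2) = of_real x" by simp
    then have "- (sinh t)\<^sup>2 = x" by (simp only: of_real_eq_iff)
    then show False using lt x by auto
  qed
qed

lemma imag_param:
  assumes "l \<in> im_axis"
  shows "Re ((- l + \<rho>) / 2) > 0" "Re (complex_of_real \<gamma>) > Re ((- l + \<rho>) / 2)" "Re ((l + \<rho>) / 2) = \<rho> / 2"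
    "Re ((- l + \<rho>) / 2) = \<rho> / 2" "l + \<rho> \<noteq> 0"
proof -
  have l: "Re l = 0" using assms by (simp add: im_axis_def)
  show "Re ((- l + \<rho>) / 2) > 0" "Re (complex_of_real \<gamma>) > Re ((- l + \<rho>) / 2)" "Re ((l + \<rho>) / 2) = \<rho> / 2"
    "Re ((- l + \<rho>) / 2) = \<rho> / 2"
    using l \<rho>_pos \<gamma>_gt by auto
  show "l + \<rho> \<noteq> 0"
  proof
    assume "l + \<rho> = 0"
    from arg_cong[OF this, of Re] show False using l \<rho>_pos by simp
  qed
qed

lemma co_kernel_eq:
  assumes "l \<in> im_axis"
  shows "co_kernel b \<iota> l t = kernel_even l t + kernel_odd l t"
proof -
  note p = imag_param[OF assms]
  have g: "(1 + \<iota>) / 2 + b = \<gamma>" by (simp add: \<gamma>_def add.commute)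
  have "deriv (hyp_2F1 ((l + \<rho>) / 2) ((- l + \<rho>) / 2) \<gamma>) (- of_real ((sinh t)\<^sup>2)) =
      (l + \<rho>) / 2 * ((- l + \<rho>) / 2) / \<gamma> *
      hyp_2F1 ((l + \<rho>) / 2 + 1) ((- l + \<rho>) / 2 + 1) (of_real \<gamma> + 1) (- of_real ((sinh t)\<^sup>2))"
    by (rule deriv_hyp_2F1[OF p(1,2) neg_sinh_sq_in_slit_plane])
  then have "1 / (l + \<rho>) * of_real (sinh (2 * t)) * deriv (hyp_2F1 ((l + \<rho>) / 2) ((- l + \<rho>) / 2) \<gamma>) (- of_real ((sinh t)\<^sup>2)) = kernel_odd l t"
  proof -
    assume D: "deriv (hyp_2F1 ((l + \<rho>) / 2) ((- l + \<rho>) / 2) \<gamma>) (- of_real ((sinh t)\<^sup>2)) =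
      (l + \<rho>) / 2 * ((- l + \<rho>) / 2) / \<gamma> *
      hyp_2F1 ((l + \<rho>) / 2 + 1) ((- l + \<rho>) / 2 + 1) (of_real \<gamma> + 1) (- of_real ((sinh t)\<^sup>2))"
    have alg: "1 / q * S * (q / 2 * ((- l + R) / 2) / G * H) = (R - l) / (4 * G) * S * H"
      if "q \<noteq> 0" "G \<noteq> 0" for q S R G H :: complex using that by (simp add: field_simps)
    show "1 / (l + \<rho>) * of_real (sinh (2 * t)) * deriv (hyp_2F1 ((l + \<rho>) / 2) ((- l + \<rho>) / 2) \<gamma>) (- of_real ((sinh t)\<^sup>2)) = kernel_odd l t"
      unfolding D kernel_odd_def by (subst alg) (use p(5) \<gamma>_pos in simp_all)
  qed
  then show ?thesis
    unfolding co_kernel_def Let_def g co_rho_def \<rho>_def[symmetric] kernel_even_def by simp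
qed

lemma continuous_on_hyp_2F1_neg_sinh_sq:
  assumes "Re b' > 0" "Re c > Re b'"
  shows "continuous_on A (\<lambda>t. hyp_2F1 a b' c (- of_real ((sinh t)\<^sup>2)))"
  by (rule continuous_on_compose2[OF holomorphic_on_imp_continuous_on[OF hyp_2F1_spec(1)[OF assms]]])
    (use neg_sinh_sq_in_slit_plane in \<open>auto intro!: continuous_intros\<close>)

lemma continuous_on_hyp_2F1_neg_exp:
  assumes "Re b' > 0" "Re c > Re b'"
  shows "continuous_on A (\<lambda>\<xi>. hyp_2F1 a b' c (- of_real (exp \<xi>)))"
  by (rule continuous_on_compose2[OF holomorphic_on_imp_continuous_on[OF hyp_2F1_spec(1)[OF assms]]])
    (use neg_exp_in_slit_plane in \<open>auto intro!: continuous_intros\<close>)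

lemma kernel_measurable [measurable]:
  assumes "l \<in> im_axis"
  shows "kernel_even l \<in> borel_measurable borel" "kernel_odd l \<in> borel_measurable borel"
proof -
  note p = imag_param[OF assms]
  show "kernel_even l \<in> borel_measurable borel" unfolding kernel_even_def
    by (intro borel_measurable_continuous_onI continuous_on_hyp_2F1_neg_sinh_sq p)
  show "kernel_odd l \<in> borel_measurable borel" unfolding kernel_odd_def
    by (intro borel_measurable_continuous_onI continuous_intros continuous_on_hyp_2F1_neg_sinh_sq) (use p in auto)
qed

text \<open>For the even part boundedness of the Gauss function suffices, the case
  \<open>m = 0\<close> of \<open>hyp_2F1_neg_bound\<close>. In the odd part
  \<open>sinh (2 t)\<close> grows like \<open>cosh^2 t\<close>, and the case \<open>m = 1\<close>
  supplies the compensating decay \<open>1 / (1 + sinh^2 t)\<close>.\<close>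

lemma kernel_bounded:
  assumes "l \<in> im_axis"
  shows "\<exists>C. \<forall>t. norm (kernel_even l t) \<le> C" "\<exists>C. \<forall>t. norm (kernel_odd l t) \<le> C"
proof -
  note p = imag_param[OF assms]
  obtain C where C: "\<And>\<xi>. norm (hyp_2F1 ((l + \<rho>) / 2) ((- l + \<rho>) / 2) \<gamma> (- of_real (exp \<xi>))) \<le> C"
    using hyp_2F1_neg_bound[of 0 "(- l + \<rho>) / 2" \<gamma> "(l + \<rho>) / 2"] p \<rho>_pos by auto
  have "norm (kernel_even l t) \<le> max C (norm (kernel_even l 0))" for t
  proof (cases "t = 0")
    case False
    then show ?thesis using C[of "log_sinh_sq t"] by (simp add: kernel_even_def exp_log_sinh_sq)
  qed simp
  then show "\<exists>C. \<forall>t. norm (kernel_even l t) \<le> C" by blast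
  obtain D where D: "\<And>\<xi>. norm (hyp_2F1 ((l + \<rho>) / 2 + 1) ((- l + \<rho>) / 2 + 1) (of_real \<gamma> + 1) (- of_real (exp \<xi>))) \<le> D / (1 + exp \<xi>)"
    using hyp_2F1_neg_bound[of 1 "(- l + \<rho>) / 2 + 1" "\<gamma> + 1" "(l + \<rho>) / 2 + 1"] p \<rho>_pos by auto
  have D0: "D \<ge> 0"
  proof -
    have "0 \<le> D / (1 + exp 0)" using order_trans[OF norm_ge_zero D[of 0]] .
    then show ?thesis by simp
  qed
  have "norm (kernel_odd l t) \<le> norm ((\<rho> - l) / (4 * \<gamma>)) * (2 * D)" for t
  proof (cases "t = 0")
    case True
    then show ?thesis using D0 by (simp add: kernel_odd_def)
  next
    case False
    let ?F = "hyp_2F1 ((l + \<rho>) / 2 + 1) ((- l + \<rho>) / 2 + 1) (of_real \<gamma> + 1) (- of_real ((sinh t)\<^sup>2))"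
    have F: "norm ?F \<le> D / (cosh t)\<^sup>2"
      using D[of "log_sinh_sq t"] False by (simp add: exp_log_sinh_sq cosh_square_eq add.commute)
    have "\<bar>sinh t\<bar> \<le> cosh t"
      by (rule power2_le_imp_le) (simp_all add: cosh_square_eq)
    then have "\<bar>sinh (2 * t)\<bar> \<le> 2 * cosh t * cosh t"
      unfolding sinh_double by (simp add: abs_mult mult_right_mono)
    then have "norm (of_real (sinh (2 * t)) * ?F) \<le> 2 * cosh t * cosh t * (D / (cosh t)\<^sup>2)"
      unfolding norm_mult using F by (intro mult_mono) auto
    also have "\<dots> = 2 * D" by (simp add: power2_eq_square)
    finally show ?thesis
      unfolding kernel_odd_def mult.assoc norm_mult[of "(\<rho> - l) / (4 * \<gamma>)"] by (rule mult_left_mono) simp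
  qed
  then show "\<exists>C. \<forall>t. norm (kernel_odd l t) \<le> C" by blast
qed

lemma integrable_mult_kernel:
  fixes f :: "real \<Rightarrow> complex"
  assumes l: "l \<in> im_axis" and f: "integrable (co_mu b \<iota>) f"
  shows "integrable (co_mu b \<iota>) (\<lambda>t. f t * kernel_even l t)" "integrable (co_mu b \<iota>) (\<lambda>t. f t * kernel_odd l t)"
proof -
  have *: "integrable (co_mu b \<iota>) (\<lambda>t. f t * k t)"
    if k [measurable]: "k \<in> borel_measurable borel" and C: "\<forall>t. norm (k t) \<le> C" for k :: "real \<Rightarrow> complex" and C
  proof (rule Bochner_Integration.integrable_bound)
    show "integrable (co_mu b \<iota>) (\<lambda>t. C * norm (f t))" using f by simp
    have [measurable]: "f \<in> borel_measurable (co_mu b \<iota>)" using f by auto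
    show "(\<lambda>t. f t * k t) \<in> borel_measurable (co_mu b \<iota>)" by measurable
    have "norm (f t * k t) \<le> norm (C * norm (f t))" for t
    proof -
      have "norm (f t * k t) \<le> norm (f t) * C" unfolding norm_mult using C by (intro mult_left_mono) auto
      then show ?thesis by (simp add: mult.commute abs_mult) (smt (verit) mult_right_mono norm_ge_zero)
    qed
    then show "AE t in co_mu b \<iota>. norm (f t * k t) \<le> norm (C * norm (f t))" by simp
  qed
  show "integrable (co_mu b \<iota>) (\<lambda>t. f t * kernel_even l t)"
    using *[OF kernel_measurable(1)[OF l]] kernel_bounded(1)[OF l] by blast
  show "integrable (co_mu b \<iota>) (\<lambda>t. f t * kernel_odd l t)"
    using *[OF kernel_measurable(2)[OF l]] kernel_bounded(2)[OF l] by blast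
qed

lemma integrable_mult_co_kernel:
  fixes f :: "real \<Rightarrow> complex"
  assumes l: "l \<in> im_axis" and f: "integrable (co_mu b \<iota>) f" and r: "r \<in> {1, -1::int}"
  shows "integrable (co_mu b \<iota>) (\<lambda>t. f t * co_kernel b \<iota> l (of_int r * t))"
proof -
  have "integrable (co_mu b \<iota>) (\<lambda>t. f t * kernel_even l t + of_int r * (f t * kernel_odd l t))"
    by (intro Bochner_Integration.integrable_add integrable_mult_right integrable_mult_kernel l f)
  moreover have "f t * co_kernel b \<iota> l (of_int r * t) = f t * kernel_even l t + of_int r * (f t * kernel_odd l t)" for t
    using r by (auto simp: co_kernel_eq[OF l] ring_distribs)
  ultimately show ?thesis by simp
qed

lemma co_transform_even:
  fixes f :: "real \<Rightarrow> complex"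
  assumes l: "l \<in> im_axis" and f: "integrable (co_mu b \<iota>) f" and r: "r \<in> {1, -1::int}"
    and even: "\<And>t. f (- t) = f t"
  shows "co_transform b \<iota> r f l = (\<integral>t. f t * kernel_even l t \<partial>co_mu b \<iota>)"
proof -
  have "f t * co_kernel b \<iota> l (of_int r * t) = f t * kernel_even l t + of_int r * (f t * kernel_odd l t)" for t
    using r by (auto simp: co_kernel_eq[OF l] ring_distribs)
  then have "co_transform b \<iota> r f l = (\<integral>t. f t * kernel_even l t \<partial>co_mu b \<iota>) + of_int r * (\<integral>t. f t * kernel_odd l t \<partial>co_mu b \<iota>)"
    unfolding co_transform_def using integrable_mult_kernel[OF l f] by simp
  moreover have "(\<integral>t. f t * kernel_odd l t \<partial>co_mu b \<iota>) = 0"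
    by (rule integral_co_mu_odd) (simp add: even)
  ultimately show ?thesis by simp
qed

lemma co_transform_odd:
  fixes f :: "real \<Rightarrow> complex"
  assumes l: "l \<in> im_axis" and f: "integrable (co_mu b \<iota>) f" and r: "r \<in> {1, -1::int}"
    and odd: "\<And>t. f (- t) = - f t"
  shows "co_transform b \<iota> r f l = of_int r * (\<integral>t. f t * kernel_odd l t \<partial>co_mu b \<iota>)"
proof -
  have "f t * co_kernel b \<iota> l (of_int r * t) = f t * kernel_even l t + of_int r * (f t * kernel_odd l t)" for t
    using r by (auto simp: co_kernel_eq[OF l] ring_distribs)
  then have "co_transform b \<iota> r f l = (\<integral>t. f t * kernel_even l t \<partial>co_mu b \<iota>) + of_int r * (\<integral>t. f t * kernel_odd l t \<partial>co_mu b \<iota>)"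
    unfolding co_transform_def using integrable_mult_kernel[OF l f] by simp
  moreover have "(\<integral>t. f t * kernel_even l t \<partial>co_mu b \<iota>) = 0"
    by (rule integral_co_mu_odd) (simp add: odd)
  ultimately show ?thesis by simp
qed

definition gamma_factor :: "real \<Rightarrow> complex \<Rightarrow> complex" where
  "gamma_factor p l = of_real (2 powr (2 * \<rho>)) * Gamma (of_real \<gamma>) *
     Gamma ((of_real (p - \<rho>) + l) / 2) * Gamma ((of_real (p - \<rho>) - l) / 2) /
     (Gamma (of_real (p / 2)) * Gamma (of_real ((p + 1 - \<iota>) / 2)))"

lemma cosh_measurable [measurable]: "(cosh :: real \<Rightarrow> real) \<in> borel_measurable borel"
  and tanh_measurable [measurable]: "(tanh :: real \<Rightarrow> real) \<in> borel_measurable borel"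
  by (auto intro!: borel_measurable_continuous_onI continuous_intros)

lemma integrable_cosh_powr:
  assumes "p > 2 * \<rho>"
  shows "integrable (co_mu b \<iota>) (\<lambda>t. cosh t powr (- p))"
proof -
  \<comment> \<open>\<open>p > 2 * \<rho>\<close> is equivalent to \<open>d > \<gamma>\<close>, the
    convergence of the beta integral at infinity.\<close>
  define d where "d = (p + 1 - \<iota>) / 2"
  have "d > \<gamma>" using assms by (simp add: d_def \<gamma>_def \<rho>_def field_simps)
  then have "integrable lborel (\<lambda>\<xi>. Re (2 powr (2 * \<rho>) * beta_density \<gamma> d \<xi>))"
    using \<gamma>_pos by (intro integrable_Re integrable_mult_right integrable_beta_density) auto
  moreover have "Re (2 powr (2 * \<rho>) * beta_density \<gamma> d \<xi>) = log_weight \<xi> *\<^sub>R exp (- p / 2 * softplus \<xi>)" for \<xi>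
  proof -
    have "beta_density \<gamma> d \<xi> = of_real (exp (\<gamma> * \<xi> - d * softplus \<xi>))"
      by (simp add: beta_density_def exp_of_real flip: of_real_mult of_real_diff)
    moreover have "exp (\<gamma> * \<xi> - d * softplus \<xi>) = exp (\<gamma> * \<xi> - (1 - \<iota>) / 2 * softplus \<xi>) * exp (- p / 2 * softplus \<xi>)"
      unfolding exp_add[symmetric] by (rule arg_cong[of _ _ exp]) (simp add: d_def field_simps)
    ultimately show ?thesis
      by (simp add: log_weight_def flip: of_real_mult)
  qed
  ultimately have "integrable lborel (\<lambda>\<xi>. log_weight \<xi> *\<^sub>R exp (- p / 2 * softplus \<xi>))" by (simp only:)
  then show ?thesis
    by (subst integrable_co_mu_iff[where h = "\<lambda>\<xi>. exp (- p / 2 * softplus \<xi>)"])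
      (auto simp: cosh_powr_log_sinh_sq)
qed

text \<open>\<open>m = 0\<close> serves the even part of the kernel; \<open>m = 1\<close> comes from
  \<open>tanh t * sinh (2 t) = 2 e^\<xi>\<close> in the odd part.\<close>

lemma log_weight_beta_density:
  "log_weight \<xi> *\<^sub>R (of_real (exp (- p / 2 * softplus \<xi>)) * of_real (exp (real m * \<xi>)) * z) =
     2 powr (2 * \<rho>) * (beta_density (of_real \<gamma> + of_nat m) ((p + 1 - \<iota>) / 2) \<xi> * z)"
proof -
  have "exp (\<gamma> * \<xi> - (1 - \<iota>) / 2 * softplus \<xi>) * exp (- p / 2 * softplus \<xi>) * exp (real m * \<xi>) =
      exp ((\<gamma> + real m) * \<xi> - ((p + 1 - \<iota>) / 2) * softplus \<xi>)"
    unfolding exp_add[symmetric] by (rule arg_cong[of _ _ exp]) (simp add: field_simps)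
  moreover have "beta_density (of_real \<gamma> + of_nat m) ((p + 1 - \<iota>) / 2) \<xi> =
      of_real (exp ((\<gamma> + real m) * \<xi> - ((p + 1 - \<iota>) / 2) * softplus \<xi>))"
    by (simp add: beta_density_def flip: exp_of_real)
  ultimately show ?thesis
    by (simp add: log_weight_def scaleR_conv_of_real mult_ac flip: of_real_mult)
qed

lemma transform_cosh_powr:
  assumes l: "l \<in> im_axis" and p: "p > 2 * \<rho>" and r: "r \<in> {1, -1::int}"
  shows "co_transform b \<iota> r (\<lambda>t. of_real (cosh t powr (- p))) l = gamma_factor p l"
proof -
  note ip = imag_param[OF l]
  have lr: "Re l = 0" using l by (simp add: im_axis_def)
  define d where "d = (p + 1 - \<iota>) / 2"
  let ?a = "(l + \<rho>) / 2" and ?b = "(- l + \<rho>) / 2"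
  have e: "?a - \<gamma> + d = (of_real (p - \<rho>) + l) / 2" "?b - \<gamma> + d = (of_real (p - \<rho>) - l) / 2" "?a + ?b - \<gamma> + d = of_real (p / 2)"
    by (simp_all add: d_def \<rho>_def \<gamma>_def field_simps)
  have "co_transform b \<iota> r (\<lambda>t. of_real (cosh t powr (- p))) l = (\<integral>t. of_real (cosh t powr (- p)) * kernel_even l t \<partial>co_mu b \<iota>)"
    using integrable_cosh_powr[OF p] by (intro co_transform_even l r) auto
  also have "\<dots> = (\<integral>\<xi>. log_weight \<xi> *\<^sub>R (of_real (exp (- p / 2 * softplus \<xi>)) * of_real (exp (real 0 * \<xi>)) * hyp_2F1 ?a ?b \<gamma> (- of_real (exp \<xi>))) \<partial>lborel)"
  proof (rule integral_co_mu_eq)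
    have [measurable]: "(\<lambda>\<xi>. hyp_2F1 ?a ?b \<gamma> (- of_real (exp \<xi>))) \<in> borel_measurable borel"
      by (intro borel_measurable_continuous_onI continuous_on_hyp_2F1_neg_exp ip)
    show "(\<lambda>\<xi>. of_real (exp (- p / 2 * softplus \<xi>)) * of_real (exp (real 0 * \<xi>)) * hyp_2F1 ?a ?b \<gamma> (- of_real (exp \<xi>))) \<in> borel_measurable borel"
      by measurable
    show "(\<lambda>t. of_real (cosh t powr (- p)) * kernel_even l t) \<in> borel_measurable borel"
      using kernel_measurable(1)[OF l] by measurable
  qed (simp add: cosh_powr_log_sinh_sq kernel_even_def exp_log_sinh_sq)
  also have "\<dots> = 2 powr (2 * \<rho>) * (\<integral>\<xi>. beta_density \<gamma> d \<xi> * hyp_2F1 ?a ?b \<gamma> (- of_real (exp \<xi>)) \<partial>lborel)"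
    unfolding log_weight_beta_density by (simp add: d_def)
  also have "(\<integral>\<xi>. beta_density \<gamma> d \<xi> * hyp_2F1 ?a ?b \<gamma> (- of_real (exp \<xi>)) \<partial>lborel) =
      Gamma (of_real \<gamma>) * Gamma (?a - \<gamma> + d) * Gamma (?b - \<gamma> + d) / (Gamma (of_real d) * Gamma (?a + ?b - \<gamma> + d))"
  proof (rule integral_hyp_2F1_mellin)
    show "Re (?a - \<gamma> + d) > 0" "Re (?b - \<gamma> + d) > 0" unfolding e using p lr \<rho>_pos by auto
  qed (use ip in auto)
  finally show ?thesis unfolding e gamma_factor_def by (simp add: d_def mult_ac flip: Gamma_complex_of_real)
qed

text \<open>The extra \<open>sinh^2 t\<close> raises the exponent of \<open>e^\<xi>\<close> to
  \<open>\<gamma> + 1\<close>, which is the lower parameter of the differentiated Gauss function, so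
  the Mellin formula applies again. \<open>Gamma(\<gamma> + 1)\<close> and
  \<open>Gamma(p / 2 + 1)\<close> then reduce the value to that of the even case.\<close>

lemma transform_cosh_powr_tanh:
  assumes l: "l \<in> im_axis" and p: "p > 2 * \<rho>" and r: "r \<in> {1, -1::int}"
  shows "co_transform b \<iota> r (\<lambda>t. of_real (cosh t powr (- p) * tanh t)) l =
     of_int r * (of_real \<rho> - l) / of_real p * gamma_factor p l"
proof -
  note ip = imag_param[OF l]
  have ip1: "Re ((- l + \<rho>) / 2 + 1) > 0" "Re (complex_of_real \<gamma> + 1) > Re ((- l + \<rho>) / 2 + 1)"
    using ip by auto
  have lr: "Re l = 0" using l by (simp add: im_axis_def)
  have p0: "p > 0" using p \<rho>_pos by linarith
  define d where "d = (p + 1 - \<iota>) / 2"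
  let ?a = "(l + \<rho>) / 2" and ?b = "(- l + \<rho>) / 2"
  let ?F = "\<lambda>\<xi>. hyp_2F1 (?a + 1) (?b + 1) (of_real \<gamma> + 1) (- of_real (exp \<xi>))"
  have e: "?a + 1 - (of_real \<gamma> + 1) + d = (of_real (p - \<rho>) + l) / 2" "?b + 1 - (of_real \<gamma> + 1) + d = (of_real (p - \<rho>) - l) / 2"
     "?a + 1 + (?b + 1) - (of_real \<gamma> + 1) + d = of_real (p / 2) + 1"
    by (simp_all add: d_def \<rho>_def \<gamma>_def field_simps)
  have "integrable (co_mu b \<iota>) (\<lambda>t. cosh t powr (- p) * tanh t)"
  proof (rule Bochner_Integration.integrable_bound[OF integrable_cosh_powr[OF p]])
    have "\<bar>tanh t\<bar> \<le> 1" for t :: real using tanh_real_lt_1[of t] tanh_real_gt_neg1[of t] by simp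
    then show "AE t in co_mu b \<iota>. norm (cosh t powr (- p) * tanh t) \<le> norm (cosh t powr (- p))"
      by (simp add: abs_mult mult_left_le)
  qed measurable
  then have "co_transform b \<iota> r (\<lambda>t. of_real (cosh t powr (- p) * tanh t)) l =
      of_int r * (\<integral>t. of_real (cosh t powr (- p) * tanh t) * kernel_odd l t \<partial>co_mu b \<iota>)"
    by (intro co_transform_odd l r) (auto simp del: of_real_mult)
  also have "(\<integral>t. of_real (cosh t powr (- p) * tanh t) * kernel_odd l t \<partial>co_mu b \<iota>) =
     (\<integral>\<xi>. log_weight \<xi> *\<^sub>R (of_real (exp (- p / 2 * softplus \<xi>)) * of_real (exp (real 1 * \<xi>)) * ((\<rho> - l) / (2 * \<gamma>) * ?F \<xi>)) \<partial>lborel)"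
  proof (rule integral_co_mu_eq)
    have [measurable]: "?F \<in> borel_measurable borel"
      by (intro borel_measurable_continuous_onI continuous_on_hyp_2F1_neg_exp ip1)
    show "(\<lambda>\<xi>. of_real (exp (- p / 2 * softplus \<xi>)) * of_real (exp (real 1 * \<xi>)) * ((\<rho> - l) / (2 * \<gamma>) * ?F \<xi>)) \<in> borel_measurable borel"
      by measurable
    show "(\<lambda>t. of_real (cosh t powr (- p) * tanh t) * kernel_odd l t) \<in> borel_measurable borel"
      using kernel_measurable(2)[OF l] by measurable
    fix t :: real assume t: "t \<noteq> 0"
    have ts: "tanh t * sinh (2 * t) = 2 * (sinh t)\<^sup>2"
      by (simp add: tanh_def sinh_double power2_eq_square)
    have "of_real (cosh t powr (- p) * tanh t) * kernel_odd l t =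
        of_real (cosh t powr (- p)) * of_real (tanh t * sinh (2 * t)) * ((\<rho> - l) / (4 * \<gamma>) * ?F (log_sinh_sq t))"
      using t by (simp add: kernel_odd_def exp_log_sinh_sq)
    then show "of_real (cosh t powr (- p) * tanh t) * kernel_odd l t =
       of_real (exp (- p / 2 * softplus (log_sinh_sq t))) * of_real (exp (real 1 * log_sinh_sq t)) *
         ((\<rho> - l) / (2 * \<gamma>) * ?F (log_sinh_sq t))"
      unfolding ts using t by (simp add: cosh_powr_log_sinh_sq exp_log_sinh_sq)
  qed
  also have "\<dots> = 2 powr (2 * \<rho>) * ((\<rho> - l) / (2 * \<gamma>)) * (\<integral>\<xi>. beta_density (of_real \<gamma> + 1) d \<xi> * ?F \<xi> \<partial>lborel)"
    unfolding log_weight_beta_density by (simp add: d_def mult.left_commute mult.assoc)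
  also have "(\<integral>\<xi>. beta_density (of_real \<gamma> + 1) d \<xi> * ?F \<xi> \<partial>lborel) =
      Gamma (of_real \<gamma> + 1) * Gamma (?a + 1 - (of_real \<gamma> + 1) + d) * Gamma (?b + 1 - (of_real \<gamma> + 1) + d) / (Gamma (of_real d) * Gamma (?a + 1 + (?b + 1) - (of_real \<gamma> + 1) + d))"
  proof (rule integral_hyp_2F1_mellin[OF ip1])
    show "Re (?a + 1 - (of_real \<gamma> + 1) + d) > 0" "Re (?b + 1 - (of_real \<gamma> + 1) + d) > 0" unfolding e using p lr \<rho>_pos by auto
  qed
  also have "Gamma (complex_of_real \<gamma> + 1) = \<gamma> * Gamma (complex_of_real \<gamma>)"
    using \<gamma>_pos by (intro Gamma_plus1 of_real_pos_not_nonpos_Ints)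
  also have "Gamma (?a + 1 + (?b + 1) - (of_real \<gamma> + 1) + d) = p / 2 * Gamma (complex_of_real (p / 2))"
  proof -
    have "complex_of_real (p / 2) \<notin> \<int>\<^sub>\<le>\<^sub>0" using p0 by (intro of_real_pos_not_nonpos_Ints) simp
    from Gamma_plus1[OF this] show ?thesis unfolding e by simp
  qed
  finally show ?thesis
    unfolding e gamma_factor_def using \<gamma>_pos p0
    by (simp add: d_def flip: Gamma_complex_of_real) (simp add: mult_ac)
qed

end

section \<open>Jacobi polynomials\<close>

text \<open>The real form of \<open>beta_density\<close>; with \<open>s = logistic \<xi>\<close> it
  is \<open>s^A (1 - s)^(d - A)\<close>.\<close>

definition beta_weight :: "real \<Rightarrow> real \<Rightarrow> real \<Rightarrow> real" where
  "beta_weight A d \<xi> = exp (A * \<xi> - d * softplus \<xi>)"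

lemma beta_weight_pos: "beta_weight A d \<xi> > 0"
  by (simp add: beta_weight_def)

lemma beta_weight_measurable [measurable]: "beta_weight A d \<in> borel_measurable borel"
  unfolding beta_weight_def by measurable

lemma beta_weight_complex: "of_real (beta_weight A d \<xi>) = beta_density (of_real A) (of_real d) \<xi>"
  by (simp add: beta_weight_def beta_density_def flip: exp_of_real)

lemma beta_weight_mult: "beta_weight A d \<xi> * beta_weight A' d' \<xi> = beta_weight (A + A') (d + d') \<xi>"
  by (simp add: beta_weight_def algebra_simps flip: exp_add)

lemma beta_weight_logistic: "logistic \<xi> ^ m = beta_weight (real m) (real m) \<xi>"
  by (simp add: beta_weight_def logistic_def algebra_simps flip: exp_of_nat_mult)

lemma beta_weight_one_minus_logistic: "(1 - logistic \<xi>) ^ m = beta_weight 0 (real m) \<xi>"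
proof -
  have "1 - logistic \<xi> = exp (- softplus \<xi>)"
    by (simp add: logistic_eq exp_minus add_pos_pos less_imp_neq[symmetric] inverse_eq_divide field_simps)
  then show ?thesis by (simp add: beta_weight_def flip: exp_of_nat_mult)
qed

lemma
  assumes "A > 0" "d > A"
  shows integrable_beta_weight: "integrable lborel (beta_weight A d)"
    and integral_beta_weight: "(LINT \<xi>|lborel. beta_weight A d \<xi>) = Gamma A * Gamma (d - A) / Gamma d"
proof -
  have i: "integrable lborel (beta_density (of_real A) (of_real d))"
    using assms by (intro integrable_beta_density) auto
  have e: "beta_weight A d = (\<lambda>\<xi>. Re (beta_density (of_real A) (of_real d) \<xi>))"
    by (rule ext) (simp flip: beta_weight_complex)
  show "integrable lborel (beta_weight A d)" unfolding e by (rule integrable_Re[OF i])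
  have "of_real (LINT \<xi>|lborel. beta_weight A d \<xi>) = (LINT \<xi>|lborel. beta_density (of_real A) (of_real d) \<xi>)"
    by (subst integral_complex_of_real[symmetric]) (simp add: beta_weight_complex)
  also have "\<dots> = of_real (Gamma A * Gamma (d - A) / Gamma d)"
    using assms by (subst integral_beta_density) (auto simp flip: Gamma_complex_of_real of_real_diff)
  finally show "(LINT \<xi>|lborel. beta_weight A d \<xi>) = Gamma A * Gamma (d - A) / Gamma d"
    by (simp only: of_real_eq_iff)
qed

lemma poly_logistic_bounded: "\<exists>C. \<forall>\<xi>. \<bar>poly p (c0 + c1 * logistic \<xi>)\<bar> \<le> C" for p :: "real poly"
proof -
  have "bounded ((\<lambda>x. poly p (c0 + c1 * x)) ` {0..1})"
    by (intro compact_imp_bounded compact_continuous_image continuous_intros) auto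
  then obtain C where "\<forall>x\<in>{0..1}. \<bar>poly p (c0 + c1 * x)\<bar> \<le> C" by (auto simp: bounded_iff)
  then show ?thesis using logistic_bounds by (metis atLeastAtMost_iff less_imp_le)
qed

lemma poly_measurable [measurable]:
  "f \<in> borel_measurable M \<Longrightarrow> (\<lambda>x. poly p (f x)) \<in> borel_measurable M" for p :: "real poly"
proof -
  assume f: "f \<in> borel_measurable M"
  have "poly p \<in> borel_measurable borel"
    by (intro borel_measurable_continuous_onI continuous_on_poly continuous_on_id)
  from measurable_compose[OF f this] show ?thesis .
qed

lemma integrable_poly_beta_weight:
  assumes "A > 0" "d > A"
  shows "integrable lborel (\<lambda>\<xi>. poly p (c0 + c1 * logistic \<xi>) * beta_weight A d \<xi>)"
proof -
  obtain C where C: "\<And>\<xi>. \<bar>poly p (c0 + c1 * logistic \<xi>)\<bar> \<le> C" using poly_logistic_bounded by blast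
  show ?thesis
  proof (rule Bochner_Integration.integrable_bound)
    show "integrable lborel (\<lambda>\<xi>. C * beta_weight A d \<xi>)"
      using integrable_beta_weight[OF assms] by simp
    have "\<bar>poly p (c0 + c1 * logistic \<xi>) * beta_weight A d \<xi>\<bar> \<le> \<bar>C * beta_weight A d \<xi>\<bar>" for \<xi>
      using C[of \<xi>] beta_weight_pos[of A d \<xi>] by (simp add: abs_mult)
    then show "AE \<xi> in lborel. norm (poly p (c0 + c1 * logistic \<xi>) * beta_weight A d \<xi>) \<le> norm (C * beta_weight A d \<xi>)"
      by simp
  qed measurable
qed

lemma poly_logistic_AE_zero:
  fixes p :: "real poly"
  assumes "AE \<xi> in lborel. poly p (c0 + c1 * logistic \<xi>) = 0" "c1 \<noteq> 0"
  shows "p = 0"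
proof (rule ccontr)
  assume "p \<noteq> 0"
  then have fin: "finite {x. poly p x = 0}" by (rule poly_roots_finite)
  have inj: "inj (\<lambda>\<xi>. c0 + c1 * logistic \<xi>)"
  proof (rule injI)
    fix x y assume "c0 + c1 * logistic x = c0 + c1 * logistic y"
    then have "logistic x = logistic y" using assms(2) by simp
    then have "1 - 1 / (1 + exp x) = 1 - 1 / (1 + exp y)"
      by (simp add: logistic_eq field_simps add_pos_pos less_imp_neq[symmetric])
    then show "x = y" by (simp add: add_pos_pos less_imp_neq[symmetric])
  qed
  define N where "N = (\<lambda>\<xi>. c0 + c1 * logistic \<xi>) -` {x. poly p x = 0}"
  have "finite N" unfolding N_def by (rule finite_vimageI[OF fin inj])
  then have "N \<in> null_sets lborel" by (intro finite_imp_null_set_lborel)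
  then have "AE \<xi> in lborel. \<xi> \<notin> N" by (rule AE_not_in)
  with assms(1) have "AE \<xi> in (lborel :: real measure). False" by eventually_elim (auto simp: N_def)
  then show False by (simp add: eventually_False ae_filter_eq_bot_iff)
qed

text \<open>Definiteness of the inner product, used for the uniqueness of the Jacobi polynomials and
  for the nonvanishing of the norms of the basis.\<close>

lemma poly_square_integral_zero:
  fixes p :: "real poly"
  assumes "A > 0" "d > A" "(LINT \<xi>|lborel. (poly p (c0 + c1 * logistic \<xi>))\<^sup>2 * beta_weight A d \<xi>) = 0" "c1 \<noteq> 0"
  shows "p = 0"
proof (rule poly_logistic_AE_zero[OF _ assms(4)])
  have int: "integrable lborel (\<lambda>\<xi>. (poly p (c0 + c1 * logistic \<xi>))\<^sup>2 * beta_weight A d \<xi>)"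
    using integrable_poly_beta_weight[OF assms(1,2), of "p\<^sup>2" c0 c1] by simp
  have "AE \<xi> in lborel. (poly p (c0 + c1 * logistic \<xi>))\<^sup>2 * beta_weight A d \<xi> = 0"
    using integral_nonneg_eq_0_iff_AE[OF int] assms(3) by (simp add: less_imp_le[OF beta_weight_pos])
  then show "AE \<xi> in lborel. poly p (c0 + c1 * logistic \<xi>) = 0"
    by eventually_elim (use beta_weight_pos in \<open>auto simp: less_imp_neq[symmetric]\<close>)
qed

lemma logistic_deriv:
  "(logistic has_real_derivative logistic \<xi> * (1 - logistic \<xi>)) (at \<xi>)"
proof -
  have nz: "1 + exp \<xi> \<noteq> 0" by (intro less_imp_neq[symmetric] add_pos_pos) auto
  have "((\<lambda>\<xi>. exp \<xi> / (1 + exp \<xi>)) has_real_derivative logistic \<xi> * (1 - logistic \<xi>)) (at \<xi>)"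
    using nz by (auto intro!: derivative_eq_intros simp: logistic_eq field_simps power2_eq_square)
  then show ?thesis by (simp add: logistic_eq[abs_def])
qed

lemma range_logistic: "range (\<lambda>\<xi>. 2 * logistic \<xi> - 1) = {-1<..<1}"
proof (intro equalityI subsetI)
  fix y :: real assume y: "y \<in> {-1<..<1}"
  have "2 * logistic (ln ((1 + y) / (1 - y))) - 1 = y"
    using y by (simp add: logistic_eq field_simps)
  then show "y \<in> range (\<lambda>\<xi>. 2 * logistic \<xi> - 1)" by (metis rangeI)
qed (use logistic_bounds in auto)

text \<open>With \<open>x = 2 s - 1\<close> and \<open>s = logistic \<xi>\<close> one has
  \<open>dx = 2 s (1 - s) d\<xi>\<close>, which raises both exponents by one: the weight becomes a
  multiple of \<open>s^(\<beta> + 1) (1 - s)^(\<alpha> + 1)\<close>.\<close>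

lemma jacobi_weight_integral:
  fixes f :: "real \<Rightarrow> real"
  assumes [measurable]: "f \<in> borel_measurable borel"
  shows "(LINT x:{-1<..<1}|lborel. f x * ((1 - x) powr \<alpha> * (1 + x) powr \<beta>)) =
    2 powr (\<alpha> + \<beta> + 1) * (LINT \<xi>|lborel. f (2 * logistic \<xi> - 1) * beta_weight (\<beta> + 1) (\<alpha> + \<beta> + 2) \<xi>)"
proof -
  have "(LINT x:{-1<..<1}|lborel. f x * ((1 - x) powr \<alpha> * (1 + x) powr \<beta>)) =
     (LINT \<xi>|lborel. (2 * (logistic \<xi> * (1 - logistic \<xi>))) *\<^sub>R (f (2 * logistic \<xi> - 1) *
        ((1 - (2 * logistic \<xi> - 1)) powr \<alpha> * (1 + (2 * logistic \<xi> - 1)) powr \<beta>)))"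
  proof (rule integral_substitution_diffeo[OF _ _ _ range_logistic])
    show "((\<lambda>\<xi>. 2 * logistic \<xi> - 1) has_real_derivative 2 * (logistic \<xi> * (1 - logistic \<xi>))) (at \<xi>)" for \<xi>
      by (auto intro!: derivative_eq_intros logistic_deriv)
    show "2 * (logistic \<xi> * (1 - logistic \<xi>)) > 0" for \<xi> using logistic_bounds[of \<xi>] by simp
    show "continuous_on UNIV (\<lambda>\<xi>. 2 * (logistic \<xi> * (1 - logistic \<xi>)))"
      by (intro continuous_intros)
  qed auto
  also have "\<dots> = (LINT \<xi>|lborel. 2 powr (\<alpha> + \<beta> + 1) * (f (2 * logistic \<xi> - 1) * beta_weight (\<beta> + 1) (\<alpha> + \<beta> + 2) \<xi>))"
  proof (rule Bochner_Integration.integral_cong[OF refl])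
    fix \<xi> :: real
    define s where "s = softplus \<xi>"
    have l: "logistic \<xi> = exp (\<xi> - s)" "1 - logistic \<xi> = exp (- s)"
      using beta_weight_one_minus_logistic[of \<xi> 1] by (simp_all add: logistic_def s_def beta_weight_def)
    define F where "F = f (2 * logistic \<xi> - 1)"
    have P1: "(1 - (2 * logistic \<xi> - 1)) powr \<alpha> = 2 powr \<alpha> * exp (- \<alpha> * s)"
    proof -
      have "1 - (2 * logistic \<xi> - 1) = 2 * exp (- s)" using l(2) by simp
      then show ?thesis by (simp add: powr_mult exp_powr_real mult.commute)
    qed
    have P2: "(1 + (2 * logistic \<xi> - 1)) powr \<beta> = 2 powr \<beta> * exp (\<beta> * (\<xi> - s))"
      using l(1) by (simp add: powr_mult exp_powr_real mult.commute)
    have P3: "2 * (2 powr \<alpha> * 2 powr \<beta>) = 2 powr (\<alpha> + \<beta> + 1)" by (simp add: powr_add)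
    have P4: "exp (\<xi> - s) * exp (- s) * (exp (- \<alpha> * s) * exp (\<beta> * (\<xi> - s))) = beta_weight (\<beta> + 1) (\<alpha> + \<beta> + 2) \<xi>"
      unfolding beta_weight_def exp_add[symmetric] s_def[symmetric] by (rule arg_cong[of _ _ exp]) (simp add: algebra_simps)
    have "(2 * (logistic \<xi> * (1 - logistic \<xi>))) *\<^sub>R (F * ((1 - (2 * logistic \<xi> - 1)) powr \<alpha> * (1 + (2 * logistic \<xi> - 1)) powr \<beta>)) =
        (2 * (2 powr \<alpha> * 2 powr \<beta>)) * (F * (exp (\<xi> - s) * exp (- s) * (exp (- \<alpha> * s) * exp (\<beta> * (\<xi> - s)))))"
      unfolding P1 P2 unfolding l(2) unfolding l(1) real_scaleR_def by (simp only: mult_ac)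
    then show "(2 * (logistic \<xi> * (1 - logistic \<xi>))) *\<^sub>R (f (2 * logistic \<xi> - 1) *
        ((1 - (2 * logistic \<xi> - 1)) powr \<alpha> * (1 + (2 * logistic \<xi> - 1)) powr \<beta>)) =
        2 powr (\<alpha> + \<beta> + 1) * (f (2 * logistic \<xi> - 1) * beta_weight (\<beta> + 1) (\<alpha> + \<beta> + 2) \<xi>)"
      unfolding P3 P4 F_def .
  qed
  finally show ?thesis by simp
qed

definition jacobi_coeff :: "nat \<Rightarrow> real \<Rightarrow> real \<Rightarrow> nat \<Rightarrow> real" where
  "jacobi_coeff n \<alpha> \<beta> m = pochhammer (\<alpha> + 1) n / fact n *
     (pochhammer (- real n) m * pochhammer (real n + \<alpha> + \<beta> + 1) m / (pochhammer (\<alpha> + 1) m * fact m))"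

text \<open>The Jacobi polynomial in the variable \<open>u = (1 - x)/2\<close>.\<close>

definition jacobi_explicit :: "nat \<Rightarrow> real \<Rightarrow> real \<Rightarrow> real poly" where
  "jacobi_explicit n \<alpha> \<beta> = (\<Sum>m\<le>n. monom (jacobi_coeff n \<alpha> \<beta> m) m)"

lemma coeff_jacobi_explicit: "coeff (jacobi_explicit n \<alpha> \<beta>) m = (if m \<le> n then jacobi_coeff n \<alpha> \<beta> m else 0)"
proof -
  have "coeff (jacobi_explicit n \<alpha> \<beta>) m = (\<Sum>j\<le>n. if m = j then jacobi_coeff n \<alpha> \<beta> j else 0)"
    unfolding jacobi_explicit_def coeff_sum by (intro sum.cong) auto
  then show ?thesis by simp
qed

lemma poly_jacobi_explicit: "poly (jacobi_explicit n \<alpha> \<beta>) u = (\<Sum>m\<le>n. jacobi_coeff n \<alpha> \<beta> m * u ^ m)"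
  unfolding jacobi_explicit_def by (simp add: poly_sum poly_monom)

lemma pochhammer_pos_real: "x > 0 \<Longrightarrow> pochhammer (x::real) n > 0"
  by (rule pochhammer_pos)

lemma degree_jacobi_explicit:
  assumes "\<alpha> > -1" "\<beta> > -1"
  shows "degree (jacobi_explicit n \<alpha> \<beta>) = n"
proof (rule antisym)
  show "degree (jacobi_explicit n \<alpha> \<beta>) \<le> n"
    by (rule degree_le) (simp add: coeff_jacobi_explicit)
  have "pochhammer (- real n) n \<noteq> 0"
    using pochhammer_of_nat_eq_0_iff[of n n, where 'a = real] by simp
  moreover have "pochhammer (real n + \<alpha> + \<beta> + 1) n \<noteq> 0"
  proof (cases "n = 0")
    case False
    then have "real n \<ge> 1" by simp
    then have "real n + \<alpha> + \<beta> + 1 > 0" using assms by linarith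
    then show ?thesis using pochhammer_pos_real less_imp_neq by metis
  qed simp
  moreover have "pochhammer (\<alpha> + 1) n > 0" using assms by (intro pochhammer_pos_real) simp
  ultimately have "coeff (jacobi_explicit n \<alpha> \<beta>) n \<noteq> 0"
    by (simp add: coeff_jacobi_explicit jacobi_coeff_def)
  then show "n \<le> degree (jacobi_explicit n \<alpha> \<beta>)" by (rule le_degree)
qed

lemma Gamma_pochhammer_real: "x > 0 \<Longrightarrow> Gamma (x + real n) = pochhammer x n * Gamma (x::real)"
proof -
  assume x: "x > 0"
  then have "x \<notin> \<int>\<^sub>\<le>\<^sub>0" by (auto elim!: nonpos_Ints_cases)
  from pochhammer_Gamma[OF this, of n] show ?thesis using Gamma_real_pos[OF x] by (simp add: field_simps)
qed

text \<open>Tested against a power of \<open>1 - u\<close>, the term \<open>u^m\<close> yields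
  \<open>(\<alpha> + 1)_m\<close>, which cancels the denominator in \<open>jacobi_coeff\<close>, so
  the sum is a terminating \<open>2F1\<close> at 1. Chu-Vandermonde evaluates it to a multiple of
  \<open>(j + 1 - n)_n\<close>, which contains the factor 0 for \<open>j < n\<close>.\<close>

lemma jacobi_explicit_orthogonal_monomial:
  assumes ab: "\<alpha> > -1" "\<beta> > -1" and j: "j < n"
  shows "(LINT \<xi>|lborel. poly (jacobi_explicit n \<alpha> \<beta>) (1 - logistic \<xi>) * logistic \<xi> ^ j * beta_weight (\<beta> + 1) (\<alpha> + \<beta> + 2) \<xi>) = 0"
proof -
  define s where "s = \<alpha> + \<beta> + 1"
  have w: "(1 - logistic \<xi>) ^ m * logistic \<xi> ^ j * beta_weight (\<beta> + 1) (\<alpha> + \<beta> + 2) \<xi> =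
      beta_weight (\<beta> + 1 + real j) (s + real j + 1 + real m) \<xi>" for m \<xi>
    unfolding beta_weight_one_minus_logistic beta_weight_logistic beta_weight_mult
    by (simp add: s_def algebra_simps)
  have pos: "\<beta> + 1 + real j > 0" "s + real j + 1 > 0" "\<alpha> + 1 > 0" "s + real j + 1 + real m > \<beta> + 1 + real j" for m
    using ab by (auto simp: s_def)
  have G: "(LINT \<xi>|lborel. beta_weight (\<beta> + 1 + real j) (s + real j + 1 + real m) \<xi>) =
      Gamma (\<beta> + 1 + real j) * Gamma (\<alpha> + 1) / Gamma (s + real j + 1) * (pochhammer (\<alpha> + 1) m / pochhammer (s + real j + 1) m)" for m
  proof -
    have "s + real j + 1 + real m - (\<beta> + 1 + real j) = \<alpha> + 1 + real m" by (simp add: s_def)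
    then have "(LINT \<xi>|lborel. beta_weight (\<beta> + 1 + real j) (s + real j + 1 + real m) \<xi>) =
        Gamma (\<beta> + 1 + real j) * Gamma (\<alpha> + 1 + real m) / Gamma (s + real j + 1 + real m)"
      using integral_beta_weight[OF pos(1) pos(4)[of m]] by (simp only:)
    then show ?thesis
      unfolding Gamma_pochhammer_real[OF pos(2)] Gamma_pochhammer_real[OF pos(3)] by simp (simp add: mult_ac)
  qed
  have "(LINT \<xi>|lborel. poly (jacobi_explicit n \<alpha> \<beta>) (1 - logistic \<xi>) * logistic \<xi> ^ j * beta_weight (\<beta> + 1) (\<alpha> + \<beta> + 2) \<xi>) =
     (LINT \<xi>|lborel. (\<Sum>m\<le>n. jacobi_coeff n \<alpha> \<beta> m * beta_weight (\<beta> + 1 + real j) (s + real j + 1 + real m) \<xi>))"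
    unfolding poly_jacobi_explicit sum_distrib_right w[symmetric] by (simp add: mult.assoc)
  also have "\<dots> = (\<Sum>m\<le>n. jacobi_coeff n \<alpha> \<beta> m * (LINT \<xi>|lborel. beta_weight (\<beta> + 1 + real j) (s + real j + 1 + real m) \<xi>))"
    using pos by (subst Bochner_Integration.integral_sum) (auto intro!: integrable_mult_right integrable_beta_weight)
  also have "\<dots> = (\<Sum>m\<le>n. pochhammer (\<alpha> + 1) n / fact n * (Gamma (\<beta> + 1 + real j) * Gamma (\<alpha> + 1) / Gamma (s + real j + 1)) *
      (pochhammer (real n + s) m * pochhammer (- real n) m / (fact m * pochhammer (s + real j + 1) m)))"
  proof (intro sum.cong refl)
    fix m
    have "pochhammer (\<alpha> + 1) m > 0" using pos by (intro pochhammer_pos_real) simp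
    then show "jacobi_coeff n \<alpha> \<beta> m * (LINT \<xi>|lborel. beta_weight (\<beta> + 1 + real j) (s + real j + 1 + real m) \<xi>) =
      pochhammer (\<alpha> + 1) n / fact n * (Gamma (\<beta> + 1 + real j) * Gamma (\<alpha> + 1) / Gamma (s + real j + 1)) *
      (pochhammer (real n + s) m * pochhammer (- real n) m / (fact m * pochhammer (s + real j + 1) m))"
      unfolding G jacobi_coeff_def by (simp add: s_def add.assoc) (simp add: mult_ac)
  qed
  also have "\<dots> = pochhammer (\<alpha> + 1) n / fact n * (Gamma (\<beta> + 1 + real j) * Gamma (\<alpha> + 1) / Gamma (s + real j + 1)) *
      (\<Sum>m=0..n. pochhammer (real n + s) m * pochhammer (- real n) m / (of_nat (fact m) * pochhammer (s + real j + 1) m))"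
    by (simp add: sum_distrib_left atLeast0AtMost)
  also have "(\<Sum>m=0..n. pochhammer (real n + s) m * pochhammer (- real n) m / (of_nat (fact m) * pochhammer (s + real j + 1) m)) =
      pochhammer (s + real j + 1 - (real n + s)) n / pochhammer (s + real j + 1) n"
  proof (rule Vandermonde_pochhammer, rule ballI)
    fix i assume "i \<in> {0..<n}"
    have "s + real j + 1 + real i > 0" using pos(2) by simp
    then show "s + real j + 1 \<noteq> - of_nat i" by linarith
  qed
  also have "pochhammer (s + real j + 1 - (real n + s)) n = 0"
    unfolding pochhammer_eq_0_iff using j by (intro exI[of _ "n - 1 - j"]) (auto simp: of_nat_diff)
  finally show ?thesis by simp
qed

lemma jacobi_explicit_orthogonal:
  assumes ab: "\<alpha> > -1" "\<beta> > -1" and q: "degree q < n"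
  shows "(LINT \<xi>|lborel. poly (jacobi_explicit n \<alpha> \<beta>) (1 - logistic \<xi>) * poly q (logistic \<xi>) * beta_weight (\<beta> + 1) (\<alpha> + \<beta> + 2) \<xi>) = 0"
proof -
  have int: "integrable lborel (\<lambda>\<xi>. poly (jacobi_explicit n \<alpha> \<beta>) (1 - logistic \<xi>) * logistic \<xi> ^ j * beta_weight (\<beta> + 1) (\<alpha> + \<beta> + 2) \<xi>)" for j
  proof -
    have "poly (jacobi_explicit n \<alpha> \<beta>) (1 - x) * x ^ j = poly (pcompose (jacobi_explicit n \<alpha> \<beta>) [:1, -1:] * monom 1 j) (0 + 1 * x)" for x
      by (simp add: poly_pcompose poly_monom)
    then show ?thesis using ab by (simp only:) (intro integrable_poly_beta_weight, auto)
  qed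
  have "(LINT \<xi>|lborel. poly (jacobi_explicit n \<alpha> \<beta>) (1 - logistic \<xi>) * poly q (logistic \<xi>) * beta_weight (\<beta> + 1) (\<alpha> + \<beta> + 2) \<xi>) =
     (LINT \<xi>|lborel. (\<Sum>j\<le>degree q. coeff q j * (poly (jacobi_explicit n \<alpha> \<beta>) (1 - logistic \<xi>) * logistic \<xi> ^ j * beta_weight (\<beta> + 1) (\<alpha> + \<beta> + 2) \<xi>)))"
    unfolding poly_altdef[of q] by (simp add: sum_distrib_left sum_distrib_right mult_ac)
  also have "\<dots> = (\<Sum>j\<le>degree q. coeff q j * (LINT \<xi>|lborel. poly (jacobi_explicit n \<alpha> \<beta>) (1 - logistic \<xi>) * logistic \<xi> ^ j * beta_weight (\<beta> + 1) (\<alpha> + \<beta> + 2) \<xi>))"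
    using int by (subst Bochner_Integration.integral_sum) auto
  also have "\<dots> = 0" using q by (intro sum.neutral) (auto simp: jacobi_explicit_orthogonal_monomial[OF ab])
  finally show ?thesis .
qed

definition is_jacobi_poly :: "nat \<Rightarrow> real \<Rightarrow> real \<Rightarrow> real poly \<Rightarrow> bool" where
  "is_jacobi_poly n \<alpha> \<beta> p \<longleftrightarrow> degree p = n \<and> poly p 1 = pochhammer (\<alpha> + 1) n / fact n \<and>
     (\<forall>q. degree q < n \<longrightarrow> (LINT x:{-1<..<1}|lborel. poly p x * poly q x * ((1 - x) powr \<alpha> * (1 + x) powr \<beta>)) = 0)"

lemma jacobi_orthogonality_iff:
  "(LINT x:{-1<..<1}|lborel. poly p x * poly q x * ((1 - x) powr \<alpha> * (1 + x) powr \<beta>)) = 0 \<longleftrightarrow>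
   (LINT \<xi>|lborel. poly p (2 * logistic \<xi> - 1) * poly q (2 * logistic \<xi> - 1) * beta_weight (\<beta> + 1) (\<alpha> + \<beta> + 2) \<xi>) = 0"
  using jacobi_weight_integral[of "\<lambda>x. poly p x * poly q x" \<alpha> \<beta>] by simp

lemma is_jacobi_poly_explicit:
  assumes ab: "\<alpha> > -1" "\<beta> > -1"
  shows "is_jacobi_poly n \<alpha> \<beta> (pcompose (jacobi_explicit n \<alpha> \<beta>) [:1/2, -1/2:])"
  unfolding is_jacobi_poly_def
proof (intro conjI allI impI)
  show "degree (pcompose (jacobi_explicit n \<alpha> \<beta>) [:1/2, -1/2:]) = n"
    by (simp add: degree_pcompose degree_jacobi_explicit[OF ab])
  show "poly (pcompose (jacobi_explicit n \<alpha> \<beta>) [:1/2, -1/2:]) 1 = pochhammer (\<alpha> + 1) n / fact n"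
    by (simp add: poly_pcompose poly_0_coeff_0 coeff_jacobi_explicit jacobi_coeff_def)
  fix q :: "real poly" assume "degree q < n"
  then have "degree (pcompose q [:-1, 2:]) < n" by (simp add: degree_pcompose)
  from jacobi_explicit_orthogonal[OF ab this]
  show "(LINT x:{-1<..<1}|lborel. poly (pcompose (jacobi_explicit n \<alpha> \<beta>) [:1/2, -1/2:]) x * poly q x * ((1 - x) powr \<alpha> * (1 + x) powr \<beta>)) = 0"
    unfolding jacobi_orthogonality_iff by (simp add: poly_pcompose algebra_simps)
qed

lemma is_jacobi_poly_unique:
  assumes ab: "\<alpha> > -1" "\<beta> > -1" and p: "is_jacobi_poly n \<alpha> \<beta> p" and q: "is_jacobi_poly n \<alpha> \<beta> q"
  shows "p = q"
proof -
  have v: "poly p 1 = poly q 1" "poly p 1 \<noteq> 0"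
  proof -
    have "pochhammer (\<alpha> + 1) n > 0" using ab by (intro pochhammer_pos_real) simp
    then show "poly p 1 = poly q 1" "poly p 1 \<noteq> 0" using p q by (auto simp: is_jacobi_poly_def)
  qed
  have d: "degree p = n" "degree q = n" using p q by (auto simp: is_jacobi_poly_def)
  \<comment> \<open>Cross-multiplying by the leading coefficients cancels the terms of degree
    \<open>n\<close>; \<open>r\<close> is then orthogonal to \<open>p\<close> and to
    \<open>q\<close>, hence to itself. For \<open>n = 0\<close> there is no smaller degree and the
    constants are compared directly.\<close>
  define r where "r = smult (lead_coeff q) p - smult (lead_coeff p) q"
  have "r = 0"
  proof (cases "n = 0")
    case True
    then obtain x y where "p = [:x:]" "q = [:y:]" using d by (metis degree_eq_zeroE)
    then show ?thesis using v by (simp add: r_def)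
  next
    case False
    have "degree r < n"
    proof (rule degree_lessI)
      show "r \<noteq> 0 \<or> n > 0" using False by simp
      show "\<forall>k\<ge>n. coeff r k = 0"
      proof (intro allI impI)
        fix k assume "n \<le> k"
        then show "coeff r k = 0"
          using d by (cases "k = n") (auto simp: r_def mult.commute coeff_eq_0)
      qed
    qed
    then have z: "(LINT \<xi>|lborel. poly p (2 * logistic \<xi> - 1) * poly r (2 * logistic \<xi> - 1) * beta_weight (\<beta> + 1) (\<alpha> + \<beta> + 2) \<xi>) = 0"
      "(LINT \<xi>|lborel. poly q (2 * logistic \<xi> - 1) * poly r (2 * logistic \<xi> - 1) * beta_weight (\<beta> + 1) (\<alpha> + \<beta> + 2) \<xi>) = 0"
      using p q unfolding is_jacobi_poly_def jacobi_orthogonality_iff by auto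
    have int: "integrable lborel (\<lambda>\<xi>. poly f (2 * logistic \<xi> - 1) * poly r (2 * logistic \<xi> - 1) * beta_weight (\<beta> + 1) (\<alpha> + \<beta> + 2) \<xi>)" for f
      using integrable_poly_beta_weight[of "\<beta> + 1" "\<alpha> + \<beta> + 2" "f * r" "-1" 2] ab by simp
    have "(LINT \<xi>|lborel. (poly r (-1 + 2 * logistic \<xi>))\<^sup>2 * beta_weight (\<beta> + 1) (\<alpha> + \<beta> + 2) \<xi>) =
       (LINT \<xi>|lborel. lead_coeff q * (poly p (2 * logistic \<xi> - 1) * poly r (2 * logistic \<xi> - 1) * beta_weight (\<beta> + 1) (\<alpha> + \<beta> + 2) \<xi>) -
         lead_coeff p * (poly q (2 * logistic \<xi> - 1) * poly r (2 * logistic \<xi> - 1) * beta_weight (\<beta> + 1) (\<alpha> + \<beta> + 2) \<xi>))"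
    proof (rule Bochner_Integration.integral_cong[OF refl])
      fix \<xi>
      let ?W = "beta_weight (\<beta> + 1) (\<alpha> + \<beta> + 2) \<xi>" and ?y = "2 * logistic \<xi> - 1"
      have e: "poly r (-1 + 2 * logistic \<xi>) = lead_coeff q * poly p ?y - lead_coeff p * poly q ?y"
        by (simp add: r_def)
      have "(poly r (-1 + 2 * logistic \<xi>))\<^sup>2 * ?W = poly r (-1 + 2 * logistic \<xi>) * (poly r ?y * ?W)"
        by (simp add: power2_eq_square)
      also have "\<dots> = lead_coeff q * (poly p ?y * poly r ?y * ?W) - lead_coeff p * (poly q ?y * poly r ?y * ?W)"
        unfolding e by (simp only: left_diff_distrib mult.assoc)
      finally show "(poly r (-1 + 2 * logistic \<xi>))\<^sup>2 * ?W =
         lead_coeff q * (poly p ?y * poly r ?y * ?W) - lead_coeff p * (poly q ?y * poly r ?y * ?W)" .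
    qed
    also have "\<dots> = 0" using int z by (subst Bochner_Integration.integral_diff) auto
    finally show "r = 0" by (rule poly_square_integral_zero[rotated 2]) (use ab in auto)
  qed
  then have eq: "smult (lead_coeff q) p = smult (lead_coeff p) q" by (simp add: r_def)
  then have "lead_coeff q * poly p 1 = lead_coeff p * poly q 1" by (metis poly_smult)
  then have "lead_coeff q = lead_coeff p" using v by simp
  moreover have "lead_coeff p \<noteq> 0" using v by auto
  ultimately show "p = q" using eq by (metis smult_eq_iff smult_smult mult.commute poly_eqI coeff_smult mult_left_cancel)
qed

lemma poly_jacobi_poly:
  assumes "\<alpha> > -1" "\<beta> > -1"
  shows "poly (jacobi_poly n \<alpha> \<beta>) x = poly (jacobi_explicit n \<alpha> \<beta>) ((1 - x) / 2)"
proof -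
  have "jacobi_poly n \<alpha> \<beta> = pcompose (jacobi_explicit n \<alpha> \<beta>) [:1/2, -1/2:]"
    unfolding jacobi_poly_def
    using is_jacobi_poly_explicit[OF assms] is_jacobi_poly_unique[OF assms]
    by (intro the_equality) (auto simp: is_jacobi_poly_def)
  then show ?thesis by (simp add: poly_pcompose diff_divide_distrib)
qed

section \<open>Density of the even polynomials\<close>

text \<open>
  Densities with an exponential moment: the Taylor series of \<open>exp (\<i> h y)\<close> converges in \<open>L\<^sup>2\<close> for small
  \<open>h\<close>, so the closure of the polynomials is stable under multiplication by every \<open>exp (\<i> s y)\<close>.
\<close>

locale exp_moment_measure = finite_measure \<nu> for \<nu> :: "real measure" +
  fixes \<delta> :: real
  assumes sets_nu [measurable_cong]: "sets \<nu> = sets borel" and delta_pos: "\<delta> > 0"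
    and exp_moment: "integrable \<nu> (\<lambda>y. exp (\<delta> * \<bar>y\<bar>))"
begin

definition sq_integrable :: "(real \<Rightarrow> complex) \<Rightarrow> bool" where
  "sq_integrable f \<longleftrightarrow> f \<in> borel_measurable borel \<and> integrable \<nu> (\<lambda>y. (norm (f y))\<^sup>2)"

text \<open>The square of the \<open>L^2\<close> norm; in place of the triangle inequality stands
  \<open>|x + y|^2 \<le> 2 |x|^2 + 2 |y|^2\<close>, whence the tolerances \<open>e / 4\<close>
  below.\<close>

definition sq_norm :: "(real \<Rightarrow> complex) \<Rightarrow> real" where "sq_norm f = (LINT y|\<nu>. (norm (f y))\<^sup>2)"

definition approx :: "(real \<Rightarrow> complex) \<Rightarrow> bool" where
  "approx f \<longleftrightarrow> sq_integrable f \<and> (\<forall>e>0. \<exists>P. sq_norm (\<lambda>y. f y - poly P (of_real y)) < e)"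

lemma norm_add_sq: "(norm (x + y))\<^sup>2 \<le> 2 * (norm x)\<^sup>2 + 2 * (norm y)\<^sup>2" for x y :: complex
proof -
  have "(norm (x + y))\<^sup>2 \<le> (norm x + norm y)\<^sup>2" by (intro power_mono norm_triangle_ineq) auto
  also have "\<dots> \<le> 2 * (norm x)\<^sup>2 + 2 * (norm y)\<^sup>2"
    using zero_le_power2[of "norm x - norm y"] by (simp add: power2_eq_square algebra_simps)
  finally show ?thesis .
qed

lemma sq_integrable_bound:
  assumes "f \<in> borel_measurable borel" "integrable \<nu> g" "\<And>y. (norm (f y))\<^sup>2 \<le> g y"
  shows "sq_integrable f"
proof -
  have [measurable]: "f \<in> borel_measurable borel" by fact
  have "integrable \<nu> (\<lambda>y. (norm (f y))\<^sup>2)"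
    by (rule Bochner_Integration.integrable_bound[OF assms(2)])
      (use assms(3) in \<open>auto intro: order_trans abs_ge_self\<close>)
  then show ?thesis using assms(1) by (simp add: sq_integrable_def)
qed

lemma sq_integrable_add: "sq_integrable f \<Longrightarrow> sq_integrable g \<Longrightarrow> sq_integrable (\<lambda>y. f y + g y)"
  by (rule sq_integrable_bound[where g = "\<lambda>y. 2 * (norm (f y))\<^sup>2 + 2 * (norm (g y))\<^sup>2"])
    (auto simp: sq_integrable_def norm_add_sq)

lemma sq_integrable_mult: "sq_integrable f \<Longrightarrow> sq_integrable (\<lambda>y. c * f y)"
  by (auto simp: sq_integrable_def norm_mult power_mult_distrib)

lemma sq_integrable_diff: "sq_integrable f \<Longrightarrow> sq_integrable g \<Longrightarrow> sq_integrable (\<lambda>y. f y - g y)"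
  using sq_integrable_add[of f "\<lambda>y. -1 * g y"] sq_integrable_mult[of g "-1"] by simp

lemma sq_norm_nonneg: "sq_norm f \<ge> 0" by (simp add: sq_norm_def)

lemma sq_norm_add: "sq_integrable f \<Longrightarrow> sq_integrable g \<Longrightarrow> sq_norm (\<lambda>y. f y + g y) \<le> 2 * sq_norm f + 2 * sq_norm g"
proof -
  assume f: "sq_integrable f" and g: "sq_integrable g"
  have "sq_norm (\<lambda>y. f y + g y) \<le> (LINT y|\<nu>. 2 * (norm (f y))\<^sup>2 + 2 * (norm (g y))\<^sup>2)"
    unfolding sq_norm_def using sq_integrable_add[OF f g] f g by (intro integral_mono) (auto simp: sq_integrable_def norm_add_sq)
  also have "\<dots> = 2 * sq_norm f + 2 * sq_norm g" using f g unfolding sq_norm_def sq_integrable_def by simp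
  finally show ?thesis .
qed

lemma sq_norm_mult: "sq_norm (\<lambda>y. c * f y) = (norm c)\<^sup>2 * sq_norm f"
  by (simp add: sq_norm_def norm_mult power_mult_distrib)

lemma poly_exp_bound:
  assumes "e > 0"
  shows "\<exists>C. \<forall>y. norm (poly P (complex_of_real y)) \<le> C * exp (e * \<bar>y\<bar>)"
  using assms
proof (induction P arbitrary: e)
  case 0
  then show ?case by (intro exI[of _ 0]) simp
next
  case (pCons a P)
  obtain C where C: "\<And>y. norm (poly P (complex_of_real y)) \<le> C * exp (e / 2 * \<bar>y\<bar>)"
    using pCons.IH[of "e / 2"] pCons.prems by auto
  have "norm (poly (pCons a P) (complex_of_real y)) \<le> (norm a + 2 / e * C) * exp (e * \<bar>y\<bar>)" for y
  proof -
    have "e / 2 * \<bar>y\<bar> \<le> exp (e / 2 * \<bar>y\<bar>)" using exp_ge_add_one_self[of "e / 2 * \<bar>y\<bar>"] by linarith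
    then have 1: "\<bar>y\<bar> \<le> 2 / e * exp (e / 2 * \<bar>y\<bar>)" using pCons.prems by (simp add: field_simps)
    have "norm (poly (pCons a P) (complex_of_real y)) \<le> norm a + \<bar>y\<bar> * norm (poly P (complex_of_real y))"
      using norm_triangle_ineq[of a "of_real y * poly P (of_real y)"] by (simp add: norm_mult)
    also have "\<bar>y\<bar> * norm (poly P (complex_of_real y)) \<le> (2 / e * exp (e / 2 * \<bar>y\<bar>)) * (C * exp (e / 2 * \<bar>y\<bar>))"
      using 1 C[of y] pCons.prems by (intro mult_mono) auto
    also have "\<dots> = 2 / e * C * exp (e * \<bar>y\<bar>)"
      using exp_add[of "e / 2 * \<bar>y\<bar>" "e / 2 * \<bar>y\<bar>"] by simp
    also have "norm a \<le> norm a * exp (e * \<bar>y\<bar>)" using pCons.prems by (simp add: mult_le_cancel_left1)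
    finally show ?thesis by (simp add: ring_distribs)
  qed
  then show ?case by blast
qed

lemma complex_poly_measurable [measurable]: "(\<lambda>y. poly P (complex_of_real y)) \<in> borel_measurable borel"
  by (intro borel_measurable_continuous_onI continuous_intros)

lemma integrable_poly_exp:
  assumes "2 * \<bar>h\<bar> < \<delta>"
  shows "integrable \<nu> (\<lambda>y. (norm (poly P (complex_of_real y)))\<^sup>2 * exp (2 * \<bar>h\<bar> * \<bar>y\<bar>))"
proof -
  define e where "e = (\<delta> - 2 * \<bar>h\<bar>) / 2"
  obtain C where C: "\<And>y. norm (poly P (complex_of_real y)) \<le> C * exp (e * \<bar>y\<bar>)"
    using poly_exp_bound[of e P] assms by (auto simp: e_def)
  show ?thesis
  proof (rule Bochner_Integration.integrable_bound)
    show "integrable \<nu> (\<lambda>y. C\<^sup>2 * exp (\<delta> * \<bar>y\<bar>))" using exp_moment by simp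
    have "(norm (poly P (complex_of_real y)))\<^sup>2 * exp (2 * \<bar>h\<bar> * \<bar>y\<bar>) \<le> C\<^sup>2 * exp (\<delta> * \<bar>y\<bar>)" for y
    proof -
      have "(norm (poly P (complex_of_real y)))\<^sup>2 * exp (2 * \<bar>h\<bar> * \<bar>y\<bar>) \<le> (C * exp (e * \<bar>y\<bar>))\<^sup>2 * exp (2 * \<bar>h\<bar> * \<bar>y\<bar>)"
        using C by (intro mult_right_mono power_mono) auto
      also have "\<dots> = C\<^sup>2 * (exp (e * \<bar>y\<bar>) * exp (e * \<bar>y\<bar>) * exp (2 * \<bar>h\<bar> * \<bar>y\<bar>))"
        by (simp add: power2_eq_square)
      also have "exp (e * \<bar>y\<bar>) * exp (e * \<bar>y\<bar>) * exp (2 * \<bar>h\<bar> * \<bar>y\<bar>) = exp (\<delta> * \<bar>y\<bar>)"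
        unfolding exp_add[symmetric] by (rule arg_cong[of _ _ exp]) (simp add: e_def field_simps)
      finally show ?thesis .
    qed
    then show "AE y in \<nu>. norm ((norm (poly P (complex_of_real y)))\<^sup>2 * exp (2 * \<bar>h\<bar> * \<bar>y\<bar>)) \<le> norm (C\<^sup>2 * exp (\<delta> * \<bar>y\<bar>))"
      by simp
  qed measurable
qed

lemma sq_integrable_poly: "sq_integrable (\<lambda>y. poly P (of_real y))"
  using integrable_poly_exp[of 0 P] delta_pos by (simp add: sq_integrable_def)

lemma approx_poly: "approx (\<lambda>y. poly P (of_real y))"
  unfolding approx_def by (intro conjI sq_integrable_poly allI impI exI[of _ P]) (simp add: sq_norm_def)

lemma approx_add:
  assumes f: "approx f" and g: "approx g"
  shows "approx (\<lambda>y. f y + g y)"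
  unfolding approx_def
proof (intro conjI allI impI)
  show "sq_integrable (\<lambda>y. f y + g y)" using f g by (auto simp: approx_def intro: sq_integrable_add)
  fix e :: real assume e: "e > 0"
  then have e4: "e / 4 > 0" by simp
  obtain P Q where P: "sq_norm (\<lambda>y. f y - poly P (of_real y)) < e / 4" and Q: "sq_norm (\<lambda>y. g y - poly Q (of_real y)) < e / 4"
    using f g e4 unfolding approx_def by blast
  have "sq_norm (\<lambda>y. (f y - poly P (of_real y)) + (g y - poly Q (of_real y))) \<le>
      2 * sq_norm (\<lambda>y. f y - poly P (of_real y)) + 2 * sq_norm (\<lambda>y. g y - poly Q (of_real y))"
    using f g by (intro sq_norm_add sq_integrable_diff sq_integrable_poly) (auto simp: approx_def)
  also have "\<dots> < e" using P Q by linarith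
  finally have "sq_norm (\<lambda>y. f y + g y - poly (P + Q) (of_real y)) < e" by (simp add: algebra_simps)
  then show "\<exists>P. sq_norm (\<lambda>y. f y + g y - poly P (of_real y)) < e" by blast
qed

lemma approx_mult:
  assumes f: "approx f"
  shows "approx (\<lambda>y. c * f y)"
  unfolding approx_def
proof (intro conjI allI impI)
  show "sq_integrable (\<lambda>y. c * f y)" using f by (auto simp: approx_def intro: sq_integrable_mult)
  fix e :: real assume e: "e > 0"
  define k where "k = (norm c)\<^sup>2 + 1"
  have k: "k > 0" by (simp add: k_def add_nonneg_pos)
  then obtain P where P: "sq_norm (\<lambda>y. f y - poly P (of_real y)) < e / k"
    using f e unfolding approx_def by (meson divide_pos_pos)
  have "sq_norm (\<lambda>y. c * (f y - poly P (of_real y))) \<le> k * sq_norm (\<lambda>y. f y - poly P (of_real y))"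
    unfolding sq_norm_mult by (intro mult_right_mono sq_norm_nonneg) (simp add: k_def)
  also have "\<dots> < e" using P k by (simp add: field_simps)
  finally have "sq_norm (\<lambda>y. c * f y - poly (smult c P) (of_real y)) < e" by (simp add: algebra_simps)
  then show "\<exists>P. sq_norm (\<lambda>y. c * f y - poly P (of_real y)) < e" by blast
qed

lemma approx_sum: "finite I \<Longrightarrow> (\<And>i. i \<in> I \<Longrightarrow> approx (f i)) \<Longrightarrow> approx (\<lambda>y. \<Sum>i\<in>I. f i y)"
proof (induction I rule: finite_induct)
  case empty
  then show ?case using approx_poly[of 0] by simp
next
  case (insert i I)
  then show ?case by (simp add: approx_add)
qed

lemma approx_closed:
  assumes f: "sq_integrable f" and g: "\<And>e. e > 0 \<Longrightarrow> \<exists>g. approx g \<and> sq_norm (\<lambda>y. f y - g y) < e"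
  shows "approx f"
  unfolding approx_def
proof (intro conjI f allI impI)
  fix e :: real assume e: "e > 0"
  then obtain g where g: "approx g" "sq_norm (\<lambda>y. f y - g y) < e / 4" using assms(2)[of "e / 4"] by auto
  then obtain P where P: "sq_norm (\<lambda>y. g y - poly P (of_real y)) < e / 4"
    using e unfolding approx_def by (meson divide_pos_pos zero_less_numeral)
  have "sq_norm (\<lambda>y. (f y - g y) + (g y - poly P (of_real y))) \<le> 2 * sq_norm (\<lambda>y. f y - g y) + 2 * sq_norm (\<lambda>y. g y - poly P (of_real y))"
    using f g(1) by (intro sq_norm_add sq_integrable_diff sq_integrable_poly) (auto simp: approx_def)
  also have "\<dots> < e" using P g by linarith
  finally show "\<exists>P. sq_norm (\<lambda>y. f y - poly P (of_real y)) < e" by auto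
qed

text \<open>Dominated convergence in the form used for the limits below: a pointwise limit under one
  integrable majorant stays in the closure of the polynomials.\<close>

lemma approx_limit:
  assumes f: "f \<in> borel_measurable borel" and s: "\<And>n. approx (s n)"
    and lim: "\<And>y. (\<lambda>n. s n y) \<longlonglongrightarrow> f y" and w: "integrable \<nu> w"
    and bound: "\<And>n y. (norm (f y - s n y))\<^sup>2 \<le> w y" and fb: "\<And>y. (norm (f y))\<^sup>2 \<le> w' y" "integrable \<nu> w'"
  shows "approx f"
proof (rule approx_closed)
  show sf: "sq_integrable f" by (rule sq_integrable_bound[OF f fb(2) fb(1)])
  have [measurable]: "f \<in> borel_measurable borel" by fact
  have [measurable]: "s n \<in> borel_measurable borel" for n using s by (simp add: approx_def sq_integrable_def)
  have "(\<lambda>n. sq_norm (\<lambda>y. f y - s n y)) \<longlonglongrightarrow> (LINT y|\<nu>. 0)"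
    unfolding sq_norm_def
  proof (rule integral_dominated_convergence[OF _ _ w])
    show "AE y in \<nu>. (\<lambda>n. (norm (f y - s n y))\<^sup>2) \<longlonglongrightarrow> 0"
    proof (rule AE_I2)
      fix y
      have "(\<lambda>n. (norm (f y - s n y))\<^sup>2) \<longlonglongrightarrow> (norm (f y - f y))\<^sup>2"
        by (intro tendsto_intros lim)
      then show "(\<lambda>n. (norm (f y - s n y))\<^sup>2) \<longlonglongrightarrow> 0" by simp
    qed
  qed (use bound in auto)
  then have z: "(\<lambda>n. sq_norm (\<lambda>y. f y - s n y)) \<longlonglongrightarrow> 0" by simp
  fix e :: real assume "e > 0"
  then have "\<forall>\<^sub>F n in sequentially. sq_norm (\<lambda>y. f y - s n y) < e" using order_tendstoD(2)[OF z] by blast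
  then obtain n where "sq_norm (\<lambda>y. f y - s n y) < e" by (auto simp: eventually_sequentially)
  then show "\<exists>g. approx g \<and> sq_norm (\<lambda>y. f y - g y) < e" using s by blast
qed

section \<open>Exponentials in the closure of the polynomials\<close>

definition expi :: "real \<Rightarrow> real \<Rightarrow> complex" where "expi s y = exp (\<i> * of_real (s * y))"

lemma norm_expi [simp]: "norm (expi s y) = 1" by (simp add: expi_def)

lemma expi_add: "expi (s + t) y = expi s y * expi t y"
  by (simp add: expi_def ring_distribs exp_add)

lemma expi_measurable [measurable]: "expi s \<in> borel_measurable borel"
  unfolding expi_def by (intro borel_measurable_continuous_onI continuous_intros)

text \<open>The Taylor polynomials of \<open>exp (i h y)\<close> are bounded by
  \<open>exp (|h| |y|)\<close>, whose square times that of a polynomial is integrable when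
  \<open>2 |h| < \<delta>\<close>. The assumption covers all polynomials because it is applied to
  \<open>P\<close> times a Taylor polynomial.\<close>

lemma approx_expi_step:
  assumes IH: "\<And>P. approx (\<lambda>y. poly P (of_real y) * expi s y)" and h: "2 * \<bar>h\<bar> < \<delta>"
  shows "approx (\<lambda>y. poly P (of_real y) * expi (s + h) y)"
proof -
  define T where "T = (\<lambda>n. \<Sum>k<n. monom ((\<i> * of_real h) ^ k / fact k) k)"
  have T: "poly (T n) (of_real y) = (\<Sum>k<n. (\<i> * of_real (h * y)) ^ k /\<^sub>R fact k)" for n y
    by (simp add: T_def poly_sum poly_monom power_mult_distrib scaleR_conv_of_real divide_inverse mult_ac)
  have Tlim: "(\<lambda>n. poly (T n) (of_real y)) \<longlonglongrightarrow> expi h y" for y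
    unfolding T expi_def using exp_converges[of "\<i> * of_real (h * y)"] by (simp add: sums_def)
  have Tbound: "norm (poly (T n) (of_real y)) \<le> exp (\<bar>h\<bar> * \<bar>y\<bar>)" for n y
  proof -
    have "norm (poly (T n) (of_real y)) \<le> (\<Sum>k<n. norm ((\<i> * of_real (h * y)) ^ k /\<^sub>R fact k))"
      unfolding T by (rule norm_sum)
    also have "\<dots> = (\<Sum>k<n. (\<bar>h\<bar> * \<bar>y\<bar>) ^ k /\<^sub>R fact k)" by (simp add: norm_power norm_mult abs_mult)
    also have "\<dots> \<le> (\<Sum>k. (\<bar>h\<bar> * \<bar>y\<bar>) ^ k /\<^sub>R fact k)"
      using sums_summable[OF exp_converges[of "\<bar>h\<bar> * \<bar>y\<bar>"]] by (intro sum_le_suminf) auto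
    also have "\<dots> = exp (\<bar>h\<bar> * \<bar>y\<bar>)" by (simp add: exp_def)
    finally show ?thesis .
  qed
  show ?thesis
  proof (rule approx_limit[where s = "\<lambda>n y. poly (P * T n) (of_real y) * expi s y"])
    show "(\<lambda>y. poly P (of_real y) * expi (s + h) y) \<in> borel_measurable borel" by measurable
    show "approx (\<lambda>y. poly (P * T n) (of_real y) * expi s y)" for n by (rule IH)
    show "(\<lambda>n. poly (P * T n) (of_real y) * expi s y) \<longlonglongrightarrow> poly P (of_real y) * expi (s + h) y" for y
      unfolding expi_add poly_mult using Tlim[of y] by (auto intro!: tendsto_eq_intros simp: mult_ac)
    show "integrable \<nu> (\<lambda>y. 4 * ((norm (poly P (complex_of_real y)))\<^sup>2 * exp (2 * \<bar>h\<bar> * \<bar>y\<bar>)))"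
      using integrable_poly_exp[OF h, of P] by simp
    show "(norm (poly P (of_real y) * expi (s + h) y - poly (P * T n) (of_real y) * expi s y))\<^sup>2 \<le>
        4 * ((norm (poly P (complex_of_real y)))\<^sup>2 * exp (2 * \<bar>h\<bar> * \<bar>y\<bar>))" for n y
    proof -
      have "norm (expi h y - poly (T n) (of_real y)) \<le> 1 + exp (\<bar>h\<bar> * \<bar>y\<bar>)"
        using norm_triangle_ineq4[of "expi h y" "poly (T n) (of_real y)"] Tbound[of n y] by simp
      also have "\<dots> \<le> 2 * exp (\<bar>h\<bar> * \<bar>y\<bar>)" by simp
      finally have b: "norm (expi h y - poly (T n) (of_real y)) \<le> 2 * exp (\<bar>h\<bar> * \<bar>y\<bar>)" .
      have "poly P (of_real y) * expi (s + h) y - poly (P * T n) (of_real y) * expi s y =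
          poly P (of_real y) * expi s y * (expi h y - poly (T n) (of_real y))"
        by (simp add: expi_add algebra_simps)
      then have "norm (poly P (of_real y) * expi (s + h) y - poly (P * T n) (of_real y) * expi s y) \<le>
          norm (poly P (complex_of_real y)) * (2 * exp (\<bar>h\<bar> * \<bar>y\<bar>))"
        using b by (simp add: norm_mult mult_left_mono)
      then have "(norm (poly P (of_real y) * expi (s + h) y - poly (P * T n) (of_real y) * expi s y))\<^sup>2 \<le>
          (norm (poly P (complex_of_real y)) * (2 * exp (\<bar>h\<bar> * \<bar>y\<bar>)))\<^sup>2"
        by (intro power_mono) auto
      also have "\<dots> = 4 * ((norm (poly P (complex_of_real y)))\<^sup>2 * (exp (\<bar>h\<bar> * \<bar>y\<bar>) * exp (\<bar>h\<bar> * \<bar>y\<bar>)))"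
        by (simp add: power2_eq_square)
      also have "exp (\<bar>h\<bar> * \<bar>y\<bar>) * exp (\<bar>h\<bar> * \<bar>y\<bar>) = exp (2 * \<bar>h\<bar> * \<bar>y\<bar>)"
        by (simp flip: exp_add)
      finally show ?thesis .
    qed
    show "(norm (poly P (of_real y) * expi (s + h) y))\<^sup>2 \<le> (norm (poly P (complex_of_real y)))\<^sup>2" for y
      by (simp add: norm_mult)
    show "integrable \<nu> (\<lambda>y. (norm (poly P (complex_of_real y)))\<^sup>2)" using sq_integrable_poly by (simp add: sq_integrable_def)
  qed
qed

lemma approx_expi: "approx (expi s)"
proof -
  \<comment> \<open>Enough steps for each to have length less than
    \<open>\<delta> / 2\<close>.\<close>
  obtain n :: nat where n: "2 * \<bar>s\<bar> / \<delta> < real n" using reals_Archimedean2 by blast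
  then have n0: "real n > 0" using delta_pos by (smt (verit) divide_nonneg_pos abs_ge_zero)
  have h: "2 * \<bar>s / real n\<bar> < \<delta>" using n n0 delta_pos by (simp add: field_simps)
  have "approx (\<lambda>y. poly P (of_real y) * expi (real m * (s / real n)) y)" for m P
  proof (induction m arbitrary: P)
    case 0
    then show ?case using approx_poly[of P] by (simp add: expi_def)
  next
    case (Suc m)
    have "real (Suc m) * (s / real n) = real m * (s / real n) + s / real n" by (simp only: of_nat_Suc ring_distribs mult_1 add.commute)
    then show ?case using approx_expi_step[OF Suc.IH h, of P] by (simp only:)
  qed
  from this[of 1 n] show ?thesis using n0 by simp
qed

lemma approx_cos_power: "approx (\<lambda>y. of_real (cos (s * y) ^ n))"
proof -
  have "complex_of_real (cos (s * y) ^ n) = (\<Sum>k\<le>n. (of_nat (n choose k) / 2 ^ n) * expi (real k * s - real (n - k) * s) y)" for y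
  proof -
    have E: "complex_of_real (cos (s * y)) = (expi s y + expi (- s) y) / 2"
      by (simp add: expi_def cos_exp_eq flip: cos_of_real)
    have "complex_of_real (cos (s * y) ^ n) = (expi s y + expi (- s) y) ^ n / 2 ^ n"
      unfolding of_real_power E by (rule power_divide)
    also have "(expi s y + expi (- s) y) ^ n = (\<Sum>k\<le>n. of_nat (n choose k) * expi s y ^ k * expi (- s) y ^ (n - k))"
      by (rule binomial_ring)
    also have "\<dots> / 2 ^ n = (\<Sum>k\<le>n. (of_nat (n choose k) / 2 ^ n) * expi (real k * s - real (n - k) * s) y)"
      unfolding sum_divide_distrib
      by (intro sum.cong refl) (simp add: expi_def algebra_simps flip: exp_of_nat_mult exp_add)
    finally show ?thesis .
  qed
  then show ?thesis by (simp only:) (intro approx_sum approx_mult approx_expi finite_atMost)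
qed

text \<open>On \<open>[-L, L]\<close> the function \<open>\<phi> |y|\<close> is a continuous
  function of \<open>cos (pi y / L)\<close>, so Weierstrass's theorem gives a trigonometric
  polynomial close to it there. Outside, periodicity keeps that polynomial bounded; as
  \<open>L\<close> grows, dominated convergence with a constant majorant finishes, the measure being
  finite.\<close>

lemma approx_even_continuous:
  fixes \<phi> :: "real \<Rightarrow> real"
  assumes cont: "continuous_on UNIV \<phi>" and supp: "\<And>y. y \<ge> R \<Longrightarrow> \<phi> y = 0"
  shows "approx (\<lambda>y. of_real (\<phi> \<bar>y\<bar>))"
proof -
  obtain B where B: "B > 0" "\<And>y. y \<ge> 0 \<Longrightarrow> \<bar>\<phi> y\<bar> \<le> B"
  proof -
    have "bounded (\<phi> ` {0..\<bar>R\<bar>})"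
      by (intro compact_imp_bounded compact_continuous_image continuous_on_subset[OF cont]) auto
    then obtain B where "B > 0" "\<forall>y\<in>{0..\<bar>R\<bar>}. \<bar>\<phi> y\<bar> \<le> B" by (auto simp: bounded_pos)
    then show ?thesis using supp by (intro that[of B]) (metis abs_ge_self abs_zero atLeastAtMost_iff less_imp_le linear order_trans)+
  qed
  have phm: "(\<lambda>y. complex_of_real (\<phi> \<bar>y\<bar>)) \<in> borel_measurable borel"
    by (intro borel_measurable_continuous_onI continuous_on_compose2[OF cont] continuous_intros) auto
  have q: "\<exists>q n. \<forall>y. (\<bar>y\<bar> \<le> L \<longrightarrow> \<bar>\<phi> \<bar>y\<bar> - (\<Sum>i\<le>n. q i * cos (pi / L * y) ^ i)\<bar> < e) \<and>
      \<bar>(\<Sum>i\<le>n. q i * cos (pi / L * y) ^ i)\<bar> < B + e" if L: "L > 0" and e: "e > 0" for L e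
  proof -
    define g where "g = (\<lambda>u. \<phi> (L / pi * arccos u))"
    have "continuous_on {-1..1} g" unfolding g_def
      by (intro continuous_on_compose2[OF cont] continuous_intros) auto
    then obtain p where p: "real_polynomial_function p" "\<And>u. u \<in> {-1..1} \<Longrightarrow> \<bar>g u - p u\<bar> < e"
      using Stone_Weierstrass_real_polynomial_function[of "{-1..1}" g e] e by auto
    then obtain q n where q: "p = (\<lambda>x. \<Sum>i\<le>n. q i * x ^ i)"
      using real_polynomial_function_iff_sum by blast
    have "(\<bar>y\<bar> \<le> L \<longrightarrow> \<bar>\<phi> \<bar>y\<bar> - (\<Sum>i\<le>n. q i * cos (pi / L * y) ^ i)\<bar> < e) \<and>
      \<bar>(\<Sum>i\<le>n. q i * cos (pi / L * y) ^ i)\<bar> < B + e" for y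
    proof (intro conjI impI)
      define u where "u = cos (pi / L * y)"
      have u: "u \<in> {-1..1}" by (simp add: u_def)
      have pu: "p u = (\<Sum>i\<le>n. q i * cos (pi / L * y) ^ i)" by (simp add: q u_def)
      have "L / pi * arccos u \<ge> 0" using L u arccos_lbound[of u] by simp
      then have "\<bar>g u\<bar> \<le> B" unfolding g_def by (rule B(2))
      then show "\<bar>(\<Sum>i\<le>n. q i * cos (pi / L * y) ^ i)\<bar> < B + e" using p(2)[OF u] pu by linarith
      assume y: "\<bar>y\<bar> \<le> L"
      have "u = cos (pi / L * \<bar>y\<bar>)" by (cases "y \<ge> 0") (auto simp: u_def)
      moreover have "pi / L * \<bar>y\<bar> \<le> pi" using y L by (simp add: field_simps)
      ultimately have "arccos u = pi / L * \<bar>y\<bar>" using L by (simp add: arccos_cos)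
      then have "g u = \<phi> \<bar>y\<bar>" using L by (simp add: g_def)
      then show "\<bar>\<phi> \<bar>y\<bar> - (\<Sum>i\<le>n. q i * cos (pi / L * y) ^ i)\<bar> < e" using p(2)[OF u] pu by simp
    qed
    then show ?thesis by blast
  qed
  define R' where "R' = (\<lambda>n q m. \<forall>y. (\<bar>y\<bar> \<le> real (Suc n) + \<bar>R\<bar> \<longrightarrow> \<bar>\<phi> \<bar>y\<bar> - (\<Sum>i\<le>m. q i * cos (pi / (real (Suc n) + \<bar>R\<bar>) * y) ^ i)\<bar> < 1 / real (Suc n)) \<and>
      \<bar>(\<Sum>i\<le>m. q i * cos (pi / (real (Suc n) + \<bar>R\<bar>) * y) ^ i)\<bar> < B + 1 / real (Suc n))"
  have "\<exists>q m. R' n q m" for n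
    unfolding R'_def by (rule q) (auto simp: add_pos_nonneg)
  then obtain q m where "R' n (q n) (m n)" for n by metis
  then have q: "\<And>n y. \<bar>y\<bar> \<le> real (Suc n) + \<bar>R\<bar> \<Longrightarrow>
      \<bar>\<phi> \<bar>y\<bar> - (\<Sum>i\<le>m n. q n i * cos (pi / (real (Suc n) + \<bar>R\<bar>) * y) ^ i)\<bar> < 1 / real (Suc n)"
    "\<And>n y. \<bar>(\<Sum>i\<le>m n. q n i * cos (pi / (real (Suc n) + \<bar>R\<bar>) * y) ^ i)\<bar> < B + 1 / real (Suc n)"
    unfolding R'_def by blast+
  define s where "s = (\<lambda>n y. (\<Sum>i\<le>m n. q n i * cos (pi / (real (Suc n) + \<bar>R\<bar>) * y) ^ i))"
  show ?thesis
  proof (rule approx_limit[where s = "\<lambda>n y. of_real (s n y)" and w = "\<lambda>_. (2 * B + 1)\<^sup>2" and w' = "\<lambda>_. B\<^sup>2"])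
    show "(\<lambda>y. complex_of_real (\<phi> \<bar>y\<bar>)) \<in> borel_measurable borel" by (rule phm)
    show "approx (\<lambda>y. of_real (s n y))" for n
      unfolding s_def of_real_sum of_real_mult by (intro approx_sum approx_mult approx_cos_power finite_atMost)
    show "(\<lambda>n. complex_of_real (s n y)) \<longlonglongrightarrow> of_real (\<phi> \<bar>y\<bar>)" for y
    proof (rule tendsto_of_real, rule LIM_zero_cancel, rule Lim_null_comparison)
      obtain N where N: "\<bar>y\<bar> \<le> real N" using real_arch_simple by blast
      show "\<forall>\<^sub>F n in sequentially. norm (s n y - \<phi> \<bar>y\<bar>) \<le> 1 / real (Suc n)"
      proof (rule eventually_sequentiallyI[of N])
        fix n assume "N \<le> n"
        then have "\<bar>y\<bar> \<le> real (Suc n) + \<bar>R\<bar>" using N by linarith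
        from q(1)[OF this] show "norm (s n y - \<phi> \<bar>y\<bar>) \<le> 1 / real (Suc n)"
          by (simp add: s_def abs_minus_commute less_imp_le)
      qed
      show "(\<lambda>n. 1 / real (Suc n)) \<longlonglongrightarrow> 0" by (rule LIMSEQ_Suc) (rule lim_1_over_n)
    qed
    show "integrable \<nu> (\<lambda>_. (2 * B + 1)\<^sup>2)" "integrable \<nu> (\<lambda>_. B\<^sup>2)" by simp_all
    show "(norm (complex_of_real (\<phi> \<bar>y\<bar>) - of_real (s n y)))\<^sup>2 \<le> (2 * B + 1)\<^sup>2" for n y
    proof (rule power_mono)
      have "1 / real (Suc n) \<le> 1" by simp
      then have "\<bar>s n y\<bar> \<le> B + 1" using q(2)[of n y] unfolding s_def by linarith
      then have "\<bar>\<phi> \<bar>y\<bar> - s n y\<bar> \<le> 2 * B + 1" using B(2)[of "\<bar>y\<bar>"] by linarith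
      then show "norm (complex_of_real (\<phi> \<bar>y\<bar>) - of_real (s n y)) \<le> 2 * B + 1"
        by (simp flip: of_real_diff)
    qed simp
    show "(norm (complex_of_real (\<phi> \<bar>y\<bar>)))\<^sup>2 \<le> B\<^sup>2" for y
      using B(2)[of "\<bar>y\<bar>"] by (intro power_mono) auto
  qed
qed

lemma approx_even_indicator_interval: "approx (\<lambda>y. indicator {u..v} \<bar>y\<bar>)"
proof -
  \<comment> \<open>A trapezoid: 1 on \<open>{u..v}\<close> and decreasing to 0 with slope
    \<open>n\<close> in the distance from it.\<close>
  define \<phi> where "\<phi> = (\<lambda>(n::nat) y. max 0 (1 - real n * max 0 (max (u - y) (y - v))))"
  have ph: "0 \<le> \<phi> n y" "\<phi> n y \<le> 1" for n y by (auto simp: \<phi>_def)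
  have meas: "(\<lambda>y. indicator {u..v} \<bar>y\<bar> :: complex) \<in> borel_measurable borel" by measurable
  show ?thesis
  proof (rule approx_limit[where s = "\<lambda>n y. of_real (\<phi> (Suc n) \<bar>y\<bar>)" and w = "\<lambda>_. 1" and w' = "\<lambda>_. 1"])
    show "approx (\<lambda>y. of_real (\<phi> (Suc n) \<bar>y\<bar>))" for n
    proof (rule approx_even_continuous)
      show "continuous_on UNIV (\<phi> (Suc n))" unfolding \<phi>_def by (intro continuous_intros)
      show "\<phi> (Suc n) y = 0" if "y \<ge> v + 1" for y
      proof -
        have "1 \<le> real (Suc n) * (y - v)" using mult_mono[of 1 "real (Suc n)" 1 "y - v"] that by simp
        also have "\<dots> \<le> real (Suc n) * max 0 (max (u - y) (y - v))" by (intro mult_left_mono) auto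
        finally show ?thesis by (simp add: \<phi>_def)
      qed
    qed
    show "(\<lambda>n. of_real (\<phi> (Suc n) \<bar>y\<bar>)) \<longlonglongrightarrow> (indicator {u..v} \<bar>y\<bar> :: complex)" for y
    proof (cases "\<bar>y\<bar> \<in> {u..v}")
      case True
      then show ?thesis by (auto simp: \<phi>_def max_def indicator_def)
    next
      case False
      define d where "d = max (u - \<bar>y\<bar>) (\<bar>y\<bar> - v)"
      have d: "d > 0" using False by (auto simp: d_def)
      obtain N where N: "1 / d < real N" using reals_Archimedean2 by blast
      have "\<forall>\<^sub>F n in sequentially. complex_of_real (\<phi> (Suc n) \<bar>y\<bar>) = 0"
      proof (rule eventually_sequentiallyI[of N])
        fix n assume "N \<le> n"
        then have "1 / d < real (Suc n)" using N by linarith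
        then have "1 \<le> real (Suc n) * d" using d by (simp add: field_simps)
        then show "complex_of_real (\<phi> (Suc n) \<bar>y\<bar>) = 0"
          using d unfolding \<phi>_def d_def[symmetric] by (simp add: max_def)
      qed
      then have "(\<lambda>n. complex_of_real (\<phi> (Suc n) \<bar>y\<bar>)) \<longlonglongrightarrow> 0" by (rule tendsto_eventually)
      then show ?thesis using False by simp
    qed
    show "(norm ((indicator {u..v} \<bar>y\<bar> :: complex) - of_real (\<phi> (Suc n) \<bar>y\<bar>)))\<^sup>2 \<le> 1" for n y
    proof (rule power_le_one)
      show "norm ((indicator {u..v} \<bar>y\<bar> :: complex) - of_real (\<phi> (Suc n) \<bar>y\<bar>)) \<le> 1"
      proof -
        have "(indicator {u..v} \<bar>y\<bar> :: complex) - of_real (\<phi> (Suc n) \<bar>y\<bar>) = of_real (indicator {u..v} \<bar>y\<bar> - \<phi> (Suc n) \<bar>y\<bar>)"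
          by (simp add: indicator_def)
        moreover have "\<bar>indicator {u..v} \<bar>y\<bar> - \<phi> (Suc n) \<bar>y\<bar>\<bar> \<le> 1"
          using ph[of "Suc n" "\<bar>y\<bar>"] by (auto simp: indicator_def)
        ultimately show ?thesis by (simp only: norm_of_real)
      qed
    qed simp
  qed (use meas in \<open>auto simp: indicator_def\<close>)
qed

text \<open>Dynkin's argument: closed intervals generate the Borel sets and are stable under
  intersection, and the class of admissible sets is closed under complements and countable disjoint
  unions.\<close>

lemma approx_even_indicator:
  assumes "A \<in> sets borel"
  shows "approx (\<lambda>y. indicator A \<bar>y\<bar>)"
proof -
  have gen: "sets borel = sigma_sets UNIV (range (\<lambda>(u, v). {u..v::real}))"
    by (subst borel_eq_atLeastAtMost) (simp add: sets_measure_of)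
  have "Int_stable (range (\<lambda>(u, v). {u..v::real}))"
    by (auto simp: Int_stable_def)
  moreover have "range (\<lambda>(u, v). {u..v::real}) \<subseteq> Pow UNIV" by auto
  moreover have "A \<in> sigma_sets UNIV (range (\<lambda>(u, v). {u..v::real}))" using assms unfolding gen .
  ultimately show ?thesis
  proof (induction rule: sigma_sets_induct_disjoint)
    case (basic A)
    then show ?case using approx_even_indicator_interval by auto
  next
    case empty
    then show ?case using approx_poly[of 0] by simp
  next
    case (compl A)
    have "approx (\<lambda>y. poly 1 (of_real y) + (- 1) * indicator A \<bar>y\<bar>)"
      by (intro approx_add approx_poly approx_mult compl)
    moreover have "poly 1 (of_real y) + (- 1) * indicator A \<bar>y\<bar> = (indicator (UNIV - A) \<bar>y\<bar> :: complex)" for y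
      by (auto simp: indicator_def)
    ultimately show ?case by simp
  next
    case (union A)
    have Am: "A i \<in> sets borel" for i using union(2) unfolding gen by auto
    then have [measurable]: "A i \<in> sets borel" for i .
    have U: "(\<Union>i. A i) \<in> sets borel" using Am by auto
    have ps: "(\<Sum>i<n. indicator (A i) y :: complex) = indicator (\<Union>i<n. A i) y" for n y
    proof (induction n)
      case (Suc n)
      have "A n \<inter> A i = {}" if "i < n" for i
        using union(1) that by (simp add: disjoint_family_on_def)
      then have "A n \<inter> (\<Union>i<n. A i) = {}" by blast
      then have "(indicator (\<Union>i<n. A i) y + indicator (A n) y :: complex) = indicator (\<Union>i<Suc n. A i) y"
        by (auto simp: lessThan_Suc indicator_def)
      then show ?case using Suc by (simp only: sum.lessThan_Suc)
    qed simp
    show ?case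
    proof (rule approx_limit[where s = "\<lambda>n y. (\<Sum>i<n. indicator (A i) \<bar>y\<bar>)" and w = "\<lambda>_. 1" and w' = "\<lambda>_. 1"])
      have [measurable]: "(\<Union>i. A i) \<in> sets borel" by (rule U)
      show "(\<lambda>y. indicator (\<Union>i. A i) \<bar>y\<bar> :: complex) \<in> borel_measurable borel" by measurable
      show "approx (\<lambda>y. \<Sum>i<n. indicator (A i) \<bar>y\<bar>)" for n by (intro approx_sum union) auto
      show "(\<lambda>n. \<Sum>i<n. indicator (A i) \<bar>y\<bar>) \<longlonglongrightarrow> (indicator (\<Union>i. A i) \<bar>y\<bar> :: complex)" for y
        unfolding ps
      proof (cases "\<bar>y\<bar> \<in> (\<Union>i. A i)")
        case True
        then obtain i where i: "\<bar>y\<bar> \<in> A i" by auto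
        have "\<forall>\<^sub>F n in sequentially. (indicator (\<Union>i<n. A i) \<bar>y\<bar> :: complex) = indicator (\<Union>i. A i) \<bar>y\<bar>"
          by (rule eventually_sequentiallyI[of "Suc i"]) (use i in \<open>auto simp: indicator_def\<close>)
        then show "(\<lambda>n. indicator (\<Union>i<n. A i) \<bar>y\<bar> :: complex) \<longlonglongrightarrow> indicator (\<Union>i. A i) \<bar>y\<bar>"
          by (rule tendsto_eventually)
      qed auto
      show "(norm ((indicator (\<Union>i. A i) \<bar>y\<bar> :: complex) - (\<Sum>i<n. indicator (A i) \<bar>y\<bar>)))\<^sup>2 \<le> 1" for n y
        unfolding ps by (auto simp: indicator_def)
    qed (auto simp: indicator_def)
  qed
qed

text \<open>Simple functions of \<open>|y|\<close> with \<open>|F i| \<le> 2 |f|\<close> give the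
  majorant \<open>9 |f|^2\<close>. The approximating polynomials are arbitrary here; their odd parts
  are discarded in \<open>jacobi_dense_nu\<close>, where the measure is even.\<close>

theorem even_polynomials_dense:
  fixes f :: "real \<Rightarrow> complex"
  assumes f: "f \<in> borel_measurable borel" and int: "integrable \<nu> (\<lambda>y. (norm (f \<bar>y\<bar>))\<^sup>2)"
  shows "approx (\<lambda>y. f \<bar>y\<bar>)"
proof -
  have [measurable]: "f \<in> borel_measurable borel" by fact
  obtain F where F: "\<And>i. simple_function borel (F i)" "\<And>x. (\<lambda>i. F i x) \<longlonglongrightarrow> f x"
    "\<And>i x. dist (F i x) 0 \<le> 2 * dist (f x) 0"
    using borel_measurable_implies_sequence_metric[OF f, of 0] by auto
  have simple: "approx (\<lambda>y. g \<bar>y\<bar>)" if g: "simple_function borel g" for g :: "real \<Rightarrow> complex"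
  proof -
    have fin: "finite (range g)" using g by (simp add: simple_function_def)
    have "g x = (\<Sum>c\<in>range g. c * indicator (g -` {c}) x)" for x
    proof -
      have "(\<Sum>c\<in>range g. c * indicator (g -` {c}) x) = (\<Sum>c\<in>{g x}. c * indicator (g -` {c}) x)"
        by (rule sum.mono_neutral_right[OF fin]) auto
      then show ?thesis by simp
    qed
    then have "(\<lambda>y. g \<bar>y\<bar>) = (\<lambda>y. \<Sum>c\<in>range g. c * indicator (g -` {c}) \<bar>y\<bar>)" by (intro ext)
    moreover have "approx (\<lambda>y. \<Sum>c\<in>range g. c * indicator (g -` {c}) \<bar>y\<bar>)"
      by (intro approx_sum fin approx_mult approx_even_indicator) (use g in \<open>auto simp: simple_function_def\<close>)
    ultimately show ?thesis by simp
  qed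
  show ?thesis
  proof (rule approx_limit[where s = "\<lambda>n y. F n \<bar>y\<bar>"])
    show "(\<lambda>y. f \<bar>y\<bar>) \<in> borel_measurable borel" by measurable
    show "approx (\<lambda>y. F n \<bar>y\<bar>)" for n by (intro simple F)
    show "(\<lambda>n. F n \<bar>y\<bar>) \<longlonglongrightarrow> f \<bar>y\<bar>" for y by (rule F)
    show "integrable \<nu> (\<lambda>y. 9 * (norm (f \<bar>y\<bar>))\<^sup>2)" using int by simp
    show "(norm (f \<bar>y\<bar> - F n \<bar>y\<bar>))\<^sup>2 \<le> 9 * (norm (f \<bar>y\<bar>))\<^sup>2" for n y
    proof -
      have "norm (f \<bar>y\<bar> - F n \<bar>y\<bar>) \<le> 3 * norm (f \<bar>y\<bar>)"
        using norm_triangle_ineq4[of "f \<bar>y\<bar>" "F n \<bar>y\<bar>"] F(3)[of n "\<bar>y\<bar>"] by simp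
      then have "(norm (f \<bar>y\<bar> - F n \<bar>y\<bar>))\<^sup>2 \<le> (3 * norm (f \<bar>y\<bar>))\<^sup>2" by (intro power_mono) auto
      then show ?thesis by (simp add: power_mult_distrib)
    qed
  qed (use int in auto)
qed

end

section \<open>Transforms of Jacobi type functions\<close>

locale jacobi_type = cherednik_opdam b \<iota> for b \<iota> +
  fixes \<sigma> :: real and k :: nat
  assumes \<sigma>_gt: "\<sigma> > 2 * \<rho>"
begin

definition \<tau> :: real where "\<tau> = (\<sigma> + 1 - \<iota>) / 2"

lemma params_pos: "\<sigma> > 0" "\<sigma> - \<rho> > 0" "\<tau> > 0" "\<sigma> / 2 > 0"
  using \<sigma>_gt \<rho>_pos b_pos \<iota>_pos by (auto simp: \<tau>_def \<rho>_def)

definition e_fun :: "nat \<Rightarrow> real poly \<Rightarrow> real \<Rightarrow> real" where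
  "e_fun \<epsilon> r t = cosh t powr (- \<sigma>) * poly r (1 - (tanh t)\<^sup>2) * tanh t ^ \<epsilon>"

lemma e_fun_measurable [measurable]: "e_fun \<epsilon> r \<in> borel_measurable borel"
  unfolding e_fun_def by measurable

lemma abs_tanh_le_1: "\<bar>tanh t\<bar> \<le> 1" for t :: real
  using tanh_real_lt_1[of t] tanh_real_gt_neg1[of t] by simp

lemma tanh_sq_le_1: "(tanh t)\<^sup>2 \<le> 1" for t :: real
  using abs_tanh_le_1[of t] by (simp add: abs_square_le_1)

lemma e_fun_bound: "\<exists>C. \<forall>t. \<bar>e_fun \<epsilon> r t\<bar> \<le> C * cosh t powr (- \<sigma>)"
proof -
  have "bounded (poly r ` {0..1})"
    by (intro compact_imp_bounded compact_continuous_image continuous_intros) auto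
  then obtain C where "\<forall>x\<in>{0..1}. \<bar>poly r x\<bar> \<le> C" by (auto simp: bounded_iff)
  then have C: "\<And>x. x \<in> {0..1} \<Longrightarrow> \<bar>poly r x\<bar> \<le> C" by blast
  have "\<bar>e_fun \<epsilon> r t\<bar> \<le> C * cosh t powr (- \<sigma>)" for t
  proof -
    have "\<bar>poly r (1 - (tanh t)\<^sup>2)\<bar> \<le> C" using tanh_sq_le_1[of t] by (intro C) auto
    moreover have "\<bar>tanh t ^ \<epsilon>\<bar> \<le> 1" using abs_tanh_le_1[of t] by (simp add: power_abs power_le_one)
    ultimately have "\<bar>poly r (1 - (tanh t)\<^sup>2)\<bar> * \<bar>tanh t ^ \<epsilon>\<bar> \<le> C * 1"
      by (intro mult_mono) (auto intro: order_trans[OF abs_ge_zero])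
    then have "cosh t powr (- \<sigma>) * (\<bar>poly r (1 - (tanh t)\<^sup>2)\<bar> * \<bar>tanh t ^ \<epsilon>\<bar>) \<le> cosh t powr (- \<sigma>) * C"
      by (intro mult_left_mono) auto
    then show ?thesis by (simp add: e_fun_def abs_mult mult_ac)
  qed
  then show ?thesis by blast
qed

lemma integrable_e_fun: "integrable (co_mu b \<iota>) (\<lambda>t. complex_of_real (e_fun \<epsilon> r t))"
proof -
  obtain C where C: "\<And>t. \<bar>e_fun \<epsilon> r t\<bar> \<le> C * cosh t powr (- \<sigma>)" using e_fun_bound by blast
  show ?thesis
  proof (rule Bochner_Integration.integrable_bound)
    show "integrable (co_mu b \<iota>) (\<lambda>t. C * cosh t powr (- \<sigma>))"
      using integrable_cosh_powr[OF \<sigma>_gt] by simp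
    show "AE t in co_mu b \<iota>. norm (complex_of_real (e_fun \<epsilon> r t)) \<le> norm (C * cosh t powr (- \<sigma>))"
      using C by (auto intro: order_trans[OF _ abs_ge_self])
  qed measurable
qed

lemma e_fun_sum:
  "e_fun \<epsilon> r t = (\<Sum>j\<le>degree r. coeff r j * (cosh t powr (- (\<sigma> + 2 * real j)) * tanh t ^ \<epsilon>))"
proof -
  have c: "(1 - (tanh t)\<^sup>2) ^ j = cosh t powr (- (2 * real j))" for j
  proof -
    have "1 - (tanh t)\<^sup>2 = 1 / (cosh t)\<^sup>2"
      using hyperbolic_pythagoras[of t] by (simp add: tanh_def power_divide eq_divide_eq left_diff_distrib)
    also have "\<dots> = cosh t powr (- 2)"
      by (simp add: powr_minus powr_numeral inverse_eq_divide)
    finally have "(1 - (tanh t)\<^sup>2) ^ j = (cosh t powr (- 2)) powr (real j)"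
      by (simp add: powr_realpow)
    then show ?thesis by (simp add: powr_powr)
  qed
  have "cosh t powr (- (\<sigma> + 2 * real j)) = cosh t powr (- \<sigma>) * (1 - (tanh t)\<^sup>2) ^ j" for j
    unfolding c by (simp flip: powr_add)
  then show ?thesis
    unfolding e_fun_def poly_altdef by (simp add: sum_distrib_left sum_distrib_right mult_ac)
qed

text \<open>The transform of \<open>(cosh t)^(-\<sigma> - 2 j) (tanh t)^\<epsilon>\<close> relative
  to that for \<open>j = 0\<close>. The shift by \<open>\<epsilon>\<close> in the denominator comes
  from the factor \<open>1 / (\<sigma> + 2 j)\<close> of the odd transforms.\<close>

definition S_fun :: "nat \<Rightarrow> nat \<Rightarrow> complex \<Rightarrow> complex" where
  "S_fun \<epsilon> j l = pochhammer ((of_real (\<sigma> - \<rho>) + l) / 2) j * pochhammer ((of_real (\<sigma> - \<rho>) - l) / 2) j /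
     of_real (pochhammer (\<sigma> / 2 + real \<epsilon>) j * pochhammer \<tau> j)"

definition spec :: "nat \<Rightarrow> real poly \<Rightarrow> complex \<Rightarrow> complex" where
  "spec \<epsilon> r l = (\<Sum>j\<le>degree r. of_real (coeff r j) * S_fun \<epsilon> j l)"

lemma spec_eq: "degree r \<le> N \<Longrightarrow> spec \<epsilon> r l = (\<Sum>j\<le>N. of_real (coeff r j) * S_fun \<epsilon> j l)"
  unfolding spec_def by (rule sum.mono_neutral_left) (auto simp: coeff_eq_0)

lemma spec_add: "spec \<epsilon> (p + q) l = spec \<epsilon> p l + spec \<epsilon> q l"
proof -
  define N where "N = max (degree p) (degree q)"
  have "degree (p + q) \<le> N" "degree p \<le> N" "degree q \<le> N" by (auto simp: N_def degree_add_le_max)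
  then show ?thesis by (simp add: spec_eq ring_distribs sum.distrib)
qed

lemma spec_monom: "spec \<epsilon> (monom c j) l = of_real c * S_fun \<epsilon> j l"
proof -
  have "spec \<epsilon> (monom c j) l = (\<Sum>i\<le>j. of_real (coeff (monom c j) i) * S_fun \<epsilon> i l)"
    by (rule spec_eq) (rule degree_monom_le)
  also have "\<dots> = (\<Sum>i\<le>j. if i = j then of_real c * S_fun \<epsilon> j l else 0)"
    by (intro sum.cong) auto
  finally show ?thesis by simp
qed

lemma spec_0 [simp]: "spec \<epsilon> 0 l = 0" by (simp add: spec_def)

lemma spec_sum: "finite I \<Longrightarrow> spec \<epsilon> (\<Sum>i\<in>I. p i) l = (\<Sum>i\<in>I. spec \<epsilon> (p i) l)"
  by (induction I rule: finite_induct) (auto simp: spec_add)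

lemma im_axis_param:
  assumes "l \<in> im_axis"
  shows "(of_real (\<sigma> - \<rho>) + l) / 2 \<notin> \<int>\<^sub>\<le>\<^sub>0" "(of_real (\<sigma> - \<rho>) - l) / 2 \<notin> \<int>\<^sub>\<le>\<^sub>0"
proof -
  have "Re l = 0" using assms by (simp add: im_axis_def)
  then have "(of_real (\<sigma> - \<rho>) + l) / 2 = Complex ((\<sigma> - \<rho>) / 2) (Im l / 2)"
    "(of_real (\<sigma> - \<rho>) - l) / 2 = Complex ((\<sigma> - \<rho>) / 2) (- Im l / 2)"
    by (simp_all add: complex_eq_iff)
  then show "(of_real (\<sigma> - \<rho>) + l) / 2 \<notin> \<int>\<^sub>\<le>\<^sub>0" "(of_real (\<sigma> - \<rho>) - l) / 2 \<notin> \<int>\<^sub>\<le>\<^sub>0"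
    using params_pos by auto
qed

lemma gamma_factor_shift:
  assumes "l \<in> im_axis"
  shows "gamma_factor (\<sigma> + 2 * real j) l = gamma_factor \<sigma> l * S_fun 0 j l"
    and "gamma_factor (\<sigma> + 2 * real j) l / of_real (\<sigma> + 2 * real j) = gamma_factor \<sigma> l / of_real \<sigma> * S_fun 1 j l"
proof -
  note ip = im_axis_param[OF assms]
  have np: "complex_of_real (\<sigma> / 2) \<notin> \<int>\<^sub>\<le>\<^sub>0" "complex_of_real \<tau> \<notin> \<int>\<^sub>\<le>\<^sub>0"
    by (rule of_real_pos_not_nonpos_Ints[OF params_pos(4)]) (rule of_real_pos_not_nonpos_Ints[OF params_pos(3)])
  have shift: "Gamma (z + of_nat j) = pochhammer z j * Gamma z" if "z \<notin> \<int>\<^sub>\<le>\<^sub>0" for z :: complex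
    using pochhammer_Gamma[OF that, of j] that by (simp add: Gamma_eq_zero_iff)
  have e: "(of_real (\<sigma> + 2 * real j - \<rho>) + l) / 2 = (of_real (\<sigma> - \<rho>) + l) / 2 + of_nat j"
    "(of_real (\<sigma> + 2 * real j - \<rho>) - l) / 2 = (of_real (\<sigma> - \<rho>) - l) / 2 + of_nat j"
    "complex_of_real ((\<sigma> + 2 * real j) / 2) = of_real (\<sigma> / 2) + of_nat j"
    "complex_of_real ((\<sigma> + 2 * real j + 1 - \<iota>) / 2) = of_real \<tau> + of_nat j"
    by (simp_all add: \<tau>_def add_divide_distrib diff_divide_distrib)
  show 1: "gamma_factor (\<sigma> + 2 * real j) l = gamma_factor \<sigma> l * S_fun 0 j l"
    unfolding gamma_factor_def e shift[OF ip(1)] shift[OF ip(2)] shift[OF np(1)] shift[OF np(2)]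
    unfolding S_fun_def \<tau>_def[symmetric]
    by (simp add: pochhammer_of_real[symmetric] mult_ac del: of_real_divide)
  have pp: "pochhammer (\<sigma> / 2 + 1) j > 0" "pochhammer (\<sigma> / 2) j > 0"
    using params_pos by (auto intro!: pochhammer_pos_real simp: add_pos_pos)
  \<comment> \<open>The symbol \<open>(\<sigma> / 2)_(j + 1)\<close> is peeled off at its first and
    at its last factor; comparing both turns \<open>1 / (\<sigma> + 2 j)\<close> into a quotient of
    Pochhammer symbols.\<close>
  have "pochhammer (\<sigma> / 2) (Suc j) = \<sigma> / 2 * pochhammer (\<sigma> / 2 + 1) j" by (simp add: pochhammer_rec)
  then have "(\<sigma> / 2 + real j) * pochhammer (\<sigma> / 2) j = \<sigma> / 2 * pochhammer (\<sigma> / 2 + 1) j"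
    by (simp add: pochhammer_Suc mult.commute)
  then have "(\<sigma> + 2 * real j) * pochhammer (\<sigma> / 2) j = \<sigma> * pochhammer (\<sigma> / 2 + 1) j" by (simp add: field_simps)
  then have r: "1 / ((\<sigma> + 2 * real j) * pochhammer (\<sigma> / 2) j) = 1 / (\<sigma> * pochhammer (\<sigma> / 2 + 1) j)" by simp
  define Z where "Z = pochhammer ((of_real (\<sigma> - \<rho>) + l) / 2) j * pochhammer ((of_real (\<sigma> - \<rho>) - l) / 2) j / of_real (pochhammer \<tau> j)"
  have S: "S_fun 0 j l = Z * of_real (1 / pochhammer (\<sigma> / 2) j)" "S_fun 1 j l = Z * of_real (1 / pochhammer (\<sigma> / 2 + 1) j)"
    by (simp_all add: S_fun_def Z_def)
  have "S_fun 0 j l / of_real (\<sigma> + 2 * real j) = Z * of_real (1 / ((\<sigma> + 2 * real j) * pochhammer (\<sigma> / 2) j))"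
    unfolding S by (simp add: mult.commute)
  also have "\<dots> = S_fun 1 j l / of_real \<sigma>" unfolding r S by (simp add: mult.commute)
  finally have "S_fun 0 j l / of_real (\<sigma> + 2 * real j) = S_fun 1 j l / of_real \<sigma>" .
  then show "gamma_factor (\<sigma> + 2 * real j) l / of_real (\<sigma> + 2 * real j) = gamma_factor \<sigma> l / of_real \<sigma> * S_fun 1 j l"
    unfolding 1 by (metis times_divide_eq_right times_divide_eq_left)
qed

definition spec_factor :: "nat \<Rightarrow> int \<Rightarrow> complex \<Rightarrow> complex" where
  "spec_factor \<epsilon> s l = (if \<epsilon> = 0 then 1 else of_int s * (of_real \<rho> - l) / of_real \<sigma>)"

lemma transform_e_fun:
  assumes l: "l \<in> im_axis" and s: "s \<in> {1, -1::int}" and \<epsilon>: "\<epsilon> \<le> 1"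
  shows "co_transform b \<iota> s (\<lambda>t. of_real (e_fun \<epsilon> r t)) l = spec_factor \<epsilon> s l * gamma_factor \<sigma> l * spec \<epsilon> r l"
proof -
  define f where "f = (\<lambda>j t. complex_of_real (cosh t powr (- (\<sigma> + 2 * real j)) * tanh t ^ \<epsilon>))"
  have int: "integrable (co_mu b \<iota>) (\<lambda>t. f j t * co_kernel b \<iota> l (of_int s * t))" for j
  proof (rule integrable_mult_co_kernel[OF l _ s])
    have p: "\<sigma> + 2 * real j > 2 * \<rho>" using \<sigma>_gt by simp
    have "integrable (co_mu b \<iota>) (\<lambda>t. cosh t powr (- (\<sigma> + 2 * real j)) * tanh t ^ \<epsilon>)"
    proof (rule Bochner_Integration.integrable_bound[OF integrable_cosh_powr[OF p]])
      have "\<bar>tanh t ^ \<epsilon>\<bar> \<le> 1" for t :: real using abs_tanh_le_1[of t] by (simp add: power_abs power_le_one)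
      then show "AE t in co_mu b \<iota>. norm (cosh t powr (- (\<sigma> + 2 * real j)) * tanh t ^ \<epsilon>) \<le> norm (cosh t powr (- (\<sigma> + 2 * real j)))"
        by (simp add: abs_mult mult_left_le del: power_abs)
    qed measurable
    then show "integrable (co_mu b \<iota>) (f j)" unfolding f_def by (rule integrable_of_real)
  qed
  have "co_transform b \<iota> s (\<lambda>t. of_real (e_fun \<epsilon> r t)) l =
      (\<integral>t. (\<Sum>j\<le>degree r. of_real (coeff r j) * (f j t * co_kernel b \<iota> l (of_int s * t))) \<partial>co_mu b \<iota>)"
    unfolding co_transform_def e_fun_sum f_def by (simp add: sum_distrib_right sum_distrib_left mult_ac)
  also have "\<dots> = (\<Sum>j\<le>degree r. of_real (coeff r j) * co_transform b \<iota> s (f j) l)"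
    using int unfolding co_transform_def by (subst Bochner_Integration.integral_sum) auto
  also have "\<dots> = (\<Sum>j\<le>degree r. of_real (coeff r j) * (spec_factor \<epsilon> s l * gamma_factor \<sigma> l * S_fun \<epsilon> j l))"
  proof (intro sum.cong refl)
    fix j
    have p: "\<sigma> + 2 * real j > 2 * \<rho>" using \<sigma>_gt by simp
    have "co_transform b \<iota> s (f j) l = spec_factor \<epsilon> s l * gamma_factor \<sigma> l * S_fun \<epsilon> j l"
    proof (cases "\<epsilon> = 0")
      case True
      then show ?thesis
        using transform_cosh_powr[OF l p s] gamma_factor_shift(1)[OF l, of j] by (simp add: f_def spec_factor_def)
    next
      case False
      then have e1: "\<epsilon> = 1" using \<epsilon> by simp
      have "co_transform b \<iota> s (f j) l = of_int s * (of_real \<rho> - l) * (gamma_factor (\<sigma> + 2 * real j) l / of_real (\<sigma> + 2 * real j))"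
        using transform_cosh_powr_tanh[OF l p s] unfolding f_def e1 by simp
      also have "\<dots> = spec_factor \<epsilon> s l * gamma_factor \<sigma> l * S_fun \<epsilon> j l"
        unfolding gamma_factor_shift(2)[OF l] by (simp add: spec_factor_def e1)
      finally show ?thesis .
    qed
    then show "of_real (coeff r j) * co_transform b \<iota> s (f j) l = of_real (coeff r j) * (spec_factor \<epsilon> s l * gamma_factor \<sigma> l * S_fun \<epsilon> j l)"
      by simp
  qed
  finally show ?thesis by (simp add: spec_def sum_distrib_left mult_ac)
qed

section \<open>Jacobi type functions as polynomials in u\<close>

definition parity :: "int \<Rightarrow> nat" where "parity s = (if s = 1 then 0 else 1)"

definition jac_alpha :: real where "jac_alpha = sigma0 b \<iota> \<sigma>"
definition jac_beta :: "nat \<Rightarrow> real" where "jac_beta \<epsilon> = delta0 b \<iota> + real \<epsilon> + 2 * real k"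

lemma jac_params: "jac_alpha > -1" "jac_beta \<epsilon> > -1" "jac_alpha + 1 = \<sigma> - \<rho>"
    "jac_beta \<epsilon> + 1 = \<gamma> + real \<epsilon> + 2 * real k"
    "jac_alpha + jac_beta \<epsilon> + 2 = \<sigma> + (1 - \<iota>) / 2 + real \<epsilon> + 2 * real k"
  using params_pos b_pos \<iota>_pos by (auto simp: jac_alpha_def sigma0_def jac_beta_def delta0_def \<rho>_def \<gamma>_def field_simps)

text \<open>The factor \<open>tanh^(2 k)\<close> of the function is \<open>(1 - u)^k\<close> in the
  variable \<open>u = 1 - tanh^2\<close>.\<close>

definition jac_rpoly :: "nat \<Rightarrow> nat \<Rightarrow> real poly" where
  "jac_rpoly \<epsilon> n = [:1, -1:] ^ k * jacobi_explicit n jac_alpha (jac_beta \<epsilon>)"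

lemma jacobi_fun_eq:
  assumes s: "s \<in> {1, -1::int}"
  shows "jacobi_fun b \<iota> \<sigma> k n s = (\<lambda>t. of_real (e_fun (parity s) (jac_rpoly (parity s) n) t))"
proof
  fix t
  have P: "poly (jacobi_poly n jac_alpha (jac_beta \<epsilon>)) (2 * (tanh t)\<^sup>2 - 1) =
      poly (jacobi_explicit n jac_alpha (jac_beta \<epsilon>)) (1 - (tanh t)\<^sup>2)" for \<epsilon>
  proof -
    have "(1 - (2 * (tanh t)\<^sup>2 - 1)) / 2 = 1 - (tanh t)\<^sup>2" by simp
    then show ?thesis using poly_jacobi_poly[OF jac_params(1,2), of n \<epsilon> "2 * (tanh t)\<^sup>2 - 1"] by (simp only:)
  qed
  have e: "e_fun \<epsilon> (jac_rpoly \<epsilon> n) t = w_fun \<sigma> k t * poly (jacobi_poly n jac_alpha (jac_beta \<epsilon>)) (2 * (tanh t)\<^sup>2 - 1) * tanh t ^ \<epsilon>" for \<epsilon>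
    unfolding P by (simp add: e_fun_def jac_rpoly_def w_fun_def power_mult)
  show "jacobi_fun b \<iota> \<sigma> k n s t = of_real (e_fun (parity s) (jac_rpoly (parity s) n) t)"
    using s unfolding e by (auto simp: parity_def jacobi_fun_def jac_alpha_def jac_beta_def delta1_def)
qed

text \<open>\<open>(1 - u)^k\<close> is expanded with the coefficients \<open>(-k)_i / i!\<close>.
  Since \<open>(z)_(m + i) = (z)_m (z + m)_i\<close>, the term
  \<open>S_fun \<epsilon> (m + i)\<close> splits off \<open>S_fun \<epsilon> m\<close>, and the sum
  over \<open>i\<close> is a terminating \<open>3F2\<close> at 1 with all parameters other than
  \<open>-k\<close> shifted by \<open>m\<close>.\<close>

lemma spec_jac_rpoly:
  "spec \<epsilon> (jac_rpoly \<epsilon> n) l = (\<Sum>m\<le>n. of_real (jacobi_coeff n jac_alpha (jac_beta \<epsilon>) m) * S_fun \<epsilon> m l *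
     hyp_pFq [- of_nat k, (of_real (\<sigma> - \<rho>) + l) / 2 + of_nat m, (of_real (\<sigma> - \<rho>) - l) / 2 + of_nat m]
       [of_real (\<sigma> / 2 + real \<epsilon>) + of_nat m, of_real \<tau> + of_nat m] 1)"
proof -
  define c where "c = jacobi_coeff n jac_alpha (jac_beta \<epsilon>)"
  let ?a = "(of_real (\<sigma> - \<rho>) + l) / 2" and ?b = "(of_real (\<sigma> - \<rho>) - l) / 2"
  have bin: "([:1, -1:] :: real poly) ^ k = (\<Sum>i\<le>k. monom (pochhammer (- real k) i / fact i) i)"
  proof -
    have "([:1, -1:] :: real poly) = monom (-1) 1 + 1" by (simp add: monom_altdef one_pCons)
    then have "([:1, -1:] :: real poly) ^ k = (\<Sum>i\<le>k. of_nat (k choose i) * monom (-1) 1 ^ i * 1 ^ (k - i))"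
      by (simp only: binomial_ring)
    also have "\<dots> = (\<Sum>i\<le>k. monom (pochhammer (- real k) i / fact i) i)"
    proof (intro sum.cong refl)
      fix i
      have "pochhammer (- real k) i / fact i = (- 1) ^ i * real (k choose i)"
        using gbinomial_pochhammer[of "real k" i] by (simp add: binomial_gbinomial mult_ac flip: power_mult_distrib)
      then show "of_nat (k choose i) * monom (-1) 1 ^ i * 1 ^ (k - i) = monom (pochhammer (- real k) i / fact i) i"
        by (simp add: monom_power of_nat_poly smult_monom mult.commute)
    qed
    finally show ?thesis .
  qed
  have "jac_rpoly \<epsilon> n = (\<Sum>m\<le>n. \<Sum>i\<le>k. monom (c m * (pochhammer (- real k) i / fact i)) (m + i))"
    unfolding jac_rpoly_def bin jacobi_explicit_def c_def[symmetric]
    by (simp add: sum_product mult_monom mult.commute add.commute sum.swap[of _ "{..k}" "{..n}"])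
  then have "spec \<epsilon> (jac_rpoly \<epsilon> n) l = (\<Sum>m\<le>n. \<Sum>i\<le>k. of_real (c m * (pochhammer (- real k) i / fact i)) * S_fun \<epsilon> (m + i) l)"
    by (simp add: spec_sum spec_monom)
  also have "\<dots> = (\<Sum>m\<le>n. of_real (c m) * S_fun \<epsilon> m l *
     hyp_pFq [- of_nat k, ?a + of_nat m, ?b + of_nat m] [of_real (\<sigma> / 2 + real \<epsilon>) + of_nat m, of_real \<tau> + of_nat m] 1)"
  proof (intro sum.cong refl)
    fix m
    define t where "t = (\<lambda>i. pochhammer (- of_nat k) i * (pochhammer (?a + of_nat m) i * pochhammer (?b + of_nat m) i) /
        (pochhammer (of_real (\<sigma> / 2 + real \<epsilon>) + of_nat m) i * pochhammer (of_real \<tau> + of_nat m) i) / (fact i :: complex))"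
    have "hyp_pFq [- of_nat k, ?a + of_nat m, ?b + of_nat m] [of_real (\<sigma> / 2 + real \<epsilon>) + of_nat m, of_real \<tau> + of_nat m] 1 = (\<Sum>i. t i)"
      by (simp add: hyp_pFq_def t_def mult.assoc)
    also have "\<dots> = (\<Sum>i\<le>k. t i)"
    proof (rule suminf_finite)
      fix i assume "i \<notin> {..k}"
      then have "pochhammer (- of_nat k :: complex) i = 0" by (simp add: pochhammer_of_nat_eq_0_iff)
      then show "t i = 0" by (simp add: t_def)
    qed simp
    finally have h: "hyp_pFq [- of_nat k, ?a + of_nat m, ?b + of_nat m] [of_real (\<sigma> / 2 + real \<epsilon>) + of_nat m, of_real \<tau> + of_nat m] 1 = (\<Sum>i\<le>k. t i)" .
    have "of_real (c m * (pochhammer (- real k) i / fact i)) * S_fun \<epsilon> (m + i) l = of_real (c m) * S_fun \<epsilon> m l * t i" for i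
    proof -
      have p: "pochhammer z (m + i) = pochhammer z m * pochhammer (z + of_nat m) i" for z :: complex
        by (rule pochhammer_product')
      have q: "complex_of_real (pochhammer x j) = pochhammer (of_real x) j" for x j
        by (simp add: pochhammer_of_real)
      show ?thesis
        unfolding S_fun_def t_def of_real_mult q p of_real_divide[of "pochhammer (- real k) i"]
        by simp (simp add: mult_ac)
    qed
    then show "(\<Sum>i\<le>k. of_real (c m * (pochhammer (- real k) i / fact i)) * S_fun \<epsilon> (m + i) l) = of_real (c m) * S_fun \<epsilon> m l *
     hyp_pFq [- of_nat k, ?a + of_nat m, ?b + of_nat m] [of_real (\<sigma> / 2 + real \<epsilon>) + of_nat m, of_real \<tau> + of_nat m] 1"
      unfolding h by (simp add: sum_distrib_left)
  qed
  finally show ?thesis by (simp add: c_def)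
qed

text \<open>Factors with opposite signs of \<open>l\<close> combine to
  \<open>((\<sigma> - \<rho>) / 2 + m)^2 - l^2 / 4\<close>. In the variable \<open>- l^2 / 4\<close>
  the degree is exactly \<open>j\<close>, so these polynomials form a graded basis, as completeness
  requires.\<close>

definition S_poly :: "nat \<Rightarrow> nat \<Rightarrow> complex poly" where
  "S_poly \<epsilon> j = smult (1 / of_real (pochhammer (\<sigma> / 2 + real \<epsilon>) j * pochhammer \<tau> j))
     (\<Prod>m<j. [: (of_real ((\<sigma> - \<rho>) / 2 + real m))\<^sup>2, 1 :])"

lemma S_fun_poly: "S_fun \<epsilon> j l = poly (S_poly \<epsilon> j) (- (l\<^sup>2) / 4)"
proof -
  have "pochhammer ((of_real (\<sigma> - \<rho>) + l) / 2) j * pochhammer ((of_real (\<sigma> - \<rho>) - l) / 2) j =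
     (\<Prod>m<j. (of_real ((\<sigma> - \<rho>) / 2 + real m))\<^sup>2 - l\<^sup>2 / 4)"
    unfolding pochhammer_prod atLeast0LessThan prod.distrib[symmetric]
    by (intro prod.cong refl) (simp add: power2_eq_square field_simps)
  then show ?thesis by (simp add: S_fun_def S_poly_def poly_prod)
qed

lemma spec_poly: "\<exists>p. \<forall>l. spec \<epsilon> r l = poly p l"
proof -
  define p where "p = (\<Sum>j\<le>degree r. smult (of_real (coeff r j)) (pcompose (S_poly \<epsilon> j) [:0, 0, -1/4:]))"
  have "spec \<epsilon> r l = poly p l" for l
  proof -
    have "poly [:0, 0, -1/4:] l = - (l\<^sup>2) / 4" by (simp add: power2_eq_square)
    then show ?thesis
      by (simp add: spec_def p_def poly_sum poly_pcompose S_fun_poly)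
  qed
  then show ?thesis by blast
qed

section \<open>Orthogonality\<close>

definition S_real :: "nat \<Rightarrow> nat \<Rightarrow> real \<Rightarrow> real" where
  "S_real \<epsilon> j y = (norm (pochhammer (Complex ((\<sigma> - \<rho>) / 2) (y / 2)) j))\<^sup>2 / (pochhammer (\<sigma> / 2 + real \<epsilon>) j * pochhammer \<tau> j)"

lemma S_fun_imag: "S_fun \<epsilon> j (\<i> * of_real y) = of_real (S_real \<epsilon> j y)"
proof -
  define z where "z = Complex ((\<sigma> - \<rho>) / 2) (y / 2)"
  have e: "(of_real (\<sigma> - \<rho>) + \<i> * of_real y) / 2 = z" "(of_real (\<sigma> - \<rho>) - \<i> * of_real y) / 2 = cnj z"
    by (simp_all add: z_def complex_eq_iff)
  have "pochhammer (cnj z) j = cnj (pochhammer z j)"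
    by (simp add: pochhammer_prod)
  then have "pochhammer z j * pochhammer (cnj z) j = of_real ((norm (pochhammer z j))\<^sup>2)"
    by (simp only: complex_norm_square)
  then show ?thesis unfolding S_fun_def e S_real_def z_def[symmetric] by (simp only: of_real_divide)
qed

lemma S_real_measurable [measurable]: "S_real \<epsilon> j \<in> borel_measurable borel"
  unfolding S_real_def by (intro borel_measurable_continuous_onI continuous_intros)
    (use params_pos in \<open>auto simp: less_imp_neq[symmetric] pochhammer_pos_real add_pos_nonneg intro!: mult_pos_pos less_imp_neq[symmetric]\<close>)

lemma S_real_minus [simp]: "S_real \<epsilon> j (- y) = S_real \<epsilon> j y"
proof -
  have "pochhammer (Complex ((\<sigma> - \<rho>) / 2) (- y / 2)) j = cnj (pochhammer (Complex ((\<sigma> - \<rho>) / 2) (y / 2)) j)"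
    by (simp add: pochhammer_prod cnj_Complex)
  then show ?thesis unfolding S_real_def by (simp only: complex_mod_cnj)
qed

text \<open>The \<open>2 pi^2\<close> cancels the constant of \<open>wilson_integral\<close>, and
  the squares of the Gamma values cancel those left over from
  \<open>wilson_value_shift\<close>.\<close>

definition V_const :: "nat \<Rightarrow> real" where
  "V_const \<epsilon> = 2 powr (2 * \<rho>) / (2 * pi\<^sup>2 * (Gamma (\<sigma> / 2 + real \<epsilon>))\<^sup>2 * (Gamma \<tau>)\<^sup>2)"

text \<open>The weight at \<open>\<lambda> = \<i> y\<close> is Wilson's at \<open>y / 2\<close>; for its relation to the Plancherel density see \<open>V_eq\<close>.\<close>

definition V :: "nat \<Rightarrow> real \<Rightarrow> real" where
  "V \<epsilon> y = V_const \<epsilon> * wilson_kernel (\<rho> / 2 + real \<epsilon>) ((b + 1) / 2) ((\<sigma> - \<rho>) / 2) ((\<sigma> - \<rho>) / 2) (y / 2)"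

lemma wilson_params: "\<rho> / 2 + real \<epsilon> > 0" "(b + 1) / 2 > 0" "(\<sigma> - \<rho>) / 2 + real i > 0" "(\<sigma> - \<rho>) / 2 > 0"
  using \<rho>_pos b_pos params_pos by (auto intro!: add_pos_nonneg)

lemma V_const_pos: "V_const \<epsilon> > 0"
proof -
  have "Gamma (\<sigma> / 2 + real \<epsilon>) > 0" "Gamma \<tau> > 0" using params_pos by (auto intro!: Gamma_real_pos add_pos_nonneg)
  then show ?thesis unfolding V_const_def by (intro divide_pos_pos mult_pos_pos zero_less_power) auto
qed

lemma V_nonneg: "V \<epsilon> y \<ge> 0"
  unfolding V_def by (intro mult_nonneg_nonneg wilson_kernel_nonneg less_imp_le[OF V_const_pos])

lemma V_measurable [measurable]: "V \<epsilon> \<in> borel_measurable borel"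
proof -
  have "wilson_kernel (\<rho> / 2 + real \<epsilon>) ((b + 1) / 2) ((\<sigma> - \<rho>) / 2) ((\<sigma> - \<rho>) / 2) \<in> borel_measurable borel"
    by (intro borel_measurable_continuous_onI continuous_on_wilson_kernel wilson_params)
  then show ?thesis unfolding V_def by measurable
qed

lemma wilson_kernel_minus [simp]: "wilson_kernel a b' c d (- y) = wilson_kernel a b' c d y"
  by (simp add: wilson_kernel_def norm_Gamma_cnj)

lemma V_minus [simp]: "V \<epsilon> (- y) = V \<epsilon> y"
  by (simp add: V_def)

lemma norm_Gamma_shift_sq:
  assumes "a > 0"
  shows "(norm (Gamma (Complex (a + real j) x)))\<^sup>2 = (norm (pochhammer (Complex a x) j))\<^sup>2 * (norm (Gamma (Complex a x)))\<^sup>2"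
proof -
  have "Complex a x + of_nat j = Complex (a + real j) x" by (simp add: complex_eq_iff)
  then have "Gamma (Complex (a + real j) x) = pochhammer (Complex a x) j * Gamma (Complex a x)"
    using pochhammer_Gamma[of "Complex a x" j] assms by (simp add: Gamma_eq_zero_iff)
  then show ?thesis by (simp add: norm_mult power_mult_distrib)
qed

text \<open>\<open>norm_Gamma_shift_sq\<close> absorbs each Pochhammer symbol into a Gamma factor,
  so the two equal parameters \<open>(\<sigma> - \<rho>) / 2\<close> of the weight are raised by
  \<open>i\<close> and \<open>j\<close>.\<close>

lemma V_S_real: "V \<epsilon> y * (S_real \<epsilon> i y * S_real \<epsilon> j y) =
    V_const \<epsilon> / (pochhammer (\<sigma> / 2 + real \<epsilon>) i * pochhammer \<tau> i * (pochhammer (\<sigma> / 2 + real \<epsilon>) j * pochhammer \<tau> j)) *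
    wilson_kernel (\<rho> / 2 + real \<epsilon>) ((b + 1) / 2) ((\<sigma> - \<rho>) / 2 + real i) ((\<sigma> - \<rho>) / 2 + real j) (y / 2)"
  unfolding V_def wilson_kernel_def norm_Gamma_shift_sq[OF wilson_params(4)] S_real_def by (simp add: mult_ac)

lemma wilson_value_shift:
  "wilson_value (\<rho> / 2 + real \<epsilon>) ((b + 1) / 2) ((\<sigma> - \<rho>) / 2 + real i) ((\<sigma> - \<rho>) / 2 + real j) =
     Gamma (\<gamma> + real \<epsilon>) * Gamma (\<sigma> / 2 + real \<epsilon> + real i) * Gamma (\<sigma> / 2 + real \<epsilon> + real j) *
     Gamma (\<tau> + real i) * Gamma (\<tau> + real j) * Gamma (\<sigma> - \<rho> + real (i + j)) / Gamma (\<gamma> + real \<epsilon> + (\<sigma> - \<rho> + real (i + j)))"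
proof -
  have e: "\<rho> / 2 + real \<epsilon> + (b + 1) / 2 = \<gamma> + real \<epsilon>"
    "\<rho> / 2 + real \<epsilon> + ((\<sigma> - \<rho>) / 2 + real i) = \<sigma> / 2 + real \<epsilon> + real i" for i
    by (simp_all add: \<rho>_def \<gamma>_def field_simps)
  have e2: "(b + 1) / 2 + ((\<sigma> - \<rho>) / 2 + real i) = \<tau> + real i" for i
    by (simp add: \<rho>_def \<tau>_def field_simps)
  have e3: "(\<sigma> - \<rho>) / 2 + real i + ((\<sigma> - \<rho>) / 2 + real j) = \<sigma> - \<rho> + real (i + j)"
    by (simp add: field_simps)
  have e4: "\<rho> / 2 + real \<epsilon> + (b + 1) / 2 + ((\<sigma> - \<rho>) / 2 + real i) + ((\<sigma> - \<rho>) / 2 + real j) = \<gamma> + real \<epsilon> + (\<sigma> - \<rho> + real (i + j))"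
    unfolding e by (simp add: field_simps)
  show ?thesis unfolding wilson_value_def e4 e e2 e3 by (simp add: ac_simps)
qed

definition moment :: "nat \<Rightarrow> nat \<Rightarrow> real" where
  "moment \<epsilon> n = Gamma (\<gamma> + real \<epsilon>) * Gamma (\<sigma> - \<rho> + real n) / Gamma (\<gamma> + real \<epsilon> + (\<sigma> - \<rho> + real n))"

text \<open>Of the six Gamma factors in the numerator of Wilson's value four contain
  \<open>i\<close> or \<open>j\<close> alone and cancel against the normalization of
  \<open>S_real\<close>. What remains depends on \<open>i + j\<close>, as it must for the Gram
  matrix of powers of \<open>u\<close>. The leading 2 comes from the argument \<open>y / 2\<close>
  and disappears on the half axis.\<close>

lemma
  shows integrable_V_S_real: "integrable lborel (\<lambda>y. V \<epsilon> y * (S_real \<epsilon> i y * S_real \<epsilon> j y))"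
    and integral_V_S_real: "(LINT y|lborel. V \<epsilon> y * (S_real \<epsilon> i y * S_real \<epsilon> j y)) = 2 * (2 powr (2 * \<rho>) * moment \<epsilon> (i + j))"
proof -
  let ?w = "wilson_kernel (\<rho> / 2 + real \<epsilon>) ((b + 1) / 2) ((\<sigma> - \<rho>) / 2 + real i) ((\<sigma> - \<rho>) / 2 + real j)"
  have int: "integrable lborel ?w" by (intro wilson_kernel_integrable wilson_params)
  have int2: "integrable lborel (\<lambda>y. ?w (y / 2))"
    using lborel_integrable_real_affine[OF int, of "1/2" 0] by simp
  then show "integrable lborel (\<lambda>y. V \<epsilon> y * (S_real \<epsilon> i y * S_real \<epsilon> j y))"
    unfolding V_S_real by (intro integrable_mult_right)
  have half: "(LINT y|lborel. ?w (y / 2)) = 2 * (LINT y|lborel. ?w y)"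
    using lborel_integral_real_affine[of "1/2" ?w 0] by simp
  let ?P = "pochhammer (\<sigma> / 2 + real \<epsilon>)" and ?Q = "pochhammer \<tau>" and ?g = "\<sigma> / 2 + real \<epsilon>"
  have gp: "?g > 0" using params_pos by simp
  have nz: "?P i > 0" "?P j > 0" "?Q i > 0" "?Q j > 0" "Gamma ?g > 0" "Gamma \<tau> > 0"
    using gp params_pos by (auto intro!: pochhammer_pos_real Gamma_real_pos)
  have "(LINT y|lborel. V \<epsilon> y * (S_real \<epsilon> i y * S_real \<epsilon> j y)) =
      V_const \<epsilon> / (?P i * ?Q i * (?P j * ?Q j)) * (2 * (2 * pi\<^sup>2 *
       (Gamma (\<gamma> + real \<epsilon>) * (?P i * Gamma ?g) * (?P j * Gamma ?g) *
     (?Q i * Gamma \<tau>) * (?Q j * Gamma \<tau>) * Gamma (\<sigma> - \<rho> + real (i + j)) / Gamma (\<gamma> + real \<epsilon> + (\<sigma> - \<rho> + real (i + j))))))"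
    unfolding V_S_real integral_mult_right_zero half wilson_integral[OF wilson_params(1,2,3,3)] wilson_value_shift
      Gamma_pochhammer_real[OF gp] Gamma_pochhammer_real[OF params_pos(3)] ..
  also have "\<dots> = 2 * (2 powr (2 * \<rho>) * moment \<epsilon> (i + j))"
  proof -
    have alg: "X / (2 * p * g\<^sup>2 * t\<^sup>2) / (Pi * Qi * (Pj * Qj)) * (2 * (2 * p * (G * (Pi * g) * (Pj * g) * (Qi * t) * (Qj * t) * M / N))) =
        2 * (X * (G * M / N))" if "p \<noteq> 0" "g \<noteq> 0" "t \<noteq> 0" "Pi \<noteq> 0" "Pj \<noteq> 0" "Qi \<noteq> 0" "Qj \<noteq> 0"
      for X p g t Pi Qi Pj Qj G M N :: real
      using that by (simp add: power2_eq_square)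
    show ?thesis unfolding V_const_def moment_def by (rule alg) (use nz in auto)
  qed
  finally show "(LINT y|lborel. V \<epsilon> y * (S_real \<epsilon> i y * S_real \<epsilon> j y)) = 2 * (2 powr (2 * \<rho>) * moment \<epsilon> (i + j))" .
qed

definition spectral_real :: "nat \<Rightarrow> real poly \<Rightarrow> real \<Rightarrow> real" where
  "spectral_real \<epsilon> r y = (\<Sum>j\<le>degree r. coeff r j * S_real \<epsilon> j y)"

lemma spec_imag: "spec \<epsilon> r (\<i> * of_real y) = of_real (spectral_real \<epsilon> r y)"
  by (simp add: spec_def spectral_real_def S_fun_imag)

lemma spectral_real_measurable [measurable]: "spectral_real \<epsilon> r \<in> borel_measurable borel"
  unfolding spectral_real_def by measurable

lemma spectral_real_minus [simp]: "spectral_real \<epsilon> r (- y) = spectral_real \<epsilon> r y"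
  by (simp add: spectral_real_def)

text \<open>The measure \<open>(cosh t)^(-2 \<sigma>) (tanh t)^(2 \<epsilon>) d\<mu>\<close> in the
  variable \<open>\<xi>\<close>, without its constant \<open>2^(2 \<rho>)\<close>.\<close>

definition t_weight :: "nat \<Rightarrow> real \<Rightarrow> real" where
  "t_weight \<epsilon> = beta_weight (\<gamma> + real \<epsilon>) (\<gamma> + real \<epsilon> + (\<sigma> - \<rho>))"

definition tanh_inner :: "nat \<Rightarrow> real poly \<Rightarrow> real poly \<Rightarrow> real" where
  "tanh_inner \<epsilon> p q = (LINT \<xi>|lborel. poly p (1 - logistic \<xi>) * poly q (1 - logistic \<xi>) * t_weight \<epsilon> \<xi>)"

lemma integrable_tanh_inner: "integrable lborel (\<lambda>\<xi>. poly p (1 - logistic \<xi>) * poly q (1 - logistic \<xi>) * t_weight \<epsilon> \<xi>)"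
proof -
  have "integrable lborel (\<lambda>\<xi>. poly (p * q) (1 + (-1) * logistic \<xi>) * t_weight \<epsilon> \<xi>)"
    unfolding t_weight_def using \<gamma>_pos params_pos by (intro integrable_poly_beta_weight) auto
  then show ?thesis by simp
qed

lemma tanh_inner_monom:
  "(LINT \<xi>|lborel. (1 - logistic \<xi>) ^ i * (1 - logistic \<xi>) ^ j * t_weight \<epsilon> \<xi>) = moment \<epsilon> (i + j)"
proof -
  have "(LINT \<xi>|lborel. (1 - logistic \<xi>) ^ i * (1 - logistic \<xi>) ^ j * t_weight \<epsilon> \<xi>) =
     (LINT \<xi>|lborel. beta_weight (\<gamma> + real \<epsilon>) (\<gamma> + real \<epsilon> + (\<sigma> - \<rho> + real (i + j))) \<xi>)"
    unfolding beta_weight_one_minus_logistic t_weight_def beta_weight_mult by (simp add: ac_simps)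
  also have "\<dots> = moment \<epsilon> (i + j)"
    using \<gamma>_pos params_pos by (subst integral_beta_weight) (auto simp: moment_def)
  finally show ?thesis .
qed

lemma tanh_inner_sum: "tanh_inner \<epsilon> p q = (\<Sum>i\<le>degree p. \<Sum>j\<le>degree q. coeff p i * coeff q j * moment \<epsilon> (i + j))"
proof -
  have int: "integrable lborel (\<lambda>\<xi>. (1 - logistic \<xi>) ^ i * (1 - logistic \<xi>) ^ j * t_weight \<epsilon> \<xi>)" for i j
    using integrable_tanh_inner[of "monom 1 i" "monom 1 j" \<epsilon>] by (simp add: poly_monom)
  have e: "poly p x * poly q x * w = (\<Sum>i\<le>degree p. \<Sum>j\<le>degree q. coeff p i * coeff q j * (x ^ i * x ^ j * w))" for x w
    unfolding poly_altdef sum_product unfolding sum_distrib_right by (intro sum.cong refl) (simp add: mult_ac)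
  have "tanh_inner \<epsilon> p q = (LINT \<xi>|lborel. (\<Sum>i\<le>degree p. \<Sum>j\<le>degree q. coeff p i * coeff q j *
      ((1 - logistic \<xi>) ^ i * (1 - logistic \<xi>) ^ j * t_weight \<epsilon> \<xi>)))"
    unfolding tanh_inner_def e ..
  also have "\<dots> = (\<Sum>i\<le>degree p. \<Sum>j\<le>degree q. coeff p i * coeff q j * moment \<epsilon> (i + j))"
    using int by (simp add: Bochner_Integration.integral_sum tanh_inner_monom)
  finally show ?thesis .
qed

text \<open>Bilinear extension of the moment identity. Up to the doubling of the half axis, this is
  the isometry between polynomials in \<open>u\<close> and their spectral images.\<close>

lemma
  shows integrable_V_spectral_real: "integrable lborel (\<lambda>y. V \<epsilon> y * (spectral_real \<epsilon> p y * spectral_real \<epsilon> q y))"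
    and integral_V_spectral_real: "(LINT y|lborel. V \<epsilon> y * (spectral_real \<epsilon> p y * spectral_real \<epsilon> q y)) = 2 * (2 powr (2 * \<rho>) * tanh_inner \<epsilon> p q)"
proof -
  have e: "V \<epsilon> y * (spectral_real \<epsilon> p y * spectral_real \<epsilon> q y) = (\<Sum>i\<le>degree p. \<Sum>j\<le>degree q. coeff p i * coeff q j *
      (V \<epsilon> y * (S_real \<epsilon> i y * S_real \<epsilon> j y)))" for y
    unfolding spectral_real_def sum_product unfolding sum_distrib_left by (intro sum.cong refl) (simp add: mult_ac)
  show "integrable lborel (\<lambda>y. V \<epsilon> y * (spectral_real \<epsilon> p y * spectral_real \<epsilon> q y))"
    unfolding e using integrable_V_S_real by (intro Bochner_Integration.integrable_sum integrable_mult_right)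
  show "(LINT y|lborel. V \<epsilon> y * (spectral_real \<epsilon> p y * spectral_real \<epsilon> q y)) = 2 * (2 powr (2 * \<rho>) * tanh_inner \<epsilon> p q)"
    unfolding e tanh_inner_sum using integrable_V_S_real
    by (simp add: Bochner_Integration.integral_sum integral_V_S_real sum_distrib_left mult_ac)
qed

lemma e_fun_inner: "(\<integral>t. e_fun \<epsilon> p t * e_fun \<epsilon> q t \<partial>co_mu b \<iota>) = 2 powr (2 * \<rho>) * tanh_inner \<epsilon> p q"
proof -
  define h where "h = (\<lambda>\<xi>. exp (- \<sigma> * softplus \<xi>) * (poly p (1 - logistic \<xi>) * poly q (1 - logistic \<xi>)) * logistic \<xi> ^ \<epsilon>)"
  have "(\<integral>t. e_fun \<epsilon> p t * e_fun \<epsilon> q t \<partial>co_mu b \<iota>) = (\<integral>\<xi>. log_weight \<xi> *\<^sub>R h \<xi> \<partial>lborel)"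
  proof (rule integral_co_mu_eq)
    show "h \<in> borel_measurable borel" unfolding h_def by measurable
    show "(\<lambda>t. e_fun \<epsilon> p t * e_fun \<epsilon> q t) \<in> borel_measurable borel" by measurable
    fix t :: real assume t: "t \<noteq> 0"
    have "cosh t powr (- \<sigma>) * cosh t powr (- \<sigma>) = exp (- \<sigma> * softplus (log_sinh_sq t))"
      unfolding cosh_powr_log_sinh_sq[OF t] by (simp flip: exp_add)
    moreover have "tanh t ^ \<epsilon> * tanh t ^ \<epsilon> = logistic (log_sinh_sq t) ^ \<epsilon>"
      unfolding tanh_sq_log_sinh_sq[OF t, symmetric] by (simp add: power2_eq_square flip: power_mult_distrib)
    moreover have "e_fun \<epsilon> p t * e_fun \<epsilon> q t = cosh t powr (- \<sigma>) * cosh t powr (- \<sigma>) *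
        (poly p (1 - (tanh t)\<^sup>2) * poly q (1 - (tanh t)\<^sup>2)) * (tanh t ^ \<epsilon> * tanh t ^ \<epsilon>)"
      by (simp add: e_fun_def mult_ac)
    ultimately show "e_fun \<epsilon> p t * e_fun \<epsilon> q t = h (log_sinh_sq t)"
      unfolding h_def by (simp only: tanh_sq_log_sinh_sq[OF t])
  qed
  also have "\<dots> = (\<integral>\<xi>. 2 powr (2 * \<rho>) * (poly p (1 - logistic \<xi>) * poly q (1 - logistic \<xi>) * t_weight \<epsilon> \<xi>) \<partial>lborel)"
  proof (rule Bochner_Integration.integral_cong[OF refl])
    fix \<xi> :: real
    have "exp (\<gamma> * \<xi> - (1 - \<iota>) / 2 * softplus \<xi>) * exp (- \<sigma> * softplus \<xi>) * logistic \<xi> ^ \<epsilon> = t_weight \<epsilon> \<xi>"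
      unfolding beta_weight_logistic unfolding t_weight_def beta_weight_def exp_add[symmetric]
      by (rule arg_cong[of _ _ exp]) (simp add: \<gamma>_def \<rho>_def field_simps)
    then show "log_weight \<xi> *\<^sub>R h \<xi> = 2 powr (2 * \<rho>) * (poly p (1 - logistic \<xi>) * poly q (1 - logistic \<xi>) * t_weight \<epsilon> \<xi>)"
      by (simp add: log_weight_def h_def mult_ac)
  qed
  finally show ?thesis by (simp add: tanh_inner_def)
qed

text \<open>Each polynomial carries \<open>(1 - u)^k\<close>; the product
  \<open>(1 - u)^(2 k)\<close> moves into the weight, where it raises the second Jacobi parameter by
  \<open>2 k\<close>. This is the origin of that shift in \<open>jacobi_fun\<close>.\<close>

lemma tanh_inner_jacobi_orthogonal:
  assumes "m \<noteq> n"
  shows "tanh_inner \<epsilon> (jac_rpoly \<epsilon> m) (jac_rpoly \<epsilon> n) = 0"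
proof -
  have *: "tanh_inner \<epsilon> (jac_rpoly \<epsilon> n) (jac_rpoly \<epsilon> m) = 0" if "m < n" for m n
  proof -
    let ?J = "\<lambda>n. jacobi_explicit n jac_alpha (jac_beta \<epsilon>)"
    have d: "degree (pcompose (?J m) [:1, -1:]) < n"
      using that by (simp add: degree_pcompose degree_jacobi_explicit jac_params)
    have "tanh_inner \<epsilon> (jac_rpoly \<epsilon> n) (jac_rpoly \<epsilon> m) = (LINT \<xi>|lborel. poly (?J n) (1 - logistic \<xi>) * poly (pcompose (?J m) [:1, -1:]) (logistic \<xi>) *
        beta_weight (jac_beta \<epsilon> + 1) (jac_alpha + jac_beta \<epsilon> + 2) \<xi>)"
      unfolding tanh_inner_def
    proof (rule Bochner_Integration.integral_cong[OF refl])
      fix \<xi> :: real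
      have "logistic \<xi> ^ (2 * k) * t_weight \<epsilon> \<xi> = beta_weight (jac_beta \<epsilon> + 1) (jac_alpha + jac_beta \<epsilon> + 2) \<xi>"
        unfolding beta_weight_logistic t_weight_def beta_weight_mult jac_params
        by (rule arg_cong[of _ _ "\<lambda>z. z"]) (simp add: \<gamma>_def \<rho>_def field_simps)
      moreover have "poly (jac_rpoly \<epsilon> n) (1 - logistic \<xi>) * poly (jac_rpoly \<epsilon> m) (1 - logistic \<xi>) * t_weight \<epsilon> \<xi> =
          poly (?J n) (1 - logistic \<xi>) * poly (?J m) (1 - logistic \<xi>) * (logistic \<xi> ^ (2 * k) * t_weight \<epsilon> \<xi>)"
        by (simp add: jac_rpoly_def mult_2 mult_2_right power_add mult_ac)
      ultimately show "poly (jac_rpoly \<epsilon> n) (1 - logistic \<xi>) * poly (jac_rpoly \<epsilon> m) (1 - logistic \<xi>) * t_weight \<epsilon> \<xi> =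
          poly (?J n) (1 - logistic \<xi>) * poly (pcompose (?J m) [:1, -1:]) (logistic \<xi>) *
          beta_weight (jac_beta \<epsilon> + 1) (jac_alpha + jac_beta \<epsilon> + 2) \<xi>"
        by (simp add: poly_pcompose)
    qed
    also have "\<dots> = 0" by (rule jacobi_explicit_orthogonal[OF jac_params(1,2) d])
    finally show ?thesis .
  qed
  have comm: "tanh_inner \<epsilon> p q = tanh_inner \<epsilon> q p" for p q by (simp add: tanh_inner_def mult_ac)
  show ?thesis using assms *[of m n] *[of n m] comm by (cases "m < n") auto
qed

lemma tanh_inner_self_pos: "p \<noteq> 0 \<Longrightarrow> tanh_inner \<epsilon> p p > 0"
proof -
  assume p: "p \<noteq> 0"
  have "tanh_inner \<epsilon> p p \<ge> 0"
    unfolding tanh_inner_def t_weight_def by (intro integral_nonneg_AE) (auto intro!: AE_I2 mult_nonneg_nonneg[OF zero_le_square] less_imp_le[OF beta_weight_pos])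
  moreover have "tanh_inner \<epsilon> p p \<noteq> 0"
  proof
    assume "tanh_inner \<epsilon> p p = 0"
    then have "(LINT \<xi>|lborel. (poly p (1 + (- 1) * logistic \<xi>))\<^sup>2 * beta_weight (\<gamma> + real \<epsilon>) (\<gamma> + real \<epsilon> + (\<sigma> - \<rho>)) \<xi>) = 0"
      by (simp add: tanh_inner_def t_weight_def power2_eq_square)
    then have "p = 0" using \<gamma>_pos params_pos by (intro poly_square_integral_zero[of _ _ p 1 "-1"]) auto
    then show False using p by simp
  qed
  ultimately show ?thesis by simp
qed

lemma jac_rpoly_nonzero: "jac_rpoly \<epsilon> n \<noteq> 0"
proof -
  have "poly (jacobi_explicit n jac_alpha (jac_beta \<epsilon>)) 0 = pochhammer (jac_alpha + 1) n / fact n"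
    by (simp add: poly_0_coeff_0 coeff_jacobi_explicit jacobi_coeff_def)
  moreover have "pochhammer (jac_alpha + 1) n > 0" using jac_params(1) by (intro pochhammer_pos_real) simp
  ultimately have "jacobi_explicit n jac_alpha (jac_beta \<epsilon>) \<noteq> 0" by auto
  then show ?thesis by (simp add: jac_rpoly_def)
qed

section \<open>The Plancherel density as Wilson's weight\<close>

lemma norm_Gamma_imag_sq:
  assumes "y > 0"
  shows "(norm (Gamma (\<i> * of_real y)))\<^sup>2 = pi / (y * sinh (pi * y))"
proof -
  have "Complex 1 y = \<i> * of_real y + 1" by (simp add: complex_eq_iff)
  moreover have "Gamma (\<i> * of_real y + 1) = \<i> * of_real y * Gamma (\<i> * of_real y)"
    by (rule Gamma_plus1) (use assms in \<open>auto elim!: nonpos_Ints_cases simp: complex_eq_iff\<close>)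
  ultimately have "(norm (Gamma (Complex 1 y)))\<^sup>2 = y\<^sup>2 * (norm (Gamma (\<i> * of_real y)))\<^sup>2"
    by (simp add: norm_mult power_mult_distrib)
  then have "y\<^sup>2 * (norm (Gamma (\<i> * of_real y)))\<^sup>2 = pi * y / sinh (pi * y)"
    using norm_Gamma_1_sq[of y] assms by simp
  then have "(norm (Gamma (\<i> * of_real y)))\<^sup>2 = pi * y / sinh (pi * y) / y\<^sup>2"
    using assms by (simp add: eq_divide_eq mult.commute)
  then show ?thesis using assms by (simp add: power2_eq_square)
qed

lemma c_fun_minus: "c_fun b \<iota> (- (\<i> * of_real y)) = cnj (c_fun b \<iota> (\<i> * of_real y))"
  by (simp add: c_fun_def cnj_Gamma)

text \<open>Legendre's duplication formula at \<open>z = (b + i y) / 2\<close> replaces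
  \<open>Gamma(z) / Gamma(2 z)\<close> by a multiple of \<open>1 / Gamma(z + 1/2)\<close>, which
  creates the parameter \<open>(b + 1) / 2\<close>.\<close>

lemma norm_c_fun_sq:
  assumes y: "y > 0"
  shows "(norm (c_fun b \<iota> (\<i> * of_real y)))\<^sup>2 = pi / (y * sinh (pi * y)) * ((2 powr (1 - b))\<^sup>2 * pi) /
     ((norm (Gamma (Complex ((b + 1) / 2) (y / 2))))\<^sup>2 * (norm (Gamma (Complex (\<rho> / 2) (y / 2))))\<^sup>2)"
proof -
  define z where "z = Complex (b / 2) (y / 2)"
  have e: "\<i> * of_real y / 2 + of_real (b / 2) = z" "\<i> * of_real y + of_real b = 2 * z"
    "z + of_real (\<iota> / 2) = Complex (\<rho> / 2) (y / 2)" "z + 1 / 2 = Complex ((b + 1) / 2) (y / 2)"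
    by (simp_all add: z_def complex_eq_iff \<rho>_def add_divide_distrib)
  have z: "z \<notin> \<int>\<^sub>\<le>\<^sub>0" "z + 1 / 2 \<notin> \<int>\<^sub>\<le>\<^sub>0"
    unfolding e(4) using b_pos by (auto simp: z_def)
  have "norm (Gamma z * Gamma (z + 1/2)) = norm (exp ((1 - 2*z) * of_real (ln 2)) * of_real (sqrt pi) * Gamma (2*z))"
    using Gamma_legendre_duplication[OF z] by simp
  moreover have "norm (exp ((1 - 2*z) * of_real (ln 2))) = 2 powr (1 - b)"
    by (simp add: z_def powr_def)
  ultimately have leg: "norm (Gamma z) * norm (Gamma (z + 1/2)) = 2 powr (1 - b) * sqrt pi * norm (Gamma (2 * z))"
    by (simp add: norm_mult)
  have "Gamma (z + 1/2) \<noteq> 0" using z(2) by (simp add: Gamma_eq_zero_iff)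
  moreover have "Gamma (2 * z) \<noteq> 0" by (rule Gamma_nonzero_pos) (use b_pos in \<open>simp add: z_def\<close>)
  ultimately have nz: "norm (Gamma (z + 1/2)) > 0" "norm (Gamma (2 * z)) > 0" by simp_all
  have "norm (Gamma z) / norm (Gamma (2 * z)) = 2 powr (1 - b) * sqrt pi / norm (Gamma (z + 1/2))"
    using leg nz by (simp add: field_simps)
  then have "norm (c_fun b \<iota> (\<i> * of_real y)) = norm (Gamma (\<i> * of_real y)) * (2 powr (1 - b) * sqrt pi / norm (Gamma (z + 1/2))) /
      norm (Gamma (Complex (\<rho> / 2) (y / 2)))"
    unfolding c_fun_def e norm_divide norm_mult by (metis times_divide_eq_right divide_divide_eq_left)
  then have "(norm (c_fun b \<iota> (\<i> * of_real y)))\<^sup>2 = (norm (Gamma (\<i> * of_real y)))\<^sup>2 * ((2 powr (1 - b))\<^sup>2 * pi / (norm (Gamma (z + 1/2)))\<^sup>2) /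
      (norm (Gamma (Complex (\<rho> / 2) (y / 2))))\<^sup>2"
    by (simp add: power_mult_distrib power_divide)
  then show ?thesis unfolding norm_Gamma_imag_sq[OF y] e by simp
qed

text \<open>At \<open>l = \<rho>\<close> the factor \<open>Gamma(\<rho> + 1)\<close> stands in
  numerator and denominator; the rest is \<open>Gamma(\<gamma> + 1/2) / Gamma(2 \<gamma>)\<close>,
  which the duplication formula evaluates.\<close>

lemma c_minus_rho: "c_minus b \<iota> (of_real \<rho>) = of_real (2 powr (- (\<rho> + b)) * sqrt pi / Gamma \<gamma>)"
proof -
  have e: "complex_of_real \<rho> / 2 + of_real (b / 2) + 1 = of_real \<gamma> + 1 / 2" "complex_of_real \<rho> + of_real b + 1 = 2 * of_real \<gamma>"
    "complex_of_real \<rho> / 2 + of_real (b / 2) + of_real (\<iota> / 2) + 1 = of_real \<rho> + 1"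
    by (simp_all add: \<rho>_def \<gamma>_def field_simps)
  have R: "Gamma (complex_of_real \<rho> + 1) \<noteq> 0" using \<rho>_pos by (intro Gamma_nonzero_pos) simp
  have G: "Gamma (complex_of_real \<gamma>) \<noteq> 0" "Gamma (2 * complex_of_real \<gamma>) \<noteq> 0" using \<gamma>_pos by (auto intro!: Gamma_nonzero_pos)
  have "Gamma (complex_of_real \<gamma>) * Gamma (of_real \<gamma> + 1/2) =
      exp ((1 - 2 * of_real \<gamma>) * of_real (ln 2)) * of_real (sqrt pi) * Gamma (2 * of_real \<gamma>)"
  proof (rule Gamma_legendre_duplication)
    show "complex_of_real \<gamma> \<notin> \<int>\<^sub>\<le>\<^sub>0" by (rule of_real_pos_not_nonpos_Ints[OF \<gamma>_pos])
    show "complex_of_real \<gamma> + 1 / 2 \<notin> \<int>\<^sub>\<le>\<^sub>0" using of_real_pos_not_nonpos_Ints[of "\<gamma> + 1/2"] \<gamma>_pos by simp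
  qed
  moreover have "exp ((1 - 2 * complex_of_real \<gamma>) * of_real (ln 2)) = of_real (2 powr (- (\<rho> + b)))"
  proof -
    have "(1 - 2 * complex_of_real \<gamma>) * of_real (ln 2) = of_real ((- (\<rho> + b)) * ln 2)"
      by (simp add: \<gamma>_def \<rho>_def field_simps)
    then show ?thesis by (simp only: exp_of_real powr_def) simp
  qed
  ultimately have "Gamma (of_real \<gamma> + 1/2) / Gamma (2 * complex_of_real \<gamma>) = of_real (2 powr (- (\<rho> + b))) * of_real (sqrt pi) / Gamma (of_real \<gamma>)"
    using G by (simp add: field_simps)
  then show ?thesis
    unfolding c_minus_def e using R by (simp add: Gamma_complex_of_real)
qed

definition hat_density :: "real \<Rightarrow> real" where
  "hat_density y = 2 powr (- 2 * \<rho>) / (4 * pi\<^sup>2 * (Gamma \<gamma>)\<^sup>2) *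
     ((norm (Gamma (Complex ((b + 1) / 2) (y / 2))))\<^sup>2 * (norm (Gamma (Complex (\<rho> / 2) (y / 2))))\<^sup>2 * (y / 2 * sinh (2 * pi * (y / 2))))"

lemma hat_density_eq:
  assumes y: "y > 0"
  shows "Re (1 / (2 * of_real pi) * ((c_minus b \<iota> (of_real (co_rho b \<iota>)))\<^sup>2 /
     (c_fun b \<iota> (\<i> * of_real y) * c_fun b \<iota> (- (\<i> * of_real y))))) = hat_density y"
proof -
  define C where "C = 2 powr (- (\<rho> + b)) * sqrt pi / Gamma \<gamma>"
  define N where "N = (norm (c_fun b \<iota> (\<i> * of_real y)))\<^sup>2"
  have r: "co_rho b \<iota> = \<rho>" by (simp add: co_rho_def \<rho>_def)
  have "c_fun b \<iota> (\<i> * of_real y) * c_fun b \<iota> (- (\<i> * of_real y)) = of_real N"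
    unfolding c_fun_minus N_def by (rule complex_norm_square[symmetric])
  then have "1 / (2 * of_real pi) * ((c_minus b \<iota> (of_real (co_rho b \<iota>)))\<^sup>2 /
     (c_fun b \<iota> (\<i> * of_real y) * c_fun b \<iota> (- (\<i> * of_real y)))) = of_real (1 / (2 * pi) * (C\<^sup>2 / N))"
    unfolding r c_minus_rho C_def[symmetric] by simp
  then have "Re (1 / (2 * of_real pi) * ((c_minus b \<iota> (of_real (co_rho b \<iota>)))\<^sup>2 /
     (c_fun b \<iota> (\<i> * of_real y) * c_fun b \<iota> (- (\<i> * of_real y))))) = 1 / (2 * pi) * (C\<^sup>2 / N)"
    by (simp only: Re_complex_of_real)
  also have "\<dots> = hat_density y"
  proof -
    define nb where "nb = (norm (Gamma (Complex ((b + 1) / 2) (y / 2))))\<^sup>2"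
    define nr where "nr = (norm (Gamma (Complex (\<rho> / 2) (y / 2))))\<^sup>2"
    define S where "S = y * sinh (pi * y)"
    have N: "N = pi / S * ((2 powr (1 - b))\<^sup>2 * pi) / (nb * nr)"
      unfolding N_def norm_c_fun_sq[OF y] by (simp add: nb_def nr_def S_def)
    have C: "C\<^sup>2 = (2 powr (- (\<rho> + b)))\<^sup>2 * pi / (Gamma \<gamma>)\<^sup>2"
      by (simp add: C_def power_mult_distrib power_divide)
    have p: "(2 powr (- (\<rho> + b)))\<^sup>2 / (2 powr (1 - b))\<^sup>2 = 2 powr (- 2 * \<rho>) / 4"
    proof -
      have "(2 powr (- (\<rho> + b)))\<^sup>2 / (2 powr (1 - b))\<^sup>2 = (2 powr (- (\<rho> + b)) / 2 powr (1 - b)) * (2 powr (- (\<rho> + b)) / 2 powr (1 - b))"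
        by (simp add: power2_eq_square)
      also have "\<dots> = 2 powr (- 2 * \<rho> - 2)"
        by (simp flip: powr_diff powr_add)
      also have "\<dots> = 2 powr (- 2 * \<rho>) / 4" by (simp add: powr_diff)
      finally show ?thesis .
    qed
    have Gz: "Gamma \<gamma> \<noteq> 0" using Gamma_real_pos[OF \<gamma>_pos] by linarith
    have "1 / (2 * pi) * (C\<^sup>2 / N) = ((2 powr (- (\<rho> + b)))\<^sup>2 / (2 powr (1 - b))\<^sup>2) * (nb * nr * S) / (2 * pi\<^sup>2 * (Gamma \<gamma>)\<^sup>2)"
      unfolding N C by (simp add: power2_eq_square mult_ac)
    also have "\<dots> = 2 powr (- 2 * \<rho>) / (4 * pi\<^sup>2 * (Gamma \<gamma>)\<^sup>2) * (nb * nr * (S / 2))"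
      unfolding p by simp
    also have "S / 2 = y / 2 * sinh (2 * pi * (y / 2))" by (simp add: S_def)
    finally show ?thesis by (simp add: hat_density_def nb_def nr_def)
  qed
  finally show ?thesis .
qed

definition gamma_factor_real :: "real \<Rightarrow> real" where
  "gamma_factor_real y = 2 powr (2 * \<rho>) * Gamma \<gamma> * (norm (Gamma (Complex ((\<sigma> - \<rho>) / 2) (y / 2))))\<^sup>2 / (Gamma (\<sigma> / 2) * Gamma \<tau>)"

lemma gamma_factor_imag: "gamma_factor \<sigma> (\<i> * of_real y) = of_real (gamma_factor_real y)"
proof -
  define z where "z = Complex ((\<sigma> - \<rho>) / 2) (y / 2)"
  have e: "(of_real (\<sigma> - \<rho>) + \<i> * of_real y) / 2 = z" "(of_real (\<sigma> - \<rho>) - \<i> * of_real y) / 2 = cnj z"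
    by (simp_all add: z_def complex_eq_iff)
  have n: "Gamma z * Gamma (cnj z) = of_real ((norm (Gamma z))\<^sup>2)"
    unfolding complex_norm_square cnj_Gamma ..
  have "gamma_factor \<sigma> (\<i> * of_real y) = of_real (2 powr (2 * \<rho>)) * Gamma (of_real \<gamma>) * (Gamma z * Gamma (cnj z)) / (Gamma (of_real (\<sigma> / 2)) * Gamma (of_real \<tau>))"
    unfolding gamma_factor_def e \<tau>_def by (simp only: mult.assoc)
  then show ?thesis unfolding n Gamma_complex_of_real gamma_factor_real_def unfolding z_def by simp
qed

lemma gamma_factor_real_pos: "gamma_factor_real y > 0"
proof -
  have "Gamma (Complex ((\<sigma> - \<rho>) / 2) (y / 2)) \<noteq> 0" using params_pos by (intro Gamma_nonzero_pos) simp
  moreover have "Gamma \<gamma> > 0" "Gamma (\<sigma> / 2) > 0" "Gamma \<tau> > 0"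
    using \<gamma>_pos params_pos by (auto intro!: Gamma_real_pos)
  ultimately show ?thesis unfolding gamma_factor_real_def by (intro divide_pos_pos mult_pos_pos) auto
qed

lemma gamma_factor_real_measurable [measurable]: "gamma_factor_real \<in> borel_measurable borel"
proof -
  have "continuous_on UNIV (\<lambda>y. Gamma (Complex ((\<sigma> - \<rho>) / 2) (y / 2)))"
    by (rule continuous_on_compose2[OF continuous_on_Gamma_line[OF wilson_params(4), of UNIV]]) (auto intro!: continuous_intros)
  then have [measurable]: "(\<lambda>y. Gamma (Complex ((\<sigma> - \<rho>) / 2) (y / 2))) \<in> borel_measurable borel"
    by (rule borel_measurable_continuous_onI)
  show ?thesis unfolding gamma_factor_real_def by measurable
qed

lemma hat_density_measurable [measurable]: "hat_density \<in> borel_measurable borel"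
proof -
  have "continuous_on UNIV (\<lambda>y. Gamma (Complex a (y / 2)))" if "a > 0" for a
    by (rule continuous_on_compose2[OF continuous_on_Gamma_line[OF that, of UNIV]]) (auto intro!: continuous_intros)
  then have [measurable]: "(\<lambda>y. Gamma (Complex ((b + 1) / 2) (y / 2))) \<in> borel_measurable borel"
    "(\<lambda>y. Gamma (Complex (\<rho> / 2) (y / 2))) \<in> borel_measurable borel"
    using b_pos \<rho>_pos by (auto intro!: borel_measurable_continuous_onI)
  have [measurable]: "(sinh :: real \<Rightarrow> real) \<in> borel_measurable borel"
    by (intro borel_measurable_continuous_onI continuous_intros)
  show ?thesis unfolding hat_density_def by measurable
qed

lemma hat_density_nonneg: "hat_density y \<ge> 0"
  unfolding hat_density_def by (rule mult_nonneg_nonneg[OF _ mult_nonneg_nonneg[OF _ y_sinh_nonneg]]) simp_all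

definition parity_factor :: "nat \<Rightarrow> real \<Rightarrow> complex" where
  "parity_factor \<epsilon> y = (if \<epsilon> = 0 then 1 else (of_real \<rho> - \<i> * of_real y) / of_real \<sigma>)"

lemma parity_factor_measurable [measurable]: "parity_factor \<epsilon> \<in> borel_measurable borel"
  unfolding parity_factor_def by measurable

lemma parity_factor_nonzero: "parity_factor \<epsilon> y \<noteq> 0"
proof -
  have "of_real \<rho> - \<i> * of_real y \<noteq> 0"
    using \<rho>_pos by (auto simp: complex_eq_iff)
  then show ?thesis using params_pos by (simp add: parity_factor_def)
qed

lemma spec_factor_imag: "s \<in> {1, -1::int} \<Longrightarrow> \<epsilon> \<le> 1 \<Longrightarrow> spec_factor \<epsilon> s (\<i> * of_real y) = of_int s ^ \<epsilon> * parity_factor \<epsilon> y"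
  by (cases "\<epsilon> = 0"; cases "\<epsilon> = 1") (auto simp: spec_factor_def parity_factor_def)

text \<open>The 2 counts the two components of a pair, which have equal modulus. For
  \<open>\<epsilon> = 1\<close> the factor \<open>|\<rho> - i y|^2 / \<sigma>^2\<close> is absorbed
  by the functional equation, raising \<open>\<rho> / 2\<close> in the weight and
  \<open>\<sigma> / 2\<close> in \<open>V_const\<close> by 1.\<close>

lemma V_eq:
  assumes "\<epsilon> \<le> 1"
  shows "2 * hat_density y * (gamma_factor_real y)\<^sup>2 * (norm (parity_factor \<epsilon> y))\<^sup>2 = V \<epsilon> y"
proof -
  define x where "x = y / 2"
  define nA nb nr S where "nA = (norm (Gamma (Complex ((\<sigma> - \<rho>) / 2) x)))\<^sup>2" and "nb = (norm (Gamma (Complex ((b + 1) / 2) x)))\<^sup>2"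
    and "nr = (norm (Gamma (Complex (\<rho> / 2) x)))\<^sup>2" and "S = x * sinh (2 * pi * x)"
  have G: "Gamma \<gamma> \<noteq> 0" "Gamma (\<sigma> / 2) \<noteq> 0" "Gamma \<tau> \<noteq> 0"
    using Gamma_real_pos[OF \<gamma>_pos] Gamma_real_pos[OF params_pos(4)] Gamma_real_pos[OF params_pos(3)] by linarith+
  have p: "2 powr (- 2 * \<rho>) * (2 powr (2 * \<rho>))\<^sup>2 = 2 powr (2 * \<rho>)"
    by (simp add: power2_eq_square flip: powr_add)
  have base: "2 * hat_density y * (gamma_factor_real y)\<^sup>2 = 2 powr (2 * \<rho>) / (2 * pi\<^sup>2 * (Gamma (\<sigma> / 2))\<^sup>2 * (Gamma \<tau>)\<^sup>2) * (nr * nb * nA * nA * S)"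
  proof -
    have alg: "2 * (q / (4 * P * g\<^sup>2) * (B * R * T)) * (Q * g * X / (s * t))\<^sup>2 = q * Q\<^sup>2 / (2 * P * s\<^sup>2 * t\<^sup>2) * (R * B * X * X * T)"
      if "g \<noteq> 0" for q P g B R T Q X s t :: real
      using that by (simp add: power2_eq_square mult_ac)
    have "2 * hat_density y * (gamma_factor_real y)\<^sup>2 = 2 * (2 powr (- 2 * \<rho>) / (4 * pi\<^sup>2 * (Gamma \<gamma>)\<^sup>2) * (nb * nr * S)) *
        (2 powr (2 * \<rho>) * Gamma \<gamma> * nA / (Gamma (\<sigma> / 2) * Gamma \<tau>))\<^sup>2"
      unfolding hat_density_def gamma_factor_real_def nA_def nb_def nr_def S_def x_def ..
    also have "\<dots> = 2 powr (- 2 * \<rho>) * (2 powr (2 * \<rho>))\<^sup>2 / (2 * pi\<^sup>2 * (Gamma (\<sigma> / 2))\<^sup>2 * (Gamma \<tau>)\<^sup>2) * (nr * nb * nA * nA * S)"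
      by (rule alg[OF G(1)])
    finally show ?thesis unfolding p .
  qed
  show ?thesis
  proof (cases "\<epsilon> = 0")
    case True
    then show ?thesis
      unfolding base by (simp add: parity_factor_def V_def V_const_def wilson_kernel_def nA_def nb_def nr_def S_def x_def)
  next
    case False
    then have e1: "\<epsilon> = 1" using assms by simp
    have n1: "(norm (parity_factor \<epsilon> y))\<^sup>2 = ((\<rho> / 2)\<^sup>2 + x\<^sup>2) / (\<sigma> / 2)\<^sup>2"
    proof -
      have "(norm (of_real \<rho> - \<i> * of_real y))\<^sup>2 = \<rho>\<^sup>2 + y\<^sup>2" by (simp add: cmod_power2)
      then show ?thesis using params_pos by (simp add: parity_factor_def e1 norm_divide power_divide x_def field_simps)
    qed
    have n2: "(norm (Gamma (Complex (\<rho> / 2 + 1) x)))\<^sup>2 = ((\<rho> / 2)\<^sup>2 + x\<^sup>2) * nr"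
      unfolding nr_def using \<rho>_pos by (intro norm_Gamma_plus1_sq) simp
    have g2: "Gamma (\<sigma> / 2 + 1) = \<sigma> / 2 * Gamma (\<sigma> / 2)" by (rule Gamma_real_plus1[OF params_pos(4)])
    have alg: "c / (2 * P * (s * g)\<^sup>2 * t\<^sup>2) * (d * r * B * A * A * T) = c / (2 * P * g\<^sup>2 * t\<^sup>2) * (r * B * A * A * T) * (d / s\<^sup>2)"
      for c P s g t d r B A T :: real by (simp add: power_mult_distrib mult_ac)
    have "V \<epsilon> y = 2 powr (2 * \<rho>) / (2 * pi\<^sup>2 * (\<sigma> / 2 * Gamma (\<sigma> / 2))\<^sup>2 * (Gamma \<tau>)\<^sup>2) * (((\<rho> / 2)\<^sup>2 + x\<^sup>2) * nr * nb * nA * nA * S)"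
      unfolding V_def V_const_def wilson_kernel_def e1 x_def[symmetric] of_nat_1 n2 g2 nA_def nb_def S_def ..
    also have "\<dots> = 2 powr (2 * \<rho>) / (2 * pi\<^sup>2 * (Gamma (\<sigma> / 2))\<^sup>2 * (Gamma \<tau>)\<^sup>2) * (nr * nb * nA * nA * S) * (((\<rho> / 2)\<^sup>2 + x\<^sup>2) / (\<sigma> / 2)\<^sup>2)"
      by (rule alg)
    finally show ?thesis unfolding base n1 by simp
  qed
qed

section \<open>Integrals over the half axis\<close>

lemma hat_map_measurable: "(\<lambda>y. \<i> * complex_of_real y) \<in> measurable (restrict_space lborel {0<..}) (restrict_space borel im_half_axis)"
proof (rule measurable_restrict_space3)
  show "(\<lambda>y. \<i> * complex_of_real y) \<in> {0<..} \<rightarrow> im_half_axis" by (auto simp: im_half_axis_def)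
qed measurable

lemma co_mu_hat_eq: "co_mu_hat b \<iota> = distr (density (restrict_space lborel {0<..}) (\<lambda>y. ennreal (hat_density y)))
     (restrict_space borel im_half_axis) (\<lambda>y. \<i> * complex_of_real y)"
proof -
  have "density (restrict_space lborel {0<..}) (\<lambda>y. let l = \<i> * complex_of_real y in
             ennreal (Re (1 / (2 * of_real pi) *
               ((c_minus b \<iota> (of_real (co_rho b \<iota>)))\<^sup>2 / (c_fun b \<iota> l * c_fun b \<iota> (- l)))))) =
      density (restrict_space lborel {0<..}) (\<lambda>y. ennreal (hat_density y))"
    unfolding density_def Let_def
    by (intro arg_cong2[where f = "\<lambda>S f. measure_of _ S f"] refl ext nn_integral_cong)
      (subst hat_density_eq, simp_all add: space_restrict_space)
  then show ?thesis unfolding co_mu_hat_def by (simp only:)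
qed

lemma
  fixes \<Phi> :: "complex \<Rightarrow> 'a::{banach, second_countable_topology}"
  assumes \<Phi>: "\<Phi> \<in> borel_measurable (restrict_space borel im_half_axis)"
  shows integrable_hat_iff: "integrable (co_mu_hat b \<iota>) \<Phi> \<longleftrightarrow>
      integrable lborel (\<lambda>y. indicator {0<..} y *\<^sub>R (hat_density y *\<^sub>R \<Phi> (\<i> * of_real y)))" (is ?A)
    and integral_hat_eq: "(\<integral>l. \<Phi> l \<partial>co_mu_hat b \<iota>) =
      (LINT y|lborel. indicator {0<..} y *\<^sub>R (hat_density y *\<^sub>R \<Phi> (\<i> * of_real y)))" (is ?B)
proof -
  let ?R = "restrict_space lborel {0<..} :: real measure"
  have m: "(\<lambda>y. \<i> * complex_of_real y) \<in> measurable (density ?R (\<lambda>y. ennreal (hat_density y))) (restrict_space borel im_half_axis)"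
    using hat_map_measurable by simp
  have Pm: "(\<lambda>y. \<Phi> (\<i> * of_real y)) \<in> borel_measurable ?R"
    by (rule measurable_compose[OF hat_map_measurable \<Phi>])
  have hm: "hat_density \<in> borel_measurable ?R"
    by (rule measurable_restrict_space1) simp
  have S: "{0<..} \<inter> space (lborel :: real measure) \<in> sets lborel" by simp
  have "integrable (co_mu_hat b \<iota>) \<Phi> \<longleftrightarrow> integrable (density ?R (\<lambda>y. ennreal (hat_density y))) (\<lambda>y. \<Phi> (\<i> * of_real y))"
    unfolding co_mu_hat_eq by (rule integrable_distr_eq[OF m \<Phi>])
  also have "\<dots> \<longleftrightarrow> integrable ?R (\<lambda>y. hat_density y *\<^sub>R \<Phi> (\<i> * of_real y))"
    by (rule integrable_density[OF Pm hm]) (simp add: hat_density_nonneg)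
  also have "\<dots> \<longleftrightarrow> integrable lborel (\<lambda>y. indicator {0<..} y *\<^sub>R (hat_density y *\<^sub>R \<Phi> (\<i> * of_real y)))"
    by (rule integrable_restrict_space[OF S])
  finally show ?A .
  have "(\<integral>l. \<Phi> l \<partial>co_mu_hat b \<iota>) = (\<integral>y. \<Phi> (\<i> * of_real y) \<partial>density ?R (\<lambda>y. ennreal (hat_density y)))"
    unfolding co_mu_hat_eq by (rule integral_distr[OF m \<Phi>])
  also have "\<dots> = (\<integral>y. hat_density y *\<^sub>R \<Phi> (\<i> * of_real y) \<partial>?R)"
    by (rule integral_density[OF Pm hm]) (simp add: hat_density_nonneg)
  also have "\<dots> = (LINT y|lborel. indicator {0<..} y *\<^sub>R (hat_density y *\<^sub>R \<Phi> (\<i> * of_real y)))"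
    by (rule integral_restrict_space[OF S])
  finally show ?B .
qed

end

lemma
  fixes F :: "real \<Rightarrow> 'a::{banach, second_countable_topology}"
  assumes F [measurable]: "F \<in> borel_measurable borel" and even: "\<And>y. F (- y) = F y"
  shows integrable_even_half: "integrable lborel (\<lambda>y. indicator {0<..} y *\<^sub>R F y) \<longleftrightarrow> integrable lborel F" (is ?A)
    and integral_even_half: "(LINT y|lborel. F y) = 2 *\<^sub>R (LINT y|lborel. indicator {0<..} y *\<^sub>R F y)" (is ?B)
proof -
  let ?P = "\<lambda>y. indicator {0<..} y *\<^sub>R F y" and ?N = "\<lambda>y. indicator {0<..} (- y) *\<^sub>R F (- y)"
  have ae: "AE y in lborel. F y = ?P y + ?N y"
    by (rule AE_mp[OF AE_lborel_singleton[of 0]]) (auto simp: indicator_def even)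
  have N: "integrable lborel ?N" if "integrable lborel ?P"
    using lborel_integrable_real_affine[OF that, of "-1" 0] by simp
  have Nint: "(LINT y|lborel. ?N y) = (LINT y|lborel. ?P y)"
    using lborel_integral_real_affine[of "-1" ?P 0] by simp
  show A: ?A
  proof
    assume i: "integrable lborel ?P"
    then have "integrable lborel (\<lambda>y. ?P y + ?N y)" by (intro Bochner_Integration.integrable_add N)
    then show "integrable lborel F" using ae by (subst integrable_cong_AE[of F _ "\<lambda>y. ?P y + ?N y"]) auto
  next
    assume "integrable lborel F"
    then show "integrable lborel ?P" by (intro integrable_mult_indicator) auto
  qed
  show ?B
  proof (cases "integrable lborel F")
    case True
    then have i: "integrable lborel ?P" using A by simp
    have "(LINT y|lborel. F y) = (LINT y|lborel. ?P y + ?N y)" by (rule integral_cong_AE) (use ae in auto)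
    also have "\<dots> = (LINT y|lborel. ?P y) + (LINT y|lborel. ?N y)" by (rule Bochner_Integration.integral_add[OF i N[OF i]])
    also have "\<dots> = 2 *\<^sub>R (LINT y|lborel. ?P y)" unfolding Nint by (simp add: scaleR_2)
    finally show ?thesis .
  next
    case False
    then have "\<not> integrable lborel ?P" using A by simp
    then show ?thesis using False by (simp add: not_integrable_integral_eq)
  qed
qed

section \<open>Completeness\<close>

lemma graded_family_spans:
  fixes p :: "nat \<Rightarrow> 'a::field poly"
  assumes deg: "\<And>n. degree (p n) = n" and nz: "\<And>n. p n \<noteq> 0" and q: "\<And>i. i \<ge> N \<Longrightarrow> coeff q i = 0"
  shows "\<exists>c. q = (\<Sum>n<N. smult (c n) (p n))"
  using q
proof (induction N arbitrary: q)
  case 0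
  then have "q = 0" by (intro poly_eqI) simp
  then show ?case by simp
next
  case (Suc N)
  define a where "a = coeff q N / coeff (p N) N"
  have "coeff (p N) N \<noteq> 0" using nz[of N] deg[of N] leading_coeff_0_iff by fastforce
  then have "coeff (q - smult a (p N)) i = 0" if "i \<ge> N" for i
    using that Suc.prems[of i] deg[of N] by (cases "i = N") (auto simp: a_def coeff_eq_0)
  then obtain c where c: "q - smult a (p N) = (\<Sum>n<N. smult (c n) (p n))" using Suc.IH by blast
  have "(\<Sum>n<N. smult ((c(N := a)) n) (p n)) = (\<Sum>n<N. smult (c n) (p n))" by (intro sum.cong) auto
  then have "q = (\<Sum>n<Suc N. smult ((c(N := a)) n) (p n))" using c by (simp add: algebra_simps)
  then show ?case by blast
qed

text \<open>The argument \<open>x^2 / 4\<close> is the one at which \<open>S_poly\<close> is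
  evaluated on the imaginary axis.\<close>

lemma poly_even_odd_split: "\<exists>Q R. \<forall>x. poly P x = poly Q (x\<^sup>2 / 4) + x * poly R (x\<^sup>2 / 4)"
  for P :: "'a::field_char_0 poly"
proof (induction P)
  case 0
  then show ?case by (intro exI[of _ 0]) simp
next
  case (pCons a P)
  then obtain Q R where QR: "\<And>x. poly P x = poly Q (x\<^sup>2 / 4) + x * poly R (x\<^sup>2 / 4)" by blast
  have "poly (pCons a P) x = poly ([:a:] + [:0, 4:] * R) (x\<^sup>2 / 4) + x * poly Q (x\<^sup>2 / 4)" for x
    by (simp add: QR power2_eq_square algebra_simps)
  then show ?case by blast
qed

context jacobi_type
begin

definition nu :: "nat \<Rightarrow> real measure" where "nu \<epsilon> = density lborel (\<lambda>y. ennreal (V \<epsilon> y))"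

lemma V_decay: "\<exists>C. \<forall>y. V \<epsilon> y \<le> C * exp (- (pi / 4) * \<bar>y\<bar>)"
proof -
  obtain C where C: "\<And>y. wilson_kernel (\<rho> / 2 + real \<epsilon>) ((b + 1) / 2) ((\<sigma> - \<rho>) / 2) ((\<sigma> - \<rho>) / 2) y \<le> C * exp (- (pi / 2) * \<bar>y\<bar>)"
    using wilson_kernel_decay[OF wilson_params(1,2,4,4)] by blast
  have "V \<epsilon> y \<le> V_const \<epsilon> * C * exp (- (pi / 4) * \<bar>y\<bar>)" for y
    unfolding V_def using mult_left_mono[OF C[of "y / 2"] less_imp_le[OF V_const_pos[of \<epsilon>]]] by (simp add: mult.assoc)
  then show ?thesis by blast
qed

lemma
  fixes f :: "real \<Rightarrow> 'a::{banach, second_countable_topology}"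
  assumes "f \<in> borel_measurable borel"
  shows integrable_nu_iff: "integrable (nu \<epsilon>) f \<longleftrightarrow> integrable lborel (\<lambda>y. V \<epsilon> y *\<^sub>R f y)"
    and integral_nu: "(LINT y|nu \<epsilon>. f y) = (LINT y|lborel. V \<epsilon> y *\<^sub>R f y)"
  unfolding nu_def using assms by (auto simp: V_nonneg integrable_density integral_density)

text \<open>The exponent \<open>pi / 8\<close> is half of the decay rate in \<open>V_decay\<close>,
  so the product still decays.\<close>

lemma exp_moment_measure_nu: "exp_moment_measure (nu \<epsilon>) (pi / 8)"
proof -
  obtain C where C: "\<And>y. V \<epsilon> y \<le> C * exp (- (pi / 4) * \<bar>y\<bar>)" using V_decay by blast
  have exp: "integrable (nu \<epsilon>) (\<lambda>y. exp (pi / 8 * \<bar>y\<bar>))"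
  proof (subst integrable_nu_iff)
    show "integrable lborel (\<lambda>y. V \<epsilon> y *\<^sub>R exp (pi / 8 * \<bar>y\<bar>))"
    proof (rule integrable_exp_bound[of "pi / 8" _ C])
      fix y
      have "V \<epsilon> y * exp (pi / 8 * \<bar>y\<bar>) \<le> C * exp (- (pi / 4) * \<bar>y\<bar>) * exp (pi / 8 * \<bar>y\<bar>)"
        by (intro mult_right_mono C) simp
      also have "\<dots> = C * exp (- (pi / 8) * \<bar>y\<bar>)" by (simp add: mult.assoc flip: exp_add)
      finally show "norm (V \<epsilon> y *\<^sub>R exp (pi / 8 * \<bar>y\<bar>)) \<le> C * exp (- (pi / 8) * \<bar>y\<bar>)"
        using V_nonneg[of \<epsilon> y] by simp
    qed auto
  qed simp
  have "integrable (nu \<epsilon>) (\<lambda>y. 1 :: real)"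
    by (rule Bochner_Integration.integrable_bound[OF exp]) (auto simp: nu_def)
  then have "finite_measure (nu \<epsilon>)"
    by (intro finite_measureI) (auto simp: integrable_iff_bounded nu_def)
  then show ?thesis
    unfolding exp_moment_measure_def exp_moment_measure_axioms_def using exp by (auto simp: nu_def)
qed

lemma integral_nu_minus:
  fixes f :: "real \<Rightarrow> real"
  assumes [measurable]: "f \<in> borel_measurable borel"
  shows "(LINT y|nu \<epsilon>. f (- y)) = (LINT y|nu \<epsilon>. f y)"
proof -
  have "(LINT y|nu \<epsilon>. f (- y)) = (LINT y|lborel. V \<epsilon> (- y) *\<^sub>R f (- y))" by (subst integral_nu) simp_all
  also have "\<dots> = (LINT y|lborel. V \<epsilon> y *\<^sub>R f y)"
    using lborel_integral_real_affine[of "-1" "\<lambda>y. V \<epsilon> y *\<^sub>R f y" 0] by simp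
  finally show ?thesis by (simp add: integral_nu)
qed

lemma spectral_real_smult: "spectral_real \<epsilon> (smult c p) y = c * spectral_real \<epsilon> p y"
  by (cases "c = 0") (simp_all add: spectral_real_def sum_distrib_left mult.assoc)

lemma spectral_real_add: "spectral_real \<epsilon> (p + q) y = spectral_real \<epsilon> p y + spectral_real \<epsilon> q y"
  using spec_add[of \<epsilon> p q "\<i> * of_real y"] unfolding spec_imag by (simp flip: of_real_add)

lemma spectral_real_diff: "spectral_real \<epsilon> (p - q) y = spectral_real \<epsilon> p y - spectral_real \<epsilon> q y"
  using spectral_real_add[of \<epsilon> p "smult (-1) q" y] unfolding spectral_real_smult by simp

lemma spectral_real_sum: "finite I \<Longrightarrow> spectral_real \<epsilon> (\<Sum>i\<in>I. p i) y = (\<Sum>i\<in>I. spectral_real \<epsilon> (p i) y)"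
proof (induction I rule: finite_induct)
  case empty
  then show ?case by (simp add: spectral_real_def)
qed (simp add: spectral_real_add)

lemma spectral_real_monom: "spectral_real \<epsilon> (monom c j) y = c * S_real \<epsilon> j y"
  using spec_monom[of \<epsilon> c j "\<i> * of_real y"] unfolding spec_imag S_fun_imag by (simp flip: of_real_mult)

lemma degree_S_poly: "degree (S_poly \<epsilon> j) = j" and S_poly_nonzero: "S_poly \<epsilon> j \<noteq> 0"
proof -
  have c: "pochhammer (\<sigma> / 2 + real \<epsilon>) j * pochhammer \<tau> j \<noteq> 0"
    using params_pos by (intro less_imp_neq[symmetric] mult_pos_pos pochhammer_pos_real add_pos_nonneg) auto
  have "degree (\<Prod>m<n. [: (complex_of_real ((\<sigma> - \<rho>) / 2 + real m))\<^sup>2, 1 :]) = n \<and> (\<Prod>m<n. [: (complex_of_real ((\<sigma> - \<rho>) / 2 + real m))\<^sup>2, 1 :]) \<noteq> 0" for n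
  proof (induction n)
    case (Suc n)
    then show ?case unfolding prod.lessThan_Suc by (simp add: degree_mult_eq no_zero_divisors del: mult_pCons_right of_real_add of_real_divide of_real_diff)
  qed simp
  then show "degree (S_poly \<epsilon> j) = j" "S_poly \<epsilon> j \<noteq> 0" unfolding S_poly_def using c by (simp_all del: of_real_mult)
qed

text \<open>\<open>spectral_real\<close> takes real polynomials, so the complex coefficients of
  \<open>Q\<close> in the basis \<open>S_poly\<close> are split into real and imaginary parts;
  \<open>S_real\<close> is real, so the parts do not mix.\<close>

lemma even_poly_spec:
  "\<exists>r s. \<forall>y. poly Q (complex_of_real (y\<^sup>2 / 4)) = of_real (spectral_real \<epsilon> r y) + \<i> * of_real (spectral_real \<epsilon> s y)"
proof -
  obtain c where c: "Q = (\<Sum>n<Suc (degree Q). smult (c n) (S_poly \<epsilon> n))"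
    using graded_family_spans[of "S_poly \<epsilon>" "Suc (degree Q)" Q] degree_S_poly S_poly_nonzero coeff_eq_0
    by (metis Suc_le_lessD)
  define N where "N = Suc (degree Q)"
  have S: "poly (S_poly \<epsilon> j) (complex_of_real (y\<^sup>2 / 4)) = of_real (S_real \<epsilon> j y)" for j y
  proof -
    have "- ((\<i> * complex_of_real y)\<^sup>2) / 4 = of_real (y\<^sup>2 / 4)" by (simp add: power_mult_distrib)
    then show ?thesis using S_fun_poly[of \<epsilon> j "\<i> * of_real y"] unfolding S_fun_imag by simp
  qed
  have "poly Q (complex_of_real (y\<^sup>2 / 4)) = of_real (spectral_real \<epsilon> (\<Sum>n<N. monom (Re (c n)) n) y) + \<i> * of_real (spectral_real \<epsilon> (\<Sum>n<N. monom (Im (c n)) n) y)" for y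
  proof -
    have "poly Q (complex_of_real (y\<^sup>2 / 4)) = (\<Sum>n<N. c n * of_real (S_real \<epsilon> n y))"
      by (subst c) (simp only: poly_sum poly_smult S N_def)
    also have "\<dots> = (\<Sum>n<N. (of_real (Re (c n)) + \<i> * of_real (Im (c n))) * of_real (S_real \<epsilon> n y))"
      by (simp only: complex_eq[symmetric])
    finally show ?thesis
      by (simp add: spectral_real_sum spectral_real_monom ring_distribs sum.distrib sum_distrib_left mult.assoc)
  qed
  then show ?thesis by blast
qed

text \<open>The factor \<open>(1 - u)\<^sup>k\<close> common to all \<^term>\<open>jac_rpoly\<close> is harmless: \<open>(1 - u\<^sup>M)\<^sup>k\<close> is a multiple of it and tends to 1.\<close>

lemma tanh_inner_truncate:
  "(\<lambda>M. tanh_inner \<epsilon> (r - r * (1 - monom 1 M) ^ k) (r - r * (1 - monom 1 M) ^ k)) \<longlonglongrightarrow> 0"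
proof -
  let ?u = "\<lambda>\<xi>. 1 - logistic \<xi>"
  have u: "0 < ?u \<xi>" "?u \<xi> < 1" for \<xi> using logistic_bounds[of \<xi>] by auto
  have w: "t_weight \<epsilon> \<xi> > 0" for \<xi> unfolding t_weight_def by (rule beta_weight_pos)
  have wm [measurable]: "t_weight \<epsilon> \<in> borel_measurable borel" unfolding t_weight_def by measurable
  have P: "poly (r - r * (1 - monom 1 M) ^ k) x = poly r x * (1 - (1 - x ^ M) ^ k)" for M x
    by (simp add: poly_monom algebra_simps)
  have "(\<lambda>M. LINT \<xi>|lborel. poly (r - r * (1 - monom 1 M) ^ k) (?u \<xi>) * poly (r - r * (1 - monom 1 M) ^ k) (?u \<xi>) * t_weight \<epsilon> \<xi>)
      \<longlonglongrightarrow> (LINT \<xi>::real|lborel. (0 :: real))"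
  proof (rule integral_dominated_convergence[where w = "\<lambda>\<xi>. poly r (?u \<xi>) * poly r (?u \<xi>) * t_weight \<epsilon> \<xi>"])
    show "integrable lborel (\<lambda>\<xi>. poly r (?u \<xi>) * poly r (?u \<xi>) * t_weight \<epsilon> \<xi>)" by (rule integrable_tanh_inner)
    show "AE \<xi> in lborel. (\<lambda>M. poly (r - r * (1 - monom 1 M) ^ k) (?u \<xi>) * poly (r - r * (1 - monom 1 M) ^ k) (?u \<xi>) * t_weight \<epsilon> \<xi>) \<longlonglongrightarrow> 0"
    proof (rule AE_I2)
      fix \<xi>
      have t: "(\<lambda>M. ?u \<xi> ^ M) \<longlonglongrightarrow> 0" using u[of \<xi>] by (intro LIMSEQ_power_zero) auto
      have "(\<lambda>M. poly r (?u \<xi>) * (1 - (1 - ?u \<xi> ^ M) ^ k) * (poly r (?u \<xi>) * (1 - (1 - ?u \<xi> ^ M) ^ k)) * t_weight \<epsilon> \<xi>)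
         \<longlonglongrightarrow> poly r (?u \<xi>) * (1 - (1 - 0) ^ k) * (poly r (?u \<xi>) * (1 - (1 - 0) ^ k)) * t_weight \<epsilon> \<xi>"
        by (intro t tendsto_mult tendsto_diff tendsto_power tendsto_const)
      then show "(\<lambda>M. poly (r - r * (1 - monom 1 M) ^ k) (?u \<xi>) * poly (r - r * (1 - monom 1 M) ^ k) (?u \<xi>) * t_weight \<epsilon> \<xi>) \<longlonglongrightarrow> 0"
        unfolding P by simp
    qed
    show "AE \<xi> in lborel. norm (poly (r - r * (1 - monom 1 M) ^ k) (?u \<xi>) * poly (r - r * (1 - monom 1 M) ^ k) (?u \<xi>) * t_weight \<epsilon> \<xi>)
       \<le> poly r (?u \<xi>) * poly r (?u \<xi>) * t_weight \<epsilon> \<xi>" for M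
    proof (rule AE_I2)
      fix \<xi>
      define z where "z = 1 - (1 - ?u \<xi> ^ M) ^ k"
      have "0 \<le> ?u \<xi> ^ M" "?u \<xi> ^ M \<le> 1" using u[of \<xi>] by (auto intro: power_le_one)
      then have "0 \<le> (1 - ?u \<xi> ^ M) ^ k" "(1 - ?u \<xi> ^ M) ^ k \<le> 1" by (auto intro: power_le_one)
      then have "z\<^sup>2 \<le> 1" by (auto simp: z_def abs_square_le_1)
      then have "(poly r (?u \<xi>))\<^sup>2 * z\<^sup>2 * t_weight \<epsilon> \<xi> \<le> (poly r (?u \<xi>))\<^sup>2 * 1 * t_weight \<epsilon> \<xi>"
        using w[of \<xi>] by (intro mult_right_mono mult_left_mono) auto
      then show "norm (poly (r - r * (1 - monom 1 M) ^ k) (?u \<xi>) * poly (r - r * (1 - monom 1 M) ^ k) (?u \<xi>) * t_weight \<epsilon> \<xi>)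
         \<le> poly r (?u \<xi>) * poly r (?u \<xi>) * t_weight \<epsilon> \<xi>"
        unfolding P z_def[symmetric] using w[of \<xi>] by (simp add: abs_mult power2_eq_square mult_ac)
    qed
  qed measurable
  then show ?thesis by (simp add: tanh_inner_def)
qed

lemma truncate_span:
  "\<exists>N0. \<forall>N\<ge>N0. \<exists>c. r * (1 - monom 1 M) ^ k = (\<Sum>n<N. smult (c n) (jac_rpoly \<epsilon> n))"
proof -
  define q where "q = r * (\<Sum>i<M. [:0, 1:] ^ i) ^ k"
  have "(1 - monom 1 M :: real poly) = (1 - [:0, 1:]) * (\<Sum>i<M. [:0, 1:] ^ i)"
    unfolding one_diff_power_eq[symmetric] by (simp add: monom_altdef)
  also have "(1 - [:0, 1:] :: real poly) = [:1, -1:]" by (simp add: one_pCons)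
  finally have e: "r * (1 - monom 1 M) ^ k = [:1, -1:] ^ k * q"
    by (simp only: q_def power_mult_distrib mult_ac)
  have nz: "jacobi_explicit n jac_alpha (jac_beta \<epsilon>) \<noteq> 0" for n
    using jac_rpoly_nonzero[of \<epsilon> n] by (auto simp: jac_rpoly_def)
  have "\<exists>c. r * (1 - monom 1 M) ^ k = (\<Sum>n<N. smult (c n) (jac_rpoly \<epsilon> n))" if N: "N \<ge> Suc (degree q)" for N
  proof -
    have "\<exists>c. q = (\<Sum>n<N. smult (c n) (jacobi_explicit n jac_alpha (jac_beta \<epsilon>)))"
      by (rule graded_family_spans) (use N in \<open>auto simp: degree_jacobi_explicit jac_params nz coeff_eq_0\<close>)
    then obtain c where "q = (\<Sum>n<N. smult (c n) (jacobi_explicit n jac_alpha (jac_beta \<epsilon>)))" by blast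
    then have "[:1, -1:] ^ k * q = (\<Sum>n<N. smult (c n) (jac_rpoly \<epsilon> n))"
      by (simp only: sum_distrib_left jac_rpoly_def mult_smult_right)
    then show ?thesis unfolding e by blast
  qed
  then show ?thesis by blast
qed

text \<open>By \<open>integral_V_spectral_real\<close> the spectral error is a multiple of the error
  of the truncation in the variable \<open>u\<close>, which tends to 0. Real and imaginary parts
  contribute separately, as the spectral images of real polynomials are real.\<close>

lemma spectral_real_jacobi_dense:
  assumes "e > 0"
  shows "\<exists>N0. \<forall>N\<ge>N0. \<exists>c. (LINT y|nu \<epsilon>. (norm (of_real (spectral_real \<epsilon> r y) + \<i> * of_real (spectral_real \<epsilon> s y) -
     (\<Sum>n<N. c n * of_real (spectral_real \<epsilon> (jac_rpoly \<epsilon> n) y))))\<^sup>2) < e"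
proof -
  let ?T = "\<lambda>r M. r * (1 - monom 1 M) ^ k :: real poly"
  have "(\<lambda>M. 2 * (2 powr (2 * \<rho>) * tanh_inner \<epsilon> (r - ?T r M) (r - ?T r M)) + 2 * (2 powr (2 * \<rho>) * tanh_inner \<epsilon> (s - ?T s M) (s - ?T s M)))
     \<longlonglongrightarrow> 2 * (2 powr (2 * \<rho>) * 0) + 2 * (2 powr (2 * \<rho>) * 0)"
    by (intro tendsto_intros tanh_inner_truncate)
  then have "\<forall>\<^sub>F M in sequentially. 2 * (2 powr (2 * \<rho>) * tanh_inner \<epsilon> (r - ?T r M) (r - ?T r M)) + 2 * (2 powr (2 * \<rho>) * tanh_inner \<epsilon> (s - ?T s M) (s - ?T s M)) < e"
    using assms by (intro order_tendstoD) auto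
  then obtain M where M: "2 * (2 powr (2 * \<rho>) * tanh_inner \<epsilon> (r - ?T r M) (r - ?T r M)) + 2 * (2 powr (2 * \<rho>) * tanh_inner \<epsilon> (s - ?T s M) (s - ?T s M)) < e"
    using eventually_happens' sequentially_bot by blast
  obtain N1 N2 where N: "\<And>N. N \<ge> N1 \<Longrightarrow> \<exists>c. ?T r M = (\<Sum>n<N. smult (c n) (jac_rpoly \<epsilon> n))"
    "\<And>N. N \<ge> N2 \<Longrightarrow> \<exists>c. ?T s M = (\<Sum>n<N. smult (c n) (jac_rpoly \<epsilon> n))"
    using truncate_span by metis
  have "\<exists>c. (LINT y|nu \<epsilon>. (norm (of_real (spectral_real \<epsilon> r y) + \<i> * of_real (spectral_real \<epsilon> s y) -
     (\<Sum>n<N. c n * of_real (spectral_real \<epsilon> (jac_rpoly \<epsilon> n) y))))\<^sup>2) < e" if "N \<ge> max N1 N2" for N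
  proof -
    obtain c d where c: "?T r M = (\<Sum>n<N. smult (c n) (jac_rpoly \<epsilon> n))" and d: "?T s M = (\<Sum>n<N. smult (d n) (jac_rpoly \<epsilon> n))"
      using N \<open>N \<ge> max N1 N2\<close> by fastforce
    define x where "x = spectral_real \<epsilon> (r - ?T r M)"
    define z where "z = spectral_real \<epsilon> (s - ?T s M)"
    have eq: "of_real (spectral_real \<epsilon> r y) + \<i> * of_real (spectral_real \<epsilon> s y) - (\<Sum>n<N. (of_real (c n) + \<i> * of_real (d n)) * of_real (spectral_real \<epsilon> (jac_rpoly \<epsilon> n) y))
        = Complex (x y) (z y)" for y
      unfolding x_def z_def spectral_real_diff c d spectral_real_sum[OF finite_lessThan] spectral_real_smult
      by (simp add: Complex_eq ring_distribs sum.distrib sum_distrib_left mult.assoc)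
    have mx [measurable]: "x \<in> borel_measurable borel" "z \<in> borel_measurable borel" by (simp_all add: x_def z_def)
    have i: "integrable lborel (\<lambda>y. V \<epsilon> y * (x y * x y))" "integrable lborel (\<lambda>y. V \<epsilon> y * (z y * z y))"
      unfolding x_def z_def by (rule integrable_V_spectral_real)+
    have n: "(norm (Complex (x y) (z y)))\<^sup>2 = x y * x y + z y * z y" for y
      by (simp add: cmod_power2 flip: power2_eq_square)
    have "(LINT y|nu \<epsilon>. (norm (Complex (x y) (z y)))\<^sup>2) = (LINT y|lborel. V \<epsilon> y * (x y * x y) + V \<epsilon> y * (z y * z y))"
      unfolding n by (subst integral_nu) (simp_all add: ring_distribs)
    also have "\<dots> = 2 * (2 powr (2 * \<rho>) * tanh_inner \<epsilon> (r - ?T r M) (r - ?T r M)) + 2 * (2 powr (2 * \<rho>) * tanh_inner \<epsilon> (s - ?T s M) (s - ?T s M))"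
      unfolding Bochner_Integration.integral_add[OF i] unfolding x_def z_def integral_V_spectral_real ..
    finally show ?thesis using M by (intro exI[of _ "\<lambda>n. of_real (c n) + \<i> * of_real (d n)"]) (simp only: eq)
  qed
  then show ?thesis by blast
qed

lemma jacobi_dense_nu:
  fixes \<phi> :: "real \<Rightarrow> complex"
  assumes \<phi> [measurable]: "\<phi> \<in> borel_measurable borel" and int: "integrable (nu \<epsilon>) (\<lambda>y. (norm (\<phi> \<bar>y\<bar>))\<^sup>2)" and e: "e > 0"
  shows "\<exists>N0. \<forall>N\<ge>N0. \<exists>c. (LINT y|nu \<epsilon>. (norm (\<phi> \<bar>y\<bar> - (\<Sum>n<N. c n * of_real (spectral_real \<epsilon> (jac_rpoly \<epsilon> n) y))))\<^sup>2) < e"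
proof -
  interpret exp_moment_measure "nu \<epsilon>" "pi / 8" by (rule exp_moment_measure_nu)
  have f: "sq_integrable (\<lambda>y. \<phi> \<bar>y\<bar>)" using int by (simp add: sq_integrable_def)
  have "approx (\<lambda>y. \<phi> \<bar>y\<bar>)" by (rule even_polynomials_dense[OF \<phi> int])
  then obtain P where P: "sq_norm (\<lambda>y. \<phi> \<bar>y\<bar> - poly P (of_real y)) < e / 4"
    using e unfolding approx_def by (meson divide_pos_pos zero_less_numeral)
  obtain Q R where QR: "\<And>x. poly P x = poly Q (x\<^sup>2 / 4) + x * poly R (x\<^sup>2 / 4)" using poly_even_odd_split by blast
  obtain r s where rs: "\<And>y. poly Q (complex_of_real (y\<^sup>2 / 4)) = of_real (spectral_real \<epsilon> r y) + \<i> * of_real (spectral_real \<epsilon> s y)"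
    using even_poly_spec by blast
  let ?D = "\<lambda>y. \<phi> \<bar>y\<bar> - poly P (complex_of_real y)"
  have D: "sq_integrable ?D" by (intro sq_integrable_diff f sq_integrable_poly)
  have D': "sq_integrable (\<lambda>y. ?D (- y))"
  proof -
    have "poly P (complex_of_real (- y)) = poly (pcompose P [:0, -1:]) (of_real y)" for y by (simp add: poly_pcompose)
    then have "sq_integrable (\<lambda>y. poly P (complex_of_real (- y)))" using sq_integrable_poly[of "pcompose P [:0, -1:]"] by simp
    from sq_integrable_diff[OF f this] show ?thesis by simp
  qed
  have [measurable]: "?D \<in> borel_measurable borel" using D by (simp add: sq_integrable_def)
  have minus: "sq_norm (\<lambda>y. ?D (- y)) = sq_norm ?D"
    unfolding sq_norm_def by (rule integral_nu_minus[of "\<lambda>y. (norm (?D y))\<^sup>2"]) measurable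
  \<comment> \<open>Averaging over \<open>y\<close> and \<open>- y\<close> removes the odd part of
    \<open>P\<close>; both terms have the same norm because \<open>nu\<close> is even, so the error
    does not grow.\<close>
  have eq: "\<phi> \<bar>y\<bar> - poly Q (complex_of_real (y\<^sup>2 / 4)) = 1 / 2 * ?D y + 1 / 2 * ?D (- y)" for y
    by (simp add: QR field_simps)
  have Qs: "sq_norm (\<lambda>y. \<phi> \<bar>y\<bar> - poly Q (complex_of_real (y\<^sup>2 / 4))) < e / 4" "sq_integrable (\<lambda>y. \<phi> \<bar>y\<bar> - poly Q (complex_of_real (y\<^sup>2 / 4)))"
  proof -
    have "sq_norm (\<lambda>y. 1 / 2 * ?D y + 1 / 2 * ?D (- y)) \<le> 2 * sq_norm (\<lambda>y. 1 / 2 * ?D y) + 2 * sq_norm (\<lambda>y. 1 / 2 * ?D (- y))"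
      by (intro sq_norm_add sq_integrable_mult D D')
    also have "\<dots> = sq_norm ?D" unfolding sq_norm_mult minus by (simp add: power2_eq_square)
    finally show "sq_norm (\<lambda>y. \<phi> \<bar>y\<bar> - poly Q (complex_of_real (y\<^sup>2 / 4))) < e / 4" unfolding eq using P by simp
    show "sq_integrable (\<lambda>y. \<phi> \<bar>y\<bar> - poly Q (complex_of_real (y\<^sup>2 / 4)))" unfolding eq by (intro sq_integrable_add sq_integrable_mult D D')
  qed
  obtain N0 where N0: "\<And>N. N \<ge> N0 \<Longrightarrow> \<exists>c. sq_norm (\<lambda>y. poly Q (complex_of_real (y\<^sup>2 / 4)) - (\<Sum>n<N. c n * of_real (spectral_real \<epsilon> (jac_rpoly \<epsilon> n) y))) < e / 4"
    using spectral_real_jacobi_dense[of "e / 4" \<epsilon> r s] e unfolding rs sq_norm_def by auto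
  have spec: "sq_integrable (\<lambda>y. of_real (spectral_real \<epsilon> p y))" for p
  proof -
    have "integrable (nu \<epsilon>) (\<lambda>y. (spectral_real \<epsilon> p y)\<^sup>2)"
      using integrable_V_spectral_real[of \<epsilon> p p] by (subst integrable_nu_iff) (simp_all add: power2_eq_square)
    then show ?thesis by (simp add: sq_integrable_def)
  qed
  have sumspec: "sq_integrable (\<lambda>y. \<Sum>n<N. c n * of_real (spectral_real \<epsilon> (jac_rpoly \<epsilon> n) y))" for c N
  proof (induction N)
    case 0
    then show ?case by (simp add: sq_integrable_def)
  next
    case (Suc N)
    then show ?case by (simp add: sq_integrable_add sq_integrable_mult spec)
  qed
  have Q: "sq_integrable (\<lambda>y. poly Q (complex_of_real (y\<^sup>2 / 4)))" unfolding rs by (intro sq_integrable_add sq_integrable_mult spec)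
  have "\<exists>c. sq_norm (\<lambda>y. \<phi> \<bar>y\<bar> - (\<Sum>n<N. c n * of_real (spectral_real \<epsilon> (jac_rpoly \<epsilon> n) y))) < e" if "N \<ge> N0" for N
  proof -
    obtain c where c: "sq_norm (\<lambda>y. poly Q (complex_of_real (y\<^sup>2 / 4)) - (\<Sum>n<N. c n * of_real (spectral_real \<epsilon> (jac_rpoly \<epsilon> n) y))) < e / 4"
      using N0[OF \<open>N \<ge> N0\<close>] by blast
    have "sq_norm (\<lambda>y. (\<phi> \<bar>y\<bar> - poly Q (complex_of_real (y\<^sup>2 / 4))) + (poly Q (complex_of_real (y\<^sup>2 / 4)) - (\<Sum>n<N. c n * of_real (spectral_real \<epsilon> (jac_rpoly \<epsilon> n) y)))) \<le>
      2 * sq_norm (\<lambda>y. \<phi> \<bar>y\<bar> - poly Q (complex_of_real (y\<^sup>2 / 4))) + 2 * sq_norm (\<lambda>y. poly Q (complex_of_real (y\<^sup>2 / 4)) - (\<Sum>n<N. c n * of_real (spectral_real \<epsilon> (jac_rpoly \<epsilon> n) y)))"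
      by (rule sq_norm_add[OF Qs(2) sq_integrable_diff[OF Q sumspec]])
    also have "\<dots> < e" using Qs(1) c by simp
    finally have "sq_norm (\<lambda>y. \<phi> \<bar>y\<bar> - (\<Sum>n<N. c n * of_real (spectral_real \<epsilon> (jac_rpoly \<epsilon> n) y))) < e"
      by (simp only: diff_add_cancel add_diff_eq)
    then show ?thesis by blast
  qed
  then show ?thesis unfolding sq_norm_def by blast
qed

section \<open>Pairs of transforms and their even and odd components\<close>

definition e_transform :: "nat \<Rightarrow> real poly \<Rightarrow> complex \<Rightarrow> complex \<times> complex" where
  "e_transform \<epsilon> p = co_transform_pair b \<iota> (\<lambda>t. of_real (e_fun \<epsilon> p t))"

definition e_spectrum :: "nat \<Rightarrow> real poly \<Rightarrow> real \<Rightarrow> complex" where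
  "e_spectrum \<epsilon> p y = parity_factor \<epsilon> y * of_real (gamma_factor_real y) * of_real (spectral_real \<epsilon> p y)"

lemma e_spectrum_measurable [measurable]: "e_spectrum \<epsilon> p \<in> borel_measurable borel"
  unfolding e_spectrum_def by measurable

lemma e_transform_imag: "\<epsilon> \<le> 1 \<Longrightarrow> e_transform \<epsilon> p (\<i> * of_real y) = (e_spectrum \<epsilon> p y, (-1) ^ \<epsilon> * e_spectrum \<epsilon> p y)"
proof -
  assume "\<epsilon> \<le> 1"
  moreover have "\<i> * of_real y \<in> im_axis" by (simp add: im_axis_def)
  ultimately show ?thesis
    by (simp add: e_transform_def co_transform_pair_def transform_e_fun spec_factor_imag gamma_factor_imag spec_imag e_spectrum_def mult_ac)
qed

lemma half_axis_eq: "l \<in> im_half_axis \<Longrightarrow> l = \<i> * of_real (Im l)"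
  by (simp add: im_half_axis_def complex_eq_iff)

lemma e_transform_measurable [measurable]: "\<epsilon> \<le> 1 \<Longrightarrow> e_transform \<epsilon> p \<in> borel_measurable (restrict_space borel im_half_axis)"
proof -
  assume \<epsilon>: "\<epsilon> \<le> 1"
  have "(\<lambda>l. (e_spectrum \<epsilon> p (Im l), (-1) ^ \<epsilon> * e_spectrum \<epsilon> p (Im l))) \<in> borel_measurable (restrict_space borel im_half_axis)"
    by (rule measurable_restrict_space1) measurable
  also have "?this \<longleftrightarrow> ?thesis"
    using e_transform_imag[OF \<epsilon>] half_axis_eq by (intro measurable_cong) (metis Int_UNIV_right space_borel space_restrict_space)
  finally show ?thesis .
qed

lemma co_mu_hat_borel: "borel_measurable (co_mu_hat b \<iota>) = borel_measurable (restrict_space borel im_half_axis)"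
  by (rule measurable_cong_sets) (simp_all add: co_mu_hat_eq)

text \<open>The even and odd parts of a pair, divided by the factor that turns the Plancherel density into \<^const>\<open>V\<close>.\<close>

definition component :: "nat \<Rightarrow> (complex \<Rightarrow> complex \<times> complex) \<Rightarrow> real \<Rightarrow> complex" where
  "component \<epsilon> \<Phi> y = (fst (\<Phi> (\<i> * of_real y)) + (-1) ^ \<epsilon> * snd (\<Phi> (\<i> * of_real y))) / (2 * (parity_factor \<epsilon> y * of_real (gamma_factor_real y)))"

lemma component_e_transform:
  assumes "\<epsilon> \<le> 1" "\<epsilon>' \<le> 1"
  shows "component \<epsilon> (e_transform \<epsilon>' p) y = (if \<epsilon> = \<epsilon>' then of_real (spectral_real \<epsilon> p y) else 0)"
proof -
  have "parity_factor \<epsilon> y \<noteq> 0" "gamma_factor_real y \<noteq> 0" using parity_factor_nonzero gamma_factor_real_pos[of y] by auto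
  moreover have "\<epsilon> \<in> {0, 1}" "\<epsilon>' \<in> {0, 1}" using assms by auto
  ultimately show ?thesis by (auto simp: component_def e_transform_imag e_spectrum_def)
qed

lemma norm_sq_parts: "(norm (u, v))\<^sup>2 = 2 * (norm ((u + v) / 2))\<^sup>2 + 2 * (norm ((u - v) / 2))\<^sup>2" for u v :: complex
proof -
  have "(norm (u, v))\<^sup>2 = (norm u)\<^sup>2 + (norm v)\<^sup>2" by (simp add: norm_Pair)
  moreover have "2 * (norm ((u + v) / 2))\<^sup>2 + 2 * (norm ((u - v) / 2))\<^sup>2 = (norm u)\<^sup>2 + (norm v)\<^sup>2"
    unfolding norm_divide power_divide cmod_power2 by (simp add: power2_eq_square field_simps)
  ultimately show ?thesis by simp
qed

text \<open>Transforms of even functions have equal components, those of odd functions opposite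
  ones. \<open>norm_sq_parts\<close> splits a pair orthogonally along these two directions and
  \<open>V_eq\<close> converts the density, so the problem for pairs becomes two scalar
  problems.\<close>

lemma hat_density_norm_sq:
  "hat_density y * (norm (\<Phi> (\<i> * of_real y)))\<^sup>2 = V 0 y * (norm (component 0 \<Phi> y))\<^sup>2 + V 1 y * (norm (component 1 \<Phi> y))\<^sup>2"
proof -
  obtain u v where uv: "\<Phi> (\<i> * of_real y) = (u, v)" by fastforce
  have V: "V \<epsilon> y * (norm (component \<epsilon> \<Phi> y))\<^sup>2 = hat_density y * (2 * (norm ((u + (-1) ^ \<epsilon> * v) / 2))\<^sup>2)" if "\<epsilon> \<le> 1" for \<epsilon>
  proof -
    have nz: "parity_factor \<epsilon> y \<noteq> 0" "gamma_factor_real y \<noteq> 0" using parity_factor_nonzero gamma_factor_real_pos[of y] by auto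
    have "component \<epsilon> \<Phi> y = (u + (-1) ^ \<epsilon> * v) / 2 / (parity_factor \<epsilon> y * of_real (gamma_factor_real y))"
      by (simp add: component_def uv)
    then have "(norm (component \<epsilon> \<Phi> y))\<^sup>2 = (norm ((u + (-1) ^ \<epsilon> * v) / 2))\<^sup>2 / ((norm (parity_factor \<epsilon> y))\<^sup>2 * (gamma_factor_real y)\<^sup>2)"
      by (simp add: norm_divide norm_mult power_divide power_mult_distrib)
    then show ?thesis unfolding V_eq[OF that, symmetric] using nz by simp
  qed
  show ?thesis using V[of 0] V[of 1] by (simp add: uv norm_sq_parts distrib_left)
qed

text \<open>\<open>\<Phi>\<close> is known to be measurable on the half axis only, so the component
  is cut off before it is regarded as a function on the line.\<close>

lemma component_measurable:
  assumes "\<Phi> \<in> borel_measurable (restrict_space borel im_half_axis)"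
  shows "(\<lambda>y. indicator {0<..} y *\<^sub>R component \<epsilon> \<Phi> y) \<in> borel_measurable borel"
proof -
  have m: "(\<lambda>y. \<Phi> (\<i> * of_real y)) \<in> borel_measurable (restrict_space lborel {0<..})"
    by (rule measurable_compose[OF hat_map_measurable assms])
  have f: "(\<lambda>y. fst (\<Phi> (\<i> * of_real y))) \<in> borel_measurable (restrict_space lborel {0<..})"
    by (rule measurable_compose[OF m]) (intro borel_measurable_continuous_onI continuous_intros)
  have s: "(\<lambda>y. snd (\<Phi> (\<i> * of_real y))) \<in> borel_measurable (restrict_space lborel {0<..})"
    by (rule measurable_compose[OF m]) (intro borel_measurable_continuous_onI continuous_intros)
  have d: "(\<lambda>y. 2 * (parity_factor \<epsilon> y * of_real (gamma_factor_real y))) \<in> borel_measurable (restrict_space lborel {0<..})"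
    by (rule measurable_restrict_space1) measurable
  have "component \<epsilon> \<Phi> \<in> borel_measurable (restrict_space lborel {0<..})"
    unfolding component_def using f s d by measurable
  then show ?thesis by (subst (asm) borel_measurable_restrict_space_iff) auto
qed

text \<open>Evaluation at \<open>|y|\<close> extends the components evenly to the line, as the
  density theorem requires, and the indicator discards the point 0. The factor 2 is the doubling of
  the half axis.\<close>

lemma
  assumes \<Phi>: "\<Phi> \<in> borel_measurable (restrict_space borel im_half_axis)"
  shows L2_hat_iff: "integrable (co_mu_hat b \<iota>) (\<lambda>l. (norm (\<Phi> l))\<^sup>2) \<longleftrightarrow>
      integrable lborel (\<lambda>y. V 0 y * (norm (indicator {0<..} \<bar>y\<bar> *\<^sub>R component 0 \<Phi> \<bar>y\<bar>))\<^sup>2) \<and>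
      integrable lborel (\<lambda>y. V 1 y * (norm (indicator {0<..} \<bar>y\<bar> *\<^sub>R component 1 \<Phi> \<bar>y\<bar>))\<^sup>2)" (is "?I \<longleftrightarrow> ?A \<and> ?B")
    and L2_hat_norm: "integrable (co_mu_hat b \<iota>) (\<lambda>l. (norm (\<Phi> l))\<^sup>2) \<Longrightarrow> 2 * (L2_nrm (co_mu_hat b \<iota>) \<Phi>)\<^sup>2 =
      (LINT y|lborel. V 0 y * (norm (indicator {0<..} \<bar>y\<bar> *\<^sub>R component 0 \<Phi> \<bar>y\<bar>))\<^sup>2) +
      (LINT y|lborel. V 1 y * (norm (indicator {0<..} \<bar>y\<bar> *\<^sub>R component 1 \<Phi> \<bar>y\<bar>))\<^sup>2)"
proof -
  define F where "F = (\<lambda>\<epsilon> y. V \<epsilon> y * (norm (indicator {0<..} \<bar>y\<bar> *\<^sub>R component \<epsilon> \<Phi> \<bar>y\<bar>))\<^sup>2)"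
  have mF [measurable]: "F \<epsilon> \<in> borel_measurable borel" for \<epsilon>
  proof -
    have "(\<lambda>y. indicator {0<..} \<bar>y\<bar> *\<^sub>R component \<epsilon> \<Phi> \<bar>y\<bar>) \<in> borel_measurable borel"
      by (rule measurable_compose[OF _ component_measurable[OF \<Phi>]]) measurable
    then show ?thesis unfolding F_def by measurable
  qed
  have F_nonneg: "F \<epsilon> y \<ge> 0" for \<epsilon> y by (simp add: F_def V_nonneg)
  have even: "F \<epsilon> (- y) = F \<epsilon> y" for \<epsilon> y by (simp add: F_def)
  have P: "(\<lambda>l. (norm (\<Phi> l))\<^sup>2) \<in> borel_measurable (restrict_space borel im_half_axis)"
    using \<Phi> by measurable
  have eq: "indicator {0<..} y *\<^sub>R (hat_density y *\<^sub>R (norm (\<Phi> (\<i> * of_real y)))\<^sup>2) = indicator {0<..} y *\<^sub>R (F 0 y + F 1 y)" for y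
    by (simp add: indicator_def hat_density_norm_sq F_def)
  have mFF: "(\<lambda>y. F 0 y + F 1 y) \<in> borel_measurable borel" by measurable
  have evenF: "F 0 (- y) + F 1 (- y) = F 0 y + F 1 y" for y by (simp add: even)
  have I: "?I \<longleftrightarrow> integrable lborel (\<lambda>y. F 0 y + F 1 y)"
    unfolding integrable_hat_iff[OF P] eq by (rule integrable_even_half[OF mFF evenF])
  have split: "integrable lborel (\<lambda>y. F 0 y + F 1 y) \<longleftrightarrow> integrable lborel (F 0) \<and> integrable lborel (F 1)"
  proof
    assume i: "integrable lborel (\<lambda>y. F 0 y + F 1 y)"
    have "integrable lborel (F 0)" "integrable lborel (F 1)"
      by (rule Bochner_Integration.integrable_bound[OF i], simp, intro AE_I2, use F_nonneg in simp)+
    then show "integrable lborel (F 0) \<and> integrable lborel (F 1)" by simp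
  qed simp
  then show "?I \<longleftrightarrow> ?A \<and> ?B" unfolding I F_def by simp
  assume ?I
  then have i: "integrable lborel (F 0)" "integrable lborel (F 1)" using I split by auto
  have "(L2_nrm (co_mu_hat b \<iota>) \<Phi>)\<^sup>2 = (\<integral>l. (norm (\<Phi> l))\<^sup>2 \<partial>co_mu_hat b \<iota>)"
    by (simp add: L2_nrm_def)
  also have "\<dots> = (LINT y|lborel. indicator {0<..} y *\<^sub>R (F 0 y + F 1 y))" unfolding integral_hat_eq[OF P] eq ..
  finally have "2 * (L2_nrm (co_mu_hat b \<iota>) \<Phi>)\<^sup>2 = (LINT y|lborel. F 0 y + F 1 y)"
    unfolding integral_even_half[OF mFF evenF] by simp
  also have "\<dots> = (LINT y|lborel. F 0 y) + (LINT y|lborel. F 1 y)" by (rule Bochner_Integration.integral_add[OF i])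
  finally show "2 * (L2_nrm (co_mu_hat b \<iota>) \<Phi>)\<^sup>2 =
      (LINT y|lborel. V 0 y * (norm (indicator {0<..} \<bar>y\<bar> *\<^sub>R component 0 \<Phi> \<bar>y\<bar>))\<^sup>2) +
      (LINT y|lborel. V 1 y * (norm (indicator {0<..} \<bar>y\<bar> *\<^sub>R component 1 \<Phi> \<bar>y\<bar>))\<^sup>2)"
    unfolding F_def .
qed

text \<open>For different parities the two summands cancel pointwise, one sign being +1 and the
  other -1; for equal parity they agree, and \<open>V_eq\<close> reduces the integral to
  \<open>integral_V_spectral_real\<close>.\<close>

lemma e_transform_inner:
  assumes \<epsilon>: "\<epsilon> \<le> 1" "\<epsilon>' \<le> 1"
  shows "integrable (co_mu_hat b \<iota>) (\<lambda>l. fst (e_transform \<epsilon> p l) * cnj (fst (e_transform \<epsilon>' q l)) + snd (e_transform \<epsilon> p l) * cnj (snd (e_transform \<epsilon>' q l)))" (is ?A)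
    and "L2_inner (co_mu_hat b \<iota>) (e_transform \<epsilon> p) (e_transform \<epsilon>' q) = (if \<epsilon> = \<epsilon>' then of_real (2 powr (2 * \<rho>) * tanh_inner \<epsilon> p q) else 0)" (is ?B)
proof -
  let ?f = "\<lambda>l. fst (e_transform \<epsilon> p l) * cnj (fst (e_transform \<epsilon>' q l)) + snd (e_transform \<epsilon> p l) * cnj (snd (e_transform \<epsilon>' q l))"
  let ?c = "if \<epsilon> = \<epsilon>' then 1 else 0 :: complex"
  let ?g = "\<lambda>y. ?c * of_real (V \<epsilon> y * (spectral_real \<epsilon> p y * spectral_real \<epsilon> q y))"
  have f: "?f (\<i> * of_real y) = (1 + (-1) ^ \<epsilon> * (-1) ^ \<epsilon>') * (e_spectrum \<epsilon> p y * cnj (e_spectrum \<epsilon>' q y))" for y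
    using \<epsilon> by (simp add: e_transform_imag algebra_simps)
  have m: "?f \<in> borel_measurable (restrict_space borel im_half_axis)"
  proof -
    have [measurable]: "cnj \<in> borel_measurable borel"
      by (intro borel_measurable_continuous_onI continuous_intros)
    have "(\<lambda>l. (1 + (-1) ^ \<epsilon> * (-1) ^ \<epsilon>') * (e_spectrum \<epsilon> p (Im l) * cnj (e_spectrum \<epsilon>' q (Im l)))) \<in> borel_measurable (restrict_space borel im_half_axis)"
      by (rule measurable_restrict_space1) measurable
    also have "?this \<longleftrightarrow> ?thesis"
    proof (rule measurable_cong)
      fix l assume "l \<in> space (restrict_space borel im_half_axis)"
      then have "l = \<i> * of_real (Im l)" by (intro half_axis_eq) (simp add: space_restrict_space)
      then show "(1 + (-1) ^ \<epsilon> * (-1) ^ \<epsilon>') * (e_spectrum \<epsilon> p (Im l) * cnj (e_spectrum \<epsilon>' q (Im l))) = ?f l"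
        using f[of "Im l"] by simp
    qed
    finally show ?thesis .
  qed
  have g: "hat_density y *\<^sub>R ?f (\<i> * of_real y) = ?g y" for y
  proof (cases "\<epsilon> = \<epsilon>'")
    case True
    have "e_spectrum \<epsilon> p y * cnj (e_spectrum \<epsilon> q y) = of_real ((norm (parity_factor \<epsilon> y))\<^sup>2 * (gamma_factor_real y)\<^sup>2 * (spectral_real \<epsilon> p y * spectral_real \<epsilon> q y))"
      unfolding e_spectrum_def of_real_mult complex_norm_square by (simp add: power2_eq_square mult_ac)
    moreover have "(-1 :: complex) ^ \<epsilon> * (-1) ^ \<epsilon> = 1" by (simp flip: power_mult_distrib)
    ultimately have "hat_density y *\<^sub>R ?f (\<i> * of_real y) =
        of_real (2 * hat_density y * (gamma_factor_real y)\<^sup>2 * (norm (parity_factor \<epsilon> y))\<^sup>2 * (spectral_real \<epsilon> p y * spectral_real \<epsilon> q y))"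
      unfolding f using True by (simp add: scaleR_conv_of_real mult_ac)
    then show ?thesis using True unfolding V_eq[OF \<epsilon>(1)] by simp
  next
    case False
    then have "(\<epsilon> = 0 \<and> \<epsilon>' = 1) \<or> (\<epsilon> = 1 \<and> \<epsilon>' = 0)" using \<epsilon> by auto
    then show ?thesis unfolding f by auto
  qed
  have even: "?g (- y) = ?g y" for y by simp
  have mg: "?g \<in> borel_measurable borel" by measurable
  have ig: "integrable lborel ?g" by (intro integrable_mult_right integrable_of_real integrable_V_spectral_real)
  show ?A unfolding integrable_hat_iff[OF m] g using integrable_even_half[OF mg even] ig by blast
  have "2 *\<^sub>R L2_inner (co_mu_hat b \<iota>) (e_transform \<epsilon> p) (e_transform \<epsilon>' q) = 2 *\<^sub>R (LINT y|lborel. indicator {0<..} y *\<^sub>R ?g y)"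
    unfolding L2_inner_def integral_hat_eq[OF m] g ..
  also have "\<dots> = (LINT y|lborel. ?g y)" by (rule integral_even_half[OF mg even, symmetric])
  also have "\<dots> = ?c * of_real (2 * (2 powr (2 * \<rho>) * tanh_inner \<epsilon> p q))"
    by (simp add: integral_V_spectral_real del: of_real_mult)
  finally show ?B by (auto simp: scaleR_conv_of_real)
qed

lemma e_transform_norm_sq: "(of_real ((norm (e_transform \<epsilon> p l))\<^sup>2) :: complex) = fst (e_transform \<epsilon> p l) * cnj (fst (e_transform \<epsilon> p l)) + snd (e_transform \<epsilon> p l) * cnj (snd (e_transform \<epsilon> p l))"
  by (simp only: complex_norm_square[symmetric] of_real_add[symmetric] of_real_eq_iff) (simp add: norm_prod_def)

lemma e_transform_L2: "\<epsilon> \<le> 1 \<Longrightarrow> e_transform \<epsilon> p \<in> L2_space (co_mu_hat b \<iota>)"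
proof -
  assume \<epsilon>: "\<epsilon> \<le> 1"
  have "integrable (co_mu_hat b \<iota>) (\<lambda>l. complex_of_real ((norm (e_transform \<epsilon> p l))\<^sup>2))"
    unfolding e_transform_norm_sq by (rule e_transform_inner[OF \<epsilon> \<epsilon>])
  from integrable_Re[OF this] show ?thesis
    unfolding L2_space_def co_mu_hat_borel using e_transform_measurable[OF \<epsilon>] by simp
qed

lemma e_transform_nrm: "\<epsilon> \<le> 1 \<Longrightarrow> L2_nrm (co_mu_hat b \<iota>) (e_transform \<epsilon> p) = sqrt (2 powr (2 * \<rho>) * tanh_inner \<epsilon> p p)"
proof -
  assume \<epsilon>: "\<epsilon> \<le> 1"
  have "complex_of_real (\<integral>l. (norm (e_transform \<epsilon> p l))\<^sup>2 \<partial>co_mu_hat b \<iota>) = L2_inner (co_mu_hat b \<iota>) (e_transform \<epsilon> p) (e_transform \<epsilon> p)"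
    unfolding L2_inner_def e_transform_norm_sq[symmetric] by (rule integral_complex_of_real[symmetric])
  then show ?thesis unfolding e_transform_inner(2)[OF \<epsilon> \<epsilon>] L2_nrm_def by (simp del: of_real_mult)
qed

lemma e_fun_nrm: "L2_nrm (co_mu b \<iota>) (\<lambda>t. complex_of_real (e_fun \<epsilon> p t)) = sqrt (2 powr (2 * \<rho>) * tanh_inner \<epsilon> p p)"
  unfolding L2_nrm_def by (simp add: e_fun_inner[symmetric] power2_eq_square)

abbreviation jacobi_transform :: "nat \<times> int \<Rightarrow> complex \<Rightarrow> complex \<times> complex" where
  "jacobi_transform \<equiv> \<lambda>(n, s). co_transform_pair b \<iota> (jacobi_fun b \<iota> \<sigma> k n s)"

lemma jacobi_transform_eq: "s \<in> {1, -1} \<Longrightarrow> jacobi_transform (n, s) = e_transform (parity s) (jac_rpoly (parity s) n)"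
  by (simp add: e_transform_def jacobi_fun_eq)

lemma parity_le: "parity s \<le> 1" by (simp add: parity_def)

lemma L2_scale_pair_measurable:
  assumes "\<Psi> \<in> borel_measurable M"
  shows "(\<lambda>x. (c * fst (\<Psi> x), c * snd (\<Psi> x)) :: complex \<times> complex) \<in> borel_measurable M"
  by (rule measurable_compose[OF assms]) (intro borel_measurable_continuous_onI continuous_intros)

lemma jacobi_span_dense:
  assumes f: "f \<in> L2_space (co_mu_hat b \<iota>)" and e: "e > 0"
  shows "\<exists>J c. finite J \<and> J \<subseteq> UNIV \<times> {1, -1} \<and>
    L2_nrm (co_mu_hat b \<iota>) (\<lambda>x. f x - (\<Sum>i\<in>J. (c i * fst (jacobi_transform i x), c i * snd (jacobi_transform i x)))) < e"
proof -
  define \<phi> where "\<phi> = (\<lambda>\<epsilon> y. indicator {0<..} y *\<^sub>R component \<epsilon> f y)"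
  have fm: "f \<in> borel_measurable (restrict_space borel im_half_axis)" and fi: "integrable (co_mu_hat b \<iota>) (\<lambda>l. (norm (f l))\<^sup>2)"
    using f by (auto simp: L2_space_def co_mu_hat_borel)
  have \<phi>m: "\<phi> \<epsilon> \<in> borel_measurable borel" for \<epsilon> unfolding \<phi>_def by (rule component_measurable[OF fm])
  have \<phi>m' [measurable]: "(\<lambda>y. \<phi> \<epsilon> \<bar>y\<bar>) \<in> borel_measurable borel" for \<epsilon>
    by (rule measurable_compose[OF _ \<phi>m]) measurable
  define G where "G = (\<lambda>\<epsilon> N c. (LINT y|nu \<epsilon>. (norm (\<phi> \<epsilon> \<bar>y\<bar> - (\<Sum>n<N. c n * of_real (spectral_real \<epsilon> (jac_rpoly \<epsilon> n) y))))\<^sup>2) < e\<^sup>2)"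
  have "integrable (nu \<epsilon>) (\<lambda>y. (norm (\<phi> \<epsilon> \<bar>y\<bar>))\<^sup>2)" if "\<epsilon> \<le> 1" for \<epsilon>
  proof -
    have "integrable lborel (\<lambda>y. V \<epsilon> y * (norm (\<phi> \<epsilon> \<bar>y\<bar>))\<^sup>2)"
    proof -
      have "\<epsilon> = 0 \<or> \<epsilon> = 1" using that by auto
      then show ?thesis using L2_hat_iff[OF fm] fi by (elim disjE) (simp_all add: \<phi>_def)
    qed
    then show ?thesis by (subst integrable_nu_iff) simp_all
  qed
  then have dense: "\<exists>N0. \<forall>N\<ge>N0. \<exists>c. G \<epsilon> N c"
    if "\<epsilon> \<le> 1" for \<epsilon>
    using jacobi_dense_nu[OF \<phi>m, of \<epsilon> \<epsilon> "e\<^sup>2"] e that by (simp add: G_def)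
  obtain A B where AB: "\<And>N. N \<ge> A \<Longrightarrow> \<exists>c. G 0 N c" "\<And>N. N \<ge> B \<Longrightarrow> \<exists>c. G 1 N c"
    using dense[of 0] dense[of 1] by auto
  \<comment> \<open>One \<open>N\<close> serves both parities; for this the density statements were
    made for all large \<open>N\<close>.\<close>
  define N where "N = max A B"
  obtain c0 c1 where c01: "G 0 N c0" "G 1 N c1" using AB[of N] by (auto simp: N_def)
  define c where "c = (\<lambda>\<epsilon>::nat. if \<epsilon> = 0 then c0 else c1)"
  have c: "G \<epsilon> N (c \<epsilon>)" if "\<epsilon> \<le> 1" for \<epsilon>
  proof -
    have "\<epsilon> = 0 \<or> \<epsilon> = 1" using that by auto
    then show ?thesis using c01 by (elim disjE) (simp_all add: c_def)
  qed
  define J where "J = {..<N} \<times> {1, -1::int}"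
  define d where "d = (\<lambda>(n, s). c (parity s) n)"
  define \<Psi> where "\<Psi> = (\<lambda>x. f x - (\<Sum>i\<in>J. (d i * fst (jacobi_transform i x), d i * snd (jacobi_transform i x))))"
  have jm: "jacobi_transform i \<in> borel_measurable (restrict_space borel im_half_axis)" if "i \<in> J" for i
  proof -
    obtain n s where i: "i = (n, s)" by fastforce
    then show ?thesis using that unfolding i J_def by (subst jacobi_transform_eq) (auto intro!: e_transform_measurable parity_le)
  qed
  have \<Psi>m: "\<Psi> \<in> borel_measurable (restrict_space borel im_half_axis)"
    unfolding \<Psi>_def by (intro borel_measurable_diff borel_measurable_sum fm L2_scale_pair_measurable jm)
  have comp: "component \<epsilon> \<Psi> y = component \<epsilon> f y - (\<Sum>n<N. c \<epsilon> n * of_real (spectral_real \<epsilon> (jac_rpoly \<epsilon> n) y))" if \<epsilon>: "\<epsilon> \<le> 1" for \<epsilon> y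
  proof -
    have lin: "component \<epsilon> \<Psi> y = component \<epsilon> f y - (\<Sum>i\<in>J. d i * component \<epsilon> (jacobi_transform i) y)"
      by (simp add: component_def \<Psi>_def fst_sum snd_sum sum_distrib_left sum.distrib ring_distribs
          diff_divide_distrib add_divide_distrib sum_divide_distrib mult_ac)
    have "(\<Sum>i\<in>J. d i * component \<epsilon> (jacobi_transform i) y) = (\<Sum>n<N. \<Sum>s\<in>{1, -1}. d (n, s) * component \<epsilon> (jacobi_transform (n, s)) y)"
      unfolding J_def sum.cartesian_product by (rule sum.cong) auto
    also have "\<dots> = (\<Sum>n<N. c \<epsilon> n * of_real (spectral_real \<epsilon> (jac_rpoly \<epsilon> n) y))"
    proof (intro sum.cong refl)
      fix n
      have "component \<epsilon> (jacobi_transform (n, s)) y = (if \<epsilon> = parity s then of_real (spectral_real \<epsilon> (jac_rpoly \<epsilon> n) y) else 0)" if "s \<in> {1, -1}" for s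
        unfolding jacobi_transform_eq[OF that] component_e_transform[OF \<epsilon> parity_le] by simp
      moreover have "\<epsilon> = 0 \<or> \<epsilon> = 1" using \<epsilon> by auto
      ultimately show "(\<Sum>s\<in>{1, -1}. d (n, s) * component \<epsilon> (jacobi_transform (n, s)) y) = c \<epsilon> n * of_real (spectral_real \<epsilon> (jac_rpoly \<epsilon> n) y)"
        by (auto simp: d_def parity_def)
    qed
    finally show ?thesis unfolding lin by simp
  qed
  define D where "D = (\<lambda>\<epsilon> y. \<phi> \<epsilon> \<bar>y\<bar> - (\<Sum>n<N. c \<epsilon> n * of_real (spectral_real \<epsilon> (jac_rpoly \<epsilon> n) y)))"
  have Dm [measurable]: "D \<epsilon> \<in> borel_measurable borel" for \<epsilon> unfolding D_def by measurable
  have spectral_real_abs: "spectral_real \<epsilon> p \<bar>y\<bar> = spectral_real \<epsilon> p y" for \<epsilon> p y by (simp add: abs_if)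
  have ae: "AE y in lborel. V \<epsilon> y * (norm (indicator {0<..} \<bar>y\<bar> *\<^sub>R component \<epsilon> \<Psi> \<bar>y\<bar>))\<^sup>2 = V \<epsilon> y * (norm (D \<epsilon> y))\<^sup>2" if "\<epsilon> \<le> 1" for \<epsilon>
    by (rule AE_mp[OF AE_lborel_singleton[of 0]]) (auto intro!: AE_I2 simp: comp[OF that] D_def \<phi>_def indicator_def spectral_real_abs)
  have Cm: "(\<lambda>y. indicator {0<..} \<bar>y\<bar> *\<^sub>R component \<epsilon> \<Psi> \<bar>y\<bar>) \<in> borel_measurable borel" for \<epsilon>
    by (rule measurable_compose[OF _ component_measurable[OF \<Psi>m]]) measurable
  have Cm': "(\<lambda>y. V \<epsilon> y * (norm (indicator {0<..} \<bar>y\<bar> *\<^sub>R component \<epsilon> \<Psi> \<bar>y\<bar>))\<^sup>2) \<in> borel_measurable lborel" for \<epsilon>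
    using Cm by measurable
  have int: "(LINT y|lborel. V \<epsilon> y * (norm (indicator {0<..} \<bar>y\<bar> *\<^sub>R component \<epsilon> \<Psi> \<bar>y\<bar>))\<^sup>2) < e\<^sup>2" if "\<epsilon> \<le> 1" for \<epsilon>
  proof -
    have "(LINT y|lborel. V \<epsilon> y * (norm (indicator {0<..} \<bar>y\<bar> *\<^sub>R component \<epsilon> \<Psi> \<bar>y\<bar>))\<^sup>2) = (LINT y|lborel. V \<epsilon> y * (norm (D \<epsilon> y))\<^sup>2)"
      by (rule integral_cong_AE[OF Cm' _ ae[OF that]]) measurable
    also have "\<dots> = (LINT y|nu \<epsilon>. (norm (D \<epsilon> y))\<^sup>2)" by (subst integral_nu) simp_all
    also have "\<dots> < e\<^sup>2" using c[OF that] by (simp only: G_def D_def)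
    finally show ?thesis .
  qed
  \<comment> \<open>\<open>L2_hat_norm\<close> presupposes square integrability: otherwise the
    integral in the norm would be 0 by convention and say nothing.\<close>
  have \<Psi>i: "integrable (co_mu_hat b \<iota>) (\<lambda>l. (norm (\<Psi> l))\<^sup>2)"
  proof -
    have sc: "integrable (co_mu_hat b \<iota>) (\<lambda>l. (norm (d i * fst (jacobi_transform i l), d i * snd (jacobi_transform i l)))\<^sup>2)" if "i \<in> J" for i
    proof -
      obtain n s where i: "i = (n, s)" by fastforce
      have "jacobi_transform i \<in> L2_space (co_mu_hat b \<iota>)"
        using that unfolding i J_def by (subst jacobi_transform_eq) (auto intro!: e_transform_L2 parity_le)
      then have "integrable (co_mu_hat b \<iota>) (\<lambda>l. (norm (d i))\<^sup>2 * (norm (jacobi_transform i l))\<^sup>2)"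
        by (simp add: L2_space_def)
      then show ?thesis by (simp add: norm_prod_def norm_mult power_mult_distrib distrib_left)
    qed
    have sm: "(\<lambda>x. (d i * fst (jacobi_transform i x), d i * snd (jacobi_transform i x))) \<in> borel_measurable (co_mu_hat b \<iota>)" if "i \<in> J" for i
      unfolding co_mu_hat_borel by (rule L2_scale_pair_measurable[OF jm[OF that]])
    have sum: "integrable M (\<lambda>l. (norm (g l + h l))\<^sup>2)"
      if g: "g \<in> borel_measurable M" "integrable M (\<lambda>l. (norm (g l))\<^sup>2)" and h: "h \<in> borel_measurable M" "integrable M (\<lambda>l. (norm (h l))\<^sup>2)"
      for g h :: "complex \<Rightarrow> complex \<times> complex" and M
    proof (rule Bochner_Integration.integrable_bound)
      show "integrable M (\<lambda>l. 2 * (norm (g l))\<^sup>2 + 2 * (norm (h l))\<^sup>2)" using g h by simp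
      show "AE l in M. norm ((norm (g l + h l))\<^sup>2) \<le> norm (2 * (norm (g l))\<^sup>2 + 2 * (norm (h l))\<^sup>2)"
      proof (rule AE_I2)
        fix l
        have "(norm (g l + h l))\<^sup>2 \<le> (norm (g l) + norm (h l))\<^sup>2" by (intro power_mono norm_triangle_ineq) auto
        also have "\<dots> \<le> 2 * (norm (g l))\<^sup>2 + 2 * (norm (h l))\<^sup>2"
          using zero_le_power2[of "norm (g l) - norm (h l)"] by (simp add: power2_eq_square algebra_simps)
        finally show "norm ((norm (g l + h l))\<^sup>2) \<le> norm (2 * (norm (g l))\<^sup>2 + 2 * (norm (h l))\<^sup>2)" by simp
      qed
    qed (use g h in measurable)
    have "K \<subseteq> J \<Longrightarrow> integrable (co_mu_hat b \<iota>) (\<lambda>x. (norm (\<Sum>i\<in>K. (d i * fst (jacobi_transform i x), d i * snd (jacobi_transform i x))))\<^sup>2)" if "finite K" for K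
      using that
    proof (induction K rule: finite_induct)
      case (insert i K)
      have "integrable (co_mu_hat b \<iota>) (\<lambda>x. (norm ((d i * fst (jacobi_transform i x), d i * snd (jacobi_transform i x)) + (\<Sum>i\<in>K. (d i * fst (jacobi_transform i x), d i * snd (jacobi_transform i x)))))\<^sup>2)"
        by (intro sum sc borel_measurable_sum sm insert.IH) (use insert.prems in blast)+
      then show ?case using insert by simp
    qed simp
    then have "integrable (co_mu_hat b \<iota>) (\<lambda>x. (norm (\<Sum>i\<in>J. (d i * fst (jacobi_transform i x), d i * snd (jacobi_transform i x))))\<^sup>2)"
      by (simp add: J_def)
    then have "integrable (co_mu_hat b \<iota>) (\<lambda>x. (norm (f x + - (\<Sum>i\<in>J. (d i * fst (jacobi_transform i x), d i * snd (jacobi_transform i x)))))\<^sup>2)"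
      using fi fm by (intro sum borel_measurable_sum borel_measurable_uminus sm) (simp_all add: co_mu_hat_borel)
    then show ?thesis by (simp add: \<Psi>_def)
  qed
  \<comment> \<open>Each parity contributes less than \<open>e^2\<close>, and the left side carries
    the factor 2 of \<open>L2_hat_norm\<close>, so the tolerances match.\<close>
  have "2 * (L2_nrm (co_mu_hat b \<iota>) \<Psi>)\<^sup>2 < 2 * e\<^sup>2"
    unfolding L2_hat_norm[OF \<Psi>m \<Psi>i] using int[of 0] int[of 1] by simp
  then have "L2_nrm (co_mu_hat b \<iota>) \<Psi> < e" using e power_less_imp_less_base[of _ 2 e] by simp
  then show ?thesis unfolding \<Psi>_def by (intro exI[of _ J] exI[of _ d]) (auto simp: J_def)
qed

text \<open>Orthogonality has two sources: cancellation between the components for different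
  parities, and orthogonality of the Jacobi polynomials within one parity.\<close>

lemma jacobi_basis: "L2_orthogonal_basis (co_mu_hat b \<iota>) (UNIV \<times> {1, -1::int}) jacobi_transform"
  unfolding L2_orthogonal_basis_def
proof (intro conjI ballI allI impI)
  fix i :: "nat \<times> int" assume "i \<in> UNIV \<times> {1, -1}"
  then obtain n s where i: "i = (n, s)" "s \<in> {1, -1}" by auto
  show "jacobi_transform i \<in> L2_space (co_mu_hat b \<iota>)" unfolding i(1) jacobi_transform_eq[OF i(2)] by (rule e_transform_L2[OF parity_le])
  have "2 powr (2 * \<rho>) * tanh_inner (parity s) (jac_rpoly (parity s) n) (jac_rpoly (parity s) n) > 0"
    by (intro mult_pos_pos tanh_inner_self_pos jac_rpoly_nonzero) simp
  then show "L2_nrm (co_mu_hat b \<iota>) (jacobi_transform i) \<noteq> 0"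
    unfolding i(1) jacobi_transform_eq[OF i(2)] e_transform_nrm[OF parity_le] by (metis less_irrefl real_sqrt_eq_zero_cancel_iff)
  fix j :: "nat \<times> int" assume "j \<in> UNIV \<times> {1, -1}" and ij: "i \<noteq> j"
  then obtain m s' where j: "j = (m, s')" "s' \<in> {1, -1}" by auto
  have "parity s = parity s' \<Longrightarrow> s = s'" using i(2) j(2) by (auto simp: parity_def split: if_splits)
  then show "L2_inner (co_mu_hat b \<iota>) (jacobi_transform i) (jacobi_transform j) = 0"
    unfolding i(1) jacobi_transform_eq[OF i(2)] j(1) jacobi_transform_eq[OF j(2)] e_transform_inner(2)[OF parity_le parity_le]
    using ij i j tanh_inner_jacobi_orthogonal[of n m] by auto
next
  fix f :: "complex \<Rightarrow> complex \<times> complex" and e :: real assume "f \<in> L2_space (co_mu_hat b \<iota>)" "e > 0"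
  then show "\<exists>J c. finite J \<and> J \<subseteq> UNIV \<times> {1, -1} \<and>
    L2_nrm (co_mu_hat b \<iota>) (\<lambda>x. f x - (\<Sum>i\<in>J. (c i * fst (jacobi_transform i x), c i * snd (jacobi_transform i x)))) < e"
    by (rule jacobi_span_dense)
qed

section \<open>The transform formulas in their stated form\<close>

lemma w_tilde_eq: "l \<in> im_axis \<Longrightarrow> w_tilde b \<iota> \<sigma> l = gamma_factor \<sigma> l"
  using transform_cosh_powr[OF _ \<sigma>_gt, of l 1] by (simp add: w_tilde_def w_fun_def)

lemma transform_jacobi_fun:
  assumes l: "l \<in> im_axis" and s: "s \<in> {1, -1}" and r: "r \<in> {1, -1}"
  shows "co_transform b \<iota> r (jacobi_fun b \<iota> \<sigma> k n s) l =
    spec_factor (parity s) r l * (w_tilde b \<iota> \<sigma> l * spec (parity s) (jac_rpoly (parity s) n) l)"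
  unfolding jacobi_fun_eq[OF s] transform_e_fun[OF l r parity_le] w_tilde_eq[OF l] by (rule mult.assoc)

lemma spec_jac_rpoly_0: "spec 0 (jac_rpoly 0 n) l =
  of_real (pochhammer (sigma0 b \<iota> \<sigma> + 1) n / fact n) * (\<Sum>m\<le>n.
    of_real (pochhammer (- real n) m * pochhammer (real n + sigma0 b \<iota> \<sigma> + delta0 b \<iota> + 2 * real k + 1) m /
      (pochhammer (sigma0 b \<iota> \<sigma> + 1) m * fact m)) *
    (pochhammer ((of_real (\<sigma> - co_rho b \<iota>) + l) / 2) m * pochhammer ((of_real (\<sigma> - co_rho b \<iota>) - l) / 2) m /
      of_real (pochhammer (\<sigma> / 2) m * pochhammer ((\<sigma> + 1 - \<iota>) / 2) m)) * L_fun b \<iota> \<sigma> k m l)"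
proof -
  have a: "real n + sigma0 b \<iota> \<sigma> + jac_beta 0 + 1 = real n + sigma0 b \<iota> \<sigma> + delta0 b \<iota> + 2 * real k + 1"
    by (simp add: jac_beta_def)
  have r: "co_rho b \<iota> = \<rho>" by (simp add: co_rho_def \<rho>_def)
  have z: "\<sigma> / 2 + real 0 = \<sigma> / 2" by simp
  show ?thesis
    unfolding spec_jac_rpoly jacobi_coeff_def jac_alpha_def a S_fun_def L_fun_def sum_distrib_left r z \<tau>_def of_real_mult mult.assoc ..
qed

lemma spec_jac_rpoly_1: "spec 1 (jac_rpoly 1 n) l =
  of_real (pochhammer (sigma0 b \<iota> \<sigma> + 1) n / fact n) * (\<Sum>m\<le>n.
    of_real (pochhammer (- real n) m * pochhammer (real n + sigma0 b \<iota> \<sigma> + delta1 b \<iota> + 2 * real k + 1) m /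
      (pochhammer (sigma0 b \<iota> \<sigma> + 1) m * fact m)) *
    (pochhammer ((of_real (\<sigma> - co_rho b \<iota>) + l) / 2) m * pochhammer ((of_real (\<sigma> - co_rho b \<iota>) - l) / 2) m /
      of_real (pochhammer (\<sigma> / 2 + 1) m * pochhammer ((\<sigma> + 1 - \<iota>) / 2) m)) * M_fun b \<iota> \<sigma> k m l)"
proof -
  have a: "real n + sigma0 b \<iota> \<sigma> + jac_beta 1 + 1 = real n + sigma0 b \<iota> \<sigma> + delta1 b \<iota> + 2 * real k + 1"
    by (simp add: jac_beta_def delta1_def)
  have r: "co_rho b \<iota> = \<rho>" by (simp add: co_rho_def \<rho>_def)
  have c: "complex_of_real (\<sigma> / 2) + 1 = of_real (\<sigma> / 2 + real 1)" by simp
  have o: "\<sigma> / 2 + 1 = \<sigma> / 2 + real 1" by simp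
  show ?thesis
    unfolding spec_jac_rpoly jacobi_coeff_def jac_alpha_def a S_fun_def M_fun_def sum_distrib_left r c o \<tau>_def of_real_mult mult.assoc ..
qed

end

theorem theorem4p3:
  fixes b \<iota> \<sigma> :: real and k :: nat
  assumes "b > 0" and "\<iota> > 0" and "\<sigma> > 2 * (\<iota> + b)"
  shows
    "(\<forall>n. \<forall>l\<in>im_axis. \<forall>s\<in>{1, -1::int}. \<forall>r\<in>{1, -1::int}.
        integrable (co_mu b \<iota>)
          (\<lambda>t. jacobi_fun b \<iota> \<sigma> k n s t * co_kernel b \<iota> l (of_int r * t))) \<and>
     (\<forall>n. \<forall>l\<in>im_axis. \<forall>r\<in>{1, -1::int}.
        co_transform b \<iota> r (jacobi_fun b \<iota> \<sigma> k n 1) l =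
          of_real (pochhammer (sigma0 b \<iota> \<sigma> + 1) n / fact n) * w_tilde b \<iota> \<sigma> l *
          (\<Sum>m\<le>n.
            of_real (pochhammer (- real n) m *
                     pochhammer (real n + sigma0 b \<iota> \<sigma> + delta0 b \<iota> + 2 * real k + 1) m /
                     (pochhammer (sigma0 b \<iota> \<sigma> + 1) m * fact m)) *
            (pochhammer ((of_real (\<sigma> - co_rho b \<iota>) + l) / 2) m *
             pochhammer ((of_real (\<sigma> - co_rho b \<iota>) - l) / 2) m /
             of_real (pochhammer (\<sigma> / 2) m * pochhammer ((\<sigma> + 1 - \<iota>) / 2) m)) *
            L_fun b \<iota> \<sigma> k m l)) \<and>
     (\<forall>n. \<forall>l\<in>im_axis. \<forall>r\<in>{1, -1::int}.
        co_transform b \<iota> r (jacobi_fun b \<iota> \<sigma> k n (-1)) l =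
          - of_real (pochhammer (sigma0 b \<iota> \<sigma> + 1) n / (fact n * \<sigma>)) *
          (of_int r * (l - of_real (co_rho b \<iota>))) * w_tilde b \<iota> \<sigma> l *
          (\<Sum>m\<le>n.
            of_real (pochhammer (- real n) m *
                     pochhammer (real n + sigma0 b \<iota> \<sigma> + delta1 b \<iota> + 2 * real k + 1) m /
                     (pochhammer (sigma0 b \<iota> \<sigma> + 1) m * fact m)) *
            (pochhammer ((of_real (\<sigma> - co_rho b \<iota>) + l) / 2) m *
             pochhammer ((of_real (\<sigma> - co_rho b \<iota>) - l) / 2) m /
             of_real (pochhammer (\<sigma> / 2 + 1) m * pochhammer ((\<sigma> + 1 - \<iota>) / 2) m)) *
            M_fun b \<iota> \<sigma> k m l)) \<and>
     (\<forall>n. \<forall>s\<in>{1, -1::int}. \<exists>p q :: complex poly. \<forall>l\<in>im_axis.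
        co_transform_pair b \<iota> (jacobi_fun b \<iota> \<sigma> k n s) l =
          (w_tilde b \<iota> \<sigma> l * poly p l, w_tilde b \<iota> \<sigma> l * poly q l)) \<and>
     L2_orthogonal_basis (co_mu_hat b \<iota>) (UNIV \<times> {1, -1::int})
       (\<lambda>(n, s). co_transform_pair b \<iota> (jacobi_fun b \<iota> \<sigma> k n s)) \<and>
     (\<forall>n. \<forall>s\<in>{1, -1::int}.
        L2_nrm (co_mu_hat b \<iota>) (co_transform_pair b \<iota> (jacobi_fun b \<iota> \<sigma> k n s)) =
          L2_nrm (co_mu b \<iota>) (jacobi_fun b \<iota> \<sigma> k n s))"
proof -
  interpret jacobi_type b \<iota> \<sigma> k
    by unfold_locales (use assms in \<open>simp_all add: cherednik_opdam.\<rho>_def cherednik_opdam_def\<close>)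
  have r: "co_rho b \<iota> = \<rho>" by (simp add: co_rho_def \<rho>_def)
  show ?thesis
  proof (intro conjI allI ballI)
    fix n l and s r :: int assume "l \<in> im_axis" "s \<in> {1, -1}" "r \<in> {1, -1}"
    then show "integrable (co_mu b \<iota>) (\<lambda>t. jacobi_fun b \<iota> \<sigma> k n s t * co_kernel b \<iota> l (of_int r * t))"
      unfolding jacobi_fun_eq[OF \<open>s \<in> {1, -1}\<close>] by (intro integrable_mult_co_kernel integrable_e_fun)
  next
    fix n l and r :: int assume l: "l \<in> im_axis" and r: "r \<in> {1, -1}"
    show "co_transform b \<iota> r (jacobi_fun b \<iota> \<sigma> k n 1) l =
          of_real (pochhammer (sigma0 b \<iota> \<sigma> + 1) n / fact n) * w_tilde b \<iota> \<sigma> l *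
          (\<Sum>m\<le>n.
            of_real (pochhammer (- real n) m *
                     pochhammer (real n + sigma0 b \<iota> \<sigma> + delta0 b \<iota> + 2 * real k + 1) m /
                     (pochhammer (sigma0 b \<iota> \<sigma> + 1) m * fact m)) *
            (pochhammer ((of_real (\<sigma> - co_rho b \<iota>) + l) / 2) m *
             pochhammer ((of_real (\<sigma> - co_rho b \<iota>) - l) / 2) m /
             of_real (pochhammer (\<sigma> / 2) m * pochhammer ((\<sigma> + 1 - \<iota>) / 2) m)) *
            L_fun b \<iota> \<sigma> k m l)" (is "_ = ?c * ?w * ?S")
    proof -
      have one: "spec_factor 0 r l = 1" by (simp add: spec_factor_def)
      have "co_transform b \<iota> r (jacobi_fun b \<iota> \<sigma> k n 1) l = spec_factor 0 r l * (?w * (?c * ?S))"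
        using transform_jacobi_fun[OF l _ r, of 1 n] unfolding spec_jac_rpoly_0[symmetric] by (simp add: parity_def)
      also have "\<dots> = ?c * ?w * ?S" unfolding one by (simp only: mult_1_left mult.left_commute[of ?w] mult.assoc)
      finally show ?thesis .
    qed
    show "co_transform b \<iota> r (jacobi_fun b \<iota> \<sigma> k n (-1)) l =
          - of_real (pochhammer (sigma0 b \<iota> \<sigma> + 1) n / (fact n * \<sigma>)) *
          (of_int r * (l - of_real (co_rho b \<iota>))) * w_tilde b \<iota> \<sigma> l *
          (\<Sum>m\<le>n.
            of_real (pochhammer (- real n) m *
                     pochhammer (real n + sigma0 b \<iota> \<sigma> + delta1 b \<iota> + 2 * real k + 1) m /
                     (pochhammer (sigma0 b \<iota> \<sigma> + 1) m * fact m)) *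
            (pochhammer ((of_real (\<sigma> - co_rho b \<iota>) + l) / 2) m *
             pochhammer ((of_real (\<sigma> - co_rho b \<iota>) - l) / 2) m /
             of_real (pochhammer (\<sigma> / 2 + 1) m * pochhammer ((\<sigma> + 1 - \<iota>) / 2) m)) *
            M_fun b \<iota> \<sigma> k m l)" (is "_ = - ?c' * ?f * ?w * ?S")
    proof -
      let ?c = "of_real (pochhammer (sigma0 b \<iota> \<sigma> + 1) n / fact n) :: complex"
      have "co_transform b \<iota> r (jacobi_fun b \<iota> \<sigma> k n (-1)) l = spec_factor 1 r l * (?w * (?c * ?S))"
        using transform_jacobi_fun[OF l _ r, of "-1" n] unfolding spec_jac_rpoly_1[symmetric] by (simp add: parity_def)
      also have "\<dots> = spec_factor 1 r l * ?c * (?w * ?S)" by (simp only: mult.left_commute[of ?w] mult.assoc)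
      \<comment> \<open>\<open>spec_factor 1 r l\<close> is
        \<open>r (\<rho> - l) / \<sigma>\<close>, written in the statement as minus
        \<open>r (l - \<rho>) / \<sigma>\<close>.\<close>
      also have "spec_factor 1 r l * ?c = - ?c' * ?f"
        unfolding \<open>co_rho b \<iota> = \<rho>\<close> by (simp add: spec_factor_def right_diff_distrib left_diff_distrib diff_divide_distrib mult_ac)
      finally show ?thesis by (simp only: mult.assoc)
    qed
  next
    fix n and s :: int assume s: "s \<in> {1, -1}"
    obtain q where q: "\<And>l. spec (parity s) (jac_rpoly (parity s) n) l = poly q l" using spec_poly by metis
    \<comment> \<open>\<open>c r\<close> is the factor of the component with sign \<open>r\<close>,
      constant for even and linear for odd functions; with \<open>q\<close> it accounts for
      everything in the transform except \<open>w_tilde\<close>.\<close>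
    define c where "c = (\<lambda>r::int. if parity s = 0 then 1 else smult (of_int r / of_real \<sigma>) [:of_real \<rho>, -1:] :: complex poly)"
    have c: "spec_factor (parity s) r l = poly (c r) l" for r l by (simp add: c_def spec_factor_def right_diff_distrib diff_divide_distrib mult_ac)
    have "co_transform_pair b \<iota> (jacobi_fun b \<iota> \<sigma> k n s) l =
        (w_tilde b \<iota> \<sigma> l * poly (c 1 * q) l, w_tilde b \<iota> \<sigma> l * poly (c (-1) * q) l)" if "l \<in> im_axis" for l
      using transform_jacobi_fun[OF that s] by (simp add: co_transform_pair_def c q mult_ac)
    then show "\<exists>p q :: complex poly. \<forall>l\<in>im_axis. co_transform_pair b \<iota> (jacobi_fun b \<iota> \<sigma> k n s) l =
        (w_tilde b \<iota> \<sigma> l * poly p l, w_tilde b \<iota> \<sigma> l * poly q l)" by blast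
    show "L2_nrm (co_mu_hat b \<iota>) (co_transform_pair b \<iota> (jacobi_fun b \<iota> \<sigma> k n s)) = L2_nrm (co_mu b \<iota>) (jacobi_fun b \<iota> \<sigma> k n s)"
      using e_transform_nrm[OF parity_le] e_fun_nrm unfolding jacobi_fun_eq[OF s] e_transform_def by metis
  next
    show "L2_orthogonal_basis (co_mu_hat b \<iota>) (UNIV \<times> {1, -1::int})
       (\<lambda>(n, s). co_transform_pair b \<iota> (jacobi_fun b \<iota> \<sigma> k n s))" by (rule jacobi_basis)
  qed
qed

end
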